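(* Let $(\eta,\beta)\in Z^1_c(Q;\hat V)\times Z^2(Q;V)$ be a compatible pair of cocycles with $\eta$ essentially bijective, let $G$ be the extension of $V$ by $Q$ defined by $\beta$, and let $b\colon Q\times Q\to\mathbb T$ be a Borel map with $\psi=\partial b$. Assume the normalization conditions $\beta(e,q)=\beta(q,e)=0$ and $b(e,q)=b(q,e)=1$ for all $q\in Q$. Consider the dual unitary $2$-cocycle on $G$ $$\Omega:=(\mathcal J\otimes\mathcal J)\,\tilde{\mathcal G}^*\,(1\otimes\mathcal J)\,\hat W .$$ Then, for $f\in L^2(Q\times\hat V\times Q\times\hat V,\ |q|^{-1}dq\times d\xi\times|q|^{-1}dq\times d\xi)$, we have $$\big((\mathcal F_V\otimes\mathcal F_V)\Omega(\mathcal F_V^*\otimes\mathcal F_V^* )f\big)(q_1,\xi_1;q_2,\xi_2)=|\eta^{-1}(\xi_1)|^{-1}\,\overline{b(\eta^{-1}(\xi_2)^{-1},\eta^{-1}(\xi_1)^{-1})}$$ $$\times\ \overline{\psi(\eta^{-1}(\xi_2)^{-1},\eta^{-1}(\xi_1)^{-1},\eta^{-1}(\xi_1)q_2)}\ f\big(q_1,\xi_1;\eta^{-1}(\xi_1)q_2,\eta^{-1}(\xi_1)^\flat\xi_2\big).$$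
   Context: Groups. $Q$ and $V$ are second countable locally compact groups, $V$ is abelian (written additively), and $Q$ acts on $V$ through a continuous homomorphism $Q\to\mathrm{Aut}(V)$. $\hat V$ is the Pontryagin dual (written additively), the pairing of $\hat V$ and $V$ is written $e^{i\langle\xi,v\rangle}\in\mathbb T$ (notation only), and $Q$ acts on $\hat V$ by the dual action $e^{i\langle q^\flat\xi,v\rangle}=e^{i\langle\xi,q^{-1}v\rangle}$. Cohomology is Moore cohomology with Borel cochains. $\beta\in Z^2(Q;V)$ is a Borel map $Q\times Q\to V$ with $\beta(q_1,q_2)+\beta(q_1q_2,q_3)=q_1\beta(q_2,q_3)+\beta(q_1,q_2q_3)$; $G$ is $Q\times V$ as a Borel space, with product $(q_1,v_1)(q_2,v_2)=(q_1q_2,v_1+q_1v_2+\beta(q_1,q_2))$ and the corresponding second countable locally compact group topology. Cocycles. $Z^1_c(Q;\hat V)$ is the set of continuous maps $\eta\colon Q\to\hat V$ with $\eta(q_1q_2)=\eta(q_1)+q_1^\flat\eta(q_2)$. $\eta$ is essentially bijective if it is a measure class isomorphism $Q\to\hat V$ (with respect to Haar measures; i.e. after removing null sets it is a Borel isomorphism preserving null sets in both directions); $\eta^{-1}$ is its almost everywhere defined inverse. Put $\psi(q_1,q_2,q_3):=e^{i\langle\eta(q_1^{-1}),\beta(q_2,q_3)\rangle}\in Z^3(Q;\mathbb T)$. The pair $(\eta,\beta)$ is compatible if $[\psi]=[1]$ in $H^3(Q;\mathbb T)$. The coboundary convention is $(\partial b)(q_1,q_2,q_3)=\dfrac{b(q_2,q_3)\,b(q_1,q_2q_3)}{b(q_1,q_2)\,b(q_1q_2,q_3)}$.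 Measures. $|q|=|q|_V$ is defined by $\int_V f(qv)\,dv=|q|^{-1}\int_V f(v)\,dv$. $dq$ is a left Haar measure on $Q$ and $\Delta_Q$ the modular function; left Haar measure and modular function of $G$ are $d(q,v)=|q|^{-1}dq\,dv$ and $\Delta(q,v)=\Delta_Q(q)/|q|$. Given a Haar measure $d\xi$ on $\hat V$, $dq$ is normalized by $\int_Q f(\eta(q))\,|q|^{-1}dq=\int_{\hat V}f(\xi)\,d\xi$ for positive Borel $f$, and $dv$ so that the Fourier transform is unitary. $\mathcal F_V$ is the partial Fourier transform $(\mathcal F_Vf)(q,\xi)=\int_Ve^{-i\langle\xi,v\rangle}f(q,v)\,dv$, a unitary $L^2(G)\to L^2(Q\times\hat V,|q|^{-1}dq\times d\xi)$. Representation, quantization and Galois map. $\pi\colon G\to U(L^2(Q))$, $(\pi(q,v)\varphi)(q_0)=e^{-i\langle\eta(q_0),v\rangle}b(q_0^{-1},q)\varphi(q^{-1}q_0)$, is an irreducible square-integrable projective representation with Duflo--Moore operator $D$ = multiplication by $|\cdot|\Delta_Q^{-1}$. $\mathrm{Op}\colon L^2(G)\to\mathrm{HS}(L^2(Q))$ is the unitary sending $f$ to the Hilbert--Schmidt operator with kernel $K(f)(q_0,q)=|q_0q|^{-1/2}b(q_0^{-1},q_0)\overline{b(q^{-1},q_0)}(\mathcal F_Vf)(q_0,\eta(q_0)-\eta(q))$; it intertwines the left regular representation with $\mathrm{Ad}\,\pi$. On $\mathcal N=B(L^2(Q))$ consider the weight $\tilde\varphi=\mathrm{Tr}(D^{1/2}\cdot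 D^{1/2})$ with GNS-space $\mathrm{HS}(L^2(Q))$ and GNS-map $\tilde\Lambda(T)=TD^{1/2}$. The Galois map $\mathcal G\colon \mathrm{HS}(L^2(Q))\otimes \mathrm{HS}(L^2(Q))\to L^2(G;\mathrm{HS}(L^2(Q)))$, $\mathcal G(\tilde\Lambda(S)\otimes\tilde\Lambda(T))(g)=\tilde\Lambda(\pi(g)S\pi(g)^*T)$, is unitary; $\tilde{\mathcal G}:=(1\otimes\mathrm{Op}^* )\mathcal G(\mathrm{Op}\otimes\mathrm{Op})$ is this map transported to $L^2(G\times G)$. Dual cocycles. $(\mathcal Jf)(g)=\Delta(g)^{-1/2}f(g^{-1})$ on $L^2(G)$ and $(\hat Wf)(g,h)=f(hg,h)$ on $L^2(G\times G)$. A dual unitary $2$-cocycle on $G$ is a unitary $\Omega\in W^*(G)\bar\otimes W^*(G)$ with $(\Omega\otimes1)(\hat\Delta\otimes\iota)(\Omega)=(1\otimes\Omega)(\iota\otimes\hat\Delta)(\Omega)$, where $W^*(G)\subset B(L^2(G))$ is the group von Neumann algebra generated by the left translations $\lambda_g$ and $\hat\Delta(\lambda_g)=\lambda_g\otimes\lambda_g$. It is known that the operator $\Omega$ in the claim is a dual unitary $2$-cocycle. *)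

theory Defs
  imports "HOL-Analysis.Analysis"
begin

text \<open>
  \<open>Q\<close> is a type of class \<^class>\<open>topological_group_add\<close>. That class does not assume
  commutativity: \<open>Q\<close> is an arbitrary topological group whose product, unit and inverse are
  written \<open>p + q\<close>, \<open>0\<close> and \<open>- q\<close>.
\<close>

section \<open>The Pontryagin dual\<close>

typedef (overloaded) 'v pdual =
  "{c :: 'v::topological_ab_group_add \<Rightarrow> complex.
      continuous_on UNIV c \<and> (\<forall>x y. c (x + y) = c x * c y) \<and> (\<forall>x. cmod (c x) = 1)}"
  morphisms pairing Abs_pdual
  by (rule exI[of _ "\<lambda>_. 1"]) simp

text \<open>\<open>pairing \<xi> v\<close> is the number written \<open>e\<close> to the power \<open>i\<langle>\<xi>,v\<rangle>\<close>.\<close>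

setup_lifting type_definition_pdual

instantiation pdual :: (topological_ab_group_add) ab_group_add
begin

lift_definition zero_pdual :: "'a pdual" is "\<lambda>_. 1" by simp

lift_definition plus_pdual :: "'a pdual \<Rightarrow> 'a pdual \<Rightarrow> 'a pdual" is "\<lambda>c c' v. c v * c' v"
  by (auto intro: continuous_on_mult simp: norm_mult)

lift_definition uminus_pdual :: "'a pdual \<Rightarrow> 'a pdual" is "\<lambda>c v. cnj (c v)"
  by (auto intro: continuous_on_cnj)

definition minus_pdual :: "'a pdual \<Rightarrow> 'a pdual \<Rightarrow> 'a pdual" where
  "minus_pdual \<xi> \<xi>' = \<xi> + - \<xi>'"

instance
proof
  fix a b c :: "'a pdual"
  show "a + b + c = a + (b + c)" by transfer (simp add: mult.assoc)
  show "a + b = b + a" by transfer (simp add: mult.commute)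
  show "0 + a = a" by transfer simp
  show "- a + a = 0"
    by transfer (metis complex_norm_square mult.commute of_real_1 one_power2)
  show "a - b = a + - b" by (rule minus_pdual_def)
qed

end

instantiation pdual :: (topological_ab_group_add) topological_space
begin

text \<open>The compact-open topology.\<close>

definition open_pdual :: "'a pdual set \<Rightarrow> bool" where
  "open_pdual = generate_topology {{\<xi>. pairing \<xi> ` K \<subseteq> U} | K U. compact K \<and> open U}"

instance
  by standard (auto simp: open_pdual_def intro: generate_topology.intros)

end


section \<open>Groups, actions and cocycles\<close>

definition topological_automorphisms :: "('v::topological_ab_group_add \<Rightarrow> 'v) set" where
  "topological_automorphisms =
     {T. (\<forall>x y. T (x + y) = T x + T y) \<and> bij T \<and> continuous_on UNIV T \<and> continuous_on UNIV (inv T)}"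

text \<open>The usual topology of \<open>Aut(V)\<close>: the compact-open topology for both \<open>T\<close> and its inverse.\<close>

definition aut_topology :: "('v::topological_ab_group_add \<Rightarrow> 'v) topology" where
  "aut_topology = topology_generated_by
     ({{T \<in> topological_automorphisms. T ` K \<subseteq> U} | K U. compact K \<and> open U} \<union>
      {{T \<in> topological_automorphisms. inv T ` K \<subseteq> U} | K U. compact K \<and> open U})"

definition continuous_action ::
  "('q::topological_group_add \<Rightarrow> 'v::topological_ab_group_add \<Rightarrow> 'v) \<Rightarrow> bool" where
  "continuous_action act \<longleftrightarrow>
     continuous_map euclidean aut_topology act \<and> (\<forall>p q. act (p + q) = act p \<circ> act q)"

definition dual_action ::
  "('q::topological_group_add \<Rightarrow> 'v::topological_ab_group_add \<Rightarrow> 'v) \<Rightarrow> 'q \<Rightarrow> 'v pdual \<Rightarrow> 'v pdual" where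
  "dual_action act q \<xi> = Abs_pdual (\<lambda>v. pairing \<xi> (act (- q) v))"

definition Z1c ::
  "('q::topological_group_add \<Rightarrow> 'v::topological_ab_group_add \<Rightarrow> 'v) \<Rightarrow> ('q \<Rightarrow> 'v pdual) set" where
  "Z1c act = {\<eta>. continuous_on UNIV \<eta> \<and> (\<forall>p q. \<eta> (p + q) = \<eta> p + dual_action act p (\<eta> q))}"

definition Z2 ::
  "('q::topological_group_add \<Rightarrow> 'v::topological_ab_group_add \<Rightarrow> 'v) \<Rightarrow> ('q \<Rightarrow> 'q \<Rightarrow> 'v) set" where
  "Z2 act = {\<beta>. (\<lambda>(p, q). \<beta> p q) \<in> borel_measurable borel \<and>
     (\<forall>p q r. \<beta> p q + \<beta> (p + q) r = act p (\<beta> q r) + \<beta> p (q + r))}"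

text \<open>Borel 2-cochains with values in the circle, and their coboundaries (trivial action).\<close>

definition circle_cochain2 :: "('q::topological_group_add \<Rightarrow> 'q \<Rightarrow> complex) \<Rightarrow> bool" where
  "circle_cochain2 b \<longleftrightarrow> (\<lambda>(p, q). b p q) \<in> borel_measurable borel \<and> (\<forall>p q. cmod (b p q) = 1)"

definition cobd :: "('q::topological_group_add \<Rightarrow> 'q \<Rightarrow> complex) \<Rightarrow> 'q \<Rightarrow> 'q \<Rightarrow> 'q \<Rightarrow> complex" where
  "cobd b q1 q2 q3 = (b q2 q3 * b q1 (q2 + q3)) / (b q1 q2 * b (q1 + q2) q3)"

definition psi ::
  "('q::topological_group_add \<Rightarrow> 'v::topological_ab_group_add pdual) \<Rightarrow> ('q \<Rightarrow> 'q \<Rightarrow> 'v)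
     \<Rightarrow> 'q \<Rightarrow> 'q \<Rightarrow> 'q \<Rightarrow> complex" where
  "psi \<eta> \<beta> q1 q2 q3 = pairing (\<eta> (- q1)) (\<beta> q2 q3)"

text \<open>\<open>psi \<eta> \<beta>\<close> is a 3-cocycle; its class is trivial iff it is the coboundary of a Borel 2-cochain.\<close>

definition compatible ::
  "('q::topological_group_add \<Rightarrow> 'v::topological_ab_group_add pdual) \<Rightarrow> ('q \<Rightarrow> 'q \<Rightarrow> 'v) \<Rightarrow> bool" where
  "compatible \<eta> \<beta> \<longleftrightarrow> (\<exists>b. circle_cochain2 b \<and> psi \<eta> \<beta> = cobd b)"

definition ext_mult ::
  "('q::topological_group_add \<Rightarrow> 'v::topological_ab_group_add \<Rightarrow> 'v) \<Rightarrow> ('q \<Rightarrow> 'q \<Rightarrow> 'v)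
     \<Rightarrow> 'q \<times> 'v \<Rightarrow> 'q \<times> 'v \<Rightarrow> 'q \<times> 'v" where
  "ext_mult act \<beta> = (\<lambda>(q1, v1) (q2, v2). (q1 + q2, v1 + act q1 v2 + \<beta> q1 q2))"

text \<open>The unit of the extension is \<open>(0, 0)\<close> because \<open>\<beta>\<close> will be normalized.\<close>

definition ext_inv ::
  "('q::topological_group_add \<Rightarrow> 'v::topological_ab_group_add \<Rightarrow> 'v) \<Rightarrow> ('q \<Rightarrow> 'q \<Rightarrow> 'v)
     \<Rightarrow> 'q \<times> 'v \<Rightarrow> 'q \<times> 'v" where
  "ext_inv act \<beta> g = (THE h. ext_mult act \<beta> g h = (0, 0) \<and> ext_mult act \<beta> h g = (0, 0))"


section \<open>Haar measures\<close>

text \<open>On second countable locally compact Hausdorff spaces, Borel measures that are finite on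
  compact sets are automatically Radon.\<close>

definition left_haar_measure :: "'a::{topological_space, plus} measure \<Rightarrow> bool" where
  "left_haar_measure M \<longleftrightarrow>
     sets M = sets borel \<and> (\<forall>K. compact K \<longrightarrow> emeasure M K < \<infinity>) \<and>
     emeasure M UNIV \<noteq> 0 \<and> (\<forall>a. distr M M (\<lambda>x. a + x) = M)"

text \<open>Modular function of \<open>Q\<close>, with the convention under which the map \<open>J\<close> below is isometric.\<close>

definition modular_function :: "'q::topological_group_add measure \<Rightarrow> 'q \<Rightarrow> real" where
  "modular_function muQ p = (THE c. 0 < c \<and> (\<forall>f :: 'q \<Rightarrow> ennreal. f \<in> borel_measurable borel \<longrightarrow>
     (\<integral>\<^sup>+q. f (q + p) \<partial>muQ) = ennreal (inverse c) * (\<integral>\<^sup>+q. f q \<partial>muQ)))"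

definition modulus ::
  "'v::topological_ab_group_add measure \<Rightarrow> ('q::topological_group_add \<Rightarrow> 'v \<Rightarrow> 'v) \<Rightarrow> 'q \<Rightarrow> real" where
  "modulus muV act q = (THE c. 0 < c \<and> (\<forall>f :: 'v \<Rightarrow> ennreal. f \<in> borel_measurable borel \<longrightarrow>
     (\<integral>\<^sup>+v. f (act q v) \<partial>muV) = ennreal (inverse c) * (\<integral>\<^sup>+v. f v \<partial>muV)))"

definition weighted_Q ::
  "'q::topological_group_add measure \<Rightarrow> 'v::topological_ab_group_add measure \<Rightarrow> ('q \<Rightarrow> 'v \<Rightarrow> 'v)
     \<Rightarrow> 'q measure" where
  "weighted_Q muQ muV act = density muQ (\<lambda>q. ennreal (inverse (modulus muV act q)))"

text \<open>Left Haar measure and modular function of the extension \<open>G\<close>, which carries the product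
  Borel structure; its topology enters only through them.\<close>

definition haar_G ::
  "'q::topological_group_add measure \<Rightarrow> 'v::topological_ab_group_add measure \<Rightarrow> ('q \<Rightarrow> 'v \<Rightarrow> 'v)
     \<Rightarrow> ('q \<times> 'v) measure" where
  "haar_G muQ muV act = weighted_Q muQ muV act \<Otimes>\<^sub>M muV"

definition modular_G ::
  "'q::topological_group_add measure \<Rightarrow> 'v::topological_ab_group_add measure \<Rightarrow> ('q \<Rightarrow> 'v \<Rightarrow> 'v)
     \<Rightarrow> 'q \<times> 'v \<Rightarrow> real" where
  "modular_G muQ muV act = (\<lambda>(q, v). modular_function muQ q / modulus muV act q)"

definition dual_side ::
  "'q::topological_group_add measure \<Rightarrow> 'v::topological_ab_group_add measure \<Rightarrow> 'v pdual measure
     \<Rightarrow> ('q \<Rightarrow> 'v \<Rightarrow> 'v) \<Rightarrow> ('q \<times> 'v pdual) measure" where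
  "dual_side muQ muV muX act = weighted_Q muQ muV act \<Otimes>\<^sub>M muX"

text \<open>\<open>f\<close> becomes a Borel isomorphism respecting null sets in both directions after null sets are
  removed, and \<open>g\<close> is a Borel representative of its almost everywhere defined inverse.\<close>

definition ae_inverse :: "'a measure \<Rightarrow> 'b measure \<Rightarrow> ('a \<Rightarrow> 'b) \<Rightarrow> ('b \<Rightarrow> 'a) \<Rightarrow> bool" where
  "ae_inverse M N f g \<longleftrightarrow> g \<in> measurable N M \<and>
     (\<exists>A \<in> null_sets M. \<exists>B \<in> null_sets N.
        bij_betw f (space M - A) (space N - B) \<and>
        f \<in> measurable (restrict_space M (space M - A)) (restrict_space N (space N - B)) \<and>
        (\<forall>y \<in> space N - B. g y \<in> space M - A \<and> f (g y) = y) \<and>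
        (\<forall>E \<in> sets M. E \<subseteq> space M - A \<longrightarrow> (E \<in> null_sets M \<longleftrightarrow> f ` E \<in> null_sets N)))"

definition measure_class_isomorphism :: "'a measure \<Rightarrow> 'b measure \<Rightarrow> ('a \<Rightarrow> 'b) \<Rightarrow> bool" where
  "measure_class_isomorphism M N f \<longleftrightarrow> (\<exists>g. ae_inverse M N f g)"


section \<open>Operators between \<open>L\<^sup>2\<close>-spaces\<close>

text \<open>Elements of \<open>L\<^sup>2(M)\<close> are represented by square-integrable functions, equality in \<open>L\<^sup>2(M)\<close>
  being equality almost everywhere. Operators act on representatives and are likewise
  considered modulo null functions: the constants defined below by Hilbert choice
  are operators which are uniquely determined in this sense, and their values outside
  \<open>L\<^sup>2\<close> are irrelevant.\<close>

definition L2 :: "'a measure \<Rightarrow> ('a \<Rightarrow> complex) set" where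
  "L2 M = {f \<in> borel_measurable M. integrable M (\<lambda>x. (cmod (f x))\<^sup>2)}"

definition L2_inner :: "'a measure \<Rightarrow> ('a \<Rightarrow> complex) \<Rightarrow> ('a \<Rightarrow> complex) \<Rightarrow> complex" where
  "L2_inner M f g = (\<integral>x. f x * cnj (g x) \<partial>M)"

definition L2_norm :: "'a measure \<Rightarrow> ('a \<Rightarrow> complex) \<Rightarrow> real" where
  "L2_norm M f = sqrt (\<integral>x. (cmod (f x))\<^sup>2 \<partial>M)"

text \<open>Bounded linear operators; that they respect equality almost everywhere follows from
  linearity and boundedness.\<close>

definition L2_operator ::
  "'a measure \<Rightarrow> 'b measure \<Rightarrow> (('a \<Rightarrow> complex) \<Rightarrow> 'b \<Rightarrow> complex) \<Rightarrow> bool" where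
  "L2_operator M N T \<longleftrightarrow>
     (\<forall>f \<in> L2 M. T f \<in> L2 N) \<and>
     (\<forall>f \<in> L2 M. \<forall>g \<in> L2 M. AE y in N. T (\<lambda>x. f x + g x) y = T f y + T g y) \<and>
     (\<forall>c. \<forall>f \<in> L2 M. AE y in N. T (\<lambda>x. c * f x) y = c * T f y) \<and>
     (\<exists>C. \<forall>f \<in> L2 M. L2_norm N (T f) \<le> C * L2_norm M f)"

definition L2_unitary ::
  "'a measure \<Rightarrow> 'b measure \<Rightarrow> (('a \<Rightarrow> complex) \<Rightarrow> 'b \<Rightarrow> complex) \<Rightarrow> bool" where
  "L2_unitary M N U \<longleftrightarrow> L2_operator M N U \<and>
     (\<forall>f \<in> L2 M. L2_norm N (U f) = L2_norm M f) \<and>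
     (\<forall>g \<in> L2 N. \<exists>f \<in> L2 M. AE y in N. U f y = g y)"

definition L2_adjoint ::
  "'a measure \<Rightarrow> 'b measure \<Rightarrow> (('a \<Rightarrow> complex) \<Rightarrow> 'b \<Rightarrow> complex) \<Rightarrow> ('b \<Rightarrow> complex) \<Rightarrow> 'a \<Rightarrow> complex" where
  "L2_adjoint M N T = (SOME S. L2_operator N M S \<and>
     (\<forall>f \<in> L2 M. \<forall>g \<in> L2 N. L2_inner N (T f) g = L2_inner M f (S g)))"

definition tensor_fun :: "('a \<Rightarrow> complex) \<Rightarrow> ('b \<Rightarrow> complex) \<Rightarrow> 'a \<times> 'b \<Rightarrow> complex" where
  "tensor_fun f g = (\<lambda>(x, y). f x * g y)"

text \<open>For operators \<open>A\<close> from \<open>L\<^sup>2(M1)\<close> to \<open>L\<^sup>2(N1)\<close> and \<open>B\<close> from \<open>L\<^sup>2(M2)\<close> to \<open>L\<^sup>2(N2)\<close>, the operator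
  \<open>A \<otimes> B\<close>, where \<open>L\<^sup>2(M1) \<otimes> L\<^sup>2(M2)\<close> is identified with the \<open>L\<^sup>2\<close>-space of the product measure.\<close>

definition L2_tensor ::
  "'a measure \<Rightarrow> 'b measure \<Rightarrow> 'c measure \<Rightarrow> 'd measure
     \<Rightarrow> (('a \<Rightarrow> complex) \<Rightarrow> 'c \<Rightarrow> complex) \<Rightarrow> (('b \<Rightarrow> complex) \<Rightarrow> 'd \<Rightarrow> complex)
     \<Rightarrow> ('a \<times> 'b \<Rightarrow> complex) \<Rightarrow> 'c \<times> 'd \<Rightarrow> complex" where
  "L2_tensor M1 M2 N1 N2 A B = (SOME T. L2_operator (M1 \<Otimes>\<^sub>M M2) (N1 \<Otimes>\<^sub>M N2) T \<and>
     (\<forall>f \<in> L2 M1. \<forall>g \<in> L2 M2. AE z in N1 \<Otimes>\<^sub>M N2. T (tensor_fun f g) z = tensor_fun (A f) (B g) z))"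


section \<open>Fourier transforms\<close>

definition fourier_integral ::
  "'v::topological_ab_group_add measure \<Rightarrow> ('v \<Rightarrow> complex) \<Rightarrow> 'v pdual \<Rightarrow> complex" where
  "fourier_integral muV f \<xi> = (\<integral>v. cnj (pairing \<xi> v) * f v \<partial>muV)"

text \<open>The normalization of the Haar measures of \<open>V\<close> and of its dual against each other.\<close>

definition fourier_unitary ::
  "'v::topological_ab_group_add measure \<Rightarrow> 'v pdual measure \<Rightarrow> bool" where
  "fourier_unitary muV muX \<longleftrightarrow> (\<exists>U. L2_unitary muV muX U \<and>
     (\<forall>f \<in> L2 muV. integrable muV f \<longrightarrow> (AE \<xi> in muX. U f \<xi> = fourier_integral muV f \<xi>)))"

text \<open>The integral formula for the partial Fourier transform makes sense on \<open>L\<^sup>1 \<inter> L\<^sup>2\<close>, and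
  is extended to \<open>L\<^sup>2(G)\<close> by continuity.\<close>

definition partial_fourier ::
  "'q::topological_group_add measure \<Rightarrow> 'v::topological_ab_group_add measure \<Rightarrow> 'v pdual measure
     \<Rightarrow> ('q \<Rightarrow> 'v \<Rightarrow> 'v) \<Rightarrow> ('q \<times> 'v \<Rightarrow> complex) \<Rightarrow> 'q \<times> 'v pdual \<Rightarrow> complex" where
  "partial_fourier muQ muV muX act = (SOME F.
     L2_operator (haar_G muQ muV act) (dual_side muQ muV muX act) F \<and>
     (\<forall>f \<in> L2 (haar_G muQ muV act). integrable (haar_G muQ muV act) f \<longrightarrow>
        (AE (q, \<xi>) in dual_side muQ muV muX act.
           F f (q, \<xi>) = fourier_integral muV (\<lambda>v. f (q, v)) \<xi>)))"


section \<open>The projective representation, quantization and the Galois map\<close>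

definition proj_rep ::
  "('q::topological_group_add \<Rightarrow> 'v::topological_ab_group_add pdual) \<Rightarrow> ('q \<Rightarrow> 'q \<Rightarrow> complex)
     \<Rightarrow> 'q \<times> 'v \<Rightarrow> ('q \<Rightarrow> complex) \<Rightarrow> 'q \<Rightarrow> complex" where
  "proj_rep \<eta> b = (\<lambda>(q, v) \<phi> q0. cnj (pairing (\<eta> q0) v) * b (- q0) q * \<phi> (- q + q0))"

definition duflo_moore ::
  "'q::topological_group_add measure \<Rightarrow> 'v::topological_ab_group_add measure \<Rightarrow> ('q \<Rightarrow> 'v \<Rightarrow> 'v)
     \<Rightarrow> 'q \<Rightarrow> real" where
  "duflo_moore muQ muV act q = modulus muV act q * inverse (modular_function muQ q)"

text \<open>The Hilbert space \<open>HS(L\<^sup>2(Q))\<close> is represented by \<open>L\<^sup>2(Q \<times> Q)\<close>, a Hilbert-Schmidt operator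
  being identified with its kernel. So \<open>Op\<close> has values in \<open>L\<^sup>2(Q \<times> Q)\<close>.\<close>

definition kernel_op :: "'q measure \<Rightarrow> ('q \<times> 'q \<Rightarrow> complex) \<Rightarrow> ('q \<Rightarrow> complex) \<Rightarrow> 'q \<Rightarrow> complex" where
  "kernel_op muQ k \<phi> q0 = (\<integral>q. k (q0, q) * \<phi> q \<partial>muQ)"

definition Op ::
  "'q::topological_group_add measure \<Rightarrow> 'v::topological_ab_group_add measure \<Rightarrow> 'v pdual measure
     \<Rightarrow> ('q \<Rightarrow> 'v \<Rightarrow> 'v) \<Rightarrow> ('q \<Rightarrow> 'v pdual) \<Rightarrow> ('q \<Rightarrow> 'q \<Rightarrow> complex)
     \<Rightarrow> ('q \<times> 'v \<Rightarrow> complex) \<Rightarrow> 'q \<times> 'q \<Rightarrow> complex" where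
  "Op muQ muV muX act \<eta> b f = (\<lambda>(q0, q).
     of_real (modulus muV act (q0 + q) powr (- 1/2)) * b (- q0) q0 * cnj (b (- q) q0)
       * partial_fourier muQ muV muX act f (q0, \<eta> q0 - \<eta> q))"

text \<open>\<open>S\<close> lies in the domain of the GNS-map of the weight \<open>Tr(sqrt D \<cdot> sqrt D)\<close>, that is, the densely
  defined operator \<open>S (sqrt D)\<close> extends to a Hilbert-Schmidt operator, and \<open>k\<close> is the kernel
  of the latter.\<close>

definition gns ::
  "'q::topological_group_add measure \<Rightarrow> 'v::topological_ab_group_add measure \<Rightarrow> ('q \<Rightarrow> 'v \<Rightarrow> 'v)
     \<Rightarrow> (('q \<Rightarrow> complex) \<Rightarrow> 'q \<Rightarrow> complex) \<Rightarrow> ('q \<times> 'q \<Rightarrow> complex) \<Rightarrow> bool" where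
  "gns muQ muV act S k \<longleftrightarrow> L2_operator muQ muQ S \<and> k \<in> L2 (muQ \<Otimes>\<^sub>M muQ) \<and>
     (\<forall>\<phi> \<in> L2 muQ. (\<lambda>q. of_real (sqrt (duflo_moore muQ muV act q)) * \<phi> q) \<in> L2 muQ \<longrightarrow>
        (AE q0 in muQ. S (\<lambda>q. of_real (sqrt (duflo_moore muQ muV act q)) * \<phi> q) q0
           = kernel_op muQ k \<phi> q0))"

text \<open>\<open>HS \<otimes> HS\<close> is \<open>L\<^sup>2((Q \<times> Q) \<times> (Q \<times> Q))\<close>, and \<open>L\<^sup>2(G; HS)\<close> is \<open>L\<^sup>2(G \<times> (Q \<times> Q))\<close>.\<close>

definition galois_map ::
  "'q::topological_group_add measure \<Rightarrow> 'v::topological_ab_group_add measure \<Rightarrow> ('q \<Rightarrow> 'v \<Rightarrow> 'v)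
     \<Rightarrow> ('q \<Rightarrow> 'v pdual) \<Rightarrow> ('q \<Rightarrow> 'q \<Rightarrow> complex)
     \<Rightarrow> (('q \<times> 'q) \<times> ('q \<times> 'q) \<Rightarrow> complex) \<Rightarrow> ('q \<times> 'v) \<times> ('q \<times> 'q) \<Rightarrow> complex" where
  "galois_map muQ muV act \<eta> b = (SOME \<G>.
     L2_operator ((muQ \<Otimes>\<^sub>M muQ) \<Otimes>\<^sub>M (muQ \<Otimes>\<^sub>M muQ)) (haar_G muQ muV act \<Otimes>\<^sub>M (muQ \<Otimes>\<^sub>M muQ)) \<G> \<and>
     (\<forall>S T kS kT. gns muQ muV act S kS \<longrightarrow> gns muQ muV act T kT \<longrightarrow>
        (AE g in haar_G muQ muV act.
           gns muQ muV act
             (proj_rep \<eta> b g \<circ> S \<circ> L2_adjoint muQ muQ (proj_rep \<eta> b g) \<circ> T)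
             (\<lambda>z. \<G> (tensor_fun kS kT) (g, z)))))"

definition galois_tilde ::
  "'q::topological_group_add measure \<Rightarrow> 'v::topological_ab_group_add measure \<Rightarrow> 'v pdual measure
     \<Rightarrow> ('q \<Rightarrow> 'v \<Rightarrow> 'v) \<Rightarrow> ('q \<Rightarrow> 'v pdual) \<Rightarrow> ('q \<Rightarrow> 'q \<Rightarrow> complex)
     \<Rightarrow> (('q \<times> 'v) \<times> ('q \<times> 'v) \<Rightarrow> complex) \<Rightarrow> ('q \<times> 'v) \<times> ('q \<times> 'v) \<Rightarrow> complex" where
  "galois_tilde muQ muV muX act \<eta> b =
     (let G = haar_G muQ muV act; HS = muQ \<Otimes>\<^sub>M muQ; Op' = Op muQ muV muX act \<eta> b in
      L2_tensor G HS G G id (L2_adjoint G HS Op')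
        \<circ> galois_map muQ muV act \<eta> b
        \<circ> L2_tensor G G HS HS Op' Op')"


section \<open>The dual cocycle\<close>

definition J_op ::
  "'q::topological_group_add measure \<Rightarrow> 'v::topological_ab_group_add measure \<Rightarrow> ('q \<Rightarrow> 'v \<Rightarrow> 'v)
     \<Rightarrow> ('q \<Rightarrow> 'q \<Rightarrow> 'v) \<Rightarrow> ('q \<times> 'v \<Rightarrow> complex) \<Rightarrow> 'q \<times> 'v \<Rightarrow> complex" where
  "J_op muQ muV act \<beta> f g = of_real (modular_G muQ muV act g powr (- 1/2)) * f (ext_inv act \<beta> g)"

definition W_hat ::
  "('q::topological_group_add \<Rightarrow> 'v::topological_ab_group_add \<Rightarrow> 'v) \<Rightarrow> ('q \<Rightarrow> 'q \<Rightarrow> 'v)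
     \<Rightarrow> (('q \<times> 'v) \<times> ('q \<times> 'v) \<Rightarrow> complex) \<Rightarrow> ('q \<times> 'v) \<times> ('q \<times> 'v) \<Rightarrow> complex" where
  "W_hat act \<beta> f = (\<lambda>(g, h). f (ext_mult act \<beta> h g, h))"

definition Omega ::
  "'q::topological_group_add measure \<Rightarrow> 'v::topological_ab_group_add measure \<Rightarrow> 'v pdual measure
     \<Rightarrow> ('q \<Rightarrow> 'v \<Rightarrow> 'v) \<Rightarrow> ('q \<Rightarrow> 'v pdual) \<Rightarrow> ('q \<Rightarrow> 'q \<Rightarrow> 'v) \<Rightarrow> ('q \<Rightarrow> 'q \<Rightarrow> complex)
     \<Rightarrow> (('q \<times> 'v) \<times> ('q \<times> 'v) \<Rightarrow> complex) \<Rightarrow> ('q \<times> 'v) \<times> ('q \<times> 'v) \<Rightarrow> complex" where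
  "Omega muQ muV muX act \<eta> \<beta> b =
     (let G = haar_G muQ muV act; J = J_op muQ muV act \<beta> in
      L2_tensor G G G G J J
        \<circ> L2_adjoint (G \<Otimes>\<^sub>M G) (G \<Otimes>\<^sub>M G) (galois_tilde muQ muV muX act \<eta> b)
        \<circ> L2_tensor G G G G id J
        \<circ> W_hat act \<beta>)"

end

theory Submission
  imports Defs
begin

text \<open>
  The involution \<open>J\<close>, the operator \<open>W\<close>, the quantization map and the Galois map are all, up to partial
  Fourier transforms, weighted substitution operators \<open>f \<mapsto> m \<cdot> (f \<circ> \<phi>)\<close>. Write \<open>g = \<Omega> F\<^sup>* f\<close> with \<open>F\<close> the Fourier
  transform in both \<open>V\<close>-variables. Applying the unitary \<open>1 \<otimes> Op\<close> to the equation that defines \<open>g\<close> turns it into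
  \<open>\<G> (Op J \<otimes> Op J) g = (1 \<otimes> Op J) W F\<^sup>* f\<close>, where \<open>\<G>\<close> is the Galois map on Hilbert-Schmidt kernels;
  after a Fourier transform in the first variable both sides are explicit weighted substitutions, applied to \<open>F g\<close>
  on the left and to \<open>f\<close> on the right. The one on the left is injective, and it takes the asserted value of \<open>F g\<close>
  to the right-hand side: for the moduli this is multiplicativity, and for the phases it is
  the identity \<open>\<psi> = \<partial>b\<close>.

  The Galois map is characterized by operators only. Its explicit form is first found for operators \<open>S\<close> that are cut off
  to the region where the Duflo-Moore operator is bounded below, for which \<open>\<pi>(g) S \<pi>(g)\<^sup>* T\<close> is
  a composition of Hilbert-Schmidt operators, and then extended by continuity along a subsequence that converges
  for almost every \<open>g\<close>; density of such kernels also gives uniqueness.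
\<close>

text \<open>Most operators in the claim (tensor products, adjoints, the partial Fourier transform,
  the Galois map) are picked by \<open>SOME\<close>, the moduli by \<open>THE\<close>. Each needs an
  existence proof and a proof that any two candidates agree almost everywhere; for most of the
  operators the latter reduces to agreement on a dense class, typically indicators of rectangles.
  Weighted substitutions are convenient because one integral identity, \<open>L2_pullback\<close>,
  makes them isometric, and an isometry is injective. So the final equation is solved by checking
  the candidate, without inverting the substitution. Of the dual it is only assumed that
  \<open>muX\<close> satisfies \<open>left_haar_measure\<close>. Its sigma-finiteness and the factor
  by which the dual action scales it are transported from \<open>Q\<close> along \<eta>, using the
  cocycle identity and the normalization of \<open>muQ\<close>. The same change of variable turns
  the inverse Fourier integral over the dual into the integral over \<open>Q\<close> that composes
  Hilbert-Schmidt kernels; most factors \<open>md\<close> in the multipliers are Jacobians of this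
  kind.\<close>

text \<open>The extended-real-valued squared norm avoids integrability side conditions.\<close>

definition sqn :: "'a measure \<Rightarrow> ('a \<Rightarrow> complex) \<Rightarrow> ennreal" where
  "sqn M f = (\<integral>\<^sup>+x. ennreal ((cmod (f x))\<^sup>2) \<partial>M)"

lemma L2_iff: "f \<in> L2 M \<longleftrightarrow> f \<in> borel_measurable M \<and> sqn M f < \<infinity>"
  unfolding L2_def sqn_def
  by (auto simp: integrable_iff_bounded)

lemma L2_measurable [measurable_dest]: "f \<in> L2 M \<Longrightarrow> f \<in> borel_measurable M"
  by (simp add: L2_iff)

lemma sqn_cong_AE: "AE x in M. f x = g x \<Longrightarrow> sqn M f = sqn M g"
  unfolding sqn_def by (rule nn_integral_cong_AE) auto

lemma L2_cong_AE: "f \<in> L2 M \<Longrightarrow> g \<in> borel_measurable M \<Longrightarrow> AE x in M. f x = g x \<Longrightarrow> g \<in> L2 M"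
  using sqn_cong_AE[of f g M] by (simp add: L2_iff)

lemma sqn_mult: "f \<in> borel_measurable M \<Longrightarrow> sqn M (\<lambda>x. c * f x) = ennreal ((cmod c)\<^sup>2) * sqn M f"
  unfolding sqn_def by (subst nn_integral_cmult[symmetric]) (auto simp: norm_mult power_mult_distrib ennreal_mult)

text \<open>\<open>sqn\<close> is a squared norm, so it obeys the triangle inequality only up to a
  factor 2. That suffices: these bounds serve finiteness and convergence to 0, never exact
  norms.\<close>

lemma cmod_add_sq: "(cmod (a + b))\<^sup>2 \<le> 2 * (cmod a)\<^sup>2 + 2 * (cmod b)\<^sup>2"
proof -
  have "(cmod (a + b))\<^sup>2 \<le> (cmod a + cmod b)\<^sup>2"
    by (intro power_mono norm_triangle_ineq) auto
  also have "\<dots> \<le> 2 * (cmod a)\<^sup>2 + 2 * (cmod b)\<^sup>2"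
    using sum_squares_bound[of "cmod a" "cmod b"] by (simp add: power2_sum)
  finally show ?thesis .
qed

lemma sqn_add_le:
  assumes [measurable]: "f \<in> borel_measurable M" "g \<in> borel_measurable M"
  shows "sqn M (\<lambda>x. f x + g x) \<le> 2 * sqn M f + 2 * sqn M g"
proof -
  have "sqn M (\<lambda>x. f x + g x) \<le> (\<integral>\<^sup>+x. 2 * ennreal ((cmod (f x))\<^sup>2) + 2 * ennreal ((cmod (g x))\<^sup>2) \<partial>M)"
    unfolding sqn_def
  proof (rule nn_integral_mono)
    fix x
    have "ennreal ((cmod (f x + g x))\<^sup>2) \<le> ennreal (2 * (cmod (f x))\<^sup>2 + 2 * (cmod (g x))\<^sup>2)"
      by (intro ennreal_leI cmod_add_sq)
    also have "\<dots> = 2 * ennreal ((cmod (f x))\<^sup>2) + 2 * ennreal ((cmod (g x))\<^sup>2)"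
      by (simp add: ennreal_mult)
    finally show "ennreal ((cmod (f x + g x))\<^sup>2) \<le> \<dots>" .
  qed
  also have "\<dots> = 2 * sqn M f + 2 * sqn M g"
    unfolding sqn_def by (simp add: nn_integral_add nn_integral_cmult)
  finally show ?thesis .
qed

lemma sqn_diff_commute: "sqn M (\<lambda>x. f x - g x) = sqn M (\<lambda>x. g x - f x)"
  by (simp add: sqn_def norm_minus_commute)

lemma sqn_triangle:
  assumes [measurable]: "f \<in> borel_measurable M" "g \<in> borel_measurable M" "h \<in> borel_measurable M"
  shows "sqn M (\<lambda>x. f x - h x) \<le> 2 * sqn M (\<lambda>x. f x - g x) + 2 * sqn M (\<lambda>x. g x - h x)"
  using sqn_add_le[of "\<lambda>x. f x - g x" M "\<lambda>x. g x - h x"] by simp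

lemma L2_add: "f \<in> L2 M \<Longrightarrow> g \<in> L2 M \<Longrightarrow> (\<lambda>x. f x + g x) \<in> L2 M"
  using sqn_add_le[of f M g] by (auto simp: L2_iff ennreal_mult_less_top intro: le_less_trans)

lemma L2_scale: "f \<in> L2 M \<Longrightarrow> (\<lambda>x. c * f x) \<in> L2 M"
  by (auto simp: L2_iff sqn_mult ennreal_mult_less_top)

lemma L2_uminus: "f \<in> L2 M \<Longrightarrow> (\<lambda>x. - f x) \<in> L2 M"
  using L2_scale[of f M "-1"] by simp

lemma L2_diff: "f \<in> L2 M \<Longrightarrow> g \<in> L2 M \<Longrightarrow> (\<lambda>x. f x - g x) \<in> L2 M"
  using L2_add[of f M "\<lambda>x. - g x"] L2_uminus[of g M] by simp

lemma L2_zero [simp]: "(\<lambda>x. 0) \<in> L2 M"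
  by (simp add: L2_iff sqn_def)

lemma L2_sum: "(\<And>i. i \<in> I \<Longrightarrow> f i \<in> L2 M) \<Longrightarrow> (\<lambda>x. \<Sum>i\<in>I. f i x) \<in> L2 M"
  by (induction I rule: infinite_finite_induct) (auto intro: L2_add)

lemma L2_bounded_mult:
  assumes "f \<in> L2 M" and [measurable]: "m \<in> borel_measurable M" and "\<And>x. x \<in> space M \<Longrightarrow> cmod (m x) \<le> C"
  shows "(\<lambda>x. m x * f x) \<in> L2 M"
proof -
  have [measurable]: "f \<in> borel_measurable M" using assms by (simp add: L2_iff)
  have "sqn M (\<lambda>x. m x * f x) \<le> sqn M (\<lambda>x. of_real C * f x)"
    unfolding sqn_def
    by (intro nn_integral_mono ennreal_leI power_mono)
      (auto simp: norm_mult intro!: mult_right_mono order.trans[OF assms(3) abs_ge_self])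
  also have "\<dots> < \<infinity>" using L2_scale[OF assms(1)] by (simp add: L2_iff)
  finally show ?thesis by (simp add: L2_iff)
qed

lemma L2_indicator:
  assumes "A \<in> sets M" "emeasure M A < \<infinity>"
  shows "(indicator A :: 'a \<Rightarrow> complex) \<in> L2 M"
proof -
  have "sqn M (indicator A) = (\<integral>\<^sup>+x. indicator A x \<partial>M)"
    unfolding sqn_def by (intro nn_integral_cong) (auto simp: indicator_def)
  then show ?thesis using assms by (simp add: L2_iff)
qed

lemma sqn_zero_iff: "f \<in> borel_measurable M \<Longrightarrow> sqn M f = 0 \<longleftrightarrow> (AE x in M. f x = 0)"
  unfolding sqn_def by (subst nn_integral_0_iff_AE) auto

lemma sqn_diff_zero_iff:
  "f \<in> borel_measurable M \<Longrightarrow> g \<in> borel_measurable M \<Longrightarrow>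
   sqn M (\<lambda>x. f x - g x) = 0 \<longleftrightarrow> (AE x in M. f x = g x)"
  by (subst sqn_zero_iff) auto

section \<open>Convergence, completeness and induction for square-integrable functions\<close>

lemma ennreal_tendsto_0_add:
  fixes a b :: "nat \<Rightarrow> ennreal"
  assumes "a \<longlonglongrightarrow> 0" "b \<longlonglongrightarrow> 0"
  shows "(\<lambda>n. 2 * a n + 2 * b n) \<longlonglongrightarrow> 0"
proof -
  have "(\<lambda>n. 2 * a n + 2 * b n) \<longlonglongrightarrow> 2 * 0 + 2 * 0"
    by (intro tendsto_add ennreal_tendsto_cmult assms) auto
  then show ?thesis by simp
qed

lemma tendsto_0_le:
  fixes a b :: "nat \<Rightarrow> ennreal"
  assumes "a \<longlonglongrightarrow> 0" "\<And>n. b n \<le> a n"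
  shows "b \<longlonglongrightarrow> 0"
  by (rule tendsto_sandwich[OF _ _ tendsto_const assms(1)]) (use assms in auto)

lemma L2_lim_unique:
  assumes [measurable]: "\<And>n. F n \<in> borel_measurable M" "f \<in> borel_measurable M" "g \<in> borel_measurable M"
    and "(\<lambda>n. sqn M (\<lambda>x. F n x - f x)) \<longlonglongrightarrow> 0" "(\<lambda>n. sqn M (\<lambda>x. F n x - g x)) \<longlonglongrightarrow> 0"
  shows "AE x in M. f x = g x"
proof -
  have "(\<lambda>n. sqn M (\<lambda>x. f x - g x)) \<longlonglongrightarrow> 0"
  proof (rule tendsto_0_le[OF ennreal_tendsto_0_add[OF assms(4,5)]])
    fix n show "sqn M (\<lambda>x. f x - g x) \<le> 2 * sqn M (\<lambda>x. F n x - f x) + 2 * sqn M (\<lambda>x. F n x - g x)"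
      using sqn_triangle[of f M "F n" g] by (simp add: sqn_diff_commute[of M f "F n"])
  qed
  then have "sqn M (\<lambda>x. f x - g x) = 0"
    by (simp add: LIMSEQ_const_iff)
  then show ?thesis by (simp add: sqn_diff_zero_iff)
qed

text \<open>Along a subsequence whose integrals are at most 2^(-j), the sum of the functions has
  finite integral; so it is finite almost everywhere and its terms tend to 0.\<close>

lemma AE_tendsto_0_subseq:
  fixes u :: "nat \<Rightarrow> 'a \<Rightarrow> ennreal"
  assumes [measurable]: "\<And>n. u n \<in> borel_measurable M"
    and lim: "(\<lambda>n. \<integral>\<^sup>+x. u n x \<partial>M) \<longlonglongrightarrow> 0"
  shows "\<exists>r::nat\<Rightarrow>nat. strict_mono r \<and> (AE x in M. (\<lambda>n. u (r n) x) \<longlonglongrightarrow> 0)"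
proof -
  have ex: "\<exists>n>k. (\<integral>\<^sup>+x. u n x \<partial>M) \<le> ennreal ((1/2)^j)" for k j
  proof -
    have "eventually (\<lambda>n. (\<integral>\<^sup>+x. u n x \<partial>M) < ennreal ((1/2)^j)) sequentially"
      using order_tendstoD(2)[OF lim, of "ennreal ((1/2)^j)"] by simp
    from eventually_happens[OF eventually_conj[OF this eventually_gt_at_top[of k]]]
    show ?thesis by (auto intro: less_imp_le)
  qed
  \<comment> \<open>Each index is chosen beyond the previous one, which makes \<open>r\<close>
    strictly increasing, and far enough out that the integral is at most
    \<open>(1/2)^j\<close>.\<close>
  define r where "r = rec_nat (SOME n. n > 0 \<and> (\<integral>\<^sup>+x. u n x \<partial>M) \<le> ennreal ((1/2)^0))
     (\<lambda>j k. SOME n. n > k \<and> (\<integral>\<^sup>+x. u n x \<partial>M) \<le> ennreal ((1/2)^Suc j))"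
  have r0: "(\<integral>\<^sup>+x. u (r 0) x \<partial>M) \<le> ennreal ((1/2)^0)"
    unfolding r_def using someI_ex[OF ex[of 0 0]] by simp
  have rS: "r (Suc j) > r j \<and> (\<integral>\<^sup>+x. u (r (Suc j)) x \<partial>M) \<le> ennreal ((1/2)^Suc j)" for j
    unfolding r_def using someI_ex[OF ex[of "r j" "Suc j"]] by (simp add: r_def)
  have le: "(\<integral>\<^sup>+x. u (r j) x \<partial>M) \<le> ennreal ((1/2)^j)" for j
    using r0 rS by (cases j) auto
  have "(\<integral>\<^sup>+x. (\<Sum>j. u (r j) x) \<partial>M) = (\<Sum>j. \<integral>\<^sup>+x. u (r j) x \<partial>M)"
    by (rule nn_integral_suminf) simp
  also have "\<dots> \<le> (\<Sum>j. ennreal ((1/2)^j))"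
    by (intro suminf_le le) auto
  also have "\<dots> = ennreal (\<Sum>j. (1/2)^j)"
    by (rule suminf_ennreal2) (auto simp: summable_geometric)
  also have "\<dots> < \<infinity>" by simp
  finally have "AE x in M. (\<Sum>j. u (r j) x) \<noteq> \<infinity>"
    by (intro nn_integral_PInf_AE) auto
  then have "AE x in M. (\<lambda>n. u (r n) x) \<longlonglongrightarrow> 0"
  proof eventually_elim
    case (elim x)
    \<comment> \<open>Finite terms allow the passage to a real series, where convergence of the sum
      forces the terms to 0.\<close>
    have "u (r j) x \<noteq> \<infinity>" for j
      using elim sum_le_suminf[of "\<lambda>j. u (r j) x" "{j}"] by (auto simp: top_unique)
    define v where "v j = enn2real (u (r j) x)" for j
    have v: "\<And>j. u (r j) x = ennreal (v j)" "\<And>j. v j \<ge> 0"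
      using \<open>\<And>j. u (r j) x \<noteq> \<infinity>\<close> by (auto simp: v_def less_top)
    have "summable v" using elim v by (intro summable_suminf_not_top) auto
    then have "v \<longlonglongrightarrow> 0" by (rule summable_LIMSEQ_zero)
    then show ?case using v by (simp add: tendsto_ennreal_iff[where x=0, simplified])
  qed
  moreover have "strict_mono r" using rS by (simp add: strict_mono_Suc_iff)
  ultimately show ?thesis by blast
qed

text \<open>The Riesz-Fischer argument, with Cauchy sequences measured by \<open>sqn\<close>. A
  rapidly convergent subsequence converges pointwise almost everywhere, and Fatou's lemma makes its
  limit the limit of the whole sequence.\<close>

lemma L2_complete:
  assumes F: "\<And>n. F n \<in> L2 M"
    and C: "\<And>e. e > 0 \<Longrightarrow> \<exists>N. \<forall>m\<ge>N. \<forall>n\<ge>N. sqn M (\<lambda>x. F m x - F n x) < e"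
  shows "\<exists>f \<in> L2 M. (\<lambda>n. sqn M (\<lambda>x. F n x - f x)) \<longlonglongrightarrow> 0"
proof -
  have [measurable]: "F n \<in> borel_measurable M" for n using F by (simp add: L2_iff)
  obtain N where N: "\<And>k m n. m \<ge> N k \<Longrightarrow> n \<ge> N k \<Longrightarrow> sqn M (\<lambda>x. F m x - F n x) < ennreal ((1/4)^k)"
    using C[of "ennreal ((1/4)^k)" for k] by simp metis
  \<comment> \<open>Partial sums make \<open>s\<close> monotone and at least \<open>N k\<close>; the
    added \<open>k\<close> also gives \<open>k \<le> s k\<close>, so that the subsequence enters
    every tail.\<close>
  define s where "s k = (\<Sum>j\<le>k. N j) + k" for k
  have s: "N k \<le> s k" "s k \<le> s (Suc k)" "k \<le> s k" for k
    unfolding s_def using member_le_sum[of k "{..k}" N] by auto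
  \<comment> \<open>The squared distances decay like 4^(-k). Weighted by 2^k they are still
    summable, which for almost every point forces the differences below 2^(-k/2) eventually, hence
    summability of the telescoping series.\<close>
  have d: "sqn M (\<lambda>x. F (s (Suc k)) x - F (s k) x) \<le> ennreal ((1/4)^k)" for k
    by (rule less_imp_le[OF N]) (meson s le_trans)+
  have "(\<integral>\<^sup>+x. (\<Sum>k. ennreal (2^k * (cmod (F (s (Suc k)) x - F (s k) x))\<^sup>2)) \<partial>M)
      = (\<Sum>k. ennreal (2^k) * sqn M (\<lambda>x. F (s (Suc k)) x - F (s k) x))"
    unfolding sqn_def by (subst nn_integral_suminf) (auto simp: nn_integral_cmult[symmetric] ennreal_mult simp del: ennreal_power)
  also have "\<dots> \<le> (\<Sum>k. ennreal ((1/2)^k))"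
  proof (intro suminf_le)
    fix k
    have "ennreal (2^k) * sqn M (\<lambda>x. F (s (Suc k)) x - F (s k) x) \<le> ennreal (2^k) * ennreal ((1/4)^k)"
      by (intro mult_left_mono d) auto
    also have "\<dots> = ennreal ((1/2)^k)"
      by (subst ennreal_mult[symmetric]) (auto simp: power_mult_distrib[symmetric])
    finally show "ennreal (2^k) * sqn M (\<lambda>x. F (s (Suc k)) x - F (s k) x) \<le> ennreal ((1/2)^k)" .
  qed auto
  also have "\<dots> = ennreal (\<Sum>j. (1/2)^j)"
    by (rule suminf_ennreal2) (auto simp: summable_geometric)
  also have "\<dots> < \<infinity>" by simp
  finally have fin: "AE x in M. (\<Sum>k. ennreal (2^k * (cmod (F (s (Suc k)) x - F (s k) x))\<^sup>2)) \<noteq> \<infinity>"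
    by (intro nn_integral_PInf_AE) auto
  have conv: "AE x in M. convergent (\<lambda>k. F (s k) x)"
    using fin
  proof eventually_elim
    case (elim x)
    let ?d = "\<lambda>k. cmod (F (s (Suc k)) x - F (s k) x)"
    have "summable (\<lambda>k. 2^k * (?d k)\<^sup>2)"
      using elim by (intro summable_suminf_not_top) auto
    then have "(\<lambda>k. 2^k * (?d k)\<^sup>2) \<longlonglongrightarrow> 0" by (rule summable_LIMSEQ_zero)
    then have ev: "eventually (\<lambda>k. 2^k * (?d k)\<^sup>2 < 1) sequentially"
      by (rule order_tendstoD) simp
    have "summable (\<lambda>k. F (s (Suc k)) x - F (s k) x)"
    proof (rule summable_comparison_test_ev)
      show "summable (\<lambda>k. (1 / sqrt 2)^k :: real)"
        by (rule summable_geometric) simp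
      show "eventually (\<lambda>k. norm (F (s (Suc k)) x - F (s k) x) \<le> (1 / sqrt 2)^k) sequentially"
        using ev
      proof eventually_elim
        case (elim k)
        have "((1 / sqrt 2)^k)\<^sup>2 = ((1 / sqrt 2)\<^sup>2)^k"
          by (simp only: power_mult[symmetric] mult.commute)
        also have "\<dots> = 1 / 2^k" by (simp add: power_divide)
        finally have "(?d k)\<^sup>2 \<le> ((1 / sqrt 2)^k)\<^sup>2"
          using elim by (simp add: field_simps)
        then show ?case by (rule power2_le_imp_le) simp
      qed
    qed
    then have "convergent (\<lambda>n. \<Sum>k<n. F (s (Suc k)) x - F (s k) x)"
      unfolding summable_iff_convergent .
    then have "convergent (\<lambda>n. F (s n) x - F (s 0) x)"
      by (simp only: sum_lessThan_telescope[of "\<lambda>k. F (s k) x"])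
    then show ?case
      using convergent_diff_const_right_iff[of "\<lambda>k. F (s k) x" "F (s 0) x"] by simp
  qed
  define f where "f x = lim (\<lambda>k. F (s k) x)" for x
  have fm[measurable]: "f \<in> borel_measurable M"
    unfolding f_def[abs_def] by measurable
  have f: "AE x in M. (\<lambda>k. F (s k) x) \<longlonglongrightarrow> f x"
    using conv by eventually_elim (simp add: f_def convergent_LIMSEQ_iff)
  have le: "sqn M (\<lambda>x. F m x - f x) \<le> e" if m: "\<And>n. n \<ge> K \<Longrightarrow> sqn M (\<lambda>x. F m x - F n x) \<le> e" for m K e
  proof -
    \<comment> \<open>Fatou's lemma along the subsequence; the shift by \<open>K\<close> keeps all
      its indices in the range where the bound by \<open>e\<close> is assumed.\<close>
    have "sqn M (\<lambda>x. F m x - f x) = (\<integral>\<^sup>+x. liminf (\<lambda>k. ennreal ((cmod (F m x - F (s (k + K)) x))\<^sup>2)) \<partial>M)"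
      unfolding sqn_def
    proof (rule nn_integral_cong_AE)
      show "AE x in M. ennreal ((cmod (F m x - f x))\<^sup>2) = liminf (\<lambda>k. ennreal ((cmod (F m x - F (s (k + K)) x))\<^sup>2))"
        using f
      proof eventually_elim
        case (elim x)
        have "(\<lambda>k. F (s (k + K)) x) \<longlonglongrightarrow> f x" using elim by (rule LIMSEQ_ignore_initial_segment)
        then have "(\<lambda>k. ennreal ((cmod (F m x - F (s (k + K)) x))\<^sup>2)) \<longlonglongrightarrow> ennreal ((cmod (F m x - f x))\<^sup>2)"
          by (intro tendsto_ennrealI tendsto_intros)
        then show ?case
          by (intro lim_imp_Liminf[symmetric]) auto
      qed
    qed
    also have "\<dots> \<le> liminf (\<lambda>k. sqn M (\<lambda>x. F m x - F (s (k + K)) x))"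
      unfolding sqn_def by (intro nn_integral_liminf) auto
    also have "\<dots> \<le> limsup (\<lambda>k. sqn M (\<lambda>x. F m x - F (s (k + K)) x))"
      by (rule Liminf_le_Limsup) simp
    also have "\<dots> \<le> e"
    proof (rule Limsup_bounded)
      show "eventually (\<lambda>k. sqn M (\<lambda>x. F m x - F (s (k + K)) x) \<le> e) sequentially"
        by (intro always_eventually allI m) (meson s(3) add_leD2)
    qed
    finally show ?thesis .
  qed
  have lim: "(\<lambda>n. sqn M (\<lambda>x. F n x - f x)) \<longlonglongrightarrow> 0"
  proof (rule order_tendstoI)
    fix e :: ennreal assume "e > 0"
    then obtain e' where e': "0 < e'" "e' < e" using dense by blast
    obtain K where "\<forall>m\<ge>K. \<forall>n\<ge>K. sqn M (\<lambda>x. F m x - F n x) < e'" using C[OF e'(1)] by blast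
    then have "sqn M (\<lambda>x. F n x - f x) \<le> e'" if "n \<ge> K" for n
      using that by (intro le[of K]) (auto intro: less_imp_le)
    then show "eventually (\<lambda>n. sqn M (\<lambda>x. F n x - f x) < e) sequentially"
      unfolding eventually_sequentially using e' by (auto intro: le_less_trans)
  qed simp
  moreover have "f \<in> L2 M"
  proof -
    obtain K where "\<forall>m\<ge>K. \<forall>n\<ge>K. sqn M (\<lambda>x. F m x - F n x) < 1" using C[of 1] by auto
    then have "sqn M (\<lambda>x. F K x - f x) \<le> 1"
      by (intro le[of K]) (auto intro: less_imp_le)
    then have "(\<lambda>x. F K x - f x) \<in> L2 M" by (auto simp: L2_iff intro: le_less_trans)
    from L2_diff[OF F[of K] this] show ?thesis by simp
  qed
  ultimately show ?thesis by blast
qed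

text \<open>The factor 2 in the bound is the one with which simple functions approximate a
  measurable function in \<open>L2_induct\<close>; the differences are then dominated by
  \<open>3 * f x\<close>.\<close>

lemma L2_dominated_lim:
  assumes f: "f \<in> L2 M" and [measurable]: "\<And>n. F n \<in> borel_measurable M"
    and lim: "AE x in M. (\<lambda>n. F n x) \<longlonglongrightarrow> f x"
    and bd: "\<And>n x. x \<in> space M \<Longrightarrow> cmod (F n x) \<le> 2 * cmod (f x)"
  shows "F n \<in> L2 M" and "(\<lambda>n. sqn M (\<lambda>x. F n x - f x)) \<longlonglongrightarrow> 0"
proof -
  have [measurable]: "f \<in> borel_measurable M" using f by (simp add: L2_iff)
  have "sqn M (F n) \<le> sqn M (\<lambda>x. 2 * f x)"
    unfolding sqn_def by (intro nn_integral_mono ennreal_leI power_mono) (auto simp: norm_mult bd)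
  also have "\<dots> < \<infinity>" using L2_scale[OF f] by (simp add: L2_iff)
  finally show "F n \<in> L2 M" by (simp add: L2_iff)
  have "(\<lambda>n. \<integral>\<^sup>+x. ennreal ((cmod (F n x - f x))\<^sup>2) \<partial>M) \<longlonglongrightarrow> (\<integral>\<^sup>+x. 0 \<partial>M)"
  proof (rule nn_integral_dominated_convergence[where w = "\<lambda>x. ennreal ((cmod (3 * f x))\<^sup>2)"])
    show "AE x in M. ennreal ((cmod (F n x - f x))\<^sup>2) \<le> ennreal ((cmod (3 * f x))\<^sup>2)" for n
    proof (intro AE_I2 ennreal_leI power_mono)
      fix x assume "x \<in> space M"
      then show "cmod (F n x - f x) \<le> cmod (3 * f x)"
        using norm_triangle_ineq4[of "F n x" "f x"] bd[of x n] by (simp add: norm_mult)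
    qed auto
    show "(\<integral>\<^sup>+x. ennreal ((cmod (3 * f x))\<^sup>2) \<partial>M) < \<infinity>"
      using L2_scale[OF f, of 3] by (simp add: L2_iff sqn_def)
    show "AE x in M. (\<lambda>n. ennreal ((cmod (F n x - f x))\<^sup>2)) \<longlonglongrightarrow> 0"
      using lim
    proof eventually_elim
      case (elim x)
      have "(\<lambda>n. ennreal ((cmod (F n x - f x))\<^sup>2)) \<longlonglongrightarrow> ennreal ((cmod (f x - f x))\<^sup>2)"
        by (intro tendsto_ennrealI tendsto_intros elim)
      then show ?case by simp
    qed
  qed auto
  then show "(\<lambda>n. sqn M (\<lambda>x. F n x - f x)) \<longlonglongrightarrow> 0" by (simp add: sqn_def)
qed

text \<open>Simple functions bounded by \<open>2 * cmod (f x)\<close> reduce everything to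
  indicators, since the level sets of their nonzero values have finite measure.\<close>

lemma L2_induct [consumes 1, case_names ind scale add lim]:
  assumes f: "f \<in> L2 M"
    and ind: "\<And>A. A \<in> sets M \<Longrightarrow> emeasure M A < \<infinity> \<Longrightarrow> Pr (indicator A :: _ \<Rightarrow> complex)"
    and scale: "\<And>c f. f \<in> L2 M \<Longrightarrow> Pr f \<Longrightarrow> Pr (\<lambda>x. c * f x)"
    and add: "\<And>f g. f \<in> L2 M \<Longrightarrow> g \<in> L2 M \<Longrightarrow> Pr f \<Longrightarrow> Pr g \<Longrightarrow> Pr (\<lambda>x. f x + g x)"
    and lim: "\<And>F f. (\<And>n. F n \<in> L2 M) \<Longrightarrow> (\<And>n. Pr (F n)) \<Longrightarrow> f \<in> L2 M \<Longrightarrow>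
       (\<lambda>n. sqn M (\<lambda>x. F n x - f x)) \<longlonglongrightarrow> 0 \<Longrightarrow> Pr f"
  shows "Pr f"
proof -
  have fm [measurable]: "f \<in> borel_measurable M" using f by (simp add: L2_iff)
  obtain s where s: "\<And>i. simple_function M (s i)" "\<And>x. x \<in> space M \<Longrightarrow> (\<lambda>i. s i x) \<longlonglongrightarrow> f x"
    "\<And>i x. x \<in> space M \<Longrightarrow> cmod (s i x) \<le> 2 * cmod (f x)"
    using borel_measurable_implies_sequence_metric[OF fm, of 0] unfolding norm_conv_dist by metis
  have sm [measurable]: "s i \<in> borel_measurable M" for i
    using s(1) by (rule borel_measurable_simple_function)
  have zero: "Pr (\<lambda>x. 0)"
    using scale[OF L2_indicator ind, of "{}" 0] by simp
  have sum: "finite I \<Longrightarrow> (\<And>i. i \<in> I \<Longrightarrow> g i \<in> L2 M) \<Longrightarrow> (\<And>i. i \<in> I \<Longrightarrow> Pr (g i)) \<Longrightarrow> Pr (\<lambda>x. \<Sum>i\<in>I. g i x)"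
    for I :: "complex set" and g
    by (induction I rule: finite_induct) (auto intro!: add zero L2_sum)
  have sL2: "s n \<in> L2 M" and slim: "(\<lambda>n. sqn M (\<lambda>x. s n x - f x)) \<longlonglongrightarrow> 0" for n
    using L2_dominated_lim[OF f, of s] s by auto
  have Ps: "Pr (s n)" for n
  proof -
    let ?A = "\<lambda>y. {x \<in> space M. s n x = y}"
    define g where "g x = (\<Sum>y\<in>s n ` space M - {0}. y * indicator (?A y) x)" for x
    have fin: "finite (s n ` space M)" using s(1) by (simp add: simple_function_def)
    have A: "?A y \<in> sets M" for y by measurable
    \<comment> \<open>Chebyshev's inequality. The value 0 is left out of the sum defining
      \<open>g\<close> because its level set may have infinite measure.\<close>
    have Afin: "emeasure M (?A y) < \<infinity>" if "y \<noteq> 0" for y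
    proof -
      have "ennreal ((cmod y)\<^sup>2) * emeasure M (?A y) = (\<integral>\<^sup>+x. ennreal ((cmod y)\<^sup>2) * indicator (?A y) x \<partial>M)"
        using A by (simp add: nn_integral_cmult_indicator)
      also have "\<dots> \<le> sqn M (s n)" unfolding sqn_def
        by (intro nn_integral_mono) (auto simp: indicator_def)
      also have "\<dots> < \<infinity>" using sL2 by (simp add: L2_iff)
      finally show ?thesis using that by (auto simp: ennreal_mult_less_top ennreal_mult_eq_top_iff less_top)
    qed
    have "Pr g" unfolding g_def
      using A Afin by (intro sum) (auto intro!: L2_scale scale ind L2_indicator fin)
    moreover have gL: "g \<in> L2 M" unfolding g_def
      using A Afin by (intro L2_sum L2_scale L2_indicator) auto
    moreover have "s n x = g x" if "x \<in> space M" for x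
    proof -
      have "g x = (\<Sum>y\<in>s n ` space M - {0}. if y = s n x then y else 0)"
        unfolding g_def by (intro sum.cong) (auto simp: indicator_def that)
      also have "\<dots> = s n x" using fin that by (auto simp: sum.delta')
      finally show ?thesis by simp
    qed
    \<comment> \<open>\<open>g\<close> and \<open>s n\<close> may differ outside
      \<open>space M\<close>, so \<open>Pr\<close> is carried over by the limit rule for a constant
      sequence.\<close>
    then have "sqn M (\<lambda>x. g x - s n x) = 0"
      by (simp add: sqn_def cong: nn_integral_cong)
    ultimately show ?thesis
      by (intro lim[of "\<lambda>_. g" "s n", OF _ _ sL2]) (simp_all only: tendsto_const)
  qed
  show ?thesis by (rule lim[OF sL2 Ps f slim])
qed

section \<open>Square-integrable functions on product spaces\<close>

lemma sqn_pair:
  assumes "sigma_finite_measure M2" and [measurable]: "f \<in> borel_measurable (M1 \<Otimes>\<^sub>M M2)"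
  shows "sqn (M1 \<Otimes>\<^sub>M M2) f = (\<integral>\<^sup>+x. sqn M2 (\<lambda>y. f (x, y)) \<partial>M1)"
proof -
  interpret sigma_finite_measure M2 by fact
  show ?thesis unfolding sqn_def by (subst nn_integral_fst[symmetric]) auto
qed

lemma borel_measurable_sqn_slice [measurable]:
  assumes "sigma_finite_measure M2" and [measurable]: "f \<in> borel_measurable (M1 \<Otimes>\<^sub>M M2)"
  shows "(\<lambda>x. sqn M2 (\<lambda>y. f (x, y))) \<in> borel_measurable M1"
proof -
  interpret sigma_finite_measure M2 by fact
  show ?thesis unfolding sqn_def by measurable
qed

lemma AE_L2_slice:
  assumes "sigma_finite_measure M2" "f \<in> L2 (M1 \<Otimes>\<^sub>M M2)"
  shows "AE x in M1. (\<lambda>y. f (x, y)) \<in> L2 M2"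
proof -
  have [measurable]: "f \<in> borel_measurable (M1 \<Otimes>\<^sub>M M2)" using assms by (simp add: L2_iff)
  have "(\<integral>\<^sup>+x. sqn M2 (\<lambda>y. f (x, y)) \<partial>M1) < \<infinity>"
    using assms by (simp add: L2_iff sqn_pair)
  then have "AE x in M1. sqn M2 (\<lambda>y. f (x, y)) \<noteq> \<infinity>"
    using assms(1) by (intro nn_integral_PInf_AE) auto
  with AE_space show ?thesis
    by eventually_elim (auto simp: L2_iff less_top intro: measurable_compose_Pair1)
qed

lemma sqn_tensor:
  assumes "sigma_finite_measure M2" "f \<in> borel_measurable M1" "g \<in> borel_measurable M2"
  shows "sqn (M1 \<Otimes>\<^sub>M M2) (tensor_fun f g) = sqn M1 f * sqn M2 g"
proof -
  have [measurable]: "f \<in> borel_measurable M1" "g \<in> borel_measurable M2" by fact+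
  have "sqn (M1 \<Otimes>\<^sub>M M2) (tensor_fun f g) = (\<integral>\<^sup>+x. sqn M2 (\<lambda>y. f x * g y) \<partial>M1)"
    using assms(1) by (subst sqn_pair) (auto simp: tensor_fun_def)
  also have "\<dots> = (\<integral>\<^sup>+x. ennreal ((cmod (f x))\<^sup>2) * sqn M2 g \<partial>M1)"
    by (simp add: sqn_mult)
  also have "\<dots> = sqn M1 f * sqn M2 g"
    by (simp add: sqn_def[of M1] nn_integral_multc)
  finally show ?thesis .
qed

lemma L2_tensor_fun:
  assumes "sigma_finite_measure M2" "f \<in> L2 M1" "g \<in> L2 M2"
  shows "tensor_fun f g \<in> L2 (M1 \<Otimes>\<^sub>M M2)"
proof -
  have [measurable]: "f \<in> borel_measurable M1" "g \<in> borel_measurable M2" using assms by (auto simp: L2_iff)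
  have "tensor_fun f g \<in> borel_measurable (M1 \<Otimes>\<^sub>M M2)" unfolding tensor_fun_def by measurable
  with assms show ?thesis by (auto simp: L2_iff sqn_tensor ennreal_mult_less_top)
qed

text \<open>A Dynkin argument: rectangles are stable under intersection and generate the product
  sigma-algebra. It is run inside rectangles \<open>R n\<close> of finite measure, where complements
  stay square-integrable, and the restriction is removed by letting \<open>R n\<close> increase to
  the whole space.\<close>

lemma L2_prod_induct [consumes 3, case_names rect scale add lim]:
  assumes sf: "sigma_finite_measure M1" "sigma_finite_measure M2"
    and f: "f \<in> L2 (M1 \<Otimes>\<^sub>M M2)"
    and rect: "\<And>A B. A \<in> sets M1 \<Longrightarrow> emeasure M1 A < \<infinity> \<Longrightarrow> B \<in> sets M2 \<Longrightarrow> emeasure M2 B < \<infinity> \<Longrightarrow>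
       Pr (tensor_fun (indicator A) (indicator B))"
    and scale: "\<And>c f. f \<in> L2 (M1 \<Otimes>\<^sub>M M2) \<Longrightarrow> Pr f \<Longrightarrow> Pr (\<lambda>x. c * f x)"
    and add: "\<And>f g. f \<in> L2 (M1 \<Otimes>\<^sub>M M2) \<Longrightarrow> g \<in> L2 (M1 \<Otimes>\<^sub>M M2) \<Longrightarrow> Pr f \<Longrightarrow> Pr g \<Longrightarrow> Pr (\<lambda>x. f x + g x)"
    and lim: "\<And>F f. (\<And>n. F n \<in> L2 (M1 \<Otimes>\<^sub>M M2)) \<Longrightarrow> (\<And>n. Pr (F n)) \<Longrightarrow> f \<in> L2 (M1 \<Otimes>\<^sub>M M2) \<Longrightarrow>
       (\<lambda>n. sqn (M1 \<Otimes>\<^sub>M M2) (\<lambda>x. F n x - f x)) \<longlonglongrightarrow> 0 \<Longrightarrow> Pr f"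
  shows "Pr f"
  using f
proof (induction rule: L2_induct)
  case (ind A)
  interpret M1: sigma_finite_measure M1 by fact
  interpret M2: sigma_finite_measure M2 by fact
  interpret pair_sigma_finite M1 M2 ..
  let ?M = "M1 \<Otimes>\<^sub>M M2"
  obtain E where E: "range E \<subseteq> sets M1" "(\<Union>i. E i) = space M1" "\<And>i. emeasure M1 (E i) \<noteq> \<infinity>" "incseq E"
    using M1.sigma_finite_incseq by blast
  obtain F where F: "range F \<subseteq> sets M2" "(\<Union>i. F i) = space M2" "\<And>i. emeasure M2 (F i) \<noteq> \<infinity>" "incseq F"
    using M2.sigma_finite_incseq by blast
  define R where "R n = E n \<times> F n" for n
  have R: "R n \<in> sets ?M" for n using E F by (auto simp: R_def)
  have Rfin: "emeasure ?M (R n) < \<infinity>" for n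
    using E F by (auto simp: R_def M2.emeasure_pair_measure_Times ennreal_mult_less_top less_top)
  have L: "(indicator (S \<inter> R n) :: _ \<Rightarrow> complex) \<in> L2 ?M" if "S \<in> sets ?M" for S n
    using that R Rfin[of n] emeasure_mono[of "S \<inter> R n" "R n" ?M]
    by (intro L2_indicator) (auto intro: le_less_trans)
  have *: "Pr (indicator (S \<inter> R n))" if "S \<in> sets ?M" for S n
  proof -
    have S: "S \<in> sigma_sets (space M1 \<times> space M2) {a \<times> b | a b. a \<in> sets M1 \<and> b \<in> sets M2}"
      using that by (simp add: sets_pair_measure)
    have pw: "{a \<times> b | a b. a \<in> sets M1 \<and> b \<in> sets M2} \<subseteq> Pow (space M1 \<times> space M2)"
      by (rule pair_measure_closed)
    have "Int_stable {a \<times> b | a b. a \<in> sets M1 \<and> b \<in> sets M2}"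
      by (rule Int_stable_pair_measure_generator)
    from this pw S show ?thesis
    proof (induction rule: sigma_sets_induct_disjoint)
      case (basic S)
      then obtain a b where ab: "S = a \<times> b" "a \<in> sets M1" "b \<in> sets M2" by auto
      have "indicator (S \<inter> R n) = tensor_fun (indicator (a \<inter> E n)) (indicator (b \<inter> F n))"
        by (auto simp: fun_eq_iff ab R_def tensor_fun_def indicator_def)
      moreover have "emeasure M1 (a \<inter> E n) < \<infinity>"
        using emeasure_mono[of "a \<inter> E n" "E n" M1] E by (auto intro: le_less_trans simp: less_top)
      moreover have "emeasure M2 (b \<inter> F n) < \<infinity>"
        using emeasure_mono[of "b \<inter> F n" "F n" M2] F by (auto intro: le_less_trans simp: less_top)
      ultimately show ?case using ab E F by (auto intro!: rect)
    next
      case empty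
      have "indicator ({} \<inter> R n) = tensor_fun (indicator {}) (indicator {})"
        by (auto simp: fun_eq_iff tensor_fun_def)
      then show ?case by (auto intro!: rect)
    next
      case (compl S)
      then have S: "S \<in> sets ?M" by (simp add: sets_pair_measure)
      have RR: "Pr (indicator (R n))"
      proof -
        have "indicator (R n) = tensor_fun (indicator (E n)) (indicator (F n))"
          by (auto simp: fun_eq_iff R_def tensor_fun_def indicator_def)
        then show ?thesis using E F by (auto intro!: rect simp: less_top)
      qed
      have "indicator ((space M1 \<times> space M2 - S) \<inter> R n) = (\<lambda>x. indicator (R n) x + (-1) * (indicator (S \<inter> R n) x :: complex))"
        using sets.sets_into_space[OF R[of n]] by (auto simp: fun_eq_iff indicator_def space_pair_measure)
      moreover have "Pr (\<lambda>x. indicator (R n) x + (-1) * (indicator (S \<inter> R n) x :: complex))"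
        by (rule add[OF L2_indicator[OF R Rfin] L2_scale[OF L[OF S]] RR scale[OF L[OF S] compl(2)]])
      ultimately show ?case by simp
    next
      case (union S)
      then have S: "S i \<in> sets ?M" for i by (auto simp: sets_pair_measure)
      have PU: "Pr (indicator ((\<Union>i<k. S i) \<inter> R n))" for k
      proof (induction k)
        case 0
        have "Pr (\<lambda>x. 0 * indicator (S 0 \<inter> R n) x)" using union S by (intro scale L) auto
        then show ?case by (simp add: indicator_def[abs_def])
      next
        case (Suc k)
        have dj: "p \<notin> S j" if "p \<in> S k" "j < k" for p j
          using disjoint_family_onD[OF union(1), of j k] that by auto
        have "indicator ((\<Union>i<Suc k. S i) \<inter> R n) = (\<lambda>x. indicator ((\<Union>i<k. S i) \<inter> R n) x + (indicator (S k \<inter> R n) x :: complex))"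
          by (auto simp: fun_eq_iff indicator_def lessThan_Suc dest: dj)
        then show ?case using union S by (auto intro!: add L Suc)
      qed
      show ?case
      proof (rule lim[of "\<lambda>k. indicator ((\<Union>i<k. S i) \<inter> R n)"])
        show "(\<lambda>k. sqn ?M (\<lambda>x. indicator ((\<Union>i<k. S i) \<inter> R n) x - indicator (\<Union> (range S) \<inter> R n) x)) \<longlonglongrightarrow> 0"
        proof (rule L2_dominated_lim(2))
          show "AE x in ?M. (\<lambda>k. indicator ((\<Union>i<k. S i) \<inter> R n) x :: complex) \<longlonglongrightarrow> indicator (\<Union> (range S) \<inter> R n) x"
          proof (rule AE_I2)
            fix x
            show "(\<lambda>k. indicator ((\<Union>i<k. S i) \<inter> R n) x :: complex) \<longlonglongrightarrow> indicator (\<Union> (range S) \<inter> R n) x"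
            proof (cases "\<exists>i. x \<in> S i \<inter> R n")
              case True
              then obtain i where i: "x \<in> S i \<inter> R n" by blast
              have "eventually (\<lambda>k. indicator ((\<Union>i<k. S i) \<inter> R n) x = (indicator (\<Union> (range S) \<inter> R n) x :: complex)) sequentially"
                using eventually_gt_at_top[of i] by eventually_elim (use i in \<open>auto simp: indicator_def\<close>)
              then show ?thesis by (rule tendsto_eventually)
            qed (auto simp: indicator_def)
          qed
        qed (use S R in \<open>auto intro!: L split: split_indicator\<close>)
      qed (use S in \<open>auto intro!: L PU\<close>)
    qed
  qed
  show ?case
  proof (rule lim[of "\<lambda>n. indicator (A \<inter> R n)"])
    show "(\<lambda>n. sqn ?M (\<lambda>x. indicator (A \<inter> R n) x - indicator A x)) \<longlonglongrightarrow> 0"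
    proof (rule L2_dominated_lim(2))
      show "AE x in ?M. (\<lambda>n. indicator (A \<inter> R n) x :: complex) \<longlonglongrightarrow> indicator A x"
      proof (rule AE_I2)
        fix x assume "x \<in> space ?M"
        then have "fst x \<in> (\<Union>i. E i)" "snd x \<in> (\<Union>j. F j)"
          by (auto simp: E(2) F(2) space_pair_measure)
        then obtain i j where "fst x \<in> E i" "snd x \<in> F j" by blast
        then have "x \<in> R n" if "n \<ge> max i j" for n
          using that E(4) F(4) by (cases x) (auto simp: R_def incseq_def subset_iff)
        then have "eventually (\<lambda>n. indicator (A \<inter> R n) x = (indicator A x :: complex)) sequentially"
          unfolding eventually_sequentially by (intro exI[of _ "max i j"]) (auto simp: indicator_def)
        then show "(\<lambda>n. indicator (A \<inter> R n) x :: complex) \<longlonglongrightarrow> indicator A x"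
          by (rule tendsto_eventually)
      qed
    qed (use ind R in \<open>auto intro!: L2_indicator split: split_indicator\<close>)
  qed (use ind in \<open>auto intro!: * L L2_indicator\<close>)
qed (auto intro: scale add lim)

section \<open>Bounded operators and their determination by dense classes\<close>

lemma sqn_eq_L2_norm:
  assumes "f \<in> L2 M"
  shows "sqn M f = ennreal ((L2_norm M f)\<^sup>2)"
proof -
  have "integrable M (\<lambda>x. (cmod (f x))\<^sup>2)" using assms by (simp add: L2_def)
  then have "sqn M f = ennreal (\<integral>x. (cmod (f x))\<^sup>2 \<partial>M)"
    unfolding sqn_def by (rule nn_integral_eq_integral) auto
  also have "\<dots> = ennreal ((L2_norm M f)\<^sup>2)"
    unfolding L2_norm_def by (subst real_sqrt_pow2) auto
  finally show ?thesis .
qed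

lemma L2_norm_nonneg [simp]: "0 \<le> L2_norm M f"
  by (simp add: L2_norm_def)

lemma L2_norm_le_iff:
  assumes "f \<in> L2 M" "g \<in> L2 N" "C \<ge> 0"
  shows "L2_norm N g \<le> C * L2_norm M f \<longleftrightarrow> sqn N g \<le> ennreal (C\<^sup>2) * sqn M f"
proof -
  have "sqn N g \<le> ennreal (C\<^sup>2) * sqn M f \<longleftrightarrow> (L2_norm N g)\<^sup>2 \<le> (C * L2_norm M f)\<^sup>2"
    using assms by (simp add: sqn_eq_L2_norm ennreal_mult[symmetric] power_mult_distrib)
  also have "\<dots> \<longleftrightarrow> L2_norm N g \<le> C * L2_norm M f"
    using assms by (subst abs_le_square_iff[symmetric]) auto
  finally show ?thesis by simp
qed

lemma L2_norm_eq_iff: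
  assumes "f \<in> L2 M" "g \<in> L2 N"
  shows "L2_norm N g = L2_norm M f \<longleftrightarrow> sqn N g = sqn M f"
  using assms by (simp add: sqn_eq_L2_norm power2_eq_iff_nonneg)

lemma L2_operator_L2: "L2_operator M N T \<Longrightarrow> f \<in> L2 M \<Longrightarrow> T f \<in> L2 N"
  by (simp add: L2_operator_def)

lemma L2_operator_add: "L2_operator M N T \<Longrightarrow> f \<in> L2 M \<Longrightarrow> g \<in> L2 M \<Longrightarrow>
    AE y in N. T (\<lambda>x. f x + g x) y = T f y + T g y"
  by (simp add: L2_operator_def)

lemma L2_operator_scale: "L2_operator M N T \<Longrightarrow> f \<in> L2 M \<Longrightarrow> AE y in N. T (\<lambda>x. c * f x) y = c * T f y"
  by (simp add: L2_operator_def)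

lemma L2_operator_bound:
  assumes "L2_operator M N T"
  obtains C where "C \<ge> 0" "\<And>f. f \<in> L2 M \<Longrightarrow> sqn N (T f) \<le> ennreal C * sqn M f"
proof -
  obtain C where C: "\<And>f. f \<in> L2 M \<Longrightarrow> L2_norm N (T f) \<le> C * L2_norm M f"
    using assms unfolding L2_operator_def by blast
  have "sqn N (T f) \<le> ennreal (\<bar>C\<bar>\<^sup>2) * sqn M f" if "f \<in> L2 M" for f
    using C[OF that] that assms
    by (subst L2_norm_le_iff[symmetric]) (auto intro: L2_operator_L2 order.trans intro!: mult_right_mono)
  then show ?thesis by (intro that[of "\<bar>C\<bar>\<^sup>2"]) auto
qed

lemma L2_operatorI:
  assumes "\<And>f. f \<in> L2 M \<Longrightarrow> T f \<in> L2 N"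
    and "\<And>f g. f \<in> L2 M \<Longrightarrow> g \<in> L2 M \<Longrightarrow> AE y in N. T (\<lambda>x. f x + g x) y = T f y + T g y"
    and "\<And>c f. f \<in> L2 M \<Longrightarrow> AE y in N. T (\<lambda>x. c * f x) y = c * T f y"
    and "C \<ge> 0" and "\<And>f. f \<in> L2 M \<Longrightarrow> sqn N (T f) \<le> ennreal C * sqn M f"
  shows "L2_operator M N T"
  unfolding L2_operator_def
proof (intro conjI ballI allI exI)
  fix f assume f: "f \<in> L2 M"
  show "L2_norm N (T f) \<le> sqrt C * L2_norm M f"
    using assms(4,5) f assms(1)[OF f] by (subst L2_norm_le_iff) auto
qed (use assms in auto)

lemma L2_operator_diff:
  assumes T: "L2_operator M N T" and "f \<in> L2 M" "g \<in> L2 M"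
  shows "AE y in N. T (\<lambda>x. f x - g x) y = T f y - T g y"
proof -
  from L2_operator_add[OF T assms(2) L2_scale[OF assms(3), of "-1"]] L2_operator_scale[OF T assms(3), of "-1"]
  show ?thesis by eventually_elim simp
qed

text \<open>Operators act on representatives. A difference that vanishes almost everywhere has norm
  0, so boundedness forces its image to vanish almost everywhere as well.\<close>

lemma L2_operator_cong:
  assumes T: "L2_operator M N T" and fg: "f \<in> L2 M" "g \<in> L2 M" and "AE x in M. f x = g x"
  shows "AE y in N. T f y = T g y"
proof -
  obtain C where C: "C \<ge> 0" "\<And>f. f \<in> L2 M \<Longrightarrow> sqn N (T f) \<le> ennreal C * sqn M f"
    by (rule L2_operator_bound[OF T]) blast
  have [measurable]: "f \<in> borel_measurable M" "g \<in> borel_measurable M"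
    using fg by (auto simp: L2_iff)
  have d: "(\<lambda>x. f x - g x) \<in> L2 M" using fg by (rule L2_diff)
  have "sqn M (\<lambda>x. f x - g x) = 0"
    using assms(4) by (simp add: sqn_diff_zero_iff)
  with C(2)[OF d] have "sqn N (T (\<lambda>x. f x - g x)) = 0" by simp
  moreover have "T (\<lambda>x. f x - g x) \<in> borel_measurable N"
    using L2_operator_L2[OF T d] by (simp add: L2_iff)
  ultimately have "AE y in N. T (\<lambda>x. f x - g x) y = 0"
    by (simp add: sqn_zero_iff)
  with L2_operator_diff[OF T fg] show ?thesis by eventually_elim simp
qed

lemma L2_operator_tendsto:
  assumes T: "L2_operator M N T" and F: "\<And>n. F n \<in> L2 M" "f \<in> L2 M"
    and lim: "(\<lambda>n. sqn M (\<lambda>x. F n x - f x)) \<longlonglongrightarrow> 0"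
  shows "(\<lambda>n. sqn N (\<lambda>y. T (F n) y - T f y)) \<longlonglongrightarrow> 0"
proof -
  obtain C where C: "C \<ge> 0" "\<And>f. f \<in> L2 M \<Longrightarrow> sqn N (T f) \<le> ennreal C * sqn M f"
    by (rule L2_operator_bound[OF T]) blast
  have "sqn N (\<lambda>y. T (F n) y - T f y) \<le> ennreal C * sqn M (\<lambda>x. F n x - f x)" for n
    using sqn_cong_AE[OF L2_operator_diff[OF T F(1)[of n] F(2)]] C(2)[OF L2_diff[OF F(1)[of n] F(2)]] by simp
  moreover have "(\<lambda>n. ennreal C * sqn M (\<lambda>x. F n x - f x)) \<longlonglongrightarrow> 0"
    using ennreal_tendsto_cmult[OF _ lim, of "ennreal C"] by simp
  ultimately show ?thesis by (rule tendsto_0_le[rotated])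
qed

lemma L2_operator_compose:
  assumes S: "L2_operator M N S" and T: "L2_operator N P T"
  shows "L2_operator M P (T \<circ> S)"
proof -
  obtain C where C: "C \<ge> 0" "\<And>f. f \<in> L2 M \<Longrightarrow> sqn N (S f) \<le> ennreal C * sqn M f"
    by (rule L2_operator_bound[OF S]) blast
  obtain D where D: "D \<ge> 0" "\<And>f. f \<in> L2 N \<Longrightarrow> sqn P (T f) \<le> ennreal D * sqn N f"
    by (rule L2_operator_bound[OF T]) blast
  show ?thesis
  proof (rule L2_operatorI[where C = "D * C"])
    fix f assume f: "f \<in> L2 M"
    then show "(T \<circ> S) f \<in> L2 P" using S T by (simp add: L2_operator_L2)
    have "sqn P (T (S f)) \<le> ennreal D * sqn N (S f)" by (rule D(2)[OF L2_operator_L2[OF S f]])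
    also have "\<dots> \<le> ennreal D * (ennreal C * sqn M f)" by (rule mult_left_mono[OF C(2)[OF f]]) simp
    finally show "sqn P ((T \<circ> S) f) \<le> ennreal (D * C) * sqn M f"
      using C D by (simp add: ennreal_mult mult.assoc)
    show "AE y in P. (T \<circ> S) (\<lambda>x. c * f x) y = c * (T \<circ> S) f y" for c
      using L2_operator_cong[OF T L2_operator_L2[OF S L2_scale[OF f]] L2_scale[OF L2_operator_L2[OF S f]] L2_operator_scale[OF S f, of c]]
        L2_operator_scale[OF T L2_operator_L2[OF S f], of c]
      by eventually_elim simp
    fix g assume g: "g \<in> L2 M"
    show "AE y in P. (T \<circ> S) (\<lambda>x. f x + g x) y = (T \<circ> S) f y + (T \<circ> S) g y"
      using L2_operator_cong[OF T L2_operator_L2[OF S L2_add[OF f g]] L2_add[OF L2_operator_L2[OF S f] L2_operator_L2[OF S g]] L2_operator_add[OF S f g]]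
        L2_operator_add[OF T L2_operator_L2[OF S f] L2_operator_L2[OF S g]]
      by eventually_elim simp
  qed (use C D in auto)
qed

lemma L2_operator_id: "L2_operator M M id"
  by (rule L2_operatorI[where C = 1]) auto

lemma L2_operators_eq_lim:
  assumes ST: "L2_operator M N S" "L2_operator M N T"
    and F: "\<And>n. F n \<in> L2 M" "f \<in> L2 M" "(\<lambda>n. sqn M (\<lambda>x. F n x - f x)) \<longlonglongrightarrow> 0"
    and eq: "\<And>n. AE y in N. S (F n) y = T (F n) y"
  shows "AE y in N. S f y = T f y"
proof (rule L2_lim_unique)
  show "(\<lambda>n. sqn N (\<lambda>y. S (F n) y - S f y)) \<longlonglongrightarrow> 0"
    by (rule L2_operator_tendsto[OF ST(1) F])
  have "sqn N (\<lambda>y. S (F n) y - T f y) = sqn N (\<lambda>y. T (F n) y - T f y)" for n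
    by (rule sqn_cong_AE) (use eq[of n] in eventually_elim, simp)
  with L2_operator_tendsto[OF ST(2) F] show "(\<lambda>n. sqn N (\<lambda>y. S (F n) y - T f y)) \<longlonglongrightarrow> 0" by simp
qed (intro L2_measurable L2_operator_L2[OF ST(1)] L2_operator_L2[OF ST(2)] F)+

text \<open>The uniqueness principle by which operators obtained through \<open>SOME\<close> are
  identified with explicit ones: the class of functions on which two bounded operators agree is
  closed under the operations of \<open>L2_prod_induct\<close>.\<close>

lemma L2_operators_eq_pair:
  assumes sf: "sigma_finite_measure M1" "sigma_finite_measure M2"
    and ST: "L2_operator (M1 \<Otimes>\<^sub>M M2) N S" "L2_operator (M1 \<Otimes>\<^sub>M M2) N T"
    and eq: "\<And>A B. A \<in> sets M1 \<Longrightarrow> emeasure M1 A < \<infinity> \<Longrightarrow> B \<in> sets M2 \<Longrightarrow> emeasure M2 B < \<infinity> \<Longrightarrow>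
       AE y in N. S (tensor_fun (indicator A) (indicator B)) y = T (tensor_fun (indicator A) (indicator B)) y"
    and f: "f \<in> L2 (M1 \<Otimes>\<^sub>M M2)"
  shows "AE y in N. S f y = T f y"
  using sf f
proof (induction rule: L2_prod_induct)
  case (rect A B) then show ?case by (rule eq)
next
  case (scale c f)
  then show ?case
    using L2_operator_scale[OF ST(1) scale(1), of c] L2_operator_scale[OF ST(2) scale(1), of c] by (auto elim: AE_mp)
next
  case (add f g)
  from L2_operator_add[OF ST(1) add(1,2)] L2_operator_add[OF ST(2) add(1,2)] add(3,4)
  show ?case by eventually_elim simp
next
  case (lim F f)
  show ?case
    by (rule L2_operators_eq_lim[OF ST, where F = F]) (fact lim)+
qed

section \<open>Fibrewise operators\<close>

text \<open>Applying \<open>U\<close> in each fibre picks representatives independently for each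
  \<open>x\<close>, so the result need not be jointly measurable. The function \<open>h\<close> is a
  jointly measurable version, built along \<open>L2_prod_induct\<close>; in the limit step it comes
  from completeness.\<close>

lemma fibre_operator_exists:
  assumes sf: "sigma_finite_measure P" "sigma_finite_measure M" "sigma_finite_measure N"
    and U: "L2_operator M N U" and f: "f \<in> L2 (P \<Otimes>\<^sub>M M)"
  shows "\<exists>h \<in> L2 (P \<Otimes>\<^sub>M N). AE x in P. AE y in N. h (x, y) = U (\<lambda>y. f (x, y)) y"
  using sf(1,2) f
proof (induction rule: L2_prod_induct)
  case (rect A B)
  let ?h = "tensor_fun (indicator A) (U (indicator B))"
  have "?h \<in> L2 (P \<Otimes>\<^sub>M N)"
    using rect sf U by (intro L2_tensor_fun L2_operator_L2[OF U] L2_indicator) auto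
  moreover have "AE y in N. ?h (x, y) = U (\<lambda>y. tensor_fun (indicator A) (indicator B) (x, y)) y" for x
    using L2_operator_scale[OF U L2_indicator[OF rect(3,4)], of "indicator A x"]
    by (simp add: tensor_fun_def) (auto elim: AE_mp)
  ultimately show ?case by blast
next
  case (scale c f)
  then obtain h where h: "h \<in> L2 (P \<Otimes>\<^sub>M N)" "AE x in P. AE y in N. h (x, y) = U (\<lambda>y. f (x, y)) y" by blast
  have "AE x in P. AE y in N. c * h (x, y) = U (\<lambda>y. c * f (x, y)) y"
    using h(2) AE_L2_slice[OF sf(2) scale(1)]
  proof eventually_elim
    case (elim x)
    from elim(1) L2_operator_scale[OF U elim(2), of c] show ?case by eventually_elim simp
  qed
  then show ?case using L2_scale[OF h(1), of c] by (intro bexI[of _ "\<lambda>z. c * h z"])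
next
  case (add f g)
  then obtain h k where h: "h \<in> L2 (P \<Otimes>\<^sub>M N)" "AE x in P. AE y in N. h (x, y) = U (\<lambda>y. f (x, y)) y"
    and k: "k \<in> L2 (P \<Otimes>\<^sub>M N)" "AE x in P. AE y in N. k (x, y) = U (\<lambda>y. g (x, y)) y" by blast
  have "AE x in P. AE y in N. h (x, y) + k (x, y) = U (\<lambda>y. f (x, y) + g (x, y)) y"
    using h(2) k(2) AE_L2_slice[OF sf(2) add(1)] AE_L2_slice[OF sf(2) add(2)]
  proof eventually_elim
    case (elim x)
    from elim(1,2) L2_operator_add[OF U elim(3,4)] show ?case by eventually_elim simp
  qed
  then show ?case using L2_add[OF h(1) k(1)] by (intro bexI[of _ "\<lambda>z. h z + k z"])
next
  case (lim F f)
  from lim(4) have "\<forall>n. \<exists>h. h \<in> L2 (P \<Otimes>\<^sub>M N) \<and> (AE x in P. AE y in N. h (x, y) = U (\<lambda>y. F n (x, y)) y)"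
    by blast
  from choice[OF this] obtain h where h: "\<And>n. h n \<in> L2 (P \<Otimes>\<^sub>M N)"
    "\<And>n. AE x in P. AE y in N. h n (x, y) = U (\<lambda>y. F n (x, y)) y" by blast
  have [measurable]: "\<And>n. h n \<in> borel_measurable (P \<Otimes>\<^sub>M N)" "\<And>n. F n \<in> borel_measurable (P \<Otimes>\<^sub>M M)"
    "f \<in> borel_measurable (P \<Otimes>\<^sub>M M)" using h(1) lim(1,2) by (simp_all add: L2_iff)
  note [measurable] = borel_measurable_sqn_slice[OF sf(2)] borel_measurable_sqn_slice[OF sf(3)]
  obtain C where C: "C \<ge> 0" "\<And>f. f \<in> L2 M \<Longrightarrow> sqn N (U f) \<le> ennreal C * sqn M f"
    by (rule L2_operator_bound[OF U]) blast
  \<comment> \<open>The fibrewise bound for \<open>U\<close> integrates to a bound on the product,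
    so the versions for a convergent sequence form a Cauchy sequence.\<close>
  have le: "sqn (P \<Otimes>\<^sub>M N) (\<lambda>z. h m z - h n z) \<le> ennreal C * sqn (P \<Otimes>\<^sub>M M) (\<lambda>z. F m z - F n z)" for m n
  proof -
    have "AE x in P. sqn N (\<lambda>y. h m (x, y) - h n (x, y)) \<le> ennreal C * sqn M (\<lambda>y. F m (x, y) - F n (x, y))"
      using h(2)[of m] h(2)[of n] AE_L2_slice[OF sf(2) lim(1)[of m]] AE_L2_slice[OF sf(2) lim(1)[of n]]
    proof eventually_elim
      case (elim x)
      have "sqn N (\<lambda>y. h m (x, y) - h n (x, y)) = sqn N (U (\<lambda>y. F m (x, y) - F n (x, y)))"
        by (rule sqn_cong_AE) (use elim(1,2) L2_operator_diff[OF U elim(3,4)] in eventually_elim, simp)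
      then show ?case using C(2)[OF L2_diff[OF elim(3,4)]] by simp
    qed
    then have "(\<integral>\<^sup>+x. sqn N (\<lambda>y. h m (x, y) - h n (x, y)) \<partial>P)
        \<le> (\<integral>\<^sup>+x. ennreal C * sqn M (\<lambda>y. F m (x, y) - F n (x, y)) \<partial>P)"
      by (rule nn_integral_mono_AE)
    then show ?thesis
      by (simp add: sqn_pair[OF sf(2)] sqn_pair[OF sf(3)] nn_integral_cmult)
  qed
  have "\<exists>g \<in> L2 (P \<Otimes>\<^sub>M N). (\<lambda>n. sqn (P \<Otimes>\<^sub>M N) (\<lambda>x. h n x - g x)) \<longlonglongrightarrow> 0"
  proof (rule L2_complete[OF h(1)])
    fix e :: ennreal assume "e > 0"
    have "(\<lambda>n. ennreal C * (4 * sqn (P \<Otimes>\<^sub>M M) (\<lambda>z. F n z - f z))) \<longlonglongrightarrow> ennreal C * (4 * 0)"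
      by (intro ennreal_tendsto_cmult lim(3)) auto
    then have "eventually (\<lambda>n. ennreal C * (4 * sqn (P \<Otimes>\<^sub>M M) (\<lambda>z. F n z - f z)) < e) sequentially"
      using \<open>e > 0\<close> by (intro order_tendstoD(2)) auto
    then obtain K where K: "\<And>n. n \<ge> K \<Longrightarrow> ennreal C * (4 * sqn (P \<Otimes>\<^sub>M M) (\<lambda>z. F n z - f z)) < e"
      unfolding eventually_sequentially by blast
    have "sqn (P \<Otimes>\<^sub>M N) (\<lambda>z. h m z - h n z) < e" if mn: "m \<ge> K" "n \<ge> K" for m n
    proof -
      let ?a = "sqn (P \<Otimes>\<^sub>M M) (\<lambda>z. F m z - f z)" and ?b = "sqn (P \<Otimes>\<^sub>M M) (\<lambda>z. F n z - f z)"
      have "sqn (P \<Otimes>\<^sub>M M) (\<lambda>z. F m z - F n z) \<le> 2 * ?a + 2 * ?b"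
        using sqn_triangle[of "F m" "P \<Otimes>\<^sub>M M" f "F n"] by (simp add: sqn_diff_commute[of _ f])
      also have "\<dots> \<le> 2 * max ?a ?b + 2 * max ?a ?b"
        by (intro add_mono mult_left_mono) auto
      also have "\<dots> = 4 * max ?a ?b" by (simp flip: distrib_right)
      finally have "ennreal C * sqn (P \<Otimes>\<^sub>M M) (\<lambda>z. F m z - F n z) \<le> ennreal C * (4 * max ?a ?b)"
        by (intro mult_left_mono) auto
      also have "\<dots> < e" using K[OF mn(1)] K[OF mn(2)] by (auto simp: max_def)
      finally show ?thesis using le[of m n] by (rule le_less_trans[rotated])
    qed
    then show "\<exists>K. \<forall>m\<ge>K. \<forall>n\<ge>K. sqn (P \<Otimes>\<^sub>M N) (\<lambda>x. h m x - h n x) < e" by blast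
  qed
  then obtain g where g: "g \<in> L2 (P \<Otimes>\<^sub>M N)" "(\<lambda>n. sqn (P \<Otimes>\<^sub>M N) (\<lambda>x. h n x - g x)) \<longlonglongrightarrow> 0" by blast
  have [measurable]: "g \<in> borel_measurable (P \<Otimes>\<^sub>M N)" using g by (simp add: L2_iff)
  \<comment> \<open>Summing both errors yields one subsequence along which, in almost every fibre,
    arguments and images converge simultaneously.\<close>
  define u where "u n x = 2 * sqn M (\<lambda>y. F n (x, y) - f (x, y)) + 2 * sqn N (\<lambda>y. h n (x, y) - g (x, y))" for n x
  have [measurable]: "u n \<in> borel_measurable P" for n unfolding u_def by measurable
  have "(\<integral>\<^sup>+x. u n x \<partial>P) = 2 * sqn (P \<Otimes>\<^sub>M M) (\<lambda>x. F n x - f x) + 2 * sqn (P \<Otimes>\<^sub>M N) (\<lambda>x. h n x - g x)" for n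
    unfolding u_def by (simp add: nn_integral_add nn_integral_cmult sqn_pair[OF sf(2)] sqn_pair[OF sf(3)])
  then have "(\<lambda>n. \<integral>\<^sup>+x. u n x \<partial>P) \<longlonglongrightarrow> 0"
    using ennreal_tendsto_0_add[OF lim(3) g(2)] by simp
  then obtain r :: "nat \<Rightarrow> nat" where r: "AE x in P. (\<lambda>n. u (r n) x) \<longlonglongrightarrow> 0"
    using AE_tendsto_0_subseq[of u P] by auto
  have all: "AE x in P. \<forall>n. (AE y in N. h n (x, y) = U (\<lambda>y. F n (x, y)) y) \<and> (\<lambda>y. F n (x, y)) \<in> L2 M \<and> (\<lambda>y. h n (x, y)) \<in> L2 N"
    using h(2) AE_L2_slice[OF sf(2) lim(1)] AE_L2_slice[OF sf(3) h(1)] by (auto simp: AE_all_countable)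
  have "AE x in P. AE y in N. g (x, y) = U (\<lambda>y. f (x, y)) y"
    using r all AE_L2_slice[OF sf(2) lim(2)] AE_L2_slice[OF sf(3) g(1)]
  proof eventually_elim
    case (elim x)
    have a: "(\<lambda>n. sqn M (\<lambda>y. F (r n) (x, y) - f (x, y))) \<longlonglongrightarrow> 0"
      by (rule tendsto_0_le[OF elim(1)]) (auto simp: u_def mult_2 add.assoc intro: add_increasing2)
    have b: "(\<lambda>n. sqn N (\<lambda>y. h (r n) (x, y) - g (x, y))) \<longlonglongrightarrow> 0"
      by (rule tendsto_0_le[OF elim(1)]) (auto simp: u_def mult_2 add.assoc intro: add_increasing add_increasing2)
    have "(\<lambda>n. sqn N (\<lambda>y. U (\<lambda>y. F (r n) (x, y)) y - U (\<lambda>y. f (x, y)) y)) \<longlonglongrightarrow> 0"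
      using elim by (intro L2_operator_tendsto[OF U _ _ a]) auto
    also have "(\<lambda>n. sqn N (\<lambda>y. U (\<lambda>y. F (r n) (x, y)) y - U (\<lambda>y. f (x, y)) y)) =
       (\<lambda>n. sqn N (\<lambda>y. h (r n) (x, y) - U (\<lambda>y. f (x, y)) y))"
    proof (intro ext sqn_cong_AE)
      fix n from elim(2) have "AE y in N. h (r n) (x, y) = U (\<lambda>y. F (r n) (x, y)) y" by blast
      then show "AE y in N. U (\<lambda>y. F (r n) (x, y)) y - U (\<lambda>y. f (x, y)) y = h (r n) (x, y) - U (\<lambda>y. f (x, y)) y"
        by eventually_elim simp
    qed
    finally show ?case
      using b elim L2_operator_L2[OF U elim(3)] by (intro L2_lim_unique[of "\<lambda>n y. h (r n) (x, y)"]) (auto simp: L2_iff)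
  qed
  from this g(1) show ?case by (rule bexI)
qed

lemma borel_measurable_cnj [measurable]:
  "f \<in> borel_measurable M \<Longrightarrow> (\<lambda>x. cnj (f x)) \<in> borel_measurable M"
  by (rule borel_measurable_continuous_on) (auto intro: continuous_intros)

section \<open>Unitary operators and their adjoints\<close>

lemma L2_unitaryD:
  assumes "L2_unitary M N U"
  shows "L2_operator M N U"
    and "\<And>f. f \<in> L2 M \<Longrightarrow> sqn N (U f) = sqn M f"
    and "\<And>g. g \<in> L2 N \<Longrightarrow> \<exists>f \<in> L2 M. AE y in N. U f y = g y"
proof -
  show U: "L2_operator M N U" using assms by (simp add: L2_unitary_def)
  show "sqn N (U f) = sqn M f" if "f \<in> L2 M" for f
    using assms that L2_norm_eq_iff[OF that L2_operator_L2[OF U that]] by (simp add: L2_unitary_def)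
  show "\<exists>f \<in> L2 M. AE y in N. U f y = g y" if "g \<in> L2 N" for g
    using assms that by (simp add: L2_unitary_def)
qed

lemma L2_unitaryI:
  assumes "L2_operator M N U"
    and "\<And>f. f \<in> L2 M \<Longrightarrow> sqn N (U f) = sqn M f"
    and "\<And>g. g \<in> L2 N \<Longrightarrow> \<exists>f \<in> L2 M. AE y in N. U f y = g y"
  shows "L2_unitary M N U"
proof -
  have "L2_norm N (U f) = L2_norm M f" if "f \<in> L2 M" for f
    using L2_norm_eq_iff[OF that L2_operator_L2[OF assms(1) that]] assms(2)[OF that] by simp
  with assms show ?thesis by (simp add: L2_unitary_def)
qed

lemma L2_isometry_inj:
  assumes U: "L2_operator M N U" and iso: "\<And>f. f \<in> L2 M \<Longrightarrow> sqn N (U f) = sqn M f"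
    and fg: "f \<in> L2 M" "g \<in> L2 M" "AE y in N. U f y = U g y"
  shows "AE x in M. f x = g x"
proof -
  have m: "f \<in> borel_measurable M" "g \<in> borel_measurable M"
    "U f \<in> borel_measurable N" "U g \<in> borel_measurable N"
    using fg U by (simp_all add: L2_measurable L2_operator_L2)
  have "sqn M (\<lambda>x. f x - g x) = sqn N (U (\<lambda>x. f x - g x))"
    using iso[OF L2_diff[OF fg(1,2)]] by simp
  also have "\<dots> = sqn N (\<lambda>y. U f y - U g y)"
    by (rule sqn_cong_AE[OF L2_operator_diff[OF U fg(1,2)]])
  also have "\<dots> = 0" using fg(3) m by (simp add: sqn_diff_zero_iff)
  finally show ?thesis using m by (simp add: sqn_diff_zero_iff)
qed

lemma L2_unitary_compose:
  assumes U: "L2_unitary M N U" and V: "L2_unitary N P V"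
  shows "L2_unitary M P (V \<circ> U)"
proof (rule L2_unitaryI)
  show "L2_operator M P (V \<circ> U)"
    by (rule L2_operator_compose[OF L2_unitaryD(1)[OF U] L2_unitaryD(1)[OF V]])
  show "sqn P ((V \<circ> U) f) = sqn M f" if "f \<in> L2 M" for f
    using that L2_unitaryD(2)[OF U that] L2_unitaryD(2)[OF V L2_operator_L2[OF L2_unitaryD(1)[OF U] that]] by simp
  fix h assume "h \<in> L2 P"
  then obtain g where g: "g \<in> L2 N" "AE y in P. V g y = h y" using L2_unitaryD(3)[OF V] by blast
  then obtain f where f: "f \<in> L2 M" "AE y in N. U f y = g y" using L2_unitaryD(3)[OF U] by blast
  have "AE y in P. V (U f) y = V g y"
    by (rule L2_operator_cong[OF L2_unitaryD(1)[OF V] L2_operator_L2[OF L2_unitaryD(1)[OF U] f(1)] g(1) f(2)])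
  with g(2) have "AE y in P. (V \<circ> U) f y = h y" by eventually_elim simp
  with f(1) show "\<exists>f \<in> L2 M. AE y in P. (V \<circ> U) f y = h y" by blast
qed

lemma integrable_L2_inner:
  assumes "f \<in> L2 M" "g \<in> L2 M"
  shows "integrable M (\<lambda>x. f x * cnj (g x))"
proof (rule Bochner_Integration.integrable_bound)
  show "integrable M (\<lambda>x. (cmod (f x))\<^sup>2 + (cmod (g x))\<^sup>2)"
    using assms by (simp add: L2_def)
  have [measurable]: "f \<in> borel_measurable M" "g \<in> borel_measurable M"
    using assms by (simp_all add: L2_measurable)
  show "(\<lambda>x. f x * cnj (g x)) \<in> borel_measurable M" by measurable
  have "norm (a * cnj b) \<le> norm ((cmod a)\<^sup>2 + (cmod b)\<^sup>2)" for a b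
    using sum_squares_bound[of "cmod a" "cmod b"] mult_nonneg_nonneg[of "cmod a" "cmod b"]
    unfolding norm_mult complex_mod_cnj real_norm_def by linarith
  then show "AE x in M. norm (f x * cnj (g x)) \<le> norm ((cmod (f x))\<^sup>2 + (cmod (g x))\<^sup>2)"
    by simp
qed

lemma L2_norm_sq: "(L2_norm M f)\<^sup>2 = (\<integral>x. (cmod (f x))\<^sup>2 \<partial>M)"
  unfolding L2_norm_def by (subst real_sqrt_pow2) auto

lemma L2_norm_add_sq:
  assumes "f \<in> L2 M" "g \<in> L2 M"
  shows "(L2_norm M (\<lambda>x. f x + g x))\<^sup>2 = (L2_norm M f)\<^sup>2 + (L2_norm M g)\<^sup>2 + 2 * Re (L2_inner M f g)"
proof -
  have eq: "(cmod (a + b))\<^sup>2 = ((cmod a)\<^sup>2 + (cmod b)\<^sup>2) + 2 * Re (a * cnj b)" for a b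
    unfolding cmod_power2 by (simp add: power2_eq_square algebra_simps)
  have i: "integrable M (\<lambda>x. (cmod (f x))\<^sup>2)" "integrable M (\<lambda>x. (cmod (g x))\<^sup>2)"
    using assms by (simp_all add: L2_def)
  have r: "integrable M (\<lambda>x. Re (f x * cnj (g x)))"
    by (rule integrable_Re[OF integrable_L2_inner[OF assms]])
  have "(L2_norm M (\<lambda>x. f x + g x))\<^sup>2 = (\<integral>x. ((cmod (f x))\<^sup>2 + (cmod (g x))\<^sup>2) + 2 * Re (f x * cnj (g x)) \<partial>M)"
    unfolding L2_norm_sq eq ..
  also have "\<dots> = (\<integral>x. (cmod (f x))\<^sup>2 + (cmod (g x))\<^sup>2 \<partial>M) + (\<integral>x. 2 * Re (f x * cnj (g x)) \<partial>M)"
    using i r by (intro Bochner_Integration.integral_add Bochner_Integration.integrable_add integrable_mult_right)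
  also have "(\<integral>x. (cmod (f x))\<^sup>2 + (cmod (g x))\<^sup>2 \<partial>M) = (L2_norm M f)\<^sup>2 + (L2_norm M g)\<^sup>2"
    unfolding L2_norm_sq using i by (rule Bochner_Integration.integral_add)
  also have "(\<integral>x. 2 * Re (f x * cnj (g x)) \<partial>M) = 2 * Re (L2_inner M f g)"
    unfolding L2_inner_def integral_Re[OF integrable_L2_inner[OF assms], symmetric] by (rule integral_mult_right_zero)
  finally show ?thesis .
qed

text \<open>Polarization: norms determine the real part of the inner product, and multiplying the
  second argument by \<i> exposes the imaginary part.\<close>

lemma L2_unitary_inner:
  assumes U: "L2_unitary M N U" and fg: "f \<in> L2 M" "g \<in> L2 M"
  shows "L2_inner N (U f) (U g) = L2_inner M f g"
proof -
  note Uo = L2_unitaryD(1)[OF U]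
  have norm_eq: "L2_norm N (U h) = L2_norm M h" if "h \<in> L2 M" for h
    using U that by (simp add: L2_unitary_def)
  have norm_cong: "L2_norm N h = L2_norm N k" if "h \<in> L2 N" "k \<in> L2 N" "AE y in N. h y = k y" for h k
    using that L2_norm_eq_iff[of k N h N] by (simp add: sqn_cong_AE)
  have Re: "Re (L2_inner N (U f) (U g)) = Re (L2_inner M f g)" if fg: "f \<in> L2 M" "g \<in> L2 M" for f g
  proof -
    have "L2_norm N (\<lambda>y. U f y + U g y) = L2_norm M (\<lambda>x. f x + g x)"
      using norm_cong[OF _ _ L2_operator_add[OF Uo fg]] norm_eq[OF L2_add[OF fg]]
      by (simp add: L2_operator_L2[OF Uo] L2_add fg)
    then show ?thesis
      using L2_norm_add_sq[OF fg] L2_norm_add_sq[OF L2_operator_L2[OF Uo fg(1)] L2_operator_L2[OF Uo fg(2)]]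
        norm_eq[OF fg(1)] norm_eq[OF fg(2)] by simp
  qed
  have Im_eq: "Re (L2_inner K h (\<lambda>x. \<i> * k x)) = Im (L2_inner K h k)" for K :: "'c measure" and h k
  proof -
    have "L2_inner K h (\<lambda>x. \<i> * k x) = - \<i> * L2_inner K h k"
      unfolding L2_inner_def by (subst integral_mult_right_zero[symmetric]) (simp add: mult.assoc mult.left_commute)
    then show ?thesis by simp
  qed
  have "Im (L2_inner N (U f) (U g)) = Re (L2_inner N (U f) (\<lambda>y. \<i> * U g y))" by (simp add: Im_eq)
  also have "L2_inner N (U f) (\<lambda>y. \<i> * U g y) = L2_inner N (U f) (U (\<lambda>x. \<i> * g x))"
    unfolding L2_inner_def
  proof (rule integral_cong_AE)
    show "AE x in N. U f x * cnj (\<i> * U g x) = U f x * cnj (U (\<lambda>x. \<i> * g x) x)"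
      using L2_operator_scale[OF Uo fg(2), of \<i>] by eventually_elim simp
    have [measurable]: "U f \<in> borel_measurable N" "U g \<in> borel_measurable N" "U (\<lambda>x. \<i> * g x) \<in> borel_measurable N"
      using fg by (auto intro!: L2_measurable L2_operator_L2[OF Uo] L2_scale)
    show "(\<lambda>x. U f x * cnj (\<i> * U g x)) \<in> borel_measurable N"
      "(\<lambda>x. U f x * cnj (U (\<lambda>x. \<i> * g x) x)) \<in> borel_measurable N" by measurable
  qed
  also have "Re \<dots> = Im (L2_inner M f g)"
    using Re[OF fg(1) L2_scale[OF fg(2)]] by (simp add: Im_eq)
  finally show ?thesis using Re[OF fg] by (simp add: complex_eq_iff)
qed

lemma L2_inner_cong:
  assumes "f \<in> L2 M" "g \<in> L2 M" "h \<in> L2 M" "AE x in M. g x = h x"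
  shows "L2_inner M f g = L2_inner M f h"
  unfolding L2_inner_def
proof (rule integral_cong_AE)
  have [measurable]: "f \<in> borel_measurable M" "g \<in> borel_measurable M" "h \<in> borel_measurable M"
    using assms by (simp_all add: L2_measurable)
  show "(\<lambda>x. f x * cnj (g x)) \<in> borel_measurable M" "(\<lambda>x. f x * cnj (h x)) \<in> borel_measurable M"
    by measurable
  show "AE x in M. f x * cnj (g x) = f x * cnj (h x)"
    using assms(4) by eventually_elim simp
qed

lemma L2_inner_diff:
  assumes "f \<in> L2 M" "g \<in> L2 M" "h \<in> L2 M"
  shows "L2_inner M f (\<lambda>x. g x - h x) = L2_inner M f g - L2_inner M f h"
  using integrable_L2_inner[OF assms(1,2)] integrable_L2_inner[OF assms(1,3)]
  by (simp add: L2_inner_def right_diff_distrib)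

lemma L2_inner_self_zero:
  assumes "f \<in> L2 M" "L2_inner M f f = 0"
  shows "AE x in M. f x = 0"
proof -
  have "L2_inner M f f = (\<integral>x. of_real ((cmod (f x))\<^sup>2) \<partial>M)"
    unfolding L2_inner_def by (intro Bochner_Integration.integral_cong) (auto simp: complex_norm_square[symmetric])
  also have "\<dots> = of_real ((L2_norm M f)\<^sup>2)"
    unfolding L2_norm_sq by (rule integral_complex_of_real)
  finally have "L2_norm M f = 0" using assms(2) by simp
  then have "sqn M f = 0" using assms(1) by (simp add: sqn_eq_L2_norm)
  then show ?thesis using assms(1) by (simp add: sqn_zero_iff L2_measurable)
qed

text \<open>Preimages are picked one by one; as a unitary is injective up to null functions, the
  choice is automatically linear and isometric up to null functions.\<close>

lemma L2_unitary_inverse: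
  assumes U: "L2_unitary M N U"
  shows "\<exists>S. L2_operator N M S \<and> (\<forall>g \<in> L2 N. AE y in N. U (S g) y = g y)"
proof -
  note Uo = L2_unitaryD(1)[OF U]
  define S where "S g = (SOME f. f \<in> L2 M \<and> (AE y in N. U f y = g y))" for g
  have S: "S g \<in> L2 M" "AE y in N. U (S g) y = g y" if "g \<in> L2 N" for g
    using someI_ex[of "\<lambda>f. f \<in> L2 M \<and> (AE y in N. U f y = g y)"] L2_unitaryD(3)[OF U that]
    unfolding S_def by blast+
  have inj: "AE x in M. f x = g x" if "f \<in> L2 M" "g \<in> L2 M" "AE y in N. U f y = U g y" for f g
    by (rule L2_isometry_inj[OF Uo L2_unitaryD(2)[OF U] that])
  have "L2_operator N M S"
  proof (rule L2_operatorI[where C = 1])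
    fix f assume f: "f \<in> L2 N"
    show "S f \<in> L2 M" by (rule S(1)[OF f])
    have "sqn N (U (S f)) = sqn N f" by (rule sqn_cong_AE[OF S(2)[OF f]])
    then show "sqn M (S f) \<le> ennreal 1 * sqn N f"
      using L2_unitaryD(2)[OF U S(1)[OF f]] by simp
    show "AE y in M. S (\<lambda>x. c * f x) y = c * S f y" for c
    proof (rule inj)
      show "AE y in N. U (S (\<lambda>x. c * f x)) y = U (\<lambda>y. c * S f y) y"
        using S(2)[OF L2_scale[OF f, of c]] S(2)[OF f] L2_operator_scale[OF Uo S(1)[OF f], of c]
        by eventually_elim simp
    qed (intro S L2_scale f)+
    fix g assume g: "g \<in> L2 N"
    show "AE y in M. S (\<lambda>x. f x + g x) y = S f y + S g y"
    proof (rule inj)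
      show "AE y in N. U (S (\<lambda>x. f x + g x)) y = U (\<lambda>y. S f y + S g y) y"
        using S(2)[OF L2_add[OF f g]] S(2)[OF f] S(2)[OF g] L2_operator_add[OF Uo S(1)[OF f] S(1)[OF g]]
        by eventually_elim simp
    qed (intro S L2_add f g)+
  qed simp
  with S(2) show ?thesis by blast
qed

text \<open>The inverse of a unitary satisfies the adjoint relation, so the choice in
  \<open>L2_adjoint\<close> is not vacuous. Any operator satisfying that relation agrees with the
  inverse, because the difference is orthogonal to itself.\<close>

lemma L2_adjoint_unitary:
  assumes U: "L2_unitary M N U"
  defines "S \<equiv> L2_adjoint M N U"
  shows "L2_operator N M S"
    and "\<And>g. g \<in> L2 N \<Longrightarrow> AE y in N. U (S g) y = g y"
    and "\<And>f. f \<in> L2 M \<Longrightarrow> AE x in M. S (U f) x = f x"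
proof -
  note Uo = L2_unitaryD(1)[OF U]
  obtain S' where S': "L2_operator N M S'" "\<And>g. g \<in> L2 N \<Longrightarrow> AE y in N. U (S' g) y = g y"
    using L2_unitary_inverse[OF U] by blast
  have "L2_operator N M S' \<and> (\<forall>f \<in> L2 M. \<forall>g \<in> L2 N. L2_inner N (U f) g = L2_inner M f (S' g))"
  proof (intro conjI ballI S'(1))
    fix f g assume fg: "f \<in> L2 M" "g \<in> L2 N"
    have S'g: "S' g \<in> L2 M" by (rule L2_operator_L2[OF S'(1) fg(2)])
    have "L2_inner N (U f) g = L2_inner N (U f) (U (S' g))"
      using L2_inner_cong[OF L2_operator_L2[OF Uo fg(1)] L2_operator_L2[OF Uo S'g] fg(2) S'(2)[OF fg(2)]] by simp
    also have "\<dots> = L2_inner M f (S' g)" by (rule L2_unitary_inner[OF U fg(1) S'g])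
    finally show "L2_inner N (U f) g = L2_inner M f (S' g)" .
  qed
  then have S: "L2_operator N M S \<and> (\<forall>f \<in> L2 M. \<forall>g \<in> L2 N. L2_inner N (U f) g = L2_inner M f (S g))"
    unfolding S_def L2_adjoint_def
    by (rule someI[where P = "\<lambda>S. L2_operator N M S \<and> (\<forall>f \<in> L2 M. \<forall>g \<in> L2 N. L2_inner N (U f) g = L2_inner M f (S g))"])
  then show So: "L2_operator N M S" by blast
  have S_eq: "AE x in M. S g x = f x" if g: "g \<in> L2 N" and f: "f \<in> L2 M" and Uf: "AE y in N. U f y = g y" for f g
  proof -
    have Sg: "S g \<in> L2 M" by (rule L2_operator_L2[OF So g])
    have "L2_inner M h (S g) = L2_inner M h f" if h: "h \<in> L2 M" for h
    proof -
      have "L2_inner M h (S g) = L2_inner N (U h) g" using S h g by simp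
      also have "\<dots> = L2_inner N (U h) (U f)"
        using L2_inner_cong[OF L2_operator_L2[OF Uo h] L2_operator_L2[OF Uo f] g Uf] by simp
      also have "\<dots> = L2_inner M h f" by (rule L2_unitary_inner[OF U h f])
      finally show ?thesis .
    qed
    then have "L2_inner M (\<lambda>x. S g x - f x) (\<lambda>x. S g x - f x) = 0"
      using L2_inner_diff[OF L2_diff[OF Sg f] Sg f] L2_diff[OF Sg f] by simp
    from L2_inner_self_zero[OF L2_diff[OF Sg f] this] show ?thesis by simp
  qed
  show "AE x in M. S (U f) x = f x" if "f \<in> L2 M" for f
    by (rule S_eq[OF L2_operator_L2[OF Uo that] that]) simp
  show "AE y in N. U (S g) y = g y" if g: "g \<in> L2 N" for g
  proof -
    have "AE x in M. S g x = S' g x"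
      by (rule S_eq[OF g L2_operator_L2[OF S'(1) g] S'(2)[OF g]])
    from L2_operator_cong[OF Uo L2_operator_L2[OF So g] L2_operator_L2[OF S'(1) g] this] S'(2)[OF g]
    show ?thesis by eventually_elim simp
  qed
qed

lemma L2_adjoint_unitary':
  assumes U: "L2_unitary M N U"
  shows "L2_unitary N M (L2_adjoint M N U)"
proof (rule L2_unitaryI[OF L2_adjoint_unitary(1)[OF U]])
  note S = L2_adjoint_unitary[OF U]
  show "sqn M (L2_adjoint M N U f) = sqn N f" if "f \<in> L2 N" for f
    using L2_unitaryD(2)[OF U L2_operator_L2[OF S(1) that]] sqn_cong_AE[OF S(2)[OF that]] by simp
  show "\<exists>f\<in>L2 N. AE y in M. L2_adjoint M N U f y = g y" if "g \<in> L2 M" for g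
    using S(3)[OF that] L2_operator_L2[OF L2_unitaryD(1)[OF U] that] by blast
qed

lemma L2_adjoint_eqI:
  assumes U: "L2_unitary M N U" and f: "f \<in> L2 M" and g: "g \<in> L2 N" and "AE y in N. U f y = g y"
  shows "AE x in M. L2_adjoint M N U g x = f x"
  using L2_operator_cong[OF L2_adjoint_unitary(1)[OF U] L2_operator_L2[OF L2_unitaryD(1)[OF U] f] g assms(4)]
    L2_adjoint_unitary(3)[OF U f] by eventually_elim simp

section \<open>Weighted pullbacks\<close>

definition pullback :: "('a \<Rightarrow> complex) \<Rightarrow> ('a \<Rightarrow> 'b) \<Rightarrow> ('b \<Rightarrow> complex) \<Rightarrow> 'a \<Rightarrow> complex" where
  "pullback m \<phi> f = (\<lambda>x. m x * f (\<phi> x))"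

text \<open>The identity says that \<phi> carries the measure with density |m|^2 to
  \<open>N\<close>, which is what makes \<open>pullback m \<phi>\<close> isometric. Such an operator
  is injective but need not be onto.\<close>

definition L2_pullback :: "'a measure \<Rightarrow> 'b measure \<Rightarrow> ('a \<Rightarrow> complex) \<Rightarrow> ('a \<Rightarrow> 'b) \<Rightarrow> bool" where
  "L2_pullback M N m \<phi> \<longleftrightarrow> \<phi> \<in> measurable M N \<and> m \<in> borel_measurable M \<and>
     (\<forall>h \<in> borel_measurable N. (\<integral>\<^sup>+x. ennreal ((cmod (m x))\<^sup>2) * h (\<phi> x) \<partial>M) = (\<integral>\<^sup>+y. h y \<partial>N))"

lemma L2_pullbackD:
  assumes "L2_pullback M N m \<phi>"
  shows "\<phi> \<in> measurable M N" "m \<in> borel_measurable M"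
    and "\<And>h. h \<in> borel_measurable N \<Longrightarrow> (\<integral>\<^sup>+x. ennreal ((cmod (m x))\<^sup>2) * h (\<phi> x) \<partial>M) = (\<integral>\<^sup>+y. h y \<partial>N)"
  using assms by (auto simp: L2_pullback_def)

lemma pullback_measurable:
  assumes "L2_pullback M N m \<phi>" "f \<in> borel_measurable N"
  shows "pullback m \<phi> f \<in> borel_measurable M"
proof -
  note [measurable] = L2_pullbackD(1,2)[OF assms(1)] assms(2)
  show ?thesis unfolding pullback_def by measurable
qed

lemma sqn_pullback:
  assumes P: "L2_pullback M N m \<phi>" and f: "f \<in> borel_measurable N"
  shows "sqn M (pullback m \<phi> f) = sqn N f"
proof -
  have "sqn M (pullback m \<phi> f) = (\<integral>\<^sup>+x. ennreal ((cmod (m x))\<^sup>2) * ennreal ((cmod (f (\<phi> x)))\<^sup>2) \<partial>M)"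
    unfolding sqn_def pullback_def by (simp add: norm_mult power_mult_distrib ennreal_mult)
  also have "\<dots> = sqn N f"
    unfolding sqn_def using f by (intro L2_pullbackD(3)[OF P]) measurable
  finally show ?thesis .
qed

lemma L2_pullback_L2: "L2_pullback M N m \<phi> \<Longrightarrow> f \<in> L2 N \<Longrightarrow> pullback m \<phi> f \<in> L2 M"
  by (simp add: L2_iff sqn_pullback pullback_measurable)

lemma L2_operator_pullback:
  assumes "L2_pullback M N m \<phi>"
  shows "L2_operator N M (pullback m \<phi>)"
proof (rule L2_operatorI[where C = 1])
  fix f assume "f \<in> L2 N"
  then show "pullback m \<phi> f \<in> L2 M" "sqn M (pullback m \<phi> f) \<le> ennreal 1 * sqn N f"
    using assms by (simp_all add: L2_pullback_L2 sqn_pullback L2_measurable)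
qed (auto simp: pullback_def algebra_simps)

text \<open>Null sets can be pulled back along \<phi> only where the density does not vanish, hence
  the premise \<open>m x \<noteq> 0\<close> under the quantifier.\<close>

lemma AE_pullback:
  assumes P: "L2_pullback M N m \<phi>" and ae: "AE y in N. Q y"
  shows "AE x in M. m x \<noteq> 0 \<longrightarrow> Q (\<phi> x)"
proof -
  note [measurable] = L2_pullbackD(1,2)[OF P]
  obtain Z where Z: "{y \<in> space N. \<not> Q y} \<subseteq> Z" "emeasure N Z = 0" "Z \<in> sets N"
    using ae by (rule AE_E)
  note [measurable] = Z(3)
  have "(\<integral>\<^sup>+x. ennreal ((cmod (m x))\<^sup>2) * indicator Z (\<phi> x) \<partial>M) = (\<integral>\<^sup>+y. indicator Z y \<partial>N)"
    by (rule L2_pullbackD(3)[OF P]) measurable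
  also have "\<dots> = 0" using Z by simp
  finally have "AE x in M. ennreal ((cmod (m x))\<^sup>2) * indicator Z (\<phi> x) = 0"
    by (subst (asm) nn_integral_0_iff_AE) measurable
  with AE_space show ?thesis
  proof eventually_elim
    case (elim x)
    then have "\<phi> x \<in> space N" using measurable_space[OF L2_pullbackD(1)[OF P]] by blast
    with elim Z(1) show ?case by (auto simp: indicator_def)
  qed
qed

lemma pullback_cong_AE:
  assumes "L2_pullback M N m \<phi>" "AE y in N. f y = g y"
  shows "AE x in M. pullback m \<phi> f x = pullback m \<phi> g x"
  using AE_pullback[OF assms] by eventually_elim (auto simp: pullback_def)

lemma pullback_inj:
  assumes P: "L2_pullback M N m \<phi>" and f: "f \<in> borel_measurable N" "g \<in> borel_measurable N"
    and ae: "AE x in M. pullback m \<phi> f x = pullback m \<phi> g x"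
  shows "AE y in N. f y = g y"
proof -
  have "sqn N (\<lambda>y. f y - g y) = sqn M (pullback m \<phi> (\<lambda>y. f y - g y))"
    using f by (subst sqn_pullback[OF P]) auto
  also have "pullback m \<phi> (\<lambda>y. f y - g y) = (\<lambda>x. pullback m \<phi> f x - pullback m \<phi> g x)"
    by (simp add: pullback_def fun_eq_iff algebra_simps)
  also have "sqn M \<dots> = 0"
    using ae pullback_measurable[OF P f(1)] pullback_measurable[OF P f(2)] by (simp add: sqn_diff_zero_iff)
  finally show ?thesis using f by (simp add: sqn_diff_zero_iff)
qed

text \<open>For surjectivity a measurable left inverse \<theta> of \<phi> is enough: the preimage of
  \<open>h\<close> is \<open>h / m\<close> read at \<theta>.\<close>

lemma L2_unitary_pullback:
  assumes P: "L2_pullback M N m \<phi>" and \<theta>: "\<theta> \<in> measurable N M"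
    and inv: "AE x in M. \<theta> (\<phi> x) = x" and nz: "AE x in M. m x \<noteq> 0"
  shows "L2_unitary N M (pullback m \<phi>)"
proof (rule L2_unitaryI[OF L2_operator_pullback[OF P]])
  note [measurable] = L2_pullbackD(1,2)[OF P] \<theta>
  show "sqn M (pullback m \<phi> f) = sqn N f" if "f \<in> L2 N" for f
    using that by (simp add: sqn_pullback[OF P] L2_measurable)
  fix h assume h: "h \<in> L2 M"
  have [measurable]: "h \<in> borel_measurable M" using h by (simp add: L2_measurable)
  define k where "k y = h (\<theta> y) / m (\<theta> y)" for y
  have k: "k \<in> borel_measurable N" unfolding k_def[abs_def] by measurable
  have ae: "AE x in M. pullback m \<phi> k x = h x"
    using inv nz by eventually_elim (simp add: pullback_def k_def)
  have "sqn N k = sqn M h"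
    using sqn_pullback[OF P k] sqn_cong_AE[OF ae] by simp
  then have "k \<in> L2 N" using h k by (simp add: L2_iff)
  with ae show "\<exists>f \<in> L2 N. AE y in M. pullback m \<phi> f y = h y" by blast
qed

lemma L2_pullback_compose:
  assumes P: "L2_pullback M N m \<phi>" and Q: "L2_pullback N K n \<psi>"
  shows "L2_pullback M K (\<lambda>x. m x * n (\<phi> x)) (\<lambda>x. \<psi> (\<phi> x))"
  unfolding L2_pullback_def
proof (intro conjI ballI)
  note [measurable] = L2_pullbackD(1,2)[OF P] L2_pullbackD(1,2)[OF Q]
  show "(\<lambda>x. \<psi> (\<phi> x)) \<in> measurable M K" by measurable
  show "(\<lambda>x. m x * n (\<phi> x)) \<in> borel_measurable M" by measurable
  fix h :: "_ \<Rightarrow> ennreal" assume [measurable]: "h \<in> borel_measurable K"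
  have "(\<integral>\<^sup>+x. ennreal ((cmod (m x * n (\<phi> x)))\<^sup>2) * h (\<psi> (\<phi> x)) \<partial>M)
      = (\<integral>\<^sup>+x. ennreal ((cmod (m x))\<^sup>2) * (ennreal ((cmod (n (\<phi> x)))\<^sup>2) * h (\<psi> (\<phi> x))) \<partial>M)"
    by (simp add: norm_mult power_mult_distrib ennreal_mult mult.assoc)
  also have "\<dots> = (\<integral>\<^sup>+y. ennreal ((cmod (n y))\<^sup>2) * h (\<psi> y) \<partial>N)"
    by (rule L2_pullbackD(3)[OF P, where h = "\<lambda>y. ennreal ((cmod (n y))\<^sup>2) * h (\<psi> y)"]) measurable
  also have "\<dots> = (\<integral>\<^sup>+y. h y \<partial>K)"
    by (rule L2_pullbackD(3)[OF Q]) measurable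
  finally show "(\<integral>\<^sup>+x. ennreal ((cmod (m x * n (\<phi> x)))\<^sup>2) * h (\<psi> (\<phi> x)) \<partial>M) = (\<integral>\<^sup>+y. h y \<partial>K)" .
qed

lemma pullback_pullback: "pullback m \<phi> (pullback n \<psi> f) = pullback (\<lambda>x. m x * n (\<phi> x)) (\<lambda>x. \<psi> (\<phi> x)) f"
  by (simp add: pullback_def mult.assoc)

lemma L2_pullback_id: "L2_pullback M M (\<lambda>_. 1) (\<lambda>x. x)"
  by (simp add: L2_pullback_def)

lemma L2_pullback_prod:
  assumes sf: "sigma_finite_measure M1" "sigma_finite_measure M2" "sigma_finite_measure N1" "sigma_finite_measure N2"
    and P: "L2_pullback M1 N1 m \<phi>" and Q: "L2_pullback M2 N2 n \<psi>"
  shows "L2_pullback (M1 \<Otimes>\<^sub>M M2) (N1 \<Otimes>\<^sub>M N2) (tensor_fun m n) (map_prod \<phi> \<psi>)"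
  unfolding L2_pullback_def
proof (intro conjI ballI)
  note [measurable] = L2_pullbackD(1,2)[OF P] L2_pullbackD(1,2)[OF Q]
  interpret M2: sigma_finite_measure M2 by fact
  interpret N2: sigma_finite_measure N2 by fact
  show "map_prod \<phi> \<psi> \<in> measurable (M1 \<Otimes>\<^sub>M M2) (N1 \<Otimes>\<^sub>M N2)"
    unfolding map_prod_def by measurable
  show "tensor_fun m n \<in> borel_measurable (M1 \<Otimes>\<^sub>M M2)"
    unfolding tensor_fun_def by measurable
  fix h :: "_ \<Rightarrow> ennreal" assume h [measurable]: "h \<in> borel_measurable (N1 \<Otimes>\<^sub>M N2)"
  have "(\<integral>\<^sup>+z. ennreal ((cmod (tensor_fun m n z))\<^sup>2) * h (map_prod \<phi> \<psi> z) \<partial>(M1 \<Otimes>\<^sub>M M2))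
      = (\<integral>\<^sup>+x. \<integral>\<^sup>+y. ennreal ((cmod (m x))\<^sup>2) * (ennreal ((cmod (n y))\<^sup>2) * h (\<phi> x, \<psi> y)) \<partial>M2 \<partial>M1)"
    by (subst M2.nn_integral_fst[symmetric])
      (auto simp: tensor_fun_def map_prod_def split_beta norm_mult power_mult_distrib ennreal_mult mult.assoc)
  also have "\<dots> = (\<integral>\<^sup>+x. ennreal ((cmod (m x))\<^sup>2) * (\<integral>\<^sup>+y. h (\<phi> x, y) \<partial>N2) \<partial>M1)"
  proof (rule nn_integral_cong)
    fix x assume x [measurable]: "x \<in> space M1"
    have \<phi>x: "\<phi> x \<in> space N1" by (rule measurable_space[OF L2_pullbackD(1)[OF P] x])
    have [measurable]: "(\<lambda>y. h (\<phi> x, y)) \<in> borel_measurable N2"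
      by (rule measurable_compose_Pair1[OF \<phi>x h])
    have [measurable]: "(\<lambda>y. h (\<phi> x, \<psi> y)) \<in> borel_measurable M2"
      by (rule measurable_compose[OF L2_pullbackD(1)[OF Q]]) measurable
    show "(\<integral>\<^sup>+y. ennreal ((cmod (m x))\<^sup>2) * (ennreal ((cmod (n y))\<^sup>2) * h (\<phi> x, \<psi> y)) \<partial>M2)
      = ennreal ((cmod (m x))\<^sup>2) * (\<integral>\<^sup>+y. h (\<phi> x, y) \<partial>N2)"
      by (subst nn_integral_cmult) (auto simp: L2_pullbackD(3)[OF Q, where h = "\<lambda>y. h (\<phi> x, y)"])
  qed
  also have "\<dots> = (\<integral>\<^sup>+x. \<integral>\<^sup>+y. h (x, y) \<partial>N2 \<partial>N1)"
    by (rule L2_pullbackD(3)[OF P, where h = "\<lambda>x. \<integral>\<^sup>+y. h (x, y) \<partial>N2"]) measurable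
  also have "\<dots> = (\<integral>\<^sup>+z. h z \<partial>(N1 \<Otimes>\<^sub>M N2))"
    by (rule N2.nn_integral_fst) measurable
  finally show "(\<integral>\<^sup>+z. ennreal ((cmod (tensor_fun m n z))\<^sup>2) * h (map_prod \<phi> \<psi> z) \<partial>(M1 \<Otimes>\<^sub>M M2))
     = (\<integral>\<^sup>+z. h z \<partial>(N1 \<Otimes>\<^sub>M N2))" .
qed

lemma pullback_tensor:
  "pullback (tensor_fun m n) (map_prod \<phi> \<psi>) (tensor_fun f g) = tensor_fun (pullback m \<phi> f) (pullback n \<psi> g)"
  by (auto simp: pullback_def tensor_fun_def fun_eq_iff)

definition swap_op :: "('a \<times> 'b \<Rightarrow> complex) \<Rightarrow> 'b \<times> 'a \<Rightarrow> complex" where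
  "swap_op = pullback (\<lambda>_. 1) (\<lambda>(y, x). (x, y))"

lemma swap_op_apply [simp]: "swap_op f (y, x) = f (x, y)"
  by (simp add: swap_op_def pullback_def)

lemma L2_unitary_swap:
  assumes "sigma_finite_measure M" "sigma_finite_measure N"
  shows "L2_unitary (M \<Otimes>\<^sub>M N) (N \<Otimes>\<^sub>M M) swap_op"
  unfolding swap_op_def
proof (rule L2_unitary_pullback)
  interpret pair_sigma_finite M N using assms by (simp add: pair_sigma_finite_def)
  have "(\<integral>\<^sup>+x. h (case x of (y, x) \<Rightarrow> (x, y)) \<partial>(N \<Otimes>\<^sub>M M)) = (\<integral>\<^sup>+z. h z \<partial>(M \<Otimes>\<^sub>M N))"
    if "h \<in> borel_measurable (M \<Otimes>\<^sub>M N)" for h :: "_ \<Rightarrow> ennreal"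
  proof -
    have "(\<integral>\<^sup>+z. h z \<partial>(M \<Otimes>\<^sub>M N)) = (\<integral>\<^sup>+z. h z \<partial>distr (N \<Otimes>\<^sub>M M) (M \<Otimes>\<^sub>M N) (\<lambda>(x, y). (y, x)))"
      using distr_pair_swap by simp
    then show ?thesis using that by (simp add: nn_integral_distr)
  qed
  then show "L2_pullback (N \<Otimes>\<^sub>M M) (M \<Otimes>\<^sub>M N) (\<lambda>_. 1) (\<lambda>(y, x). (x, y))"
    by (simp add: L2_pullback_def)
  show "(\<lambda>(y, x). (x, y)) \<in> M \<Otimes>\<^sub>M N \<rightarrow>\<^sub>M N \<Otimes>\<^sub>M M" by measurable
qed auto

section \<open>Tensor products of operators\<close>

lemma AE_pair_eqI:
  fixes f g :: "_ \<Rightarrow> complex"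
  assumes "sigma_finite_measure M" "sigma_finite_measure N"
    and [measurable]: "f \<in> borel_measurable (M \<Otimes>\<^sub>M N)" "g \<in> borel_measurable (M \<Otimes>\<^sub>M N)"
    and "AE x in M. AE y in N. f (x, y) = g (x, y)"
  shows "AE z in M \<Otimes>\<^sub>M N. f z = g z"
proof -
  interpret pair_sigma_finite M N using assms by (simp add: pair_sigma_finite_def)
  show ?thesis by (rule AE_pair_measure) (use assms(5) in auto)
qed

lemma AE_pair_eqD:
  assumes "sigma_finite_measure M" "sigma_finite_measure N"
    and "AE z in M \<Otimes>\<^sub>M N. Q z"
  shows "AE x in M. AE y in N. Q (x, y)" "AE y in N. AE x in M. Q (x, y)"
proof -
  interpret pair_sigma_finite M N using assms by (simp add: pair_sigma_finite_def)
  interpret Q: pair_sigma_finite N M ..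
  show "AE x in M. AE y in N. Q (x, y)" by (rule AE_pair[OF assms(3)])
  have "AE z in distr (N \<Otimes>\<^sub>M M) (M \<Otimes>\<^sub>M N) (\<lambda>(x, y). (y, x)). Q z"
    using assms(3) by (subst (asm) distr_pair_swap)
  then have "AE z in N \<Otimes>\<^sub>M M. Q (case z of (x, y) \<Rightarrow> (y, x))"
    by (rule AE_distrD[rotated]) measurable
  from Q.AE_pair[OF this] show "AE y in N. AE x in M. Q (x, y)" by simp
qed

lemma fibre_operator:
  assumes sf: "sigma_finite_measure P" "sigma_finite_measure M" "sigma_finite_measure N"
    and U: "L2_operator M N U"
  obtains T where "L2_operator (P \<Otimes>\<^sub>M M) (P \<Otimes>\<^sub>M N) T"
    "\<And>f. f \<in> L2 (P \<Otimes>\<^sub>M M) \<Longrightarrow> AE x in P. AE y in N. T f (x, y) = U (\<lambda>y. f (x, y)) y"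
proof -
  define T where "T f = (SOME h. h \<in> L2 (P \<Otimes>\<^sub>M N) \<and> (AE x in P. AE y in N. h (x, y) = U (\<lambda>y. f (x, y)) y))" for f
  have T: "T f \<in> L2 (P \<Otimes>\<^sub>M N)" "AE x in P. AE y in N. T f (x, y) = U (\<lambda>y. f (x, y)) y"
    if "f \<in> L2 (P \<Otimes>\<^sub>M M)" for f
    using someI_ex[of "\<lambda>h. h \<in> L2 (P \<Otimes>\<^sub>M N) \<and> (AE x in P. AE y in N. h (x, y) = U (\<lambda>y. f (x, y)) y)"]
      fibre_operator_exists[OF sf U that] unfolding T_def by blast+
  obtain C where C: "C \<ge> 0" "\<And>f. f \<in> L2 M \<Longrightarrow> sqn N (U f) \<le> ennreal C * sqn M f"
    by (rule L2_operator_bound[OF U]) blast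
  note [measurable] = borel_measurable_sqn_slice[OF sf(2)] borel_measurable_sqn_slice[OF sf(3)]
  have "L2_operator (P \<Otimes>\<^sub>M M) (P \<Otimes>\<^sub>M N) T"
  proof (rule L2_operatorI[OF T(1) _ _ C(1)])
    fix f assume f: "f \<in> L2 (P \<Otimes>\<^sub>M M)"
    have m [measurable]: "f \<in> borel_measurable (P \<Otimes>\<^sub>M M)" "T f \<in> borel_measurable (P \<Otimes>\<^sub>M N)"
      using f T(1)[OF f] by (simp_all add: L2_measurable)
    have "AE x in P. sqn N (\<lambda>y. T f (x, y)) \<le> ennreal C * sqn M (\<lambda>y. f (x, y))"
      using T(2)[OF f] AE_L2_slice[OF sf(2) f]
    proof eventually_elim
      case (elim x)
      then show ?case using C(2)[OF elim(2)] sqn_cong_AE[OF elim(1)] by simp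
    qed
    then have "(\<integral>\<^sup>+x. sqn N (\<lambda>y. T f (x, y)) \<partial>P) \<le> (\<integral>\<^sup>+x. ennreal C * sqn M (\<lambda>y. f (x, y)) \<partial>P)"
      by (rule nn_integral_mono_AE)
    then show "sqn (P \<Otimes>\<^sub>M N) (T f) \<le> ennreal C * sqn (P \<Otimes>\<^sub>M M) f"
      by (simp add: sqn_pair[OF sf(2)] sqn_pair[OF sf(3)] nn_integral_cmult)
    show "AE z in P \<Otimes>\<^sub>M N. T (\<lambda>x. c * f x) z = c * T f z" for c
    proof (rule AE_pair_eqI[OF sf(1,3)])
      show "AE x in P. AE y in N. T (\<lambda>x. c * f x) (x, y) = c * T f (x, y)"
        using T(2)[OF f] T(2)[OF L2_scale[OF f, of c]] AE_L2_slice[OF sf(2) f]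
      proof eventually_elim
        case (elim x)
        from elim(1,2) L2_operator_scale[OF U elim(3), of c] show ?case by eventually_elim simp
      qed
    qed (intro L2_measurable L2_scale T(1) f)+
    fix g assume g: "g \<in> L2 (P \<Otimes>\<^sub>M M)"
    show "AE z in P \<Otimes>\<^sub>M N. T (\<lambda>x. f x + g x) z = T f z + T g z"
    proof (rule AE_pair_eqI[OF sf(1,3)])
      show "AE x in P. AE y in N. T (\<lambda>x. f x + g x) (x, y) = T f (x, y) + T g (x, y)"
        using T(2)[OF f] T(2)[OF g] T(2)[OF L2_add[OF f g]] AE_L2_slice[OF sf(2) f] AE_L2_slice[OF sf(2) g]
      proof eventually_elim
        case (elim x)
        from elim(1-3) L2_operator_add[OF U elim(4,5)] show ?case by eventually_elim simp
      qed
    qed (intro L2_measurable L2_add T(1) f g)+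
  qed
  from this T(2) show ?thesis by (rule that)
qed

lemma L2_unitary_cong:
  assumes U: "L2_unitary M N U" and T: "L2_operator M N T"
    and eq: "\<And>f. f \<in> L2 M \<Longrightarrow> AE y in N. T f y = U f y"
  shows "L2_unitary M N T"
proof (rule L2_unitaryI[OF T])
  show "sqn N (T f) = sqn M f" if "f \<in> L2 M" for f
    using sqn_cong_AE[OF eq[OF that]] L2_unitaryD(2)[OF U that] by simp
  show "\<exists>f\<in>L2 M. AE y in N. T f y = g y" if g: "g \<in> L2 N" for g
  proof -
    obtain f where f: "f \<in> L2 M" "AE y in N. U f y = g y" using L2_unitaryD(3)[OF U g] by blast
    from eq[OF f(1)] f(2) have "AE y in N. T f y = g y" by eventually_elim simp
    with f(1) show ?thesis by blast
  qed
qed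

lemma L2_unitary_id: "L2_unitary M M id"
  by (rule L2_unitaryI[OF L2_operator_id]) auto

lemma fibre_tensor:
  assumes sf: "sigma_finite_measure P" "sigma_finite_measure M" "sigma_finite_measure N"
    and U: "L2_operator M N U" and T: "L2_operator (P \<Otimes>\<^sub>M M) (P \<Otimes>\<^sub>M N) T"
    and fib: "\<And>f. f \<in> L2 (P \<Otimes>\<^sub>M M) \<Longrightarrow> AE x in P. AE y in N. T f (x, y) = U (\<lambda>y. f (x, y)) y"
    and f: "f \<in> L2 P" and g: "g \<in> L2 M"
  shows "AE z in P \<Otimes>\<^sub>M N. T (tensor_fun f g) z = tensor_fun f (U g) z"
proof (rule AE_pair_eqI[OF sf(1,3)])
  have fg: "tensor_fun f g \<in> L2 (P \<Otimes>\<^sub>M M)" by (rule L2_tensor_fun[OF sf(2) f g])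
  show "T (tensor_fun f g) \<in> borel_measurable (P \<Otimes>\<^sub>M N)"
    by (rule L2_measurable[OF L2_operator_L2[OF T fg]])
  show "tensor_fun f (U g) \<in> borel_measurable (P \<Otimes>\<^sub>M N)"
    by (rule L2_measurable[OF L2_tensor_fun[OF sf(3) f L2_operator_L2[OF U g]]])
  show "AE x in P. AE y in N. T (tensor_fun f g) (x, y) = tensor_fun f (U g) (x, y)"
    using fib[OF fg]
  proof eventually_elim
    case (elim x)
    from elim L2_operator_scale[OF U g, of "f x"] show ?case
      by eventually_elim (simp add: tensor_fun_def)
  qed
qed

text \<open>Norms agree fibre by fibre and integrate; for surjectivity, the fibrewise operator of
  the adjoint supplies preimages.\<close>

lemma fibre_unitary:
  assumes sf: "sigma_finite_measure P" "sigma_finite_measure M" "sigma_finite_measure N"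
    and U: "L2_unitary M N U" and T: "L2_operator (P \<Otimes>\<^sub>M M) (P \<Otimes>\<^sub>M N) T"
    and fib: "\<And>f. f \<in> L2 (P \<Otimes>\<^sub>M M) \<Longrightarrow> AE x in P. AE y in N. T f (x, y) = U (\<lambda>y. f (x, y)) y"
  shows "L2_unitary (P \<Otimes>\<^sub>M M) (P \<Otimes>\<^sub>M N) T"
proof (rule L2_unitaryI[OF T])
  fix f assume f: "f \<in> L2 (P \<Otimes>\<^sub>M M)"
  have [measurable]: "f \<in> borel_measurable (P \<Otimes>\<^sub>M M)" "T f \<in> borel_measurable (P \<Otimes>\<^sub>M N)"
    by (rule L2_measurable[OF f], rule L2_measurable[OF L2_operator_L2[OF T f]])
  have "AE x in P. sqn N (\<lambda>y. T f (x, y)) = sqn M (\<lambda>y. f (x, y))"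
    using fib[OF f] AE_L2_slice[OF sf(2) f]
  proof eventually_elim
    case (elim x)
    show ?case using sqn_cong_AE[OF elim(1)] L2_unitaryD(2)[OF U elim(2)] by simp
  qed
  then show "sqn (P \<Otimes>\<^sub>M N) (T f) = sqn (P \<Otimes>\<^sub>M M) f"
    unfolding sqn_pair[OF sf(2) L2_measurable[OF f]] sqn_pair[OF sf(3) L2_measurable[OF L2_operator_L2[OF T f]]]
    by (rule nn_integral_cong_AE)
next
  fix g assume g: "g \<in> L2 (P \<Otimes>\<^sub>M N)"
  note S = L2_adjoint_unitary[OF U]
  obtain R where R: "L2_operator (P \<Otimes>\<^sub>M N) (P \<Otimes>\<^sub>M M) R"
    "\<And>f. f \<in> L2 (P \<Otimes>\<^sub>M N) \<Longrightarrow> AE x in P. AE y in M. R f (x, y) = L2_adjoint M N U (\<lambda>y. f (x, y)) y"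
    using fibre_operator[OF sf(1,3,2) S(1)] by blast
  have Rg: "R g \<in> L2 (P \<Otimes>\<^sub>M M)" by (rule L2_operator_L2[OF R(1) g])
  have "AE z in P \<Otimes>\<^sub>M N. T (R g) z = g z"
  proof (rule AE_pair_eqI[OF sf(1,3) L2_measurable[OF L2_operator_L2[OF T Rg]] L2_measurable[OF g]])
    show "AE x in P. AE y in N. T (R g) (x, y) = g (x, y)"
      using fib[OF Rg] R(2)[OF g] AE_L2_slice[OF sf(2) Rg] AE_L2_slice[OF sf(3) g]
    proof eventually_elim
      case (elim x)
      from elim(1) L2_operator_cong[OF L2_unitaryD(1)[OF U] elim(3) L2_operator_L2[OF S(1) elim(4)] elim(2)] S(2)[OF elim(4)]
      show ?case by eventually_elim simp
    qed
  qed
  with Rg show "\<exists>f\<in>L2 (P \<Otimes>\<^sub>M M). AE y in P \<Otimes>\<^sub>M N. T f y = g y" by blast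
qed

lemma swap_op_tensor: "swap_op (tensor_fun f g) = tensor_fun g f"
  by (auto simp: fun_eq_iff tensor_fun_def)

text \<open>The tensor product is built as (A \<otimes> 1)(1 \<otimes> B), the factor A \<otimes> 1
  being a fibrewise operator conjugated by the flip. The factors stay visible in the conclusion
  because unitarity is proved for each of them separately.\<close>

lemma L2_tensor_factor:
  assumes sf: "sigma_finite_measure M1" "sigma_finite_measure M2" "sigma_finite_measure N1" "sigma_finite_measure N2"
    and A: "L2_operator M1 N1 A" and B: "L2_operator M2 N2 B"
  obtains S T where
    "L2_operator (M1 \<Otimes>\<^sub>M M2) (M1 \<Otimes>\<^sub>M N2) T"
    "\<And>f. f \<in> L2 (M1 \<Otimes>\<^sub>M M2) \<Longrightarrow> AE x in M1. AE y in N2. T f (x, y) = B (\<lambda>y. f (x, y)) y"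
    "L2_operator (N2 \<Otimes>\<^sub>M M1) (N2 \<Otimes>\<^sub>M N1) S"
    "\<And>f. f \<in> L2 (N2 \<Otimes>\<^sub>M M1) \<Longrightarrow> AE x in N2. AE y in N1. S f (x, y) = A (\<lambda>y. f (x, y)) y"
    "L2_operator (M1 \<Otimes>\<^sub>M M2) (N1 \<Otimes>\<^sub>M N2) (swap_op \<circ> S \<circ> swap_op \<circ> T)"
    "\<And>f g. f \<in> L2 M1 \<Longrightarrow> g \<in> L2 M2 \<Longrightarrow>
      AE z in N1 \<Otimes>\<^sub>M N2. (swap_op \<circ> S \<circ> swap_op \<circ> T) (tensor_fun f g) z = tensor_fun (A f) (B g) z"
proof -
  obtain T where T: "L2_operator (M1 \<Otimes>\<^sub>M M2) (M1 \<Otimes>\<^sub>M N2) T"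
    "\<And>f. f \<in> L2 (M1 \<Otimes>\<^sub>M M2) \<Longrightarrow> AE x in M1. AE y in N2. T f (x, y) = B (\<lambda>y. f (x, y)) y"
    using fibre_operator[OF sf(1,2,4) B] by blast
  obtain S where S: "L2_operator (N2 \<Otimes>\<^sub>M M1) (N2 \<Otimes>\<^sub>M N1) S"
    "\<And>f. f \<in> L2 (N2 \<Otimes>\<^sub>M M1) \<Longrightarrow> AE x in N2. AE y in N1. S f (x, y) = A (\<lambda>y. f (x, y)) y"
    using fibre_operator[OF sf(4,1,3) A] by blast
  have sw1: "L2_operator (M1 \<Otimes>\<^sub>M N2) (N2 \<Otimes>\<^sub>M M1) swap_op"
    and sw2: "L2_operator (N2 \<Otimes>\<^sub>M N1) (N1 \<Otimes>\<^sub>M N2) swap_op"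
    using L2_unitaryD(1)[OF L2_unitary_swap] sf by blast+
  have R: "L2_operator (N2 \<Otimes>\<^sub>M M1) (N1 \<Otimes>\<^sub>M N2) (swap_op \<circ> S)"
    by (rule L2_operator_compose[OF S(1) sw2])
  have RR: "L2_operator (M1 \<Otimes>\<^sub>M N2) (N1 \<Otimes>\<^sub>M N2) (swap_op \<circ> S \<circ> swap_op)"
    by (rule L2_operator_compose[OF sw1 R])
  have op: "L2_operator (M1 \<Otimes>\<^sub>M M2) (N1 \<Otimes>\<^sub>M N2) (swap_op \<circ> S \<circ> swap_op \<circ> T)"
    by (rule L2_operator_compose[OF T(1) RR])
  have tens: "AE z in N1 \<Otimes>\<^sub>M N2. (swap_op \<circ> S \<circ> swap_op \<circ> T) (tensor_fun f g) z = tensor_fun (A f) (B g) z"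
    if f: "f \<in> L2 M1" and g: "g \<in> L2 M2" for f g
  proof -
    note Bg = L2_operator_L2[OF B g] and Af = L2_operator_L2[OF A f]
    note fg = L2_tensor_fun[OF sf(2) f g] and fBg = L2_tensor_fun[OF sf(4) f Bg]
    have 1: "AE z in M1 \<Otimes>\<^sub>M N2. T (tensor_fun f g) z = tensor_fun f (B g) z"
      by (rule fibre_tensor[OF sf(1,2,4) B T f g])
    have 2: "AE z in N1 \<Otimes>\<^sub>M N2. (swap_op \<circ> S \<circ> swap_op) (T (tensor_fun f g)) z = (swap_op \<circ> S \<circ> swap_op) (tensor_fun f (B g)) z"
      by (rule L2_operator_cong[OF RR L2_operator_L2[OF T(1) fg] fBg 1])
    have 3: "AE z in N2 \<Otimes>\<^sub>M N1. S (tensor_fun (B g) f) z = tensor_fun (B g) (A f) z"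
      by (rule fibre_tensor[OF sf(4,1,3) A S Bg f])
    have 4: "AE z in N1 \<Otimes>\<^sub>M N2. swap_op (S (tensor_fun (B g) f)) z = swap_op (tensor_fun (B g) (A f)) z"
      by (rule L2_operator_cong[OF sw2 L2_operator_L2[OF S(1) L2_tensor_fun[OF sf(1) Bg f]] L2_tensor_fun[OF sf(3) Bg Af] 3])
    from 2 4 show ?thesis by eventually_elim (simp add: swap_op_tensor)
  qed
  show ?thesis by (rule that[OF T S op tens])
qed

lemma L2_tensor_spec:
  assumes sf: "sigma_finite_measure M1" "sigma_finite_measure M2" "sigma_finite_measure N1" "sigma_finite_measure N2"
    and A: "L2_operator M1 N1 A" and B: "L2_operator M2 N2 B"
  shows "L2_operator (M1 \<Otimes>\<^sub>M M2) (N1 \<Otimes>\<^sub>M N2) (L2_tensor M1 M2 N1 N2 A B)"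
    and "f \<in> L2 M1 \<Longrightarrow> g \<in> L2 M2 \<Longrightarrow>
      AE z in N1 \<Otimes>\<^sub>M N2. L2_tensor M1 M2 N1 N2 A B (tensor_fun f g) z = tensor_fun (A f) (B g) z"
proof -
  let ?P = "\<lambda>T. L2_operator (M1 \<Otimes>\<^sub>M M2) (N1 \<Otimes>\<^sub>M N2) T \<and>
     (\<forall>f \<in> L2 M1. \<forall>g \<in> L2 M2. AE z in N1 \<Otimes>\<^sub>M N2. T (tensor_fun f g) z = tensor_fun (A f) (B g) z)"
  have "\<exists>T. ?P T" by (rule L2_tensor_factor[OF sf A B]) blast
  from someI_ex[OF this] have "?P (L2_tensor M1 M2 N1 N2 A B)"
    unfolding L2_tensor_def .
  then show "L2_operator (M1 \<Otimes>\<^sub>M M2) (N1 \<Otimes>\<^sub>M N2) (L2_tensor M1 M2 N1 N2 A B)"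
    and "f \<in> L2 M1 \<Longrightarrow> g \<in> L2 M2 \<Longrightarrow>
      AE z in N1 \<Otimes>\<^sub>M N2. L2_tensor M1 M2 N1 N2 A B (tensor_fun f g) z = tensor_fun (A f) (B g) z"
    by blast+
qed

lemma L2_tensor_eq:
  assumes sf: "sigma_finite_measure M1" "sigma_finite_measure M2" "sigma_finite_measure N1" "sigma_finite_measure N2"
    and A: "L2_operator M1 N1 A" and B: "L2_operator M2 N2 B"
    and T: "L2_operator (M1 \<Otimes>\<^sub>M M2) (N1 \<Otimes>\<^sub>M N2) T"
    and eq: "\<And>f g. f \<in> L2 M1 \<Longrightarrow> g \<in> L2 M2 \<Longrightarrow>
      AE z in N1 \<Otimes>\<^sub>M N2. T (tensor_fun f g) z = tensor_fun (A f) (B g) z"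
    and f: "f \<in> L2 (M1 \<Otimes>\<^sub>M M2)"
  shows "AE z in N1 \<Otimes>\<^sub>M N2. L2_tensor M1 M2 N1 N2 A B f z = T f z"
proof (rule L2_operators_eq_pair[OF sf(1,2) L2_tensor_spec(1)[OF sf A B] T _ f])
  fix C D assume "C \<in> sets M1" "emeasure M1 C < \<infinity>" "D \<in> sets M2" "emeasure M2 D < \<infinity>"
  then have i: "(indicator C :: _ \<Rightarrow> complex) \<in> L2 M1" "(indicator D :: _ \<Rightarrow> complex) \<in> L2 M2"
    by (auto intro: L2_indicator)
  from L2_tensor_spec(2)[OF sf A B i] eq[OF i]
  show "AE z in N1 \<Otimes>\<^sub>M N2. L2_tensor M1 M2 N1 N2 A B (tensor_fun (indicator C) (indicator D)) z
     = T (tensor_fun (indicator C) (indicator D)) z"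
    by eventually_elim simp
qed

lemma L2_tensor_unitary:
  assumes sf: "sigma_finite_measure M1" "sigma_finite_measure M2" "sigma_finite_measure N1" "sigma_finite_measure N2"
    and A: "L2_unitary M1 N1 A" and B: "L2_unitary M2 N2 B"
  shows "L2_unitary (M1 \<Otimes>\<^sub>M M2) (N1 \<Otimes>\<^sub>M N2) (L2_tensor M1 M2 N1 N2 A B)"
proof -
  note A' = L2_unitaryD(1)[OF A] and B' = L2_unitaryD(1)[OF B]
  show ?thesis
  proof (rule L2_tensor_factor[OF sf A' B'])
    fix S T
    assume T: "L2_operator (M1 \<Otimes>\<^sub>M M2) (M1 \<Otimes>\<^sub>M N2) T"
      "\<And>f. f \<in> L2 (M1 \<Otimes>\<^sub>M M2) \<Longrightarrow> AE x in M1. AE y in N2. T f (x, y) = B (\<lambda>y. f (x, y)) y"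
      and S: "L2_operator (N2 \<Otimes>\<^sub>M M1) (N2 \<Otimes>\<^sub>M N1) S"
      "\<And>f. f \<in> L2 (N2 \<Otimes>\<^sub>M M1) \<Longrightarrow> AE x in N2. AE y in N1. S f (x, y) = A (\<lambda>y. f (x, y)) y"
      and R: "L2_operator (M1 \<Otimes>\<^sub>M M2) (N1 \<Otimes>\<^sub>M N2) (swap_op \<circ> S \<circ> swap_op \<circ> T)"
      "\<And>f g. f \<in> L2 M1 \<Longrightarrow> g \<in> L2 M2 \<Longrightarrow>
        AE z in N1 \<Otimes>\<^sub>M N2. (swap_op \<circ> S \<circ> swap_op \<circ> T) (tensor_fun f g) z = tensor_fun (A f) (B g) z"
    have U: "L2_unitary (M1 \<Otimes>\<^sub>M M2) (N1 \<Otimes>\<^sub>M N2) (swap_op \<circ> S \<circ> swap_op \<circ> T)"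
      by (rule L2_unitary_compose[OF fibre_unitary[OF sf(1,2,4) B T]
            L2_unitary_compose[OF L2_unitary_swap[OF sf(1,4)]
            L2_unitary_compose[OF fibre_unitary[OF sf(4,1,3) A S] L2_unitary_swap[OF sf(4,3)]]]])
    show ?thesis
      by (rule L2_unitary_cong[OF U L2_tensor_spec(1)[OF sf A' B'] L2_tensor_eq[OF sf A' B' R]])
  qed
qed

text \<open>Returns from the abstract 1 \<otimes> B to an action in almost every fibre, the form in
  which integral formulas can be inserted.\<close>

lemma L2_tensor_id_fibre:
  assumes sf: "sigma_finite_measure M1" "sigma_finite_measure M2" "sigma_finite_measure N2"
    and B: "L2_operator M2 N2 B" and f: "f \<in> L2 (M1 \<Otimes>\<^sub>M M2)"
  shows "AE x in M1. AE y in N2. L2_tensor M1 M2 M1 N2 id B f (x, y) = B (\<lambda>y. f (x, y)) y"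
proof -
  obtain T where T: "L2_operator (M1 \<Otimes>\<^sub>M M2) (M1 \<Otimes>\<^sub>M N2) T"
    "\<And>f. f \<in> L2 (M1 \<Otimes>\<^sub>M M2) \<Longrightarrow> AE x in M1. AE y in N2. T f (x, y) = B (\<lambda>y. f (x, y)) y"
    using fibre_operator[OF sf B] by blast
  have "AE z in M1 \<Otimes>\<^sub>M N2. L2_tensor M1 M2 M1 N2 id B f z = T f z"
    by (rule L2_tensor_eq[OF sf(1,2,1,3) L2_operator_id B T(1) _ f])
      (use fibre_tensor[OF sf B T] in simp)
  from AE_pair_eqD(1)[OF sf(1,3) this] T(2)[OF f] show ?thesis
  proof eventually_elim
    case (elim x) then show ?case by eventually_elim simp
  qed
qed

lemma L2_tensor_fibre_id:
  assumes sf: "sigma_finite_measure M1" "sigma_finite_measure M2" "sigma_finite_measure N1"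
    and A: "L2_operator M1 N1 A" and f: "f \<in> L2 (M1 \<Otimes>\<^sub>M M2)"
  shows "AE y in M2. AE x in N1. L2_tensor M1 M2 N1 M2 A id f (x, y) = A (\<lambda>x. f (x, y)) x"
proof -
  obtain S where S: "L2_operator (M2 \<Otimes>\<^sub>M M1) (M2 \<Otimes>\<^sub>M N1) S"
    "\<And>f. f \<in> L2 (M2 \<Otimes>\<^sub>M M1) \<Longrightarrow> AE x in M2. AE y in N1. S f (x, y) = A (\<lambda>y. f (x, y)) y"
    using fibre_operator[OF sf(2,1,3) A] by blast
  have sw1: "L2_operator (M1 \<Otimes>\<^sub>M M2) (M2 \<Otimes>\<^sub>M M1) swap_op"
    and sw2: "L2_operator (M2 \<Otimes>\<^sub>M N1) (N1 \<Otimes>\<^sub>M M2) swap_op"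
    using L2_unitaryD(1)[OF L2_unitary_swap] sf by blast+
  have op: "L2_operator (M1 \<Otimes>\<^sub>M M2) (N1 \<Otimes>\<^sub>M M2) (swap_op \<circ> S \<circ> swap_op)"
    by (rule L2_operator_compose[OF sw1 L2_operator_compose[OF S(1) sw2]])
  have "AE z in N1 \<Otimes>\<^sub>M M2. L2_tensor M1 M2 N1 M2 A id f z = (swap_op \<circ> S \<circ> swap_op) f z"
  proof (rule L2_tensor_eq[OF sf(1,2,3,2) A L2_operator_id op _ f])
    fix h k assume hk: "h \<in> L2 M1" "k \<in> L2 M2"
    have 3: "AE z in M2 \<Otimes>\<^sub>M N1. S (tensor_fun k h) z = tensor_fun k (A h) z"
      by (rule fibre_tensor[OF sf(2,1,3) A S hk(2,1)])
    have "AE z in N1 \<Otimes>\<^sub>M M2. swap_op (S (tensor_fun k h)) z = swap_op (tensor_fun k (A h)) z"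
      by (rule L2_operator_cong[OF sw2 L2_operator_L2[OF S(1) L2_tensor_fun[OF sf(1) hk(2,1)]]
            L2_tensor_fun[OF sf(3) hk(2) L2_operator_L2[OF A hk(1)]] 3])
    then show "AE z in N1 \<Otimes>\<^sub>M M2. (swap_op \<circ> S \<circ> swap_op) (tensor_fun h k) z = tensor_fun (A h) (id k) z"
      by (simp add: swap_op_tensor)
  qed
  from AE_pair_eqD(2)[OF sf(3,2) this] S(2)[OF L2_operator_L2[OF sw1 f]] show ?thesis
  proof eventually_elim
    case (elim y) then show ?case by eventually_elim simp
  qed
qed

lemma L2_tensor_comp:
  assumes sf: "sigma_finite_measure M1" "sigma_finite_measure M2" "sigma_finite_measure N1"
      "sigma_finite_measure N2" "sigma_finite_measure K1" "sigma_finite_measure K2"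
    and A: "L2_operator M1 N1 A" and B: "L2_operator M2 N2 B"
    and C: "L2_operator N1 K1 C" and D: "L2_operator N2 K2 D"
    and f: "f \<in> L2 (M1 \<Otimes>\<^sub>M M2)"
  shows "AE z in K1 \<Otimes>\<^sub>M K2. L2_tensor N1 N2 K1 K2 C D (L2_tensor M1 M2 N1 N2 A B f) z
      = L2_tensor M1 M2 K1 K2 (C \<circ> A) (D \<circ> B) f z"
proof -
  note AB = L2_tensor_spec[OF sf(1-4) A B] and CD = L2_tensor_spec[OF sf(3-6) C D]
  have "AE z in K1 \<Otimes>\<^sub>M K2. L2_tensor M1 M2 K1 K2 (C \<circ> A) (D \<circ> B) f z
     = (L2_tensor N1 N2 K1 K2 C D \<circ> L2_tensor M1 M2 N1 N2 A B) f z"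
  proof (rule L2_tensor_eq[OF sf(1,2,5,6) L2_operator_compose[OF A C] L2_operator_compose[OF B D]
        L2_operator_compose[OF AB(1) CD(1)] _ f])
    fix g h assume gh: "g \<in> L2 M1" "h \<in> L2 M2"
    note Ag = L2_operator_L2[OF A gh(1)] and Bh = L2_operator_L2[OF B gh(2)]
    from L2_operator_cong[OF CD(1) L2_operator_L2[OF AB(1) L2_tensor_fun[OF sf(2) gh]]
        L2_tensor_fun[OF sf(4) Ag Bh] AB(2)[OF gh]] CD(2)[OF Ag Bh]
    show "AE z in K1 \<Otimes>\<^sub>M K2. (L2_tensor N1 N2 K1 K2 C D \<circ> L2_tensor M1 M2 N1 N2 A B) (tensor_fun g h) z
        = tensor_fun ((C \<circ> A) g) ((D \<circ> B) h) z"
      by eventually_elim simp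
  qed
  then show ?thesis by eventually_elim simp
qed

lemma L2_tensor_cong:
  assumes sf: "sigma_finite_measure M1" "sigma_finite_measure M2" "sigma_finite_measure N1" "sigma_finite_measure N2"
    and A: "L2_operator M1 N1 A" "L2_operator M1 N1 A'" and B: "L2_operator M2 N2 B" "L2_operator M2 N2 B'"
    and eqA: "\<And>f. f \<in> L2 M1 \<Longrightarrow> AE y in N1. A f y = A' f y"
    and eqB: "\<And>f. f \<in> L2 M2 \<Longrightarrow> AE y in N2. B f y = B' f y"
    and f: "f \<in> L2 (M1 \<Otimes>\<^sub>M M2)"
  shows "AE z in N1 \<Otimes>\<^sub>M N2. L2_tensor M1 M2 N1 N2 A B f z = L2_tensor M1 M2 N1 N2 A' B' f z"
proof (rule L2_tensor_eq[OF sf A(1) B(1) L2_tensor_spec(1)[OF sf A(2) B(2)] _ f])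
  fix g h assume gh: "g \<in> L2 M1" "h \<in> L2 M2"
  have "AE z in N1 \<Otimes>\<^sub>M N2. tensor_fun (A' g) (B' h) z = tensor_fun (A g) (B h) z"
  proof (rule AE_pair_eqI[OF sf(3,4)])
    show "AE x in N1. AE y in N2. tensor_fun (A' g) (B' h) (x, y) = tensor_fun (A g) (B h) (x, y)"
      using eqA[OF gh(1)]
    proof eventually_elim
      case (elim x)
      from eqB[OF gh(2)] show ?case by eventually_elim (simp add: tensor_fun_def elim)
    qed
  qed (intro L2_measurable L2_tensor_fun L2_operator_L2[OF A(1)] L2_operator_L2[OF A(2)]
      L2_operator_L2[OF B(1)] L2_operator_L2[OF B(2)] sf gh)+
  with L2_tensor_spec(2)[OF sf A(2) B(2) gh]
  show "AE z in N1 \<Otimes>\<^sub>M N2. L2_tensor M1 M2 N1 N2 A' B' (tensor_fun g h) z = tensor_fun (A g) (B h) z"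
    by eventually_elim simp
qed

lemma L2_tensor_pullback:
  assumes sf: "sigma_finite_measure M1" "sigma_finite_measure M2" "sigma_finite_measure N1" "sigma_finite_measure N2"
    and P: "L2_pullback N1 M1 m \<phi>" and Q: "L2_pullback N2 M2 n \<psi>"
    and f: "f \<in> L2 (M1 \<Otimes>\<^sub>M M2)"
  shows "AE z in N1 \<Otimes>\<^sub>M N2. L2_tensor M1 M2 N1 N2 (pullback m \<phi>) (pullback n \<psi>) f z
     = pullback (tensor_fun m n) (map_prod \<phi> \<psi>) f z"
  by (rule L2_tensor_eq[OF sf L2_operator_pullback[OF P] L2_operator_pullback[OF Q]
        L2_operator_pullback[OF L2_pullback_prod[OF sf(3,4,1,2) P Q]] _ f])
    (simp add: pullback_tensor)

section \<open>Haar measures on second countable groups\<close>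

lemma borel_measurable_uminus_group [measurable (raw)]:
  fixes f :: "'a \<Rightarrow> 'b::topological_group_add"
  assumes "f \<in> borel_measurable M"
  shows "(\<lambda>x. - f x) \<in> borel_measurable M"
  by (rule borel_measurable_continuous_on[OF _ assms]) (intro continuous_intros)

lemma borel_measurable_diff_group [measurable (raw)]:
  fixes f :: "'a \<Rightarrow> 'b::{second_countable_topology, topological_group_add}"
  assumes [measurable]: "f \<in> borel_measurable M" "g \<in> borel_measurable M"
  shows "(\<lambda>x. f x - g x) \<in> borel_measurable M"
  using borel_measurable_add[OF assms(1) borel_measurable_uminus_group[OF assms(2)]] by simp

lemma locally_compact_euclideanD:
  assumes "locally_compact_space (euclidean :: 'a::topological_space topology)"
  obtains U K where "open U" "compact K" "(x::'a) \<in> U" "U \<subseteq> K"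
proof -
  have "\<exists>U K. open U \<and> compact K \<and> x \<in> U \<and> U \<subseteq> K"
    using assms by (simp add: locally_compact_space_def)
  then show ?thesis using that by blast
qed

lemma sets_left_haar: "left_haar_measure M \<Longrightarrow> sets M = sets borel"
  by (simp add: left_haar_measure_def)

locale lc_haar =
  fixes M :: "'g::{topological_group_add, second_countable_topology, t2_space} measure"
  assumes lc: "locally_compact_space (euclidean :: 'g topology)"
    and haar: "left_haar_measure M"
begin

lemma sets_haar [measurable_cong, simp]: "sets M = sets borel"
  using haar by (rule sets_left_haar)

lemma space_haar [simp]: "space M = UNIV"
  using sets_eq_imp_space_eq[OF sets_haar] by simp

lemma measurable_haar_iff [simp]: "f \<in> borel_measurable M \<longleftrightarrow> f \<in> borel_measurable borel"
  by (rule arg_cong[where f = "\<lambda>S. f \<in> S"]) (rule measurable_cong_sets, simp_all)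

lemma emeasure_compact_less_top: "compact K \<Longrightarrow> emeasure M K < \<infinity>"
  using haar by (simp add: left_haar_measure_def)

text \<open>Local compactness covers the group by open sets inside compact ones, and by second
  countability (Lindelof) countably many of these suffice.\<close>

lemma sigma_finite_haar: "sigma_finite_measure M"
proof
  let ?F = "{U :: 'g set. open U \<and> (\<exists>K. compact K \<and> U \<subseteq> K)}"
  obtain F where F: "F \<subseteq> ?F" "countable F" "\<Union>F = \<Union>?F"
    by (rule Lindelof[of ?F]) auto
  have "x \<in> \<Union>?F" for x
    by (rule locally_compact_euclideanD[OF lc, of x]) blast
  then have "\<Union>F = UNIV" using F(3) by blast
  moreover have "emeasure M U \<noteq> \<infinity>" if "U \<in> F" for U
  proof -
    from F(1) that have "U \<in> ?F" by (rule subsetD)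
    then obtain K where "compact K" "U \<subseteq> K" by blast
    then have "emeasure M U \<le> emeasure M K"
      by (intro emeasure_mono) (auto simp: compact_imp_closed)
    with emeasure_compact_less_top[OF \<open>compact K\<close>] show ?thesis by (auto simp: top_unique)
  qed
  ultimately show "\<exists>A. countable A \<and> A \<subseteq> sets M \<and> \<Union>A = space M \<and> (\<forall>a\<in>A. emeasure M a \<noteq> \<infinity>)"
    using F(1,2) by (intro exI[of _ F]) auto
qed

lemma nn_integral_left:
  assumes [measurable]: "f \<in> borel_measurable borel"
  shows "(\<integral>\<^sup>+x. f (a + x) \<partial>M) = (\<integral>\<^sup>+x. f x \<partial>M)"
proof -
  have "(\<integral>\<^sup>+x. f x \<partial>M) = (\<integral>\<^sup>+x. f x \<partial>distr M M (\<lambda>x. a + x))"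
    using haar by (simp add: left_haar_measure_def)
  also have "\<dots> = (\<integral>\<^sup>+x. f (a + x) \<partial>M)"
    by (subst nn_integral_distr) auto
  finally show ?thesis ..
qed

text \<open>Translates of a null open set would be null and, by Lindelof, countably many of them
  cover the group, although the measure is not zero.\<close>

lemma emeasure_open_pos:
  assumes U: "open U" "U \<noteq> {}"
  shows "emeasure M U \<noteq> 0"
proof
  assume 0: "emeasure M U = 0"
  obtain u where u: "u \<in> U" using U by blast
  define T where "T a = {x. a + x \<in> U}" for a
  have opT: "open (T a)" for a
    unfolding T_def by (rule open_vimage[OF U(1), unfolded vimage_def]) (intro continuous_intros)
  have T0: "emeasure M (T a) = 0" for a
  proof -
    have "emeasure M (T a) = (\<integral>\<^sup>+x. indicator (T a) x \<partial>M)"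
      using opT by simp
    also have "\<dots> = (\<integral>\<^sup>+x. indicator U (a + x) \<partial>M)"
      by (simp add: T_def indicator_def)
    also have "\<dots> = (\<integral>\<^sup>+x. indicator U x \<partial>M)"
      using U(1) by (intro nn_integral_left) measurable
    also have "\<dots> = 0" using 0 U(1) by simp
    finally show ?thesis .
  qed
  obtain F where F: "F \<subseteq> range T" "countable F" "\<Union>F = \<Union>(range T)"
    by (rule Lindelof[of "range T"]) (use opT in auto)
  have "x \<in> T (u - x)" for x using u by (simp add: T_def)
  then have "\<Union>F = UNIV" using F(3) by blast
  moreover have "emeasure M (\<Union>F) = 0"
  proof -
    have "(\<Union>X\<in>F. X) \<in> null_sets M"
      using F(1) T0 opT by (intro null_sets_UN' F(2)) (auto simp: null_sets_def)
    then show ?thesis by (simp add: null_sets_def)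
  qed
  ultimately show False using haar by (simp add: left_haar_measure_def)
qed

lemma ex_precompact_open:
  obtains U K :: "'g set" where "open U" "U \<noteq> {}" "compact K" "U \<subseteq> K"
  by (rule locally_compact_euclideanD[OF lc, of 0]) blast

lemma emeasure_precompact_open:
  assumes "open U" "U \<noteq> {}" "compact K" "U \<subseteq> K"
  shows "0 < emeasure M U" "emeasure M U < \<infinity>"
proof -
  show "0 < emeasure M U" using emeasure_open_pos[OF assms(1,2)] by (simp add: zero_less_iff_neq_zero)
  have "emeasure M U \<le> emeasure M K"
    using assms by (intro emeasure_mono) (auto simp: compact_imp_closed)
  then show "emeasure M U < \<infinity>"
    using emeasure_compact_less_top[OF assms(3)] by (rule le_less_trans)
qed

text \<open>The measure is only left invariant, so the value may change, but a right translate is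
  again open, nonempty and inside a compact set. These values are the denominators in Weil's
  formula.\<close>

lemma emeasure_right_translate:
  assumes U: "open U" "U \<noteq> {}" "compact K" "U \<subseteq> K"
  shows "0 < emeasure M {y. y + x \<in> U}" "emeasure M {y. y + x \<in> U} < \<infinity>"
proof -
  have "open {y. y + x \<in> U}"
    by (rule open_vimage[OF U(1), unfolded vimage_def]) (intro continuous_intros)
  moreover obtain u where "u \<in> U" using U(2) by blast
  then have "u - x \<in> {y. y + x \<in> U}" by simp
  moreover have "compact ((\<lambda>k. k - x) ` K)"
    by (intro compact_continuous_image U(3)) (simp add: continuous_on_diff)
  moreover have "{y. y + x \<in> U} \<subseteq> (\<lambda>k. k - x) ` K"
    using U(4) by (force intro: image_eqI[of _ _ "_ + x"])
  ultimately show "0 < emeasure M {y. y + x \<in> U}" "emeasure M {y. y + x \<in> U} < \<infinity>"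
    using emeasure_precompact_open[of "{y. y + x \<in> U}"] by blast+
qed

end

text \<open>Weil's argument: the right-hand side depends on \<open>M\<close> only through the constant \<open>emeasure M U\<close>.\<close>

lemma haar_weil_formula:
  fixes M N :: "'g::{topological_group_add, second_countable_topology, t2_space} measure"
  assumes "lc_haar M" "lc_haar N"
    and U: "open U" "U \<noteq> {}" "compact K" "U \<subseteq> K"
    and f [measurable]: "f \<in> borel_measurable borel"
  shows "(\<integral>\<^sup>+x. f x \<partial>M) = emeasure M U * (\<integral>\<^sup>+y. f (- y) / emeasure N {t. t + - y \<in> U} \<partial>N)"
proof -
  interpret M: lc_haar M by fact
  interpret N: lc_haar N by fact
  interpret MN: pair_sigma_finite M N
    by (simp add: pair_sigma_finite_def M.sigma_finite_haar N.sigma_finite_haar)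
  note [measurable] = borel_open[OF U(1)]
  \<comment> \<open>\<open>f x\<close> is rewritten as the integral of \<open>f x / w x\<close> over
    those \<open>y\<close> with \<open>y + x \<in> U\<close>. Two left translations, one for each
    measure, together with Tonelli's theorem then separate \<open>M\<close> from
    \<open>N\<close>.\<close>
  define w where "w x = emeasure N {t. t + x \<in> U}" for x
  have w_eq: "w x = (\<integral>\<^sup>+t. indicator U (t + x) \<partial>N)" for x
  proof -
    have "w x = (\<integral>\<^sup>+t. indicator {t. t + x \<in> U} t \<partial>N)"
      unfolding w_def by (subst nn_integral_indicator) measurable
    then show ?thesis by (simp add: indicator_def)
  qed
  have w: "0 < w x" "w x < \<infinity>" for x
    unfolding w_def by (rule N.emeasure_right_translate[OF U])+
  have [measurable]: "w \<in> borel_measurable borel" unfolding w_eq by measurable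
  have "(\<integral>\<^sup>+x. f x \<partial>M) = (\<integral>\<^sup>+x. \<integral>\<^sup>+y. f x / w x * indicator U (y + x) \<partial>N \<partial>M)"
  proof (rule nn_integral_cong)
    fix x
    have "(\<integral>\<^sup>+y. f x / w x * indicator U (y + x) \<partial>N) = f x / w x * w x"
      by (subst nn_integral_cmult) (auto simp: w_eq)
    also have "\<dots> = f x" using w[of x] by (simp add: ennreal_divide_times ennreal_mult_divide_eq less_top[symmetric])
    finally show "f x = (\<integral>\<^sup>+y. f x / w x * indicator U (y + x) \<partial>N)" ..
  qed
  also have "\<dots> = (\<integral>\<^sup>+y. \<integral>\<^sup>+x. f x / w x * indicator U (y + x) \<partial>M \<partial>N)"
    by (rule MN.Fubini'[symmetric]) measurable
  also have "\<dots> = (\<integral>\<^sup>+y. \<integral>\<^sup>+x. f (- y + x) / w (- y + x) * indicator U x \<partial>M \<partial>N)"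
  proof (rule nn_integral_cong)
    fix y
    show "(\<integral>\<^sup>+x. f x / w x * indicator U (y + x) \<partial>M) = (\<integral>\<^sup>+x. f (- y + x) / w (- y + x) * indicator U x \<partial>M)"
      using M.nn_integral_left[of "\<lambda>x. f x / w x * indicator U (y + x)" "- y"]
      by (simp add: add.assoc[symmetric])
  qed
  also have "\<dots> = (\<integral>\<^sup>+x. \<integral>\<^sup>+y. f (- y + x) / w (- y + x) * indicator U x \<partial>N \<partial>M)"
    by (rule MN.Fubini') measurable
  also have "\<dots> = (\<integral>\<^sup>+x. \<integral>\<^sup>+y. f (- y) / w (- y) * indicator U x \<partial>N \<partial>M)"
  proof (rule nn_integral_cong)
    fix x
    show "(\<integral>\<^sup>+y. f (- y + x) / w (- y + x) * indicator U x \<partial>N) = (\<integral>\<^sup>+y. f (- y) / w (- y) * indicator U x \<partial>N)"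
      using N.nn_integral_left[of "\<lambda>y. f (- y + x) / w (- y + x) * indicator U x" x]
      by (simp add: minus_add add.assoc)
  qed
  also have "\<dots> = emeasure M U * (\<integral>\<^sup>+y. f (- y) / w (- y) \<partial>N)"
    by (simp add: nn_integral_multc nn_integral_cmult_indicator mult.commute nn_integral_cmult)
  finally show ?thesis by (simp add: w_def)
qed

text \<open>Both integrals are computed by \<open>haar_weil_formula\<close> against the same
  auxiliary measure \<open>M\<close>; they then differ only in the factors
  \<open>emeasure M U\<close> and \<open>emeasure N U\<close>.\<close>

lemma haar_unique:
  fixes M N :: "'g::{topological_group_add, second_countable_topology, t2_space} measure"
  assumes "lc_haar M" "lc_haar N"
  shows "\<exists>c>0. \<forall>f \<in> borel_measurable borel. (\<integral>\<^sup>+x. f x \<partial>N) = ennreal c * (\<integral>\<^sup>+x. f x \<partial>M)"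
proof -
  interpret M: lc_haar M by fact
  interpret N: lc_haar N by fact
  obtain U K :: "'g set" where U: "open U" "U \<noteq> {}" "compact K" "U \<subseteq> K"
    by (rule M.ex_precompact_open)
  note m = M.emeasure_precompact_open[OF U] and n = N.emeasure_precompact_open[OF U]
  obtain a where a: "emeasure M U = ennreal a" "0 < a"
    using m by (cases "emeasure M U") auto
  obtain b where b: "emeasure N U = ennreal b" "0 < b"
    using n by (cases "emeasure N U") auto
  have "(\<integral>\<^sup>+x. f x \<partial>N) = ennreal (b / a) * (\<integral>\<^sup>+x. f x \<partial>M)" if f: "f \<in> borel_measurable borel" for f
  proof -
    have "(\<integral>\<^sup>+x. f x \<partial>N) = ennreal b * (\<integral>\<^sup>+y. f (- y) / emeasure M {t. t + - y \<in> U} \<partial>M)"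
      unfolding b(1)[symmetric] by (rule haar_weil_formula[OF assms(2,1) U f])
    also have "\<dots> = ennreal (b / a) * (ennreal a * (\<integral>\<^sup>+y. f (- y) / emeasure M {t. t + - y \<in> U} \<partial>M))"
      using a b by (simp add: mult.assoc[symmetric] ennreal_mult[symmetric])
    also have "ennreal a * (\<integral>\<^sup>+y. f (- y) / emeasure M {t. t + - y \<in> U} \<partial>M) = (\<integral>\<^sup>+x. f x \<partial>M)"
      unfolding a(1)[symmetric] by (rule haar_weil_formula[OF assms(1,1) U f, symmetric])
    finally show ?thesis .
  qed
  then show ?thesis using a b by (intro exI[of _ "b / a"]) auto
qed

context lc_haar
begin

lemma ex_test_function:
  obtains g :: "'g \<Rightarrow> ennreal" and a where "g \<in> borel_measurable borel" "(\<integral>\<^sup>+x. g x \<partial>M) = ennreal a" "0 < a"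
proof -
  obtain U K :: "'g set" where U: "open U" "U \<noteq> {}" "compact K" "U \<subseteq> K"
    by (rule ex_precompact_open)
  note m = emeasure_precompact_open[OF U]
  obtain a where a: "emeasure M U = ennreal a" "0 < a"
    using m by (cases "emeasure M U") auto
  show ?thesis by (rule that[of "indicator U" a]) (use a U(1) in auto)
qed

text \<open>The existence and uniqueness of the scaling factors that \<^const>\<open>modular_function\<close> and
  \<^const>\<open>modulus\<close> single out with \<open>THE\<close>.\<close>

lemma ex1_scaling:
  assumes T [measurable]: "T \<in> borel_measurable borel" and "lc_haar (distr M borel T)"
  shows "\<exists>!c. 0 < c \<and> (\<forall>f :: 'g \<Rightarrow> ennreal. f \<in> borel_measurable borel \<longrightarrow>
     (\<integral>\<^sup>+x. f (T x) \<partial>M) = ennreal (inverse c) * (\<integral>\<^sup>+x. f x \<partial>M))"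
proof (rule ex_ex1I)
  obtain c where c: "c > 0" "\<And>f. f \<in> borel_measurable borel \<Longrightarrow> (\<integral>\<^sup>+x. f x \<partial>distr M borel T) = ennreal c * (\<integral>\<^sup>+x. f x \<partial>M)"
    using haar_unique[OF lc_haar_axioms assms(2)] by blast
  have "(\<integral>\<^sup>+x. f (T x) \<partial>M) = ennreal (inverse (inverse c)) * (\<integral>\<^sup>+x. f x \<partial>M)" if "f \<in> borel_measurable borel" for f
    using c(2)[OF that] that by (simp add: nn_integral_distr)
  with c(1) show "\<exists>c. 0 < c \<and> (\<forall>f :: 'g \<Rightarrow> ennreal. f \<in> borel_measurable borel \<longrightarrow>
     (\<integral>\<^sup>+x. f (T x) \<partial>M) = ennreal (inverse c) * (\<integral>\<^sup>+x. f x \<partial>M))"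
    by (intro exI[of _ "inverse c"]) auto
next
  fix c d
  assume c: "0 < c \<and> (\<forall>f :: 'g \<Rightarrow> ennreal. f \<in> borel_measurable borel \<longrightarrow>
     (\<integral>\<^sup>+x. f (T x) \<partial>M) = ennreal (inverse c) * (\<integral>\<^sup>+x. f x \<partial>M))"
    and d: "0 < d \<and> (\<forall>f :: 'g \<Rightarrow> ennreal. f \<in> borel_measurable borel \<longrightarrow>
     (\<integral>\<^sup>+x. f (T x) \<partial>M) = ennreal (inverse d) * (\<integral>\<^sup>+x. f x \<partial>M))"
  obtain g :: "'g \<Rightarrow> ennreal" and a where g: "g \<in> borel_measurable borel" "(\<integral>\<^sup>+x. g x \<partial>M) = ennreal a" "0 < a"
    by (rule ex_test_function)
  have "ennreal (inverse c) * ennreal a = ennreal (inverse d) * ennreal a"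
    using c d g by metis
  then have "ennreal (inverse c * a) = ennreal (inverse d * a)"
    using c d g by (simp add: ennreal_mult)
  then show "c = d" using c d g by simp
qed

text \<open>The hypothesis \<open>inv\<close> lets a left translation after \<open>T\<close> be
  absorbed into a left translation before \<open>T\<close>. Right translations satisfy it with
  \<open>a' a = a\<close>, automorphisms with \<open>a'\<close> the inverse automorphism.\<close>

lemma lc_haar_distr:
  fixes T T' :: "'g \<Rightarrow> 'g"
  assumes T: "continuous_on UNIV T" "continuous_on UNIV T'" "\<And>x. T (T' x) = x" "\<And>x. T' (T x) = x"
    and inv: "\<And>a x. a + T x = T (a' a + x)"
  shows "lc_haar (distr M borel T)"
proof
  have [measurable]: "T \<in> borel_measurable borel" by (rule borel_measurable_continuous_onI[OF T(1)])
  show "locally_compact_space (euclidean :: 'g topology)" by (rule lc)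
  show "left_haar_measure (distr M borel T)"
    unfolding left_haar_measure_def
  proof (intro conjI allI impI)
    fix K :: "'g set" assume K: "compact K"
    have eq: "T -` K = T' ` K"
    proof (intro equalityI subsetI)
      fix x assume "x \<in> T -` K"
      then show "x \<in> T' ` K" using T(4)[of x] by (metis imageI vimageD)
    qed (auto simp: T(3))
    have "emeasure (distr M borel T) K = emeasure M (T -` K)"
      using K by (subst emeasure_distr) (auto simp: compact_imp_closed)
    also have "\<dots> < \<infinity>"
      unfolding eq by (intro emeasure_compact_less_top compact_continuous_image K continuous_on_subset[OF T(2)]) auto
    finally show "emeasure (distr M borel T) K < \<infinity>" .
  next
    have "emeasure (distr M borel T) UNIV = emeasure M UNIV"
      by (subst emeasure_distr) auto
    then show "emeasure (distr M borel T) UNIV \<noteq> 0"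
      using haar by (simp add: left_haar_measure_def)
  next
    fix a
    show "distr (distr M borel T) (distr M borel T) (\<lambda>x. a + x) = distr M borel T"
    proof (rule measure_eqI)
      fix A assume "A \<in> sets (distr (distr M borel T) (distr M borel T) (\<lambda>x. a + x))"
      then have A [measurable]: "A \<in> sets borel" by simp
      have "emeasure (distr (distr M borel T) (distr M borel T) (\<lambda>x. a + x)) A
          = (\<integral>\<^sup>+x. indicator A x \<partial>distr (distr M borel T) (distr M borel T) (\<lambda>x. a + x))" by simp
      also have "\<dots> = (\<integral>\<^sup>+x. indicator A (a + x) \<partial>distr M borel T)"
        by (subst nn_integral_distr) auto
      also have "\<dots> = (\<integral>\<^sup>+x. indicator A (a + T x) \<partial>M)"
        by (subst nn_integral_distr) auto
      also have "\<dots> = (\<integral>\<^sup>+x. indicator A (T (a' a + x)) \<partial>M)" by (simp add: inv)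
      also have "\<dots> = (\<integral>\<^sup>+x. indicator A (T x) \<partial>M)"
        by (rule nn_integral_left[of "\<lambda>x. indicator A (T x)"]) measurable
      also have "\<dots> = (\<integral>\<^sup>+x. indicator A x \<partial>distr M borel T)"
        by (subst nn_integral_distr) auto
      also have "\<dots> = emeasure (distr M borel T) A" by simp
      finally show "emeasure (distr (distr M borel T) (distr M borel T) (\<lambda>x. a + x)) A = emeasure (distr M borel T) A" .
    qed simp
  qed simp
qed

lemma modular_function:
  shows modular_function_pos: "0 < modular_function M p"
    and nn_integral_right: "f \<in> borel_measurable borel \<Longrightarrow>
      (\<integral>\<^sup>+q. f (q + p) \<partial>M) = ennreal (inverse (modular_function M p)) * (\<integral>\<^sup>+q. f q \<partial>M)"
proof -
  have m: "(\<lambda>q. q + p) \<in> borel_measurable borel" by measurable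
  have h: "lc_haar (distr M borel (\<lambda>q. q + p))"
    by (rule lc_haar_distr[where T' = "\<lambda>q. q - p" and a' = "\<lambda>a. a"])
      (auto intro!: continuous_intros simp: add.assoc)
  have *: "0 < modular_function M p \<and> (\<forall>f :: 'g \<Rightarrow> ennreal. f \<in> borel_measurable borel \<longrightarrow>
     (\<integral>\<^sup>+q. f (q + p) \<partial>M) = ennreal (inverse (modular_function M p)) * (\<integral>\<^sup>+q. f q \<partial>M))"
    unfolding modular_function_def by (rule theI'[OF ex1_scaling[OF m h]])
  from * show "0 < modular_function M p" by (rule conjunct1)
  assume "f \<in> borel_measurable borel"
  with * show "(\<integral>\<^sup>+q. f (q + p) \<partial>M) = ennreal (inverse (modular_function M p)) * (\<integral>\<^sup>+q. f q \<partial>M)"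
    by (elim conjE allE impE)
qed

text \<open>A fixed test function of finite positive integral expresses \<open>m s\<close> through
  an integral that depends measurably on \<open>s\<close>.\<close>

lemma scaling_measurable:
  assumes [measurable]: "(\<lambda>(s, x). T s x) \<in> borel_measurable (S \<Otimes>\<^sub>M borel)"
    and m: "\<And>s. 0 < m s"
    and T: "\<And>s (f :: 'g \<Rightarrow> ennreal). f \<in> borel_measurable borel \<Longrightarrow>
      (\<integral>\<^sup>+x. f (T s x) \<partial>M) = ennreal (inverse (m s)) * (\<integral>\<^sup>+x. f x \<partial>M)"
  shows "(m :: _ \<Rightarrow> real) \<in> borel_measurable S"
proof -
  interpret sigma_finite_measure M by (rule sigma_finite_haar)
  obtain g :: "'g \<Rightarrow> ennreal" and a where g [measurable]: "g \<in> borel_measurable borel" and a: "(\<integral>\<^sup>+x. g x \<partial>M) = ennreal a" "0 < a"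
    by (rule ex_test_function)
  have "m s = inverse (enn2real (\<integral>\<^sup>+x. g (T s x) \<partial>M) / a)" for s
    using T[OF g, of s] a m[of s] by (simp add: ennreal_mult[symmetric])
  then have "m = (\<lambda>s. inverse (enn2real (\<integral>\<^sup>+x. g (T s x) \<partial>M) / a))" by blast
  also have "\<dots> \<in> borel_measurable S" by measurable
  finally show ?thesis .
qed

lemma scaling_mult:
  assumes m: "0 < m" "0 < m'" "0 < m''"
    and [measurable]: "T \<in> borel_measurable borel" "T' \<in> borel_measurable borel"
    and T: "\<And>f :: 'g \<Rightarrow> ennreal. f \<in> borel_measurable borel \<Longrightarrow>
      (\<integral>\<^sup>+x. f (T x) \<partial>M) = ennreal (inverse m) * (\<integral>\<^sup>+x. f x \<partial>M)"
    and T': "\<And>f :: 'g \<Rightarrow> ennreal. f \<in> borel_measurable borel \<Longrightarrow>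
      (\<integral>\<^sup>+x. f (T' x) \<partial>M) = ennreal (inverse m') * (\<integral>\<^sup>+x. f x \<partial>M)"
    and T'': "\<And>f :: 'g \<Rightarrow> ennreal. f \<in> borel_measurable borel \<Longrightarrow>
      (\<integral>\<^sup>+x. f (T (T' x)) \<partial>M) = ennreal (inverse m'') * (\<integral>\<^sup>+x. f x \<partial>M)"
  shows "m'' = m * m'"
proof -
  obtain g :: "'g \<Rightarrow> ennreal" and a where g [measurable]: "g \<in> borel_measurable borel" and a: "(\<integral>\<^sup>+x. g x \<partial>M) = ennreal a" "0 < a"
    by (rule ex_test_function)
  have "ennreal (inverse m'') * ennreal a = ennreal (inverse m') * (ennreal (inverse m) * ennreal a)"
    using T''[OF g] T'[of "\<lambda>x. g (T x)"] T[OF g] a by simp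
  then have "inverse m'' * a = inverse m' * inverse m * a"
    using m a by (simp add: ennreal_mult[symmetric] mult.assoc)
  then show ?thesis using m a by (simp add: field_simps)
qed

lemma modular_function_measurable [measurable]: "modular_function M \<in> borel_measurable borel"
proof (rule scaling_measurable[where T = "\<lambda>p q. q + p"])
  show "(\<lambda>(p :: 'g, q). q + p) \<in> borel_measurable (borel \<Otimes>\<^sub>M borel)" by measurable
qed (rule modular_function_pos, erule nn_integral_right)

lemma modular_function_add: "modular_function M (p + q) = modular_function M p * modular_function M q"
  \<comment> \<open>Right translations compose in the opposite order: adding \<open>p + q\<close> on
    the right means adding \<open>p\<close> before \<open>q\<close>.\<close>
  unfolding mult.commute[of "modular_function M p"]
proof (rule scaling_mult[where T = "\<lambda>x. x + q" and T' = "\<lambda>x. x + p"])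
  show "(\<integral>\<^sup>+x. f (x + p + q) \<partial>M) = ennreal (inverse (modular_function M (p + q))) * (\<integral>\<^sup>+x. f x \<partial>M)"
    if "f \<in> borel_measurable borel" for f :: "'g \<Rightarrow> ennreal"
    unfolding add.assoc by (rule nn_integral_right[OF that])
qed (rule modular_function_pos,
    rule modular_function_pos, rule modular_function_pos, measurable, measurable,
    erule nn_integral_right, erule nn_integral_right)

lemma modular_function_zero [simp]: "modular_function M 0 = 1"
proof -
  have "modular_function M 0 * modular_function M 0 = modular_function M 0 * 1"
    using modular_function_add[of 0 0] by (simp only: add_0_left mult_1_right)
  then show ?thesis using modular_function_pos[of 0] by (simp only: mult_left_cancel)
qed

lemma modular_function_minus: "modular_function M (- p) = inverse (modular_function M p)"
proof -
  have "modular_function M p * modular_function M (- p) = 1"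
    using modular_function_add[of p "- p"] by (simp only: right_minus modular_function_zero)
  then show ?thesis by (rule inverse_unique[symmetric])
qed

text \<open>Weil's formula with both measures equal to \<open>M\<close>, applied to \<open>f\<close>
  divided by the modular function: the measures of right translates of \<open>U\<close> are
  multiples of the modular function and cancel that divisor, which the reflection has
  inverted.\<close>

lemma nn_integral_inverse:
  assumes f [measurable]: "f \<in> borel_measurable borel"
  shows "(\<integral>\<^sup>+q. f (- q) \<partial>M) = (\<integral>\<^sup>+q. ennreal (inverse (modular_function M q)) * f q \<partial>M)"
proof -
  obtain U K :: "'g set" where U: "open U" "U \<noteq> {}" "compact K" "U \<subseteq> K"
    by (rule ex_precompact_open)
  note [measurable] = borel_open[OF U(1)]
  obtain a where a: "emeasure M U = ennreal a" "0 < a"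
    using emeasure_precompact_open[OF U] by (cases "emeasure M U") auto
  let ?D = "modular_function M"
  have w: "emeasure M {t. t + - y \<in> U} = ennreal (?D y * a)" for y
  proof -
    have "emeasure M {t. t + - y \<in> U} = (\<integral>\<^sup>+t. indicator {t. t + - y \<in> U} t \<partial>M)"
      by (subst nn_integral_indicator) measurable
    also have "\<dots> = (\<integral>\<^sup>+t. indicator U (t + - y) \<partial>M)" by (simp add: indicator_def)
    also have "\<dots> = ennreal (inverse (?D (- y))) * ennreal a"
      using nn_integral_right[of "indicator U" "- y"] by (simp add: a)
    finally show ?thesis using a modular_function_pos[of y]
      by (simp add: modular_function_minus ennreal_mult)
  qed
  have "(\<integral>\<^sup>+q. ennreal (inverse (?D q)) * f q \<partial>M)
     = ennreal a * (\<integral>\<^sup>+y. ennreal (inverse (?D (- y))) * f (- y) / ennreal (?D y * a) \<partial>M)"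
    unfolding w[symmetric] a(1)[symmetric]
    by (rule haar_weil_formula[OF lc_haar_axioms lc_haar_axioms U]) measurable
  also have "\<dots> = (\<integral>\<^sup>+y. ennreal a * (ennreal (?D y) * f (- y) / ennreal (?D y * a)) \<partial>M)"
    by (subst nn_integral_cmult) (auto simp: modular_function_minus)
  also have "\<dots> = (\<integral>\<^sup>+y. f (- y) \<partial>M)"
  proof (rule nn_integral_cong)
    fix y
    have p: "0 < ?D y * a" using a modular_function_pos[of y] by simp
    have "ennreal a * (ennreal (?D y) * f (- y) / ennreal (?D y * a))
        = f (- y) * ennreal (?D y * a) / ennreal (?D y * a)"
      using a modular_function_pos[of y]
      by (simp add: ennreal_times_divide ennreal_mult mult_ac)
    also have "\<dots> = f (- y)"
      using p by (intro ennreal_mult_divide_eq) auto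
    finally show "ennreal a * (ennreal (?D y) * f (- y) / ennreal (?D y * a)) = f (- y)" .
  qed
  finally show ?thesis ..
qed

end

section \<open>The Borel structure of the dual\<close>

lemma pairing_continuous: "continuous_on UNIV (pairing \<xi>)"
  and pairing_add: "pairing \<xi> (x + y) = pairing \<xi> x * pairing \<xi> y"
  and norm_pairing [simp]: "cmod (pairing \<xi> x) = 1"
proof -
  note p = pairing[of \<xi>, unfolded mem_Collect_eq]
  show "continuous_on UNIV (pairing \<xi>)" using p by (rule conjunct1)
  show "pairing \<xi> (x + y) = pairing \<xi> x * pairing \<xi> y"
    using p by (elim conjE allE[of _ x] allE[of _ y])
  show "cmod (pairing \<xi> x) = 1" using p by (elim conjE allE[of "\<lambda>x. cmod (pairing \<xi> x) = 1" x])
qed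

lemma pairing_nonzero [simp]: "pairing \<xi> x \<noteq> 0"
proof
  assume "pairing \<xi> x = 0"
  with norm_pairing[of \<xi> x] show False by (simp del: norm_pairing)
qed

lemma unimodular_cnj: "cmod z = 1 \<Longrightarrow> cnj z = inverse z"
proof -
  assume "cmod z = 1"
  then have "z * cnj z = 1" using complex_norm_square[of z] by simp
  then show ?thesis by (rule inverse_unique[symmetric])
qed

lemma cnj_pairing: "cnj (pairing \<xi> x) = inverse (pairing \<xi> x)"
  by (simp add: unimodular_cnj)

lemma pairing_zero [simp]: "pairing \<xi> 0 = 1"
proof -
  have "pairing \<xi> 0 * pairing \<xi> 0 = pairing \<xi> 0 * 1" using pairing_add[of \<xi> 0 0] by simp
  then show ?thesis by (simp only: mult_left_cancel pairing_nonzero not_False_eq_True)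
qed

lemma pairing_minus: "pairing \<xi> (- x) = inverse (pairing \<xi> x)"
proof -
  have "pairing \<xi> x * pairing \<xi> (- x) = 1" using pairing_add[of \<xi> x "- x"] by simp
  then show ?thesis by (rule inverse_unique[symmetric])
qed

lemma pairing_add_left: "pairing (\<xi> + \<zeta>) x = pairing \<xi> x * pairing \<zeta> x"
  by (simp add: plus_pdual.rep_eq)

lemma pairing_minus_left: "pairing (- \<xi>) x = inverse (pairing \<xi> x)"
  by (simp add: uminus_pdual.rep_eq cnj_pairing)

lemma pairing_diff_left: "pairing (\<xi> - \<zeta>) x = pairing \<xi> x / pairing \<zeta> x"
  by (simp only: minus_pdual_def pairing_add_left pairing_minus_left divide_inverse)

lemma pdual_eqI: "(\<And>x. pairing \<xi> x = pairing \<zeta> x) \<Longrightarrow> \<xi> = \<zeta>"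
proof -
  assume *: "\<And>x. pairing \<xi> x = pairing \<zeta> x"
  have "pairing \<xi> = pairing \<zeta>" by (rule ext) (rule *)
  then show ?thesis by (simp only: pairing_inject)
qed

lemma open_pdual_basic: "compact K \<Longrightarrow> open U \<Longrightarrow> open {\<xi>. pairing \<xi> ` K \<subseteq> U}"
proof -
  assume "compact K" "open U"
  then show ?thesis
    unfolding open_pdual_def by (intro generate_topology.Basis CollectI exI[of _ K] exI[of _ U] conjI refl)
qed

lemma borel_measurable_pairing_eval: "(\<lambda>\<xi>. pairing \<xi> v) \<in> borel_measurable borel"
proof (rule borel_measurableI)
  fix U :: "complex set" assume "open U"
  have "(\<lambda>\<xi>. pairing \<xi> v) -` U \<inter> space borel = {\<xi>. pairing \<xi> ` {v} \<subseteq> U}" by auto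
  also have "open \<dots>" by (rule open_pdual_basic[OF _ \<open>open U\<close>]) simp
  finally show "(\<lambda>\<xi>. pairing \<xi> v) -` U \<inter> space borel \<in> sets borel" by simp
qed

lemma locally_compact_nbhd:
  fixes x :: "'a::t2_space"
  assumes "locally_compact_space (euclidean :: 'a topology)" "open W" "x \<in> W"
  obtains B C where "open B" "compact C" "x \<in> B" "B \<subseteq> C" "C \<subseteq> W"
proof -
  have "neighbourhood_base_of (compactin euclidean) (euclidean :: 'a topology)"
    using assms(1) by (subst locally_compact_space_neighbourhood_base[symmetric]) (auto simp: Hausdorff_space_def separation_t2 disjnt_def)
  then have "\<exists>U V. open U \<and> compact V \<and> x \<in> U \<and> U \<subseteq> V \<and> V \<subseteq> W"
    using assms(2,3) by (simp add: neighbourhood_base_of)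
  then show ?thesis using that by blast
qed

text \<open>A compact set is covered by finitely many members of a countable base of
  \<open>V\<close> with compact closure, each closure being mapped by the given character into a
  basic open set. Closures of open sets serve as test sets because on them a character can be
  controlled through a countable dense subset.\<close>

lemma pdual_countable_base:
  assumes lc: "locally_compact_space (euclidean :: 'v::{topological_ab_group_add, second_countable_topology, t2_space} topology)"
  defines "\<S> \<equiv> {{\<xi> :: 'v pdual. pairing \<xi> ` closure B \<subseteq> U} | B U. open B \<and> compact (closure B) \<and> open U}"
  obtains \<F> where "countable \<F>" "\<And>F. F \<in> \<F> \<Longrightarrow> \<exists>A. finite A \<and> A \<subseteq> \<S> \<and> F = \<Inter>A"
    "\<And>Y. open Y \<Longrightarrow> Y = \<Union>{F \<in> \<F>. F \<subseteq> Y}"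
proof -
  obtain \<B> :: "'v set set" where \<B>: "countable \<B>" "topological_basis \<B>"
    using ex_countable_basis by blast
  obtain \<U> :: "complex set set" where \<U>: "countable \<U>" "topological_basis \<U>"
    using ex_countable_basis by blast
  define S where "S = (\<lambda>(B, U). {\<xi> :: 'v pdual. pairing \<xi> ` closure B \<subseteq> U})"
  define T where "T = S ` {(B, U). B \<in> \<B> \<and> compact (closure B) \<and> U \<in> \<U>}"
  define \<F> where "\<F> = Inter ` {A. finite A \<and> A \<subseteq> T}"
  have "countable (\<B> \<times> \<U>)" using \<B>(1) \<U>(1) by simp
  then have cT: "countable T"
    unfolding T_def by (intro countable_image) (auto elim!: countable_subset[rotated])
  have c\<F>: "countable \<F>"
    unfolding \<F>_def by (intro countable_image countable_Collect_finite_subset cT)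
  have T\<S>: "T \<subseteq> \<S>"
  proof
    fix F assume "F \<in> T"
    then obtain B U where BU: "B \<in> \<B>" "compact (closure B)" "U \<in> \<U>" "F = S (B, U)"
      unfolding T_def by auto
    then have "open B" "open U"
      using topological_basis_open[OF \<B>(2)] topological_basis_open[OF \<U>(2)] by simp_all
    with BU show "F \<in> \<S>" unfolding \<S>_def S_def by auto
  qed
  have base: "\<exists>F \<in> \<F>. \<xi> \<in> F \<and> F \<subseteq> Y" if "generate_topology {{\<xi>. pairing \<xi> ` K \<subseteq> U} | K U. compact K \<and> open U} Y" "\<xi> \<in> Y" for Y \<xi>
    using that
  proof (induction rule: generate_topology.induct)
    case UNIV
    have "UNIV \<in> \<F>" unfolding \<F>_def by (rule image_eqI[of _ _ "{}"]) auto
    then show ?case by blast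
  next
    case (Int a b)
    then obtain A A' where "finite A" "A \<subseteq> T" "finite A'" "A' \<subseteq> T" "\<xi> \<in> \<Inter>A" "\<Inter>A \<subseteq> a" "\<xi> \<in> \<Inter>A'" "\<Inter>A' \<subseteq> b"
      unfolding \<F>_def by auto
    then have "\<Inter>(A \<union> A') \<in> \<F>" "\<xi> \<in> \<Inter>(A \<union> A')" "\<Inter>(A \<union> A') \<subseteq> a \<inter> b"
      unfolding \<F>_def by (auto intro!: imageI)
    then show ?case by blast
  next
    case (UN K)
    then show ?case by (meson Union_iff Sup_upper subset_trans)
  next
    case (Basis s)
    then obtain K U where KU: "s = {\<xi>. pairing \<xi> ` K \<subseteq> U}" "compact K" "open U" by blast
    have "\<exists>B V. B \<in> \<B> \<and> compact (closure B) \<and> V \<in> \<U> \<and> x \<in> B \<and> pairing \<xi> ` closure B \<subseteq> V \<and> V \<subseteq> U" if "x \<in> K" for x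
    proof -
      have "pairing \<xi> x \<in> U" using Basis(2) KU(1) that by blast
      then obtain V where V: "V \<in> \<U>" "pairing \<xi> x \<in> V" "V \<subseteq> U"
        using topological_basisE[OF \<U>(2) KU(3)] by metis
      have "open (pairing \<xi> -` V)"
        by (rule open_vimage[OF topological_basis_open[OF \<U>(2) V(1)] pairing_continuous])
      then obtain B C where BC: "open B" "compact C" "x \<in> B" "B \<subseteq> C" "C \<subseteq> pairing \<xi> -` V"
        using locally_compact_nbhd[OF lc] V(2) by (metis vimageI)
      obtain B' where B': "B' \<in> \<B>" "x \<in> B'" "B' \<subseteq> B"
        using topological_basisE[OF \<B>(2) BC(1,3)] by metis
      have cl: "closure B' \<subseteq> C"
        using B'(3) BC(2,4) by (intro closure_minimal compact_imp_closed) auto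
      have "compact (closure B')"
        using compact_Int_closed[OF BC(2) closed_closure[of B']] cl by (simp add: Int_absorb1)
      then show ?thesis using B' V cl BC(5) by blast
    qed
    then obtain B V where BV: "\<And>x. x \<in> K \<Longrightarrow> B x \<in> \<B> \<and> compact (closure (B x)) \<and> V x \<in> \<U> \<and> x \<in> B x \<and>
        pairing \<xi> ` closure (B x) \<subseteq> V x \<and> V x \<subseteq> U" by metis
    have "\<And>x. x \<in> K \<Longrightarrow> open (B x)" using BV topological_basis_open[OF \<B>(2)] by blast
    moreover have "K \<subseteq> (\<Union>x\<in>K. B x)" using BV by blast
    ultimately obtain L where L: "L \<subseteq> K" "finite L" "K \<subseteq> (\<Union>x\<in>L. B x)"
      using compactE_image[OF KU(2)] by metis
    let ?F = "\<Inter>((\<lambda>x. S (B x, V x)) ` L)"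
    have "?F \<in> \<F>" unfolding \<F>_def T_def using L BV by (intro imageI) auto
    moreover have "\<xi> \<in> S (B x, V x)" if "x \<in> L" for x
      using BV[of x] L(1) that by (simp add: S_def subset_iff)
    then have "\<xi> \<in> ?F" by blast
    moreover have "?F \<subseteq> s"
    proof
      fix \<zeta> assume z: "\<zeta> \<in> ?F"
      have "pairing \<zeta> y \<in> U" if y: "y \<in> K" for y
      proof -
        obtain x where x: "x \<in> L" "y \<in> B x" using L(3) y by blast
        then have "\<zeta> \<in> S (B x, V x)" using z by blast
        then have "pairing \<zeta> ` closure (B x) \<subseteq> V x" by (simp add: S_def)
        then have "pairing \<zeta> y \<in> V x" using closure_subset[of "B x"] x(2) by blast
        then show ?thesis using BV[of x] x(1) L(1) by blast
      qed
      then show "\<zeta> \<in> s" using KU(1) by blast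
    qed
    ultimately show ?case by (intro bexI[of _ ?F] conjI)
  qed
  show ?thesis
  proof (rule that[OF c\<F>])
    show "\<exists>A. finite A \<and> A \<subseteq> \<S> \<and> F = \<Inter>A" if "F \<in> \<F>" for F
      using that T\<S> unfolding \<F>_def by blast
    show "Y = \<Union>{F \<in> \<F>. F \<subseteq> Y}" if "open Y" for Y
      using base[OF that[unfolded open_pdual_def]] by blast
  qed
qed

text \<open>A basic open condition on a character over the compact closure of an open set can be
  checked at countably many points, and countably many such conditions describe every open set.
  Measurability of maps into the dual is thereby reduced to scalar functions.\<close>

lemma measurable_pdual_iff:
  fixes g :: "'a \<Rightarrow> 'v::{topological_ab_group_add, second_countable_topology, t2_space} pdual"
  assumes lc: "locally_compact_space (euclidean :: 'v topology)"
  shows "g \<in> borel_measurable M \<longleftrightarrow> (\<forall>v. (\<lambda>x. pairing (g x) v) \<in> borel_measurable M)"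
proof
  assume "g \<in> borel_measurable M"
  then show "\<forall>v. (\<lambda>x. pairing (g x) v) \<in> borel_measurable M"
    using measurable_compose[OF _ borel_measurable_pairing_eval] by blast
next
  assume "\<forall>v. (\<lambda>x. pairing (g x) v) \<in> borel_measurable M"
  then have gm [measurable]: "(\<lambda>x. pairing (g x) v) \<in> borel_measurable M" for v by blast
  obtain D :: "'v set" where D: "countable D" "\<And>X. open X \<Longrightarrow> X \<noteq> {} \<Longrightarrow> \<exists>d \<in> D. d \<in> X"
    using countable_dense_exists[where 'a = 'v] by blast
  have basic: "{x \<in> space M. pairing (g x) ` closure B \<subseteq> U} \<in> sets M"
    if B: "open B" "compact (closure B)" and U: "open U" for B U
  proof -
    \<comment> \<open>Closed sets inside \<open>U\<close>: a compact image inside \<open>U\<close>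
      keeps a positive distance from the complement, so it lies in some \<open>W n\<close>, and
      closedness lets the condition extend from the dense points to the closure.\<close>
    define W where "W n = {z. \<forall>w. w \<notin> U \<longrightarrow> 1 / real (Suc n) \<le> dist z w}" for n
    have W_alt: "W n = (\<Inter>w \<in> - U. {z. 1 / real (Suc n) \<le> dist z w})" for n
      by (auto simp: W_def)
    have clW: "closed (W n)" for n
      unfolding W_alt by (intro closed_INT ballI closed_Collect_le continuous_intros)
    have WU: "W n \<subseteq> U" for n
      unfolding W_def by (auto simp: field_simps)
    have dense: "closure B \<subseteq> closure (B \<inter> D)"
    proof -
      have "closure D = UNIV"
        using D(2) by (auto simp: closure_iff_nhds_not_empty) (metis disjoint_iff empty_iff interior_subset open_interior subsetD)
      then have "B \<subseteq> closure (B \<inter> D)" using open_Int_closure_subset[OF B(1), of D] by simp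
      then show ?thesis by (rule closure_minimal) simp
    qed
    have eq: "pairing \<xi> ` closure B \<subseteq> U \<longleftrightarrow> (\<exists>n. \<forall>v \<in> B \<inter> D. pairing \<xi> v \<in> W n)" for \<xi>
    proof
      assume *: "pairing \<xi> ` closure B \<subseteq> U"
      have "compact (pairing \<xi> ` closure B)"
        by (intro compact_continuous_image B(2) continuous_on_subset[OF pairing_continuous]) simp
      then obtain d where d: "d > 0" "\<And>z w. z \<in> pairing \<xi> ` closure B \<Longrightarrow> w \<in> - U \<Longrightarrow> d \<le> dist z w"
      proof -
        have "closed (- U)" "pairing \<xi> ` closure B \<inter> - U = {}" using U * by auto
        from separate_compact_closed[OF \<open>compact (pairing \<xi> ` closure B)\<close> this] show thesis
          using that by blast
      qed
      obtain n where n: "1 / real (Suc n) < d" using nat_approx_posE[OF d(1)] by blast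
      have "pairing \<xi> v \<in> W n" if "v \<in> B \<inter> D" for v
        unfolding W_def
      proof (intro CollectI allI impI)
        fix w assume "w \<notin> U"
        then have "d \<le> dist (pairing \<xi> v) w" using that closure_subset[of B] by (intro d) auto
        then show "1 / real (Suc n) \<le> dist (pairing \<xi> v) w" using n by simp
      qed
      then show "\<exists>n. \<forall>v \<in> B \<inter> D. pairing \<xi> v \<in> W n" by blast
    next
      assume "\<exists>n. \<forall>v \<in> B \<inter> D. pairing \<xi> v \<in> W n"
      then obtain n where n: "pairing \<xi> ` (B \<inter> D) \<subseteq> W n" by blast
      have "pairing \<xi> ` closure (B \<inter> D) \<subseteq> W n"
        by (rule image_closure_subset[OF continuous_on_subset[OF pairing_continuous] clW n]) simp
      then show "pairing \<xi> ` closure B \<subseteq> U" using dense WU by blast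
    qed
    have "{x \<in> space M. pairing (g x) ` closure B \<subseteq> U} = {x \<in> space M. \<exists>n. \<forall>v \<in> B \<inter> D. pairing (g x) v \<in> W n}"
      using eq by blast
    also have "\<dots> \<in> sets M"
    proof -
      have "{x \<in> space M. pairing (g x) v \<in> W n} \<in> sets M" for n v
      proof -
        have "(\<lambda>x. pairing (g x) v) -` W n \<inter> space M \<in> sets M"
          using clW[of n] by (intro measurable_sets[OF gm]) simp
        also have "(\<lambda>x. pairing (g x) v) -` W n \<inter> space M = {x \<in> space M. pairing (g x) v \<in> W n}" by auto
        finally show ?thesis .
      qed
      moreover have "countable (B \<inter> D)" using D(1) by simp
      ultimately have "{x \<in> space M. \<forall>v \<in> B \<inter> D. pairing (g x) v \<in> W n} \<in> sets M" for n
        by (intro sets.sets_Collect_countable_All')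
      then show ?thesis by (rule sets.sets_Collect_countable_Ex)
    qed
    finally show ?thesis .
  qed
  obtain \<F> where \<F>: "countable \<F>"
    "\<And>F. F \<in> \<F> \<Longrightarrow> \<exists>A. finite A \<and> A \<subseteq> {{\<xi> :: 'v pdual. pairing \<xi> ` closure B \<subseteq> U} | B U. open B \<and> compact (closure B) \<and> open U} \<and> F = \<Inter>A"
    "\<And>Y. open Y \<Longrightarrow> Y = \<Union>{F \<in> \<F>. F \<subseteq> Y}"
    by (rule pdual_countable_base[OF lc]) blast
  have \<F>m: "g -` F \<inter> space M \<in> sets M" if F: "F \<in> \<F>" for F
  proof -
    obtain A where A: "finite A" "A \<subseteq> {{\<xi> :: 'v pdual. pairing \<xi> ` closure B \<subseteq> U} | B U. open B \<and> compact (closure B) \<and> open U}" "F = \<Inter>A"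
      using \<F>(2)[OF F] by blast
    have "{x \<in> space M. \<forall>S \<in> A. g x \<in> S} \<in> sets M"
    proof (rule sets.sets_Collect_finite_All[OF _ A(1)])
      fix S assume "S \<in> A"
      from subsetD[OF A(2) this] obtain B U
        where BU: "S = {\<xi> :: 'v pdual. pairing \<xi> ` closure B \<subseteq> U} \<and> open B \<and> compact (closure B) \<and> open U"
        unfolding mem_Collect_eq by (elim exE)
      from BU have "{x \<in> space M. g x \<in> S} = {x \<in> space M. pairing (g x) ` closure B \<subseteq> U}" by simp
      with basic[of B U] BU show "{x \<in> space M. g x \<in> S} \<in> sets M" by simp
    qed
    also have "{x \<in> space M. \<forall>S \<in> A. g x \<in> S} = g -` F \<inter> space M" using A(3) by auto
    finally show ?thesis .
  qed
  show "g \<in> borel_measurable M"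
  proof (rule borel_measurableI)
    fix Y :: "'v pdual set" assume "open Y"
    then have "Y = \<Union>{F \<in> \<F>. F \<subseteq> Y}" by (rule \<F>(3))
    then have "g -` Y \<inter> space M = (\<Union>F\<in>{F \<in> \<F>. F \<subseteq> Y}. g -` F \<inter> space M)" by blast
    also have "\<dots> \<in> sets M"
      using \<F>(1) \<F>m by (intro sets.countable_UN') (auto elim: countable_subset[rotated])
    finally show "g -` Y \<inter> space M \<in> sets M" .
  qed
qed

text \<open>No metric on \<open>V\<close> is at hand, so \<open>v\<close> is approximated by
  \<open>d (k n v)\<close>, the earliest dense point whose difference from \<open>v\<close> lies in
  the \<open>n\<close>th neighbourhood of 0. Each approximation evaluates at countably many points
  only, and continuity of the character gives convergence.\<close>

lemma borel_measurable_pairing: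
  "(\<lambda>(\<xi>, v :: 'v::{topological_ab_group_add, second_countable_topology, t2_space}). pairing \<xi> v) \<in> borel_measurable (borel \<Otimes>\<^sub>M borel)"
proof -
  obtain D :: "'v set" where D: "countable D" "\<And>X. open X \<Longrightarrow> X \<noteq> {} \<Longrightarrow> \<exists>d \<in> D. d \<in> X"
    using countable_dense_exists[where 'a = 'v] by blast
  have "D \<noteq> {}" using D(2)[of UNIV] by auto
  define d where "d = from_nat_into D"
  have d: "\<exists>k. d k \<in> X" if "open X" "X \<noteq> {}" for X
    using D(2)[OF that] from_nat_into_surj[OF D(1)] unfolding d_def by metis
  obtain A :: "nat \<Rightarrow> 'v set" where A: "\<And>i. open (A i)" "\<And>i. 0 \<in> A i"
    "\<And>S. open S \<Longrightarrow> 0 \<in> S \<Longrightarrow> eventually (\<lambda>i. A i \<subseteq> S) sequentially"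
    by (rule countable_basis_at_decseq[of "0 :: 'v"]) blast
  define k where "k n v = (LEAST k. v - d k \<in> A n)" for n v
  have k: "v - d (k n v) \<in> A n" for n v
  proof -
    have "open ((\<lambda>x. v - x) -` A n)" by (intro open_vimage A(1) continuous_intros)
    moreover have "v \<in> (\<lambda>x. v - x) -` A n" using A(2) by simp
    ultimately obtain j where "v - d j \<in> A n" using d by blast
    then show ?thesis unfolding k_def by (rule LeastI)
  qed
  have km [measurable]: "k n \<in> measurable borel (count_space UNIV)" for n
  proof -
    have "open ((\<lambda>v. v - d j) -` A n)" for j by (intro open_vimage A(1) continuous_intros)
    then have [measurable]: "Measurable.pred borel (\<lambda>v. v - d j \<in> A n)" for j
      by (simp add: pred_def vimage_def)
    show ?thesis unfolding k_def by measurable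
  qed
  show ?thesis
  proof (rule borel_measurable_LIMSEQ_metric)
    fix n
    have "(\<lambda>z :: 'v pdual \<times> 'v. pairing (fst z) (d j)) \<in> borel_measurable (borel \<Otimes>\<^sub>M borel)" for j
      by (rule measurable_compose[OF measurable_fst borel_measurable_pairing_eval])
    from measurable_compose_countable[OF this, of "\<lambda>z. k n (snd z)"]
    show "(\<lambda>z :: 'v pdual \<times> 'v. pairing (fst z) (d (k n (snd z)))) \<in> borel_measurable (borel \<Otimes>\<^sub>M borel)"
      by measurable
  next
    fix z :: "'v pdual \<times> 'v"
    obtain \<xi> v where z: "z = (\<xi>, v)" by force
    have "(\<lambda>n. v - d (k n v)) \<longlonglongrightarrow> 0"
    proof (rule topological_tendstoI)
      fix S :: "'v set" assume "open S" "0 \<in> S"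
      from A(3)[OF this] show "eventually (\<lambda>n. v - d (k n v) \<in> S) sequentially"
        by eventually_elim (use k in blast)
    qed
    then have "(\<lambda>n. v - (v - d (k n v))) \<longlonglongrightarrow> v - 0"
      by (intro tendsto_intros)
    moreover have "v - (v - d (k n v)) = d (k n v)" for n by (simp add: algebra_simps)
    ultimately have "(\<lambda>n. d (k n v)) \<longlonglongrightarrow> v" by simp
    moreover have "isCont (pairing \<xi>) v"
      using pairing_continuous[of \<xi>] by (simp add: continuous_on_eq_continuous_at)
    ultimately have "(\<lambda>n. pairing \<xi> (d (k n v))) \<longlonglongrightarrow> pairing \<xi> v"
      by (rule isCont_tendsto_compose[rotated])
    then show "(\<lambda>n. pairing (fst z) (d (k n (snd z)))) \<longlonglongrightarrow> (case z of (\<xi>, v) \<Rightarrow> pairing \<xi> v)"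
      by (simp add: z)
  qed
qed

lemma borel_measurable_pairing' [measurable (raw)]:
  fixes g :: "'a \<Rightarrow> 'v::{topological_ab_group_add, second_countable_topology, t2_space}"
  assumes "f \<in> borel_measurable M" "g \<in> borel_measurable M"
  shows "(\<lambda>x. pairing (f x) (g x)) \<in> borel_measurable M"
proof -
  have "(\<lambda>x. (f x, g x)) \<in> measurable M (borel \<Otimes>\<^sub>M borel)" using assms by measurable
  from measurable_compose[OF this borel_measurable_pairing] show ?thesis by simp
qed

section \<open>The group data\<close>

locale extension_data =
  fixes act :: "'q::{topological_group_add, second_countable_topology, t2_space}
                  \<Rightarrow> 'v::{topological_ab_group_add, second_countable_topology, t2_space} \<Rightarrow> 'v"
    and muQ :: "'q measure" and muV :: "'v measure" and muX :: "'v pdual measure"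
    and \<eta> :: "'q \<Rightarrow> 'v pdual" and \<eta>inv :: "'v pdual \<Rightarrow> 'q"
    and \<beta> :: "'q \<Rightarrow> 'q \<Rightarrow> 'v" and b :: "'q \<Rightarrow> 'q \<Rightarrow> complex"
  assumes lcQ: "locally_compact_space (euclidean :: 'q topology)"
    and lcV: "locally_compact_space (euclidean :: 'v topology)"
    and action: "continuous_action act"
    and haarQ: "left_haar_measure muQ" and haarV: "left_haar_measure muV" and haarX: "left_haar_measure muX"
    and eta: "\<eta> \<in> Z1c act" and beta: "\<beta> \<in> Z2 act"
    and etainv: "ae_inverse muQ muX \<eta> \<eta>inv"
    and cochain_b: "circle_cochain2 b" and psi_eq: "psi \<eta> \<beta> = cobd b"
    and beta_zero_left [simp]: "\<And>q. \<beta> 0 q = 0" and beta_zero_right [simp]: "\<And>q. \<beta> q 0 = 0"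
    and b_zero_left [simp]: "\<And>q. b 0 q = 1" and b_zero_right [simp]: "\<And>q. b q 0 = 1"
    and eta_integral: "\<And>h :: 'v pdual \<Rightarrow> ennreal. h \<in> borel_measurable borel \<Longrightarrow>
           (\<integral>\<^sup>+q. h (\<eta> q) * ennreal (inverse (modulus muV act q)) \<partial>muQ) = (\<integral>\<^sup>+\<xi>. h \<xi> \<partial>muX)"
    and fourier: "fourier_unitary muV muX"
begin

sublocale Q: lc_haar muQ by unfold_locales (rule lcQ, rule haarQ)
sublocale V: lc_haar muV by unfold_locales (rule lcV, rule haarV)

abbreviation "md \<equiv> modulus muV act"
abbreviation "\<Delta> \<equiv> modular_function muQ"
abbreviation "da \<equiv> dual_action act"

lemma act_comp: "act (p + q) v = act p (act q v)"
  using action by (simp add: continuous_action_def)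

lemma act_automorphism: "act q \<in> topological_automorphisms"
proof -
  have "act q \<in> topspace (aut_topology :: ('v \<Rightarrow> 'v) topology)"
    using action by (auto simp: continuous_action_def continuous_map_def)
  then show ?thesis by (auto simp: aut_topology_def)
qed

lemma act_add: "act q (v + w) = act q v + act q w"
  and act_bij: "bij (act q)"
  and act_continuous: "continuous_on UNIV (act q)"
  using act_automorphism[of q] by (simp_all add: topological_automorphisms_def)

lemma act_zero [simp]: "act 0 v = v"
proof -
  have "act 0 (act 0 v) = act 0 v" using act_comp[of 0 0 v] by simp
  then show ?thesis using act_bij[of 0] by (simp add: bij_def inj_eq)
qed

lemma act_minus_act [simp]: "act (- q) (act q v) = v"
  using act_comp[of "- q" q v] by simp

lemma act_act_minus [simp]: "act q (act (- q) v) = v"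
  using act_comp[of q "- q" v] by simp

lemma act_zero_right [simp]: "act q 0 = 0"
  using act_add[of q 0 0] by simp

lemma act_uminus: "act q (- v) = - act q v"
proof -
  have "act q v + act q (- v) = 0" using act_add[of q v "- v"] by simp
  then show ?thesis by (simp add: eq_neg_iff_add_eq_0 add.commute)
qed

lemma act_diff: "act q (v - w) = act q v - act q w"
  using act_add[of q v "- w"] by (simp add: act_uminus)

text \<open>Evaluation is continuous for the compact-open topology because \<open>V\<close> is
  locally compact: a compact neighbourhood \<open>C\<close> of \<open>v\<close> mapped into
  \<open>U\<close> by \<open>act q\<close> is also mapped into \<open>U\<close> by
  \<open>act p\<close> for all \<open>p\<close> near \<open>q\<close>.\<close>

lemma act_jointly_continuous: "continuous_on UNIV (\<lambda>(q, v). act q v)"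
proof (rule continuous_on_open_vimage[OF open_UNIV, THEN iffD2], intro allI impI)
  fix U :: "'v set" assume U: "open U"
  show "open ((\<lambda>(q, v). act q v) -` U \<inter> UNIV)"
  proof (subst open_subopen, intro ballI)
    fix z assume "z \<in> (\<lambda>(q, v). act q v) -` U \<inter> UNIV"
    then obtain q v where z: "z = (q, v)" "act q v \<in> U" by (cases z) auto
    have "open (act q -` U)" by (rule open_vimage[OF U act_continuous])
    then obtain B C where BC: "open B" "compact C" "v \<in> B" "B \<subseteq> C" "C \<subseteq> act q -` U"
      using locally_compact_nbhd[OF lcV] z(2) by (metis vimageI)
    let ?S = "{T \<in> topological_automorphisms. T ` C \<subseteq> U}"
    have "openin aut_topology ?S"
      unfolding aut_topology_def using BC(2) U by (intro topology_generated_by_Basis) blast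
    then have "openin euclidean {p \<in> topspace euclidean. act p \<in> ?S}"
      using action by (intro openin_continuous_map_preimage) (auto simp: continuous_action_def)
    then have "open {p. act p ` C \<subseteq> U}" by (simp add: act_automorphism)
    then have "open ({p. act p ` C \<subseteq> U} \<times> B)" by (rule open_Times[OF _ BC(1)])
    moreover have "z \<in> {p. act p ` C \<subseteq> U} \<times> B" using z BC by auto
    moreover have "{p. act p ` C \<subseteq> U} \<times> B \<subseteq> (\<lambda>(q, v). act q v) -` U \<inter> UNIV"
      using subsetD[OF BC(4)] by (auto simp: image_subset_iff)
    ultimately show "\<exists>T. open T \<and> z \<in> T \<and> T \<subseteq> (\<lambda>(q, v). act q v) -` U \<inter> UNIV" by blast
  qed
qed

lemma measurable_act [measurable (raw)]:
  assumes "f \<in> borel_measurable M" "g \<in> borel_measurable M"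
  shows "(\<lambda>x. act (f x) (g x)) \<in> borel_measurable M"
proof -
  have 1: "(\<lambda>(q, v). act q v) \<in> borel_measurable (borel \<Otimes>\<^sub>M borel)"
    unfolding borel_prod by (rule borel_measurable_continuous_onI[OF act_jointly_continuous])
  have "(\<lambda>x. (f x, g x)) \<in> measurable M (borel \<Otimes>\<^sub>M borel)" using assms by measurable
  from measurable_compose[OF this 1] show ?thesis by simp
qed

lemma md_spec: "0 < md q \<and> (\<forall>f :: 'v \<Rightarrow> ennreal. f \<in> borel_measurable borel \<longrightarrow>
     (\<integral>\<^sup>+v. f (act q v) \<partial>muV) = ennreal (inverse (md q)) * (\<integral>\<^sup>+v. f v \<partial>muV))"
proof -
  have m: "act q \<in> borel_measurable borel" by (rule borel_measurable_continuous_onI[OF act_continuous])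
  have h: "lc_haar (distr muV borel (act q))"
  proof (rule V.lc_haar_distr[where T' = "act (- q)" and a' = "act (- q)"])
    show "a + act q x = act q (act (- q) a + x)" for a x by (simp add: act_add)
  qed (simp_all add: act_continuous)
  show ?thesis
    unfolding modulus_def by (rule theI'[OF V.ex1_scaling[OF m h]])
qed

lemma md_pos [simp]: "0 < md q"
  using md_spec[of q] by (rule conjunct1)

lemma md_nonneg [simp]: "0 \<le> md q" and md_nonzero [simp]: "md q \<noteq> 0"
  using md_pos[of q] by linarith+

lemma nn_integral_act: "f \<in> borel_measurable borel \<Longrightarrow>
    (\<integral>\<^sup>+v. f (act q v) \<partial>muV) = ennreal (inverse (md q)) * (\<integral>\<^sup>+v. f v \<partial>muV)"
  using md_spec[of q] by (elim conjE allE impE)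

lemma measurable_md [measurable]: "md \<in> borel_measurable borel"
proof (rule V.scaling_measurable[where T = act])
  show "(\<lambda>(q, v). act q v) \<in> borel_measurable (borel \<Otimes>\<^sub>M borel)" by measurable
qed (rule md_pos, erule nn_integral_act)

lemma md_add: "md (p + q) = md p * md q"
proof (rule V.scaling_mult[where T = "act p" and T' = "act q"])
  show "(\<integral>\<^sup>+v. f (act p (act q v)) \<partial>muV) = ennreal (inverse (md (p + q))) * (\<integral>\<^sup>+v. f v \<partial>muV)"
    if "f \<in> borel_measurable borel" for f :: "'v \<Rightarrow> ennreal"
    unfolding act_comp[symmetric] by (rule nn_integral_act[OF that])
qed (rule md_pos, rule md_pos, rule md_pos, measurable, measurable, erule nn_integral_act, erule nn_integral_act)

lemma md_zero [simp]: "md 0 = 1"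
proof -
  have "md 0 * md 0 = md 0 * 1" using md_add[of 0 0] by (simp only: add_0_left mult_1_right)
  then show ?thesis by (simp only: mult_left_cancel md_nonzero not_False_eq_True)
qed

lemma md_minus: "md (- p) = inverse (md p)"
proof -
  have "md p * md (- p) = 1" using md_add[of p "- p"] by (simp only: right_minus md_zero)
  then show ?thesis by (rule inverse_unique[symmetric])
qed

lemma Delta_pos [simp]: "0 < \<Delta> q" by (rule Q.modular_function_pos)

lemma Delta_nonneg [simp]: "0 \<le> \<Delta> q" and Delta_nonzero [simp]: "\<Delta> q \<noteq> 0"
  using Delta_pos[of q] by linarith+

lemma modular_V [simp]: "modular_function muV v = 1"
proof -
  obtain g :: "'v \<Rightarrow> ennreal" and a where g: "g \<in> borel_measurable borel" "(\<integral>\<^sup>+x. g x \<partial>muV) = ennreal a" "0 < a"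
    by (rule V.ex_test_function)
  have "ennreal (inverse (modular_function muV v)) * ennreal a = ennreal a"
    using V.nn_integral_right[OF g(1), of v] V.nn_integral_left[OF g(1), of v] g(2) by (simp add: add.commute)
  then have "inverse (modular_function muV v) * a = 1 * a"
    using g(3) V.modular_function_pos[of v] by (simp add: ennreal_mult[symmetric])
  then show ?thesis using g(3) by simp
qed

lemma nn_integral_V_minus: "f \<in> borel_measurable borel \<Longrightarrow> (\<integral>\<^sup>+v. f (- v) \<partial>muV) = (\<integral>\<^sup>+v. f v \<partial>muV)"
  by (subst V.nn_integral_inverse) simp_all

lemma pairing_da: "pairing (da q \<xi>) v = pairing \<xi> (act (- q) v)"
proof -
  have "continuous_on UNIV (\<lambda>v. pairing \<xi> (act (- q) v))"
    by (rule continuous_on_compose2[OF pairing_continuous act_continuous]) simp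
  then show ?thesis
    unfolding dual_action_def by (subst Abs_pdual_inverse) (auto simp: act_add pairing_add)
qed

lemma measurable_pdualI:
  fixes g :: "'a \<Rightarrow> 'v pdual"
  assumes "\<And>v. (\<lambda>x. pairing (g x) v) \<in> borel_measurable M"
  shows "g \<in> borel_measurable M"
  using assms by (subst measurable_pdual_iff[OF lcV]) blast

lemma measurable_da [measurable (raw)]:
  assumes [measurable]: "f \<in> borel_measurable M" "g \<in> borel_measurable M"
  shows "(\<lambda>x. da (f x) (g x)) \<in> borel_measurable M"
  by (rule measurable_pdualI, unfold pairing_da) measurable

lemma measurable_pdual_add [measurable (raw)]:
  fixes f g :: "'a \<Rightarrow> 'v pdual"
  assumes [measurable]: "f \<in> borel_measurable M" "g \<in> borel_measurable M"
  shows "(\<lambda>x. f x + g x) \<in> borel_measurable M"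
  by (rule measurable_pdualI, unfold pairing_add_left) measurable

lemma measurable_pdual_diff [measurable (raw)]:
  fixes f g :: "'a \<Rightarrow> 'v pdual"
  assumes [measurable]: "f \<in> borel_measurable M" "g \<in> borel_measurable M"
  shows "(\<lambda>x. f x - g x) \<in> borel_measurable M"
  by (rule measurable_pdualI, unfold pairing_diff_left) measurable

lemma measurable_pdual_uminus [measurable (raw)]:
  fixes f :: "'a \<Rightarrow> 'v pdual"
  assumes [measurable]: "f \<in> borel_measurable M"
  shows "(\<lambda>x. - f x) \<in> borel_measurable M"
  by (rule measurable_pdualI, unfold pairing_minus_left) measurable

lemma da_diff: "da q (\<xi> - \<zeta>) = da q \<xi> - da q \<zeta>"
  by (rule pdual_eqI) (simp add: pairing_da pairing_diff_left)

lemma da_zero [simp]: "da 0 \<xi> = \<xi>"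
  by (rule pdual_eqI) (simp add: pairing_da)

lemma eta_add: "\<eta> (p + q) = \<eta> p + da p (\<eta> q)"
  and eta_continuous: "continuous_on UNIV \<eta>"
  using eta by (simp_all add: Z1c_def)

lemma eta_zero [simp]: "\<eta> 0 = 0"
  using eta_add[of 0 0] by simp

lemma eta_minus: "\<eta> (- p) = - da (- p) (\<eta> p)"
proof -
  have "\<eta> (- p) + da (- p) (\<eta> p) = 0" using eta_add[of "- p" p] by simp
  then show ?thesis by (simp add: eq_neg_iff_add_eq_0)
qed

lemma eta_left_diff: "\<eta> (- p + q) = da (- p) (\<eta> q - \<eta> p)"
  by (simp add: eta_add eta_minus da_diff)

lemma da_eta: "da p (\<eta> q) = \<eta> (p + q) - \<eta> p"
  by (simp add: eta_add)

lemma measurable_eta [measurable]: "\<eta> \<in> borel_measurable borel"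
  by (rule borel_measurable_continuous_onI[OF eta_continuous])

lemma sets_muX [measurable_cong, simp]: "sets muX = sets borel"
  by (rule sets_left_haar[OF haarX])

lemma space_muX [simp]: "space muX = UNIV"
  using sets_eq_imp_space_eq[OF sets_muX] by simp

lemma measurable_etainv [measurable]: "\<eta>inv \<in> borel_measurable borel"
proof -
  have "\<eta>inv \<in> measurable muX muQ" using etainv by (simp add: ae_inverse_def)
  also have "measurable muX muQ = (borel_measurable borel :: ('v pdual \<Rightarrow> 'q) set)"
    by (rule measurable_cong_sets) simp_all
  finally show ?thesis .
qed

lemma AE_eta_etainv: "AE \<xi> in muX. \<eta> (\<eta>inv \<xi>) = \<xi>"
  and AE_etainv_eta: "AE q in muQ. \<eta>inv (\<eta> q) = q"
proof -
  obtain A B where A: "A \<in> null_sets muQ" and B: "B \<in> null_sets muX"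
    and bij: "bij_betw \<eta> (UNIV - A) (UNIV - B)"
    and inv: "\<And>y. y \<notin> B \<Longrightarrow> \<eta>inv y \<notin> A \<and> \<eta> (\<eta>inv y) = y"
    using etainv by (auto simp: ae_inverse_def)
  show "AE \<xi> in muX. \<eta> (\<eta>inv \<xi>) = \<xi>"
    using AE_not_in[OF B] by eventually_elim (use inv in blast)
  show "AE q in muQ. \<eta>inv (\<eta> q) = q"
    using AE_not_in[OF A]
  proof eventually_elim
    case (elim q)
    have q: "\<eta> q \<notin> B" using bij elim by (auto simp: bij_betw_def)
    \<comment> \<open>\<open>\<eta>inv\<close> returns a point outside \<open>A\<close> with the
      same image as \<open>q\<close>; injectivity off \<open>A\<close> makes it \<open>q\<close>
      itself.\<close>
    have "inj_on \<eta> (UNIV - A)" using bij by (simp add: bij_betw_def)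
    then show "\<eta>inv (\<eta> q) = q"
      by (rule inj_onD) (use inv[OF q] elim in auto)
  qed
qed

lemma nn_integral_etainv:
  assumes [measurable]: "k \<in> borel_measurable borel"
  shows "(\<integral>\<^sup>+\<xi>. k (\<eta>inv \<xi>) \<partial>muX) = (\<integral>\<^sup>+q. k q * ennreal (inverse (md q)) \<partial>muQ)"
proof -
  have "(\<integral>\<^sup>+\<xi>. k (\<eta>inv \<xi>) \<partial>muX) = (\<integral>\<^sup>+q. k (\<eta>inv (\<eta> q)) * ennreal (inverse (md q)) \<partial>muQ)"
    by (rule eta_integral[symmetric, where h = "\<lambda>\<xi>. k (\<eta>inv \<xi>)"]) measurable
  also have "\<dots> = (\<integral>\<^sup>+q. k q * ennreal (inverse (md q)) \<partial>muQ)"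
    by (rule nn_integral_cong_AE) (use AE_etainv_eta in eventually_elim, simp)
  finally show ?thesis .
qed

abbreviation "Qw \<equiv> weighted_Q muQ muV act"

lemma sets_Qw [measurable_cong, simp]: "sets Qw = sets borel"
  by (simp add: weighted_Q_def)

lemma space_Qw [simp]: "space Qw = UNIV"
  by (simp add: weighted_Q_def)

lemma nn_integral_Qw: "f \<in> borel_measurable borel \<Longrightarrow>
    (\<integral>\<^sup>+q. f q \<partial>Qw) = (\<integral>\<^sup>+q. ennreal (inverse (md q)) * f q \<partial>muQ)"
  unfolding weighted_Q_def by (rule nn_integral_density) measurable

lemma AE_Qw: "(AE q in Qw. P q) \<longleftrightarrow> (AE q in muQ. P q)"
  unfolding weighted_Q_def by (subst AE_density) auto

lemma sigma_finite_muQ: "sigma_finite_measure muQ" by (rule Q.sigma_finite_haar)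
lemma sigma_finite_muV: "sigma_finite_measure muV" by (rule V.sigma_finite_haar)

lemma sigma_finite_Qw: "sigma_finite_measure Qw"
proof -
  interpret sigma_finite_measure muQ by (rule sigma_finite_muQ)
  show ?thesis unfolding weighted_Q_def
    by (subst sigma_finite_iff_density_finite) auto
qed

text \<open>Local compactness of the dual is not among the assumptions, so the exhaustion is pulled
  back from \<open>Qw\<close> along \<open>\<eta>inv\<close>, under which \<open>muX\<close>
  corresponds to \<open>Qw\<close>.\<close>

lemma sigma_finite_muX: "sigma_finite_measure muX"
proof -
  interpret sigma_finite_measure Qw by (rule sigma_finite_Qw)
  obtain E :: "nat \<Rightarrow> 'q set" where E: "range E \<subseteq> sets Qw" "(\<Union>i. E i) = space Qw" "\<And>i. emeasure Qw (E i) \<noteq> \<infinity>"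
    using sigma_finite by blast
  have Em [measurable]: "E i \<in> sets borel" for i using E(1) by auto
  show ?thesis
  proof
    have "emeasure muX (\<eta>inv -` E i) \<noteq> \<infinity>" for i
    proof -
      have [measurable]: "\<eta>inv -` E i \<in> sets borel"
        using measurable_sets[OF measurable_etainv Em] by simp
      have "emeasure muX (\<eta>inv -` E i) = (\<integral>\<^sup>+\<xi>. indicator (\<eta>inv -` E i) \<xi> \<partial>muX)"
        by simp
      also have "\<dots> = (\<integral>\<^sup>+\<xi>. indicator (E i) (\<eta>inv \<xi>) \<partial>muX)"
        by (simp add: indicator_def)
      also have "\<dots> = (\<integral>\<^sup>+q. indicator (E i) q * ennreal (inverse (md q)) \<partial>muQ)"
        by (rule nn_integral_etainv) measurable
      also have "\<dots> = (\<integral>\<^sup>+q. indicator (E i) q \<partial>Qw)"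
        by (subst nn_integral_Qw) (auto simp: mult.commute)
      also have "\<dots> = emeasure Qw (E i)" by simp
      finally show ?thesis using E(3) by simp
    qed
    moreover have "(\<Union>i. \<eta>inv -` E i) = UNIV"
      unfolding vimage_UN[symmetric] E(2) by simp
    ultimately show "\<exists>A. countable A \<and> A \<subseteq> sets muX \<and> \<Union> A = space muX \<and> (\<forall>a\<in>A. emeasure muX a \<noteq> \<infinity>)"
      using measurable_sets[OF measurable_etainv Em]
      by (intro exI[of _ "range (\<lambda>i. \<eta>inv -` E i)"]) auto
  qed
qed

lemma nn_integral_X_left:
  assumes [measurable]: "f \<in> borel_measurable borel"
  shows "(\<integral>\<^sup>+\<xi>. f (\<zeta> + \<xi>) \<partial>muX) = (\<integral>\<^sup>+\<xi>. f \<xi> \<partial>muX)"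
proof -
  have "(\<integral>\<^sup>+\<xi>. f \<xi> \<partial>muX) = (\<integral>\<^sup>+\<xi>. f \<xi> \<partial>distr muX muX (\<lambda>\<xi>. \<zeta> + \<xi>))"
    using haarX by (simp add: left_haar_measure_def)
  also have "\<dots> = (\<integral>\<^sup>+\<xi>. f (\<zeta> + \<xi>) \<partial>muX)"
    by (subst nn_integral_distr) auto
  finally show ?thesis ..
qed

text \<open>In the double integral of \<open>indicator A \<xi> * f \<zeta>\<close>, translating each
  variable in turn replaces \<open>f \<zeta>\<close> by \<open>f (- \<xi>)\<close>; the auxiliary
  factor \<open>emeasure muX A\<close>, finite and nonzero, cancels.\<close>

lemma nn_integral_X_minus:
  assumes f [measurable]: "f \<in> borel_measurable borel"
  shows "(\<integral>\<^sup>+\<xi>. f (- \<xi>) \<partial>muX) = (\<integral>\<^sup>+\<xi>. f \<xi> \<partial>muX)"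
proof -
  interpret X: sigma_finite_measure muX by (rule sigma_finite_muX)
  interpret XX: pair_sigma_finite muX muX ..
  have "emeasure muX UNIV \<noteq> 0" using haarX by (simp add: left_haar_measure_def)
  moreover obtain E :: "nat \<Rightarrow> 'v pdual set" where E: "range E \<subseteq> sets muX" "(\<Union>i. E i) = space muX" "\<And>i. emeasure muX (E i) \<noteq> \<infinity>"
    using X.sigma_finite by blast
  ultimately have "\<exists>i. emeasure muX (E i) \<noteq> 0"
    using emeasure_UN_eq_0[of muX E] by (metis space_muX)
  then obtain A where A: "A \<in> sets borel" "emeasure muX A \<noteq> 0" "emeasure muX A \<noteq> \<infinity>"
    using E by (metis range_subsetD sets_muX)
  note [measurable] = A(1)
  have "emeasure muX A * (\<integral>\<^sup>+\<zeta>. f \<zeta> \<partial>muX) = (\<integral>\<^sup>+\<xi>. \<integral>\<^sup>+\<zeta>. indicator A \<xi> * f \<zeta> \<partial>muX \<partial>muX)"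
    by (simp add: nn_integral_cmult nn_integral_multc mult.commute)
  also have "\<dots> = (\<integral>\<^sup>+\<xi>. \<integral>\<^sup>+\<zeta>. indicator A \<xi> * f (- \<xi> + \<zeta>) \<partial>muX \<partial>muX)"
  proof (rule nn_integral_cong)
    fix \<xi>
    show "(\<integral>\<^sup>+\<zeta>. indicator A \<xi> * f \<zeta> \<partial>muX) = (\<integral>\<^sup>+\<zeta>. indicator A \<xi> * f (- \<xi> + \<zeta>) \<partial>muX)"
      using nn_integral_X_left[of "\<lambda>\<zeta>. indicator A \<xi> * f \<zeta>" "- \<xi>"] by simp
  qed
  also have "\<dots> = (\<integral>\<^sup>+\<zeta>. \<integral>\<^sup>+\<xi>. indicator A \<xi> * f (- \<xi> + \<zeta>) \<partial>muX \<partial>muX)"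
    by (rule XX.Fubini'[symmetric]) measurable
  also have "\<dots> = (\<integral>\<^sup>+\<zeta>. \<integral>\<^sup>+\<xi>. indicator A (\<zeta> + \<xi>) * f (- \<xi>) \<partial>muX \<partial>muX)"
  proof (rule nn_integral_cong)
    fix \<zeta>
    show "(\<integral>\<^sup>+\<xi>. indicator A \<xi> * f (- \<xi> + \<zeta>) \<partial>muX) = (\<integral>\<^sup>+\<xi>. indicator A (\<zeta> + \<xi>) * f (- \<xi>) \<partial>muX)"
      using nn_integral_X_left[of "\<lambda>\<xi>. indicator A \<xi> * f (- \<xi> + \<zeta>)" \<zeta>] by simp
  qed
  also have "\<dots> = (\<integral>\<^sup>+\<xi>. \<integral>\<^sup>+\<zeta>. indicator A (\<zeta> + \<xi>) * f (- \<xi>) \<partial>muX \<partial>muX)"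
    by (rule XX.Fubini') measurable
  also have "\<dots> = (\<integral>\<^sup>+\<xi>. \<integral>\<^sup>+\<zeta>. indicator A \<zeta> * f (- \<xi>) \<partial>muX \<partial>muX)"
  proof (rule nn_integral_cong)
    fix \<xi>
    show "(\<integral>\<^sup>+\<zeta>. indicator A (\<zeta> + \<xi>) * f (- \<xi>) \<partial>muX) = (\<integral>\<^sup>+\<zeta>. indicator A \<zeta> * f (- \<xi>) \<partial>muX)"
      using nn_integral_X_left[of "\<lambda>\<zeta>. indicator A \<zeta> * f (- \<xi>)" \<xi>] by (simp add: add.commute)
  qed
  also have "\<dots> = emeasure muX A * (\<integral>\<^sup>+\<xi>. f (- \<xi>) \<partial>muX)"
    by (simp add: nn_integral_cmult nn_integral_multc mult.commute)
  finally show ?thesis using A by (simp add: ennreal_mult_cancel_left)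
qed

text \<open>By the cocycle identity the dual action becomes, in the coordinate \<eta>, a left
  translation of \<open>Q\<close> followed by a translation of the dual. Both preserve the measures,
  so only the weight \<open>inverse (md p)\<close> contributes, and it changes by the factor
  \<open>md q\<close>.\<close>

lemma nn_integral_da:
  assumes [measurable]: "f \<in> borel_measurable borel"
  shows "(\<integral>\<^sup>+\<xi>. f (da q \<xi>) \<partial>muX) = ennreal (md q) * (\<integral>\<^sup>+\<xi>. f \<xi> \<partial>muX)"
proof -
  have "(\<integral>\<^sup>+\<xi>. f (da q \<xi>) \<partial>muX) = (\<integral>\<^sup>+p. f (da q (\<eta> p)) * ennreal (inverse (md p)) \<partial>muQ)"
    by (rule eta_integral[symmetric, where h = "\<lambda>\<xi>. f (da q \<xi>)"]) measurable
  also have "\<dots> = (\<integral>\<^sup>+p. ennreal (md q) * (f (- \<eta> q + \<eta> (q + p)) * ennreal (inverse (md (q + p)))) \<partial>muQ)"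
  proof (rule nn_integral_cong)
    fix p
    have "ennreal (inverse (md p)) = ennreal (md q) * ennreal (inverse (md (q + p)))"
      by (subst ennreal_mult[symmetric]) (auto simp: md_add field_simps)
    then show "f (da q (\<eta> p)) * ennreal (inverse (md p)) = ennreal (md q) * (f (- \<eta> q + \<eta> (q + p)) * ennreal (inverse (md (q + p))))"
      by (simp add: da_eta mult_ac)
  qed
  also have "\<dots> = ennreal (md q) * (\<integral>\<^sup>+p. f (- \<eta> q + \<eta> (q + p)) * ennreal (inverse (md (q + p))) \<partial>muQ)"
    by (rule nn_integral_cmult) measurable
  also have "(\<integral>\<^sup>+p. f (- \<eta> q + \<eta> (q + p)) * ennreal (inverse (md (q + p))) \<partial>muQ)
      = (\<integral>\<^sup>+p. f (- \<eta> q + \<eta> p) * ennreal (inverse (md p)) \<partial>muQ)"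
    by (rule Q.nn_integral_left[where f = "\<lambda>p. f (- \<eta> q + \<eta> p) * ennreal (inverse (md p))"]) measurable
  also have "\<dots> = (\<integral>\<^sup>+\<xi>. f (- \<eta> q + \<xi>) \<partial>muX)"
    by (rule eta_integral) measurable
  also have "\<dots> = (\<integral>\<^sup>+\<xi>. f \<xi> \<partial>muX)"
    by (rule nn_integral_X_left) measurable
  finally show ?thesis .
qed

lemma measurable_beta [measurable (raw)]:
  assumes "f \<in> borel_measurable M" "g \<in> borel_measurable M"
  shows "(\<lambda>x. \<beta> (f x) (g x)) \<in> borel_measurable M"
proof -
  have 1: "(\<lambda>(p, q). \<beta> p q) \<in> borel_measurable (borel \<Otimes>\<^sub>M borel)"
    using beta unfolding borel_prod by (simp add: Z2_def)
  have "(\<lambda>x. (f x, g x)) \<in> measurable M (borel \<Otimes>\<^sub>M borel)" using assms by measurable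
  from measurable_compose[OF this 1] show ?thesis by simp
qed

lemma measurable_b [measurable (raw)]:
  assumes "f \<in> borel_measurable M" "g \<in> borel_measurable M"
  shows "(\<lambda>x. b (f x) (g x)) \<in> borel_measurable M"
proof -
  have 1: "(\<lambda>(p, q). b p q) \<in> borel_measurable (borel \<Otimes>\<^sub>M borel)"
    using cochain_b unfolding borel_prod by (simp add: circle_cochain2_def)
  have "(\<lambda>x. (f x, g x)) \<in> measurable M (borel \<Otimes>\<^sub>M borel)" using assms by measurable
  from measurable_compose[OF this 1] show ?thesis by simp
qed

lemma norm_b [simp]: "cmod (b p q) = 1"
  using cochain_b by (simp add: circle_cochain2_def)

lemma b_nonzero [simp]: "b p q \<noteq> 0"
proof
  assume "b p q = 0"
  with norm_b[of p q] show False by (simp del: norm_b)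
qed

lemma cnj_b: "cnj (b p q) = inverse (b p q)"
  by (rule unimodular_cnj[OF norm_b])

lemma pairing_eta_beta:
  "pairing (\<eta> (- p)) (\<beta> q r) = (b q r * b p (q + r)) / (b p q * b (p + q) r)"
  using psi_eq by (simp add: fun_eq_iff psi_def cobd_def)

lemma beta_cocycle: "\<beta> p q + \<beta> (p + q) r = act p (\<beta> q r) + \<beta> p (q + r)"
  using beta by (simp add: Z2_def)

end

section \<open>Fibrewise integral operators\<close>

text \<open>Common form of the partial Fourier transform and its inverse, with \<open>P\<close> the
  space of parameters. The integral formula is demanded only where almost all fibres of
  \<open>f\<close> are integrable, since it need not make sense on all of L2.\<close>

definition kernel_operator ::
  "'p measure \<Rightarrow> 'm measure \<Rightarrow> 'n measure \<Rightarrow> ('n \<Rightarrow> 'm \<Rightarrow> complex) \<Rightarrow> (('p \<times> 'm \<Rightarrow> complex) \<Rightarrow> 'p \<times> 'n \<Rightarrow> complex) \<Rightarrow> bool" where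
  "kernel_operator P M N \<kappa> A \<longleftrightarrow> L2_operator (P \<Otimes>\<^sub>M M) (P \<Otimes>\<^sub>M N) A \<and>
     (\<forall>f \<in> L2 (P \<Otimes>\<^sub>M M). (AE x in P. integrable M (\<lambda>m. f (x, m))) \<longrightarrow>
        (AE z in P \<Otimes>\<^sub>M N. A f z = (\<integral>m. \<kappa> (snd z) m * f (fst z, m) \<partial>M)))"

lemma kernel_operatorD:
  assumes "kernel_operator P M N \<kappa> A"
  shows "L2_operator (P \<Otimes>\<^sub>M M) (P \<Otimes>\<^sub>M N) A"
    and "\<And>f. f \<in> L2 (P \<Otimes>\<^sub>M M) \<Longrightarrow> AE x in P. integrable M (\<lambda>m. f (x, m)) \<Longrightarrow>
        AE z in P \<Otimes>\<^sub>M N. A f z = (\<integral>m. \<kappa> (snd z) m * f (fst z, m) \<partial>M)"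
  using assms by (simp_all add: kernel_operator_def)

lemma kernel_integral_measurable:
  fixes \<kappa> :: "'n \<Rightarrow> 'm \<Rightarrow> complex"
  assumes "sigma_finite_measure M"
    and \<kappa>: "(\<lambda>(n, m). \<kappa> n m) \<in> borel_measurable (N \<Otimes>\<^sub>M M)"
    and [measurable]: "(\<lambda>(z, m). f z m) \<in> borel_measurable (S \<Otimes>\<^sub>M M)" "u \<in> measurable S N"
  shows "(\<lambda>z. \<integral>m. \<kappa> (u z) m * f z m \<partial>M) \<in> borel_measurable S"
proof -
  interpret sigma_finite_measure M by fact
  have "(\<lambda>p. (u (fst p), snd p)) \<in> measurable (S \<Otimes>\<^sub>M M) (N \<Otimes>\<^sub>M M)" by measurable
  from measurable_compose[OF this \<kappa>]
  have k: "(\<lambda>p. \<kappa> (u (fst p)) (snd p)) \<in> borel_measurable (S \<Otimes>\<^sub>M M)" by simp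
  have f: "(\<lambda>p. f (fst p) (snd p)) \<in> borel_measurable (S \<Otimes>\<^sub>M M)"
    using assms(3) by (simp add: split_beta')
  have "(\<lambda>(z, m). \<kappa> (u z) m * f z m) \<in> borel_measurable (S \<Otimes>\<^sub>M M)"
    unfolding split_beta' by (rule borel_measurable_times[OF k f])
  then show ?thesis by (rule borel_measurable_lebesgue_integral)
qed

lemma kernel_operator_fibre:
  fixes U :: "('m \<Rightarrow> complex) \<Rightarrow> 'n \<Rightarrow> complex"
  assumes sf: "sigma_finite_measure P" "sigma_finite_measure M" "sigma_finite_measure N"
    and U: "\<And>f. f \<in> L2 M \<Longrightarrow> integrable M f \<Longrightarrow> AE y in N. U f y = (\<integral>m. \<kappa> y m * f m \<partial>M)"
    and \<kappa> [measurable]: "(\<lambda>(n, m). \<kappa> n m) \<in> borel_measurable (N \<Otimes>\<^sub>M M)"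
    and T: "L2_operator (P \<Otimes>\<^sub>M M) (P \<Otimes>\<^sub>M N) T"
    and fib: "\<And>f. f \<in> L2 (P \<Otimes>\<^sub>M M) \<Longrightarrow> AE x in P. AE y in N. T f (x, y) = U (\<lambda>y. f (x, y)) y"
  shows "kernel_operator P M N \<kappa> T"
  unfolding kernel_operator_def
proof (intro conjI T ballI impI)
  fix f assume f: "f \<in> L2 (P \<Otimes>\<^sub>M M)" and i: "AE x in P. integrable M (\<lambda>m. f (x, m))"
  have [measurable]: "f \<in> borel_measurable (P \<Otimes>\<^sub>M M)" by (rule L2_measurable[OF f])
  show "AE z in P \<Otimes>\<^sub>M N. T f z = (\<integral>m. \<kappa> (snd z) m * f (fst z, m) \<partial>M)"
  proof (rule AE_pair_eqI[OF sf(1,3) L2_measurable[OF L2_operator_L2[OF T f]]])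
    show "(\<lambda>z. \<integral>m. \<kappa> (snd z) m * f (fst z, m) \<partial>M) \<in> borel_measurable (P \<Otimes>\<^sub>M N)"
      by (rule kernel_integral_measurable[OF sf(2) \<kappa>]) measurable
    show "AE x in P. AE y in N. T f (x, y) = (\<integral>m. \<kappa> (snd (x, y)) m * f (fst (x, y), m) \<partial>M)"
      using fib[OF f] AE_L2_slice[OF sf(2) f] i
    proof eventually_elim
      case (elim x)
      from elim(1) U[OF elim(2,3)] show ?case by eventually_elim simp
    qed
  qed
qed

lemma AE_pair_eqI':
  fixes f g :: "_ \<Rightarrow> complex"
  assumes sf: "sigma_finite_measure M" "sigma_finite_measure N"
    and [measurable]: "f \<in> borel_measurable (M \<Otimes>\<^sub>M N)" "g \<in> borel_measurable (M \<Otimes>\<^sub>M N)"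
    and ae: "AE y in N. AE x in M. f (x, y) = g (x, y)"
  shows "AE z in M \<Otimes>\<^sub>M N. f z = g z"
proof (rule AE_pair_eqI[OF sf assms(3,4)])
  interpret pair_sigma_finite M N using sf by (simp add: pair_sigma_finite_def)
  show "AE x in M. AE y in N. f (x, y) = g (x, y)"
    using ae by (subst AE_commute) (auto simp: split_beta')
qed

text \<open>Lets the integral formula survive an extra variable on which nothing acts; joint
  measurability of the integral allows the fibrewise identities to be reassembled.\<close>

lemma kernel_operator_tensor_id:
  assumes sf: "sigma_finite_measure P" "sigma_finite_measure M" "sigma_finite_measure N" "sigma_finite_measure Y"
    and A: "kernel_operator P M N \<kappa> A"
    and \<kappa> [measurable]: "(\<lambda>(n, m). \<kappa> n m) \<in> borel_measurable (N \<Otimes>\<^sub>M M)"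
    and f: "f \<in> L2 ((P \<Otimes>\<^sub>M M) \<Otimes>\<^sub>M Y)"
    and i: "AE y in Y. AE x in P. integrable M (\<lambda>m. f ((x, m), y))"
  shows "AE z in (P \<Otimes>\<^sub>M N) \<Otimes>\<^sub>M Y. L2_tensor (P \<Otimes>\<^sub>M M) Y (P \<Otimes>\<^sub>M N) Y A id f z
      = (\<integral>m. \<kappa> (snd (fst z)) m * f ((fst (fst z), m), snd z) \<partial>M)"
proof -
  have sfPM: "sigma_finite_measure (P \<Otimes>\<^sub>M M)" and sfPN: "sigma_finite_measure (P \<Otimes>\<^sub>M N)"
    using sf by (simp_all add: sigma_finite_pair_measure)
  have [measurable]: "f \<in> borel_measurable ((P \<Otimes>\<^sub>M M) \<Otimes>\<^sub>M Y)" by (rule L2_measurable[OF f])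
  note T = L2_tensor_spec(1)[OF sfPM sf(4) sfPN sf(4) kernel_operatorD(1)[OF A] L2_operator_id]
  have sl: "AE y in Y. (\<lambda>x. f (x, y)) \<in> L2 (P \<Otimes>\<^sub>M M)"
    using AE_L2_slice[OF sfPM L2_operator_L2[OF L2_unitaryD(1)[OF L2_unitary_swap[OF sfPM sf(4)]] f]] by simp
  show ?thesis
  proof (rule AE_pair_eqI'[OF sfPN sf(4) L2_measurable[OF L2_operator_L2[OF T f]]])
    show "(\<lambda>z. \<integral>m. \<kappa> (snd (fst z)) m * f ((fst (fst z), m), snd z) \<partial>M) \<in> borel_measurable ((P \<Otimes>\<^sub>M N) \<Otimes>\<^sub>M Y)"
      by (rule kernel_integral_measurable[OF sf(2) \<kappa>]) measurable
    show "AE y in Y. AE x in P \<Otimes>\<^sub>M N. L2_tensor (P \<Otimes>\<^sub>M M) Y (P \<Otimes>\<^sub>M N) Y A id f (x, y)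
        = (\<integral>m. \<kappa> (snd (fst (x, y))) m * f ((fst (fst (x, y)), m), snd (x, y)) \<partial>M)"
      using L2_tensor_fibre_id[OF sfPM sf(4) sfPN kernel_operatorD(1)[OF A] f] sl i
    proof eventually_elim
      case (elim y)
      from elim(1) kernel_operatorD(2)[OF A elim(2,3)] show ?case by eventually_elim simp
    qed
  qed
qed

lemma kernel_operator_id_tensor:
  assumes sf: "sigma_finite_measure P" "sigma_finite_measure M" "sigma_finite_measure N" "sigma_finite_measure Y"
    and A: "kernel_operator P M N \<kappa> A"
    and \<kappa> [measurable]: "(\<lambda>(n, m). \<kappa> n m) \<in> borel_measurable (N \<Otimes>\<^sub>M M)"
    and f: "f \<in> L2 (Y \<Otimes>\<^sub>M (P \<Otimes>\<^sub>M M))"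
    and i: "AE y in Y. AE x in P. integrable M (\<lambda>m. f (y, (x, m)))"
  shows "AE z in Y \<Otimes>\<^sub>M (P \<Otimes>\<^sub>M N). L2_tensor Y (P \<Otimes>\<^sub>M M) Y (P \<Otimes>\<^sub>M N) id A f z
      = (\<integral>m. \<kappa> (snd (snd z)) m * f (fst z, (fst (snd z), m)) \<partial>M)"
proof -
  have sfPM: "sigma_finite_measure (P \<Otimes>\<^sub>M M)" and sfPN: "sigma_finite_measure (P \<Otimes>\<^sub>M N)"
    using sf by (simp_all add: sigma_finite_pair_measure)
  have [measurable]: "f \<in> borel_measurable (Y \<Otimes>\<^sub>M (P \<Otimes>\<^sub>M M))" by (rule L2_measurable[OF f])
  note T = L2_tensor_spec(1)[OF sf(4) sfPM sf(4) sfPN L2_operator_id kernel_operatorD(1)[OF A]]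
  show ?thesis
  proof (rule AE_pair_eqI[OF sf(4) sfPN L2_measurable[OF L2_operator_L2[OF T f]]])
    show "(\<lambda>z. \<integral>m. \<kappa> (snd (snd z)) m * f (fst z, (fst (snd z), m)) \<partial>M) \<in> borel_measurable (Y \<Otimes>\<^sub>M (P \<Otimes>\<^sub>M N))"
      by (rule kernel_integral_measurable[OF sf(2) \<kappa>]) measurable
    show "AE y in Y. AE x in P \<Otimes>\<^sub>M N. L2_tensor Y (P \<Otimes>\<^sub>M M) Y (P \<Otimes>\<^sub>M N) id A f (y, x)
        = (\<integral>m. \<kappa> (snd (snd (y, x))) m * f (fst (y, x), (fst (snd (y, x)), m)) \<partial>M)"
      using L2_tensor_id_fibre[OF sf(4) sfPM sfPN kernel_operatorD(1)[OF A] f] AE_L2_slice[OF sfPM f] i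
    proof eventually_elim
      case (elim y)
      from elim(1) kernel_operatorD(2)[OF A elim(2,3)] show ?case by eventually_elim simp
    qed
  qed
qed

lemma integrable_indicator_L2:
  assumes "A \<in> sets M" "emeasure M A < \<infinity>"
  shows "integrable M (indicator A :: 'a \<Rightarrow> complex)"
proof -
  have "integrable M (\<lambda>x. complex_of_real (indicator A x))"
    by (intro integrable_of_real integrable_real_indicator assms)
  also have "(\<lambda>x. complex_of_real (indicator A x)) = indicator A"
    by (auto simp: indicator_def fun_eq_iff)
  finally show ?thesis .
qed

section \<open>Partial Fourier transforms\<close>

context extension_data
begin

definition FV :: "('v \<Rightarrow> complex) \<Rightarrow> 'v pdual \<Rightarrow> complex" where
  "FV = (SOME U. L2_unitary muV muX U \<and>
     (\<forall>f \<in> L2 muV. integrable muV f \<longrightarrow> (AE \<xi> in muX. U f \<xi> = fourier_integral muV f \<xi>)))"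

lemma FV_spec: "L2_unitary muV muX FV \<and>
     (\<forall>f \<in> L2 muV. integrable muV f \<longrightarrow> (AE \<xi> in muX. FV f \<xi> = fourier_integral muV f \<xi>))"
  unfolding FV_def by (rule someI_ex[OF fourier[unfolded fourier_unitary_def]])

lemma FV_unitary: "L2_unitary muV muX FV"
  using FV_spec by (rule conjunct1)

lemma FV_integral: "f \<in> L2 muV \<Longrightarrow> integrable muV f \<Longrightarrow> AE \<xi> in muX. FV f \<xi> = (\<integral>v. cnj (pairing \<xi> v) * f v \<partial>muV)"
  using FV_spec unfolding fourier_integral_def by blast

abbreviation "FVi \<equiv> L2_adjoint muV muX FV"

text \<open>Fourier inversion from unitarity alone: pairing with integrable square-integrable
  \<open>f\<close> and exchanging integrals shows that \<open>FVi F\<close> and the inverse integral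
  \<open>k\<close> have the same inner products with \<open>f\<close>.\<close>

lemma FVi_integral:
  assumes F: "F \<in> L2 muX" "integrable muX F"
  shows "AE v in muV. FVi F v = (\<integral>\<xi>. pairing \<xi> v * F \<xi> \<partial>muX)"
proof -
  interpret V: sigma_finite_measure muV by (rule sigma_finite_muV)
  interpret X: sigma_finite_measure muX by (rule sigma_finite_muX)
  interpret VX: pair_sigma_finite muV muX ..
  interpret XV: pair_sigma_finite muX muV ..
  note adj = L2_adjoint_unitary[OF FV_unitary] and U = L2_unitaryD(1)[OF FV_unitary]
  have FiF: "FVi F \<in> L2 muV" by (rule L2_operator_L2[OF adj(1) F(1)])
  have [measurable]: "F \<in> borel_measurable muX" "FVi F \<in> borel_measurable muV"
    by (rule L2_measurable[OF F(1)], rule L2_measurable[OF FiF])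
  define k where "k v = (\<integral>\<xi>. pairing \<xi> v * F \<xi> \<partial>muX)" for v
  have km [measurable]: "k \<in> borel_measurable muV" unfolding k_def[abs_def] by measurable
  define h where "h v = FVi F v - k v" for v
  have [measurable]: "h \<in> borel_measurable muV" unfolding h_def[abs_def] by measurable
  have inner: "L2_inner muV f (FVi F) = (\<integral>v. f v * cnj (k v) \<partial>muV)"
    if f: "f \<in> L2 muV" "integrable muV f" for f
  proof -
    have [measurable]: "f \<in> borel_measurable muV" by (rule L2_measurable[OF f(1)])
    have Uf: "FV f \<in> L2 muX" by (rule L2_operator_L2[OF U f(1)])
    have [measurable]: "FV f \<in> borel_measurable muX" by (rule L2_measurable[OF Uf])
    have int: "integrable (muX \<Otimes>\<^sub>M muV) (\<lambda>(\<xi>, v). cnj (pairing \<xi> v) * f v * cnj (F \<xi>))"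
    proof (rule integrableI_bounded)
      have "(\<integral>\<^sup>+z. ennreal (norm ((\<lambda>(\<xi>, v). cnj (pairing \<xi> v) * f v * cnj (F \<xi>)) z)) \<partial>(muX \<Otimes>\<^sub>M muV))
          = (\<integral>\<^sup>+\<xi>. \<integral>\<^sup>+v. ennreal (norm (f v)) * ennreal (norm (F \<xi>)) \<partial>muV \<partial>muX)"
        by (subst V.nn_integral_fst[symmetric]) (auto simp: norm_mult ennreal_mult)
      also have "\<dots> = (\<integral>\<^sup>+v. ennreal (norm (f v)) \<partial>muV) * (\<integral>\<^sup>+\<xi>. ennreal (norm (F \<xi>)) \<partial>muX)"
        by (simp add: nn_integral_multc nn_integral_cmult)
      also have "\<dots> < \<infinity>" using f(2) F(2) by (simp add: integrable_iff_bounded ennreal_mult_less_top)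
      finally show "(\<integral>\<^sup>+z. ennreal (norm ((\<lambda>(\<xi>, v). cnj (pairing \<xi> v) * f v * cnj (F \<xi>)) z)) \<partial>(muX \<Otimes>\<^sub>M muV)) < \<infinity>" .
    qed measurable
    have "L2_inner muV f (FVi F) = L2_inner muX (FV f) (FV (FVi F))"
      by (rule L2_unitary_inner[OF FV_unitary f(1) FiF, symmetric])
    also have "\<dots> = L2_inner muX (FV f) F"
      by (rule L2_inner_cong[OF Uf L2_operator_L2[OF U FiF] F(1) adj(2)[OF F(1)]])
    also have "\<dots> = (\<integral>\<xi>. (\<integral>v. cnj (pairing \<xi> v) * f v \<partial>muV) * cnj (F \<xi>) \<partial>muX)"
      unfolding L2_inner_def
      by (rule integral_cong_AE) (use FV_integral[OF f] in \<open>measurable, eventually_elim, simp\<close>)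
    also have "\<dots> = (\<integral>\<xi>. \<integral>v. cnj (pairing \<xi> v) * f v * cnj (F \<xi>) \<partial>muV \<partial>muX)"
      by simp
    also have "\<dots> = (\<integral>v. \<integral>\<xi>. cnj (pairing \<xi> v) * f v * cnj (F \<xi>) \<partial>muX \<partial>muV)"
      by (rule XV.Fubini_integral[symmetric]) (rule int)
    also have "\<dots> = (\<integral>v. f v * cnj (k v) \<partial>muV)"
    proof (rule Bochner_Integration.integral_cong[OF refl])
      fix v
      have "(\<integral>\<xi>. cnj (pairing \<xi> v) * f v * cnj (F \<xi>) \<partial>muX) = (\<integral>\<xi>. f v * cnj (pairing \<xi> v * F \<xi>) \<partial>muX)"
        by (simp add: mult_ac)
      also have "\<dots> = f v * cnj (k v)" unfolding k_def by (simp only: integral_mult_right_zero Bochner_Integration.integral_cnj)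
      finally show "(\<integral>\<xi>. cnj (pairing \<xi> v) * f v * cnj (F \<xi>) \<partial>muX) = f v * cnj (k v)" .
    qed
    finally show ?thesis .
  qed
  obtain E :: "nat \<Rightarrow> 'v set" where E: "range E \<subseteq> sets muV" "(\<Union>i. E i) = space muV" "\<And>i. emeasure muV (E i) \<noteq> \<infinity>"
    using V.sigma_finite by blast
  have Em [measurable]: "E i \<in> sets muV" for i using E(1) by blast
  have kb: "cmod (k v) \<le> (\<integral>\<xi>. norm (F \<xi>) \<partial>muX)" for v
  proof -
    have "cmod (k v) \<le> (\<integral>\<xi>. norm (pairing \<xi> v * F \<xi>) \<partial>muX)" unfolding k_def by (rule integral_norm_bound)
    then show ?thesis by (simp add: norm_mult)
  qed
  have zero: "AE v in muV. v \<in> E i \<longrightarrow> cmod (h v) \<le> real n \<longrightarrow> h v = 0" for i n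
  proof -
    \<comment> \<open>\<open>k\<close> is bounded but not known to be square-integrable, so the
      difference \<open>h\<close> is tested against its own truncation to a set of finite measure on
      which it is bounded.\<close>
    define S where "S = {v \<in> space muV. v \<in> E i \<and> cmod (h v) \<le> real n}"
    have [measurable]: "S \<in> sets muV" unfolding S_def by measurable
    have Sfin: "emeasure muV S < \<infinity>"
    proof -
      have "emeasure muV S \<le> emeasure muV (E i)" by (rule emeasure_mono[OF _ Em]) (auto simp: S_def)
      with E(3)[of i] show ?thesis by (auto simp: less_top[symmetric] top_unique)
    qed
    define f where "f v = h v * indicator S v" for v
    have S2: "(indicator S :: 'v \<Rightarrow> complex) \<in> L2 muV" by (rule L2_indicator[OF _ Sfin]) measurable
    have fb: "cmod (f v) \<le> real n * indicator S v" for v by (auto simp: f_def S_def indicator_def norm_mult)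
    have [measurable]: "f \<in> borel_measurable muV" unfolding f_def[abs_def] by measurable
    have f1: "integrable muV f"
    proof (rule Bochner_Integration.integrable_bound)
      show "integrable muV (\<lambda>v. real n * indicator S v)"
        by (intro integrable_mult_right integrable_real_indicator Sfin) measurable
      show "AE v in muV. norm (f v) \<le> norm (real n * indicator S v)" 
        by (intro AE_I2 order_trans[OF fb]) simp
    qed measurable
    have f2: "f \<in> L2 muV"
    proof -
      have "f = (\<lambda>v. f v * indicator S v)" by (auto simp: f_def indicator_def fun_eq_iff)
      also have "\<dots> \<in> L2 muV" by (rule L2_bounded_mult[OF S2, of _ "real n"])
          (use order_trans[OF fb] in \<open>auto simp: indicator_def\<close>)
      finally show ?thesis .
    qed
    have i1: "integrable muV (\<lambda>v. f v * cnj (FVi F v))" by (rule integrable_L2_inner[OF f2 FiF])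
    have i2: "integrable muV (\<lambda>v. f v * cnj (k v))"
    proof (rule Bochner_Integration.integrable_bound)
      show "integrable muV (\<lambda>v. norm (f v) * (\<integral>\<xi>. norm (F \<xi>) \<partial>muX))" using f1 by simp
      show "AE v in muV. norm (f v * cnj (k v)) \<le> norm (norm (f v) * (\<integral>\<xi>. norm (F \<xi>) \<partial>muX))"
      proof (rule AE_I2)
        fix v
        have "cmod (f v) * cmod (k v) \<le> cmod (f v) * (\<integral>\<xi>. norm (F \<xi>) \<partial>muX)"
          by (rule mult_left_mono[OF kb]) simp
        then show "norm (f v * cnj (k v)) \<le> norm (norm (f v) * (\<integral>\<xi>. norm (F \<xi>) \<partial>muX))"
          unfolding norm_mult complex_mod_cnj real_norm_def abs_mult abs_norm_cancel
          by (rule order_trans[OF _ mult_left_mono[OF abs_ge_self]]) simp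
      qed
    qed measurable
    have "L2_inner muV f f = (\<integral>v. f v * cnj (FVi F v) - f v * cnj (k v) \<partial>muV)"
      unfolding L2_inner_def
      by (rule Bochner_Integration.integral_cong) (auto simp: f_def h_def indicator_def algebra_simps)
    also have "\<dots> = 0" using inner[OF f2 f1] i1 i2 by (simp add: L2_inner_def)
    finally have "AE v in muV. f v = 0" by (rule L2_inner_self_zero[OF f2])
    with AE_space show ?thesis by eventually_elim (auto simp: f_def S_def indicator_def)
  qed
  have "AE v in muV. \<forall>i n. v \<in> E i \<longrightarrow> cmod (h v) \<le> real n \<longrightarrow> h v = 0"
    by (intro AE_all_countable[THEN iffD2] allI zero)
  with AE_space show ?thesis
  proof eventually_elim
    case (elim v)
    then obtain i where "v \<in> E i" using E(2) by blast
    moreover obtain n where "cmod (h v) \<le> real n" using real_arch_simple by blast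
    ultimately have "h v = 0" using elim(2) by blast
    then show ?case by (simp add: h_def k_def)
  qed
qed

end

text \<open>The scaling law for nonnegative functions identifies the image measure with
  \<open>c\<close> times \<open>N\<close>, which carries the law over to complex integrals.\<close>

lemma scaled_integral:
  fixes f :: "'b \<Rightarrow> complex"
  assumes T [measurable]: "T \<in> measurable M N" and c: "0 \<le> c"
    and scale: "\<And>h :: 'b \<Rightarrow> ennreal. h \<in> borel_measurable N \<Longrightarrow> (\<integral>\<^sup>+x. h (T x) \<partial>M) = ennreal c * (\<integral>\<^sup>+y. h y \<partial>N)"
    and f: "integrable N f"
  shows "integrable M (\<lambda>x. f (T x))" "(\<integral>x. f (T x) \<partial>M) = complex_of_real c * (\<integral>y. f y \<partial>N)"
proof -
  have [measurable]: "f \<in> borel_measurable N" using f by (rule borel_measurable_integrable)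
  have eq: "distr M N T = density N (\<lambda>_. ennreal c)"
  proof (rule measure_eqI)
    fix A assume "A \<in> sets (distr M N T)"
    then have [measurable]: "A \<in> sets N" by simp
    have "emeasure (distr M N T) A = (\<integral>\<^sup>+x. indicator A x \<partial>distr M N T)" by simp
    also have "\<dots> = (\<integral>\<^sup>+x. indicator A (T x) \<partial>M)" by (rule nn_integral_distr) measurable
    also have "\<dots> = ennreal c * (\<integral>\<^sup>+y. indicator A y \<partial>N)" by (rule scale) measurable
    also have "\<dots> = emeasure (density N (\<lambda>_. ennreal c)) A" by (simp add: emeasure_density nn_integral_cmult)
    finally show "emeasure (distr M N T) A = emeasure (density N (\<lambda>_. ennreal c)) A" .
  qed simp
  have "integrable (density N (\<lambda>_. ennreal c)) f"
    using f c by (subst integrable_density) auto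
  then have i: "integrable (distr M N T) f" by (simp add: eq)
  then show "integrable M (\<lambda>x. f (T x))" by (subst (asm) integrable_distr_eq) measurable
  have "(\<integral>x. f (T x) \<partial>M) = (\<integral>y. f y \<partial>distr M N T)" by (rule integral_distr[symmetric]) measurable
  also have "\<dots> = (\<integral>y. c *\<^sub>R f y \<partial>N)"
    unfolding eq using c by (intro integral_density) auto
  also have "\<dots> = complex_of_real c * (\<integral>y. f y \<partial>N)" by (simp add: scaleR_conv_of_real)
  finally show "(\<integral>x. f (T x) \<partial>M) = complex_of_real c * (\<integral>y. f y \<partial>N)" .
qed

lemma powr_minus_half: "0 \<le> x \<Longrightarrow> x powr - (1 / 2) = inverse (sqrt x)"
  by (simp add: powr_minus powr_half_sqrt)

lemma ennreal_mult_mult: "0 \<le> a \<Longrightarrow> 0 \<le> b \<Longrightarrow> ennreal a * (ennreal b * x) = ennreal (a * b) * x"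
  by (simp add: ennreal_mult mult.assoc)

section \<open>Measures of the extension and of its Fourier side; the partial Fourier
  transform\<close>

context extension_data
begin

abbreviation "G \<equiv> haar_G muQ muV act"
abbreviation "X \<equiv> dual_side muQ muV muX act"
abbreviation "HS \<equiv> muQ \<Otimes>\<^sub>M muQ"
abbreviation "F \<equiv> partial_fourier muQ muV muX act"
abbreviation "F' \<equiv> L2_adjoint G X F"

lemma G_def: "G = Qw \<Otimes>\<^sub>M muV" and X_def: "X = Qw \<Otimes>\<^sub>M muX"
  by (simp_all add: haar_G_def dual_side_def)

lemma sets_G [measurable_cong]: "sets G = sets (borel \<Otimes>\<^sub>M borel)"
  and sets_X [measurable_cong]: "sets X = sets (borel \<Otimes>\<^sub>M borel)"
  unfolding G_def X_def by (rule sets_pair_measure_cong; simp)+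

lemma sigma_finite_G: "sigma_finite_measure G"
  and sigma_finite_X: "sigma_finite_measure X"
  and sigma_finite_HS: "sigma_finite_measure HS"
  unfolding G_def X_def
  by (intro sigma_finite_pair_measure sigma_finite_Qw sigma_finite_muV sigma_finite_muX sigma_finite_muQ)+

lemmas sf = sigma_finite_muQ sigma_finite_muV sigma_finite_muX sigma_finite_Qw
  sigma_finite_G sigma_finite_X sigma_finite_HS

lemma nn_integral_G:
  assumes [measurable]: "h \<in> borel_measurable (borel \<Otimes>\<^sub>M borel)"
  shows "(\<integral>\<^sup>+z. h z \<partial>G) = (\<integral>\<^sup>+q. ennreal (inverse (md q)) * (\<integral>\<^sup>+v. h (q, v) \<partial>muV) \<partial>muQ)"
proof -
  interpret V: sigma_finite_measure muV by (rule sf)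
  have "(\<integral>\<^sup>+z. h z \<partial>G) = (\<integral>\<^sup>+q. \<integral>\<^sup>+v. h (q, v) \<partial>muV \<partial>Qw)"
    unfolding G_def by (rule V.nn_integral_fst[symmetric]) measurable
  also have "\<dots> = (\<integral>\<^sup>+q. ennreal (inverse (md q)) * (\<integral>\<^sup>+v. h (q, v) \<partial>muV) \<partial>muQ)"
    by (rule nn_integral_Qw) measurable
  finally show ?thesis .
qed

lemma nn_integral_X:
  assumes [measurable]: "h \<in> borel_measurable (borel \<Otimes>\<^sub>M borel)"
  shows "(\<integral>\<^sup>+z. h z \<partial>X) = (\<integral>\<^sup>+q. ennreal (inverse (md q)) * (\<integral>\<^sup>+\<xi>. h (q, \<xi>) \<partial>muX) \<partial>muQ)"
proof -
  interpret X: sigma_finite_measure muX by (rule sf)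
  have "(\<integral>\<^sup>+z. h z \<partial>X) = (\<integral>\<^sup>+q. \<integral>\<^sup>+\<xi>. h (q, \<xi>) \<partial>muX \<partial>Qw)"
    unfolding X_def by (rule X.nn_integral_fst[symmetric]) measurable
  also have "\<dots> = (\<integral>\<^sup>+q. ennreal (inverse (md q)) * (\<integral>\<^sup>+\<xi>. h (q, \<xi>) \<partial>muX) \<partial>muQ)"
    by (rule nn_integral_Qw) measurable
  finally show ?thesis .
qed

lemma nn_integral_HS:
  assumes [measurable]: "h \<in> borel_measurable (borel \<Otimes>\<^sub>M borel)"
  shows "(\<integral>\<^sup>+z. h z \<partial>HS) = (\<integral>\<^sup>+p. \<integral>\<^sup>+q. h (p, q) \<partial>muQ \<partial>muQ)"
proof -
  interpret Q: sigma_finite_measure muQ by (rule sf)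
  show ?thesis by (rule Q.nn_integral_fst[symmetric]) measurable
qed

lemma kernel_measurable:
  "(\<lambda>(\<xi>, v). cnj (pairing \<xi> v)) \<in> borel_measurable (muX \<Otimes>\<^sub>M muV)"
  "(\<lambda>(v, \<xi>). pairing \<xi> v) \<in> borel_measurable (muV \<Otimes>\<^sub>M muX)"
  by measurable

text \<open>The choice in \<open>partial_fourier\<close> is pinned down on integrable functions
  only. The fibrewise operator of \<open>FV\<close> satisfies the same condition, so the two agree
  on rectangles and hence everywhere; unitarity and the kernel formula are read off from it.\<close>

lemma F_fibre:
  "L2_unitary G X F"
  "kernel_operator Qw muV muX (\<lambda>\<xi> v. cnj (pairing \<xi> v)) F"
  "\<And>f. f \<in> L2 G \<Longrightarrow> AE q in Qw. AE \<xi> in muX. F f (q, \<xi>) = FV (\<lambda>v. f (q, v)) \<xi>"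
proof -
  obtain T where T: "L2_operator G X T"
    "\<And>f. f \<in> L2 G \<Longrightarrow> AE q in Qw. AE \<xi> in muX. T f (q, \<xi>) = FV (\<lambda>v. f (q, v)) \<xi>"
    using fibre_operator[OF sf(4,2,3) L2_unitaryD(1)[OF FV_unitary]] unfolding G_def X_def by blast
  note T' = T[unfolded G_def X_def]
  have Tk: "kernel_operator Qw muV muX (\<lambda>\<xi> v. cnj (pairing \<xi> v)) T"
    by (rule kernel_operator_fibre[OF sf(4,2,3) FV_integral kernel_measurable(1) T'])
  define spec where "spec F \<longleftrightarrow> L2_operator G X F \<and>
     (\<forall>f \<in> L2 G. integrable G f \<longrightarrow> (AE (q, \<xi>) in X. F f (q, \<xi>) = fourier_integral muV (\<lambda>v. f (q, v)) \<xi>))" for F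
  interpret VV: pair_sigma_finite Qw muV using sf by (simp add: pair_sigma_finite_def)
  have "spec T"
    unfolding spec_def
  proof (intro conjI T(1) ballI impI)
    fix f assume f: "f \<in> L2 G" "integrable G f"
    have "AE q in Qw. integrable muV (\<lambda>v. f (q, v))"
      using f(2) unfolding G_def by (rule VV.AE_integrable_fst')
    from kernel_operatorD(2)[OF Tk _ this] f(1)
    show "AE (q, \<xi>) in X. T f (q, \<xi>) = fourier_integral muV (\<lambda>v. f (q, v)) \<xi>"
      unfolding G_def X_def by (simp add: fourier_integral_def split_beta')
  qed
  have specF: "spec F"
  proof -
    have "F = (SOME F. spec F)" unfolding partial_fourier_def spec_def ..
    with someI[of spec, OF \<open>spec T\<close>] show ?thesis by simp
  qed
  then have Fo: "L2_operator G X F" unfolding spec_def by blast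
  have eq: "AE z in X. F f z = T f z" if f: "f \<in> L2 G" for f
  proof (rule L2_operators_eq_pair[OF sf(4,2) Fo[unfolded G_def] T(1)[unfolded G_def] _ f[unfolded G_def]])
    fix A B assume AB: "A \<in> sets Qw" "emeasure Qw A < \<infinity>" "B \<in> sets muV" "emeasure muV B < \<infinity>"
    let ?f = "tensor_fun (indicator A) (indicator B) :: _ \<Rightarrow> complex"
    have "?f = indicator (A \<times> B)" by (auto simp: tensor_fun_def indicator_def fun_eq_iff)
    moreover have "A \<times> B \<in> sets G" "emeasure G (A \<times> B) < \<infinity>"
      using AB by (auto simp: G_def VV.M2.emeasure_pair_measure_Times ennreal_mult_less_top)
    ultimately have f: "?f \<in> L2 G" "integrable G ?f"
      by (simp_all add: L2_indicator integrable_indicator_L2)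
    have "AE (q, \<xi>) in X. F ?f (q, \<xi>) = fourier_integral muV (\<lambda>v. ?f (q, v)) \<xi>"
      "AE (q, \<xi>) in X. T ?f (q, \<xi>) = fourier_integral muV (\<lambda>v. ?f (q, v)) \<xi>"
      using specF \<open>spec T\<close> f unfolding spec_def by blast+
    then show "AE z in X. F ?f z = T ?f z" by eventually_elim auto
  qed
  have "L2_unitary G X T"
    using fibre_unitary[OF sf(4,2,3) FV_unitary T'] by (simp add: G_def X_def)
  then show U: "L2_unitary G X F" by (rule L2_unitary_cong[OF _ Fo eq])
  show "kernel_operator Qw muV muX (\<lambda>\<xi> v. cnj (pairing \<xi> v)) F"
    unfolding kernel_operator_def
  proof (intro conjI ballI impI)
    show "L2_operator (Qw \<Otimes>\<^sub>M muV) (Qw \<Otimes>\<^sub>M muX) F" using Fo by (simp add: G_def X_def)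
    fix f assume f: "f \<in> L2 (Qw \<Otimes>\<^sub>M muV)" "AE q in Qw. integrable muV (\<lambda>v. f (q, v))"
    from kernel_operatorD(2)[OF Tk f] eq[unfolded G_def X_def, OF f(1)]
    show "AE z in Qw \<Otimes>\<^sub>M muX. F f z = (\<integral>v. cnj (pairing (snd z) v) * f (fst z, v) \<partial>muV)"
      by eventually_elim simp
  qed
  show "AE q in Qw. AE \<xi> in muX. F f (q, \<xi>) = FV (\<lambda>v. f (q, v)) \<xi>" if f: "f \<in> L2 G" for f
    using AE_pair_eqD(1)[OF sf(4,3) eq[unfolded X_def, OF f]] T(2)[OF f]
  proof eventually_elim
    case (elim q) then show ?case by eventually_elim simp
  qed
qed

lemmas F_unitary = F_fibre(1) and F_kernel = F_fibre(2)

text \<open>The adjoint of a unitary is its inverse, and in each fibre that inverse is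
  \<open>FVi\<close>, for which \<open>FVi_integral\<close> supplies the kernel.\<close>

lemma F'_kernel: "kernel_operator Qw muX muV (\<lambda>v \<xi>. pairing \<xi> v) F'"
proof -
  note FVi = L2_adjoint_unitary[OF FV_unitary]
  obtain T where T: "L2_operator X G T"
    "\<And>f. f \<in> L2 X \<Longrightarrow> AE q in Qw. AE v in muV. T f (q, v) = FVi (\<lambda>\<xi>. f (q, \<xi>)) v"
    using fibre_operator[OF sf(4,3,2) FVi(1)] unfolding G_def X_def by blast
  note T' = T[unfolded G_def X_def]
  have Tk: "kernel_operator Qw muX muV (\<lambda>v \<xi>. pairing \<xi> v) T"
    by (rule kernel_operator_fibre[OF sf(4,3,2) FVi_integral kernel_measurable(2) T'])
  have eq: "AE z in G. F' f z = T f z" if f: "f \<in> L2 X" for f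
  proof (rule L2_adjoint_eqI[OF F_unitary _ f])
    show Tf: "T f \<in> L2 G" by (rule L2_operator_L2[OF T(1) f])
    show "AE z in X. F (T f) z = f z"
      unfolding X_def
    proof (rule AE_pair_eqI[OF sf(4,3)])
      show "F (T f) \<in> borel_measurable (Qw \<Otimes>\<^sub>M muX)"
        using L2_measurable[OF L2_operator_L2[OF L2_unitaryD(1)[OF F_unitary] Tf]] by (simp add: X_def)
      show "f \<in> borel_measurable (Qw \<Otimes>\<^sub>M muX)" using L2_measurable[OF f] by (simp add: X_def)
      show "AE q in Qw. AE \<xi> in muX. F (T f) (q, \<xi>) = f (q, \<xi>)"
        using F_fibre(3)[OF Tf] T(2)[OF f] AE_L2_slice[OF sf(2) Tf[unfolded G_def]] AE_L2_slice[OF sf(3) f[unfolded X_def]]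
      proof eventually_elim
        case (elim q)
        from elim(1) L2_operator_cong[OF L2_unitaryD(1)[OF FV_unitary] elim(3) L2_operator_L2[OF FVi(1) elim(4)] elim(2)]
          FVi(2)[OF elim(4)]
        show ?case by eventually_elim simp
      qed
    qed
  qed
  show ?thesis
    unfolding kernel_operator_def
  proof (intro conjI ballI impI)
    show "L2_operator (Qw \<Otimes>\<^sub>M muX) (Qw \<Otimes>\<^sub>M muV) F'"
      using L2_adjoint_unitary(1)[OF F_unitary] by (simp add: G_def X_def)
    fix f assume f: "f \<in> L2 (Qw \<Otimes>\<^sub>M muX)" "AE q in Qw. integrable muX (\<lambda>\<xi>. f (q, \<xi>))"
    from kernel_operatorD(2)[OF Tk f] eq[unfolded G_def X_def, OF f(1)]
    show "AE z in Qw \<Otimes>\<^sub>M muV. L2_adjoint G X F f z = (\<integral>\<xi>. pairing \<xi> (snd z) * f (fst z, \<xi>) \<partial>muX)"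
      by eventually_elim (simp add: G_def X_def)
  qed
qed

section \<open>Inversion in the extension, before and after Fourier transform\<close>

lemma ext_inv_eq: "ext_inv act \<beta> (q, v) = (- q, - act (- q) (v + \<beta> q (- q)))"
  unfolding ext_inv_def
proof (rule the_equality)
  \<comment> \<open>The cocycle identity at (-q, q, -q); normalization removes the two terms with
    argument 0.\<close>
  have "\<beta> (- q) q = act (- q) (\<beta> q (- q))"
    using beta_cocycle[of "- q" q "- q"] by simp
  then show "ext_mult act \<beta> (q, v) (- q, - act (- q) (v + \<beta> q (- q))) = (0, 0) \<and>
      ext_mult act \<beta> (- q, - act (- q) (v + \<beta> q (- q))) (q, v) = (0, 0)"
    by (simp add: ext_mult_def act_uminus act_add act_diff)
next
  fix h assume h: "ext_mult act \<beta> (q, v) h = (0, 0) \<and> ext_mult act \<beta> h (q, v) = (0, 0)"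
  obtain p w where pw: "h = (p, w)" by force
  have p: "p = - q" using h by (simp add: pw ext_mult_def eq_neg_iff_add_eq_0)
  have "v + act q w + \<beta> q (- q) = 0" using h by (simp add: pw p ext_mult_def)
  then have "act q w = - (v + \<beta> q (- q))" by (simp add: eq_neg_iff_add_eq_0 algebra_simps)
  then have "act (- q) (act q w) = - act (- q) (v + \<beta> q (- q))" by (simp only: act_uminus)
  then show "h = (- q, - act (- q) (v + \<beta> q (- q)))" by (simp add: pw p)
qed

definition mJ :: "'q \<times> 'v \<Rightarrow> complex" where
  "mJ g = of_real (inverse (sqrt (\<Delta> (fst g) / md (fst g))))"

definition \<phi>J :: "'q \<times> 'v \<Rightarrow> 'q \<times> 'v" where
  "\<phi>J g = (- fst g, - act (- fst g) (snd g + \<beta> (fst g) (- fst g)))"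

lemma J_op_eq: "J_op muQ muV act \<beta> = pullback mJ \<phi>J"
  by (auto simp: fun_eq_iff J_op_def pullback_def mJ_def \<phi>J_def ext_inv_eq modular_G_def powr_minus_half)

lemma nn_integral_V_affine:
  assumes [measurable]: "h \<in> borel_measurable borel"
  shows "(\<integral>\<^sup>+v. h (- act (- q) (v + x)) \<partial>muV) = ennreal (md q) * (\<integral>\<^sup>+v. h v \<partial>muV)"
proof -
  have "(\<integral>\<^sup>+v. h (- act (- q) (v + x)) \<partial>muV) = (\<integral>\<^sup>+v. h (- act (- q) v) \<partial>muV)"
    using V.nn_integral_left[of "\<lambda>v. h (- act (- q) v)" x] by (simp add: add.commute)
  also have "\<dots> = ennreal (inverse (md (- q))) * (\<integral>\<^sup>+v. h (- v) \<partial>muV)"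
    by (rule nn_integral_act[where f = "\<lambda>v. h (- v)"]) measurable
  also have "\<dots> = ennreal (md q) * (\<integral>\<^sup>+v. h v \<partial>muV)"
    by (simp add: md_minus nn_integral_V_minus)
  finally show ?thesis .
qed

text \<open>The affine substitution in \<open>V\<close> produces \<open>md q\<close>. With the
  weight of \<open>Qw\<close> and the squared modulus \<open>md q / \<Delta> q\<close> of
  \<open>mJ\<close> this leaves \<open>md q / \<Delta> q\<close>, which inversion in
  \<open>Q\<close> turns back into the weight \<open>inverse (md q)\<close>.\<close>

lemma L2_pullback_J: "L2_pullback G G mJ \<phi>J"
  unfolding L2_pullback_def
proof (intro conjI ballI)
  show "\<phi>J \<in> measurable G G" unfolding \<phi>J_def[abs_def] by measurable
  show "mJ \<in> borel_measurable G" unfolding mJ_def[abs_def] by measurable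
  have [measurable]: "\<phi>J \<in> borel \<Otimes>\<^sub>M borel \<rightarrow>\<^sub>M borel \<Otimes>\<^sub>M borel"
    "mJ \<in> borel_measurable (borel \<Otimes>\<^sub>M borel)"
    unfolding \<phi>J_def[abs_def] mJ_def[abs_def] by measurable
  fix h :: "_ \<Rightarrow> ennreal" assume "h \<in> borel_measurable G"
  then have h [measurable]: "h \<in> borel_measurable (borel \<Otimes>\<^sub>M borel)" by measurable
  interpret V: sigma_finite_measure muV by (rule sf)
  define H where "H p = (\<integral>\<^sup>+v. h (p, v) \<partial>muV)" for p
  have [measurable]: "H \<in> borel_measurable borel" unfolding H_def[abs_def] by measurable
  have "(\<integral>\<^sup>+g. ennreal ((cmod (mJ g))\<^sup>2) * h (\<phi>J g) \<partial>G)
      = (\<integral>\<^sup>+q. ennreal (inverse (md q)) * (\<integral>\<^sup>+v. ennreal ((cmod (mJ (q, v)))\<^sup>2) * h (\<phi>J (q, v)) \<partial>muV) \<partial>muQ)"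
    by (rule nn_integral_G) measurable
  also have "\<dots> = (\<integral>\<^sup>+q. ennreal (inverse (\<Delta> q)) * (ennreal (md q) * H (- q)) \<partial>muQ)"
  proof (rule nn_integral_cong)
    fix q
    have "(\<integral>\<^sup>+v. ennreal ((cmod (mJ (q, v)))\<^sup>2) * h (\<phi>J (q, v)) \<partial>muV)
        = ennreal (md q / \<Delta> q) * (\<integral>\<^sup>+v. h (- q, - act (- q) (v + \<beta> q (- q))) \<partial>muV)"
      by (subst nn_integral_cmult[symmetric]) (auto simp: mJ_def \<phi>J_def norm_inverse power_inverse)
    also have "(\<integral>\<^sup>+v. h (- q, - act (- q) (v + \<beta> q (- q))) \<partial>muV) = ennreal (md q) * H (- q)"
      unfolding H_def by (rule nn_integral_V_affine[where h = "\<lambda>v. h (- q, v)"]) measurable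
    finally have *: "(\<integral>\<^sup>+v. ennreal ((cmod (mJ (q, v)))\<^sup>2) * h (\<phi>J (q, v)) \<partial>muV)
        = ennreal (md q / \<Delta> q) * (ennreal (md q) * H (- q))" .
    show "ennreal (inverse (md q)) * (\<integral>\<^sup>+v. ennreal ((cmod (mJ (q, v)))\<^sup>2) * h (\<phi>J (q, v)) \<partial>muV)
        = ennreal (inverse (\<Delta> q)) * (ennreal (md q) * H (- q))"
    proof -
      have e: "inverse (md q) * (md q * inverse (\<Delta> q)) = inverse (\<Delta> q)"
        by (simp add: mult.assoc[symmetric])
      show ?thesis
        using ennreal_mult_mult[of "inverse (md q)" "md q / \<Delta> q"] * by (simp add: divide_inverse e)
    qed
  qed
  also have "\<dots> = (\<integral>\<^sup>+q. ennreal (md (- q)) * H (- (- q)) \<partial>muQ)"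
    by (rule Q.nn_integral_inverse[symmetric, where f = "\<lambda>q. ennreal (md q) * H (- q)"]) measurable
  also have "\<dots> = (\<integral>\<^sup>+q. ennreal (inverse (md q)) * (\<integral>\<^sup>+v. h (q, v) \<partial>muV) \<partial>muQ)"
    by (simp add: md_minus H_def)
  also have "\<dots> = (\<integral>\<^sup>+g. h g \<partial>G)" by (rule nn_integral_G[symmetric]) measurable
  finally show "(\<integral>\<^sup>+g. ennreal ((cmod (mJ g))\<^sup>2) * h (\<phi>J g) \<partial>G) = (\<integral>\<^sup>+g. h g \<partial>G)" .
qed

lemma \<phi>J_\<phi>J [simp]: "\<phi>J (\<phi>J g) = g"
proof -
  obtain q v where g: "g = (q, v)" by force
  have "\<beta> (- q) q = act (- q) (\<beta> q (- q))"
    using beta_cocycle[of "- q" q "- q"] by simp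
  then show ?thesis by (simp add: g \<phi>J_def act_add act_uminus act_diff)
qed

lemma mJ_nonzero [simp]: "mJ g \<noteq> 0"
  by (simp add: mJ_def)

lemma J_unitary: "L2_unitary G G (pullback mJ \<phi>J)"
  by (rule L2_unitary_pullback[OF L2_pullback_J L2_pullbackD(1)[OF L2_pullback_J]]) auto

lemma J_J [simp]: "pullback mJ \<phi>J (pullback mJ \<phi>J f) = f"
proof -
  have "mJ g * mJ (\<phi>J g) = 1" for g
    by (simp add: mJ_def \<phi>J_def Q.modular_function_minus md_minus real_sqrt_divide real_sqrt_inverse flip: of_real_mult)
  then show ?thesis by (simp add: pullback_pullback) (simp add: pullback_def)
qed

text \<open>The inversion \<open>J\<close> seen after Fourier transform in \<open>v\<close>: the
  substitution w = -q^(-1)(v + \<beta>(q, q^(-1))) contributes the Jacobian \<open>md\<close> and,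
  through its shift, the phase \<open>pairing \<xi> (\<beta> q (- q))\<close>.\<close>

definition mFJ :: "'q \<times> 'v pdual \<Rightarrow> complex" where
  "mFJ z = of_real (md (fst z) * inverse (sqrt (\<Delta> (fst z) / md (fst z)))) * pairing (snd z) (\<beta> (fst z) (- fst z))"

definition \<phi>FJ :: "'q \<times> 'v pdual \<Rightarrow> 'q \<times> 'v pdual" where
  "\<phi>FJ z = (- fst z, - da (- fst z) (snd z))"

lemma L2_pullback_FJ: "L2_pullback X X mFJ \<phi>FJ"
  unfolding L2_pullback_def
proof (intro conjI ballI)
  show "\<phi>FJ \<in> measurable X X" unfolding \<phi>FJ_def[abs_def] by measurable
  show "mFJ \<in> borel_measurable X" unfolding mFJ_def[abs_def] by measurable
  have [measurable]: "\<phi>FJ \<in> borel \<Otimes>\<^sub>M borel \<rightarrow>\<^sub>M borel \<Otimes>\<^sub>M borel"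
    "mFJ \<in> borel_measurable (borel \<Otimes>\<^sub>M borel)"
    unfolding \<phi>FJ_def[abs_def] mFJ_def[abs_def] by measurable
  fix h :: "_ \<Rightarrow> ennreal" assume "h \<in> borel_measurable X"
  then have h [measurable]: "h \<in> borel_measurable (borel \<Otimes>\<^sub>M borel)" by measurable
  interpret X: sigma_finite_measure muX by (rule sf)
  define H where "H p = (\<integral>\<^sup>+\<xi>. h (p, \<xi>) \<partial>muX)" for p
  have [measurable]: "H \<in> borel_measurable borel" unfolding H_def[abs_def] by measurable
  have "(\<integral>\<^sup>+z. ennreal ((cmod (mFJ z))\<^sup>2) * h (\<phi>FJ z) \<partial>X)
      = (\<integral>\<^sup>+q. ennreal (inverse (md q)) * (\<integral>\<^sup>+\<xi>. ennreal ((cmod (mFJ (q, \<xi>)))\<^sup>2) * h (\<phi>FJ (q, \<xi>)) \<partial>muX) \<partial>muQ)"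
    by (rule nn_integral_X) measurable
  also have "\<dots> = (\<integral>\<^sup>+q. ennreal (inverse (\<Delta> q)) * (ennreal (md q) * H (- q)) \<partial>muQ)"
  proof (rule nn_integral_cong)
    fix q
    have "(cmod (mFJ (q, \<xi>)))\<^sup>2 = (md q)\<^sup>2 * (md q / \<Delta> q)" for \<xi>
      by (simp add: mFJ_def norm_mult norm_inverse power_mult_distrib power_inverse)
    then have "(\<integral>\<^sup>+\<xi>. ennreal ((cmod (mFJ (q, \<xi>)))\<^sup>2) * h (\<phi>FJ (q, \<xi>)) \<partial>muX)
        = ennreal ((md q)\<^sup>2 * (md q / \<Delta> q)) * (\<integral>\<^sup>+\<xi>. h (- q, - da (- q) \<xi>) \<partial>muX)"
      by (subst nn_integral_cmult[symmetric]) (auto simp: \<phi>FJ_def)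
    also have "(\<integral>\<^sup>+\<xi>. h (- q, - da (- q) \<xi>) \<partial>muX) = ennreal (md (- q)) * (\<integral>\<^sup>+\<xi>. h (- q, - \<xi>) \<partial>muX)"
      by (rule nn_integral_da[where f = "\<lambda>\<xi>. h (- q, - \<xi>)"]) measurable
    also have "(\<integral>\<^sup>+\<xi>. h (- q, - \<xi>) \<partial>muX) = H (- q)"
      unfolding H_def by (rule nn_integral_X_minus[where f = "\<lambda>\<xi>. h (- q, \<xi>)"]) measurable
    finally have *: "(\<integral>\<^sup>+\<xi>. ennreal ((cmod (mFJ (q, \<xi>)))\<^sup>2) * h (\<phi>FJ (q, \<xi>)) \<partial>muX)
        = ennreal ((md q)\<^sup>2 * (md q / \<Delta> q)) * (ennreal (md (- q)) * H (- q))" .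
    show "ennreal (inverse (md q)) * (\<integral>\<^sup>+\<xi>. ennreal ((cmod (mFJ (q, \<xi>)))\<^sup>2) * h (\<phi>FJ (q, \<xi>)) \<partial>muX)
        = ennreal (inverse (\<Delta> q)) * (ennreal (md q) * H (- q))"
      unfolding *
    proof -
      have "inverse (md q) * ((md q)\<^sup>2 * (md q / \<Delta> q) * md (- q)) = inverse (\<Delta> q) * md q"
        by (simp add: md_minus power2_eq_square field_simps)
      then show "ennreal (inverse (md q)) * (ennreal ((md q)\<^sup>2 * (md q / \<Delta> q)) * (ennreal (md (- q)) * H (- q)))
          = ennreal (inverse (\<Delta> q)) * (ennreal (md q) * H (- q))"
        by (subst (1 2 3) ennreal_mult_mult) (simp_all del: times_divide_eq_right times_divide_eq_left)
    qed
  qed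
  also have "\<dots> = (\<integral>\<^sup>+q. ennreal (md (- q)) * H (- (- q)) \<partial>muQ)"
    by (rule Q.nn_integral_inverse[symmetric, where f = "\<lambda>q. ennreal (md q) * H (- q)"]) measurable
  also have "\<dots> = (\<integral>\<^sup>+q. ennreal (inverse (md q)) * (\<integral>\<^sup>+\<xi>. h (q, \<xi>) \<partial>muX) \<partial>muQ)"
    by (simp add: md_minus H_def)
  also have "\<dots> = (\<integral>\<^sup>+z. h z \<partial>X)" by (rule nn_integral_X[symmetric]) measurable
  finally show "(\<integral>\<^sup>+z. ennreal ((cmod (mFJ z))\<^sup>2) * h (\<phi>FJ z) \<partial>X) = (\<integral>\<^sup>+z. h z \<partial>X)" .
qed

end

section \<open>Testing operators on fourfold rectangles; null sets in products\<close>

lemma L2_operator_tensor_left: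
  assumes sf: "sigma_finite_measure M2" and S: "L2_operator (M1 \<Otimes>\<^sub>M M2) N S" and g: "g \<in> L2 M2"
  shows "L2_operator M1 N (\<lambda>f. S (tensor_fun f g))"
proof -
  obtain C where C: "C \<ge> 0" "\<And>f. f \<in> L2 (M1 \<Otimes>\<^sub>M M2) \<Longrightarrow> sqn N (S f) \<le> ennreal C * sqn (M1 \<Otimes>\<^sub>M M2) f"
    by (rule L2_operator_bound[OF S]) blast
  have sg: "sqn M2 g = ennreal (enn2real (sqn M2 g))" using g by (simp add: L2_iff)
  show ?thesis
  proof (rule L2_operatorI[where C = "C * enn2real (sqn M2 g)"])
    fix f assume f: "f \<in> L2 M1"
    note fg = L2_tensor_fun[OF sf f g]
    show "S (tensor_fun f g) \<in> L2 N" by (rule L2_operator_L2[OF S fg])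
    have "sqn N (S (tensor_fun f g)) \<le> ennreal C * (sqn M1 f * ennreal (enn2real (sqn M2 g)))"
      using C(2)[OF fg] sqn_tensor[OF sf L2_measurable[OF f] L2_measurable[OF g]] sg by simp
    then show "sqn N (S (tensor_fun f g)) \<le> ennreal (C * enn2real (sqn M2 g)) * sqn M1 f"
      using C(1) by (simp add: ennreal_mult mult_ac)
    show "AE y in N. S (tensor_fun (\<lambda>x. c * f x) g) y = c * S (tensor_fun f g) y" for c
    proof -
      have "tensor_fun (\<lambda>x. c * f x) g = (\<lambda>z. c * tensor_fun f g z)" by (auto simp: tensor_fun_def fun_eq_iff)
      then show ?thesis using L2_operator_scale[OF S fg, of c] by simp
    qed
    fix f' assume f': "f' \<in> L2 M1"
    have "tensor_fun (\<lambda>x. f x + f' x) g = (\<lambda>z. tensor_fun f g z + tensor_fun f' g z)"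
      by (auto simp: tensor_fun_def fun_eq_iff algebra_simps)
    then show "AE y in N. S (tensor_fun (\<lambda>x. f x + f' x) g) y = S (tensor_fun f g) y + S (tensor_fun f' g) y"
      using L2_operator_add[OF S fg L2_tensor_fun[OF sf f' g]] by simp
  qed (use C(1) in simp)
qed

lemma L2_operator_tensor_right:
  assumes sf: "sigma_finite_measure M1" "sigma_finite_measure M2"
    and S: "L2_operator (M1 \<Otimes>\<^sub>M M2) N S" and f: "f \<in> L2 M1"
  shows "L2_operator M2 N (\<lambda>g. S (tensor_fun f g))"
proof -
  have "L2_operator (M2 \<Otimes>\<^sub>M M1) N (S \<circ> swap_op)"
    by (rule L2_operator_compose[OF L2_unitaryD(1)[OF L2_unitary_swap[OF sf(2,1)]] S])
  from L2_operator_tensor_left[OF sf(1) this f] show ?thesis by (simp add: swap_op_tensor)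
qed

lemma L2_operators_eq_rect:
  assumes sf: "sigma_finite_measure M1" "sigma_finite_measure M2" "sigma_finite_measure M3" "sigma_finite_measure M4"
    and ST: "L2_operator ((M1 \<Otimes>\<^sub>M M2) \<Otimes>\<^sub>M (M3 \<Otimes>\<^sub>M M4)) N S" "L2_operator ((M1 \<Otimes>\<^sub>M M2) \<Otimes>\<^sub>M (M3 \<Otimes>\<^sub>M M4)) N T"
    and eq: "\<And>A B C D. A \<in> sets M1 \<Longrightarrow> emeasure M1 A < \<infinity> \<Longrightarrow> B \<in> sets M2 \<Longrightarrow> emeasure M2 B < \<infinity> \<Longrightarrow>
       C \<in> sets M3 \<Longrightarrow> emeasure M3 C < \<infinity> \<Longrightarrow> D \<in> sets M4 \<Longrightarrow> emeasure M4 D < \<infinity> \<Longrightarrow>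
       AE y in N. S (tensor_fun (tensor_fun (indicator A) (indicator B)) (tensor_fun (indicator C) (indicator D))) y
         = T (tensor_fun (tensor_fun (indicator A) (indicator B)) (tensor_fun (indicator C) (indicator D))) y"
    and f: "f \<in> L2 ((M1 \<Otimes>\<^sub>M M2) \<Otimes>\<^sub>M (M3 \<Otimes>\<^sub>M M4))"
  shows "AE y in N. S f y = T f y"
proof -
  have sf': "sigma_finite_measure (M1 \<Otimes>\<^sub>M M2)" "sigma_finite_measure (M3 \<Otimes>\<^sub>M M4)"
    using sf by (simp_all add: sigma_finite_pair_measure)
  have 1: "AE y in N. S (tensor_fun g (tensor_fun (indicator C) (indicator D))) y
      = T (tensor_fun g (tensor_fun (indicator C) (indicator D))) y"
    if g: "g \<in> L2 (M1 \<Otimes>\<^sub>M M2)" and CD: "C \<in> sets M3" "emeasure M3 C < \<infinity>" "D \<in> sets M4" "emeasure M4 D < \<infinity>" for g C D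
  proof -
    have k: "tensor_fun (indicator C) (indicator D) \<in> L2 (M3 \<Otimes>\<^sub>M M4)"
      by (rule L2_tensor_fun[OF sf(4) L2_indicator[OF CD(1,2)] L2_indicator[OF CD(3,4)]])
    show ?thesis
      by (rule L2_operators_eq_pair[OF sf(1,2) L2_operator_tensor_left[OF sf'(2) ST(1) k]
            L2_operator_tensor_left[OF sf'(2) ST(2) k] _ g]) (rule eq[OF _ _ _ _ CD])
  qed
  show ?thesis
  proof (rule L2_operators_eq_pair[OF sf' ST _ f])
    fix A B assume "A \<in> sets (M1 \<Otimes>\<^sub>M M2)" "emeasure (M1 \<Otimes>\<^sub>M M2) A < \<infinity>"
      and B: "B \<in> sets (M3 \<Otimes>\<^sub>M M4)" "emeasure (M3 \<Otimes>\<^sub>M M4) B < \<infinity>"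
    then have A: "(indicator A :: _ \<Rightarrow> complex) \<in> L2 (M1 \<Otimes>\<^sub>M M2)" by (intro L2_indicator)
    show "AE y in N. S (tensor_fun (indicator A) (indicator B)) y = T (tensor_fun (indicator A) (indicator B)) y"
      by (rule L2_operators_eq_pair[OF sf(3,4) L2_operator_tensor_right[OF sf' ST(1) A]
            L2_operator_tensor_right[OF sf' ST(2) A] _ L2_indicator[OF B]]) (rule 1[OF A])
  qed
qed

lemma AE_pair_fst:
  assumes "sigma_finite_measure M" "sigma_finite_measure N" "AE x in M. P x"
  shows "AE z in M \<Otimes>\<^sub>M N. P (fst z)"
proof -
  interpret pair_sigma_finite M N using assms by (simp add: pair_sigma_finite_def)
  obtain A where A: "{x \<in> space M. \<not> P x} \<subseteq> A" "emeasure M A = 0" "A \<in> sets M"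
    using assms(3) by (rule AE_E)
  note [measurable] = A(3)
  have "AE z in M \<Otimes>\<^sub>M N. fst z \<notin> A"
  proof (rule AE_pair_measure)
    show "{z \<in> space (M \<Otimes>\<^sub>M N). fst z \<notin> A} \<in> sets (M \<Otimes>\<^sub>M N)" by measurable
    have "AE x in M. x \<notin> A" using A by (intro AE_not_in) (simp add: null_sets_def)
    then show "AE x in M. AE y in N. fst (x, y) \<notin> A" by eventually_elim simp
  qed
  with AE_space show ?thesis
    by eventually_elim (use A(1) in \<open>auto simp: space_pair_measure\<close>)
qed

lemma AE_pair_snd:
  assumes "sigma_finite_measure M" "sigma_finite_measure N" "AE y in N. P y"
  shows "AE z in M \<Otimes>\<^sub>M N. P (snd z)"
proof -
  interpret pair_sigma_finite M N using assms by (simp add: pair_sigma_finite_def)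
  obtain A where A: "{x \<in> space N. \<not> P x} \<subseteq> A" "emeasure N A = 0" "A \<in> sets N"
    using assms(3) by (rule AE_E)
  note [measurable] = A(3)
  have "AE z in M \<Otimes>\<^sub>M N. snd z \<notin> A"
  proof (rule AE_pair_measure)
    show "{z \<in> space (M \<Otimes>\<^sub>M N). snd z \<notin> A} \<in> sets (M \<Otimes>\<^sub>M N)" by measurable
    have "AE x in N. x \<notin> A" using A by (intro AE_not_in) (simp add: null_sets_def)
    then show "AE x in M. AE y in N. snd (x, y) \<notin> A" by simp
  qed
  with AE_space show ?thesis
    by eventually_elim (use A(1) in \<open>auto simp: space_pair_measure\<close>)
qed

text \<open>In the non-integrable case the Bochner integral is 0 by convention, so the bound still
  holds.\<close>

lemma norm_integral_le_nn: "ennreal (cmod (\<integral>x. f x \<partial>M)) \<le> (\<integral>\<^sup>+x. ennreal (cmod (f x)) \<partial>M)"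
  by (cases "integrable M f") (auto simp: integral_norm_bound_ennreal not_integrable_integral_eq)

context extension_data
begin

lemma rect_L2:
  assumes "A \<in> sets Qw" "emeasure Qw A < \<infinity>" "B \<in> sets muV" "emeasure muV B < \<infinity>"
  shows "tensor_fun (indicator A) (indicator B) \<in> L2 G"
  unfolding G_def by (intro L2_tensor_fun sf L2_indicator assms)

lemma pairing_cnj: "cnj (pairing \<xi> v) = pairing (- \<xi>) v"
  by (simp add: cnj_pairing pairing_minus_left)

lemma FJ_integral:
  assumes "integrable muV (\<lambda>w. f (- q, w))"
  shows "integrable muV (\<lambda>v. pullback mJ \<phi>J f (q, v))"
    and "(\<integral>v. cnj (pairing \<xi> v) * pullback mJ \<phi>J f (q, v) \<partial>muV)
      = mFJ (q, \<xi>) * (\<integral>w. cnj (pairing (- da (- q) \<xi>) w) * f (- q, w) \<partial>muV)"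
proof -
  let ?\<beta> = "\<beta> q (- q)"
  define T where "T v = - act (- q) (v + ?\<beta>)" for v
  have Tm: "T \<in> measurable muV muV" unfolding T_def[abs_def] by measurable
  have sc: "(\<integral>\<^sup>+v. h (T v) \<partial>muV) = ennreal (md q) * (\<integral>\<^sup>+v. h v \<partial>muV)"
    if "h \<in> borel_measurable muV" for h :: "'v \<Rightarrow> ennreal"
    unfolding T_def using that by (intro nn_integral_V_affine) simp
  have sci: "integrable muV (\<lambda>v. g (T v))" "(\<integral>v. g (T v) \<partial>muV) = of_real (md q) * (\<integral>w. g w \<partial>muV)"
    if "integrable muV g" for g :: "'v \<Rightarrow> complex"
    by (rule scaled_integral[OF Tm md_nonneg _ that], erule sc)+
  have Jf: "pullback mJ \<phi>J f (q, v) = mJ (q, 0) * f (- q, T v)" for v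
    by (simp add: pullback_def \<phi>J_def T_def mJ_def)
  show "integrable muV (\<lambda>v. pullback mJ \<phi>J f (q, v))"
    unfolding Jf by (intro integrable_mult_right sci(1)[OF assms])
  have p: "cnj (pairing \<xi> v) = pairing \<xi> ?\<beta> * cnj (pairing (- da (- q) \<xi>) (T v))" for v
  proof -
    have "cnj (pairing (- da (- q) \<xi>) (T v)) = pairing \<xi> (act q (T v))"
      by (simp add: pairing_cnj pairing_da)
    also have "act q (T v) = - (v + ?\<beta>)" by (simp add: T_def act_uminus)
    also have "pairing \<xi> (- (v + ?\<beta>)) = inverse (pairing \<xi> v * pairing \<xi> ?\<beta>)"
      by (simp only: pairing_minus pairing_add)
    finally show ?thesis by (simp add: cnj_pairing)
  qed
  let ?g = "\<lambda>w. cnj (pairing (- da (- q) \<xi>) w) * f (- q, w)"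
  have [measurable]: "(\<lambda>w. f (- q, w)) \<in> borel_measurable muV"
    using assms by (rule borel_measurable_integrable)
  have g: "integrable muV ?g"
    by (rule Bochner_Integration.integrable_bound[OF assms]) (measurable, simp add: norm_mult)
  have "(\<integral>v. cnj (pairing \<xi> v) * pullback mJ \<phi>J f (q, v) \<partial>muV)
      = (\<integral>v. (mJ (q, 0) * pairing \<xi> ?\<beta>) * ?g (T v) \<partial>muV)"
    unfolding Jf p by (simp add: mult_ac)
  also have "\<dots> = (mJ (q, 0) * pairing \<xi> ?\<beta>) * (\<integral>v. ?g (T v) \<partial>muV)"
    by (rule integral_mult_right_zero)
  also have "(\<integral>v. ?g (T v) \<partial>muV) = of_real (md q) * (\<integral>w. ?g w \<partial>muV)"
    by (rule sci(2)[OF g])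
  also have "mJ (q, 0) * pairing \<xi> ?\<beta> * (of_real (md q) * (\<integral>w. ?g w \<partial>muV)) = mFJ (q, \<xi>) * (\<integral>w. ?g w \<partial>muV)"
    by (simp add: mFJ_def mJ_def)
  finally show "(\<integral>v. cnj (pairing \<xi> v) * pullback mJ \<phi>J f (q, v) \<partial>muV) = mFJ (q, \<xi>) * (\<integral>w. ?g w \<partial>muV)" .
qed

text \<open>Both sides are bounded operators in \<open>f\<close>. On rectangles the Fourier
  integrals converge absolutely in every fibre, so \<open>FJ_integral\<close> applies
  pointwise.\<close>

lemma FJ_eq:
  assumes f: "f \<in> L2 G"
  shows "AE z in X. F (pullback mJ \<phi>J f) z = pullback mFJ \<phi>FJ (F f) z"
proof -
  note Fo = L2_unitaryD(1)[OF F_unitary] and Jo = L2_operator_pullback[OF L2_pullback_J]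
  have 1: "L2_operator (Qw \<Otimes>\<^sub>M muV) X (F \<circ> pullback mJ \<phi>J)"
    using L2_operator_compose[OF Jo Fo] by (simp add: G_def)
  have 2: "L2_operator (Qw \<Otimes>\<^sub>M muV) X (pullback mFJ \<phi>FJ \<circ> F)"
    using L2_operator_compose[OF Fo L2_operator_pullback[OF L2_pullback_FJ]] by (simp add: G_def)
  have "AE z in X. (F \<circ> pullback mJ \<phi>J) f z = (pullback mFJ \<phi>FJ \<circ> F) f z"
  proof (rule L2_operators_eq_pair[OF sf(4,2) 1 2 _ f[unfolded G_def]])
    fix A B assume AB: "A \<in> sets Qw" "emeasure Qw A < \<infinity>" "B \<in> sets muV" "emeasure muV B < \<infinity>"
    let ?f = "tensor_fun (indicator A) (indicator B) :: _ \<Rightarrow> complex"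
    have f2: "?f \<in> L2 G" by (rule rect_L2[OF AB])
    have i: "integrable muV (\<lambda>w. ?f (p, w))" for p
      unfolding tensor_fun_def using integrable_indicator_L2[OF AB(3,4)] by simp
    have J2: "pullback mJ \<phi>J ?f \<in> L2 G" by (rule L2_operator_L2[OF Jo f2])
    define k where "k z = (\<integral>v. cnj (pairing (snd z) v) * ?f (fst z, v) \<partial>muV)" for z
    have "AE z in X. F ?f z = k z"
      using kernel_operatorD(2)[OF F_kernel f2[unfolded G_def]] i unfolding X_def k_def by simp
    from pullback_cong_AE[OF L2_pullback_FJ this]
    have a: "AE z in X. pullback mFJ \<phi>FJ (F ?f) z = pullback mFJ \<phi>FJ k z" .
    have "AE z in X. F (pullback mJ \<phi>J ?f) z = (\<integral>v. cnj (pairing (snd z) v) * pullback mJ \<phi>J ?f (fst z, v) \<partial>muV)"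
      using kernel_operatorD(2)[OF F_kernel J2[unfolded G_def]] FJ_integral(1)[OF i] unfolding X_def by simp
    moreover have "(\<integral>v. cnj (pairing (snd z) v) * pullback mJ \<phi>J ?f (fst z, v) \<partial>muV) = pullback mFJ \<phi>FJ k z" for z
      unfolding FJ_integral(2)[OF i] by (simp add: pullback_def k_def \<phi>FJ_def)
    ultimately have "AE z in X. F (pullback mJ \<phi>J ?f) z = pullback mFJ \<phi>FJ k z" by simp
    with a show "AE z in X. (F \<circ> pullback mJ \<phi>J) ?f z = (pullback mFJ \<phi>FJ \<circ> F) ?f z"
      by eventually_elim simp
  qed
  then show ?thesis by simp
qed

section \<open>The quantization map, alone and combined with the inversion\<close>

definition mOp :: "'q \<times> 'q \<Rightarrow> complex" where
  "mOp z = of_real (inverse (sqrt (md (fst z + snd z)))) * b (- fst z) (fst z) * cnj (b (- snd z) (fst z))"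

definition \<phi>Op :: "'q \<times> 'q \<Rightarrow> 'q \<times> 'v pdual" where
  "\<phi>Op z = (fst z, \<eta> (fst z) - \<eta> (snd z))"

lemma Op_eq: "Op muQ muV muX act \<eta> b = pullback mOp \<phi>Op \<circ> F"
  by (auto simp: fun_eq_iff Op_def pullback_def mOp_def \<phi>Op_def powr_minus_half)

lemma nn_integral_eta_diff:
  assumes [measurable]: "h \<in> borel_measurable borel"
  shows "(\<integral>\<^sup>+q. ennreal (inverse (md q)) * h (\<zeta> - \<eta> q) \<partial>muQ) = (\<integral>\<^sup>+\<xi>. h \<xi> \<partial>muX)"
proof -
  have "(\<integral>\<^sup>+q. ennreal (inverse (md q)) * h (\<zeta> - \<eta> q) \<partial>muQ) = (\<integral>\<^sup>+\<xi>. h (\<zeta> - \<xi>) \<partial>muX)"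
    by (subst eta_integral[symmetric]) (auto simp: mult.commute)
  also have "\<dots> = (\<integral>\<^sup>+\<xi>. h (\<zeta> + \<xi>) \<partial>muX)"
    using nn_integral_X_minus[of "\<lambda>\<xi>. h (\<zeta> + \<xi>)"] by simp
  also have "\<dots> = (\<integral>\<^sup>+\<xi>. h \<xi> \<partial>muX)" by (rule nn_integral_X_left) measurable
  finally show ?thesis .
qed

text \<open>The squared multiplier is \<open>inverse (md p) * inverse (md q)\<close>: the factor in
  \<open>q\<close> turns \<open>muQ\<close> into \<open>muX\<close> along \<eta>, the factor in
  \<open>p\<close> is the weight of \<open>Qw\<close>.\<close>

lemma L2_pullback_Op: "L2_pullback HS X mOp \<phi>Op"
  unfolding L2_pullback_def
proof (intro conjI ballI)
  show "\<phi>Op \<in> measurable HS X" unfolding \<phi>Op_def[abs_def] by measurable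
  show "mOp \<in> borel_measurable HS" unfolding mOp_def[abs_def] by measurable
  have [measurable]: "\<phi>Op \<in> borel \<Otimes>\<^sub>M borel \<rightarrow>\<^sub>M borel \<Otimes>\<^sub>M borel"
    "mOp \<in> borel_measurable (borel \<Otimes>\<^sub>M borel)"
    unfolding \<phi>Op_def[abs_def] mOp_def[abs_def] by measurable
  fix h :: "_ \<Rightarrow> ennreal" assume "h \<in> borel_measurable X"
  then have h [measurable]: "h \<in> borel_measurable (borel \<Otimes>\<^sub>M borel)" by measurable
  have "(\<integral>\<^sup>+z. ennreal ((cmod (mOp z))\<^sup>2) * h (\<phi>Op z) \<partial>HS)
      = (\<integral>\<^sup>+p. \<integral>\<^sup>+q. ennreal ((cmod (mOp (p, q)))\<^sup>2) * h (\<phi>Op (p, q)) \<partial>muQ \<partial>muQ)"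
    by (rule nn_integral_HS) measurable
  also have "\<dots> = (\<integral>\<^sup>+p. ennreal (inverse (md p)) * (\<integral>\<^sup>+\<xi>. h (p, \<xi>) \<partial>muX) \<partial>muQ)"
  proof (rule nn_integral_cong)
    fix p
    have "(cmod (mOp (p, q)))\<^sup>2 = inverse (md p) * inverse (md q)" for q
      by (simp add: mOp_def norm_mult norm_inverse power_inverse md_add)
    then have "(\<integral>\<^sup>+q. ennreal ((cmod (mOp (p, q)))\<^sup>2) * h (\<phi>Op (p, q)) \<partial>muQ)
        = (\<integral>\<^sup>+q. ennreal (inverse (md p)) * (ennreal (inverse (md q)) * h (p, \<eta> p - \<eta> q)) \<partial>muQ)"
      by (simp add: \<phi>Op_def ennreal_mult_mult)
    also have "\<dots> = ennreal (inverse (md p)) * (\<integral>\<^sup>+q. ennreal (inverse (md q)) * h (p, \<eta> p - \<eta> q) \<partial>muQ)"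
      by (rule nn_integral_cmult) measurable
    also have "(\<integral>\<^sup>+q. ennreal (inverse (md q)) * h (p, \<eta> p - \<eta> q) \<partial>muQ) = (\<integral>\<^sup>+\<xi>. h (p, \<xi>) \<partial>muX)"
      by (rule nn_integral_eta_diff[where h = "\<lambda>\<xi>. h (p, \<xi>)"]) measurable
    finally show "(\<integral>\<^sup>+q. ennreal ((cmod (mOp (p, q)))\<^sup>2) * h (\<phi>Op (p, q)) \<partial>muQ)
        = ennreal (inverse (md p)) * (\<integral>\<^sup>+\<xi>. h (p, \<xi>) \<partial>muX)" .
  qed
  also have "\<dots> = (\<integral>\<^sup>+z. h z \<partial>X)" by (rule nn_integral_X[symmetric]) measurable
  finally show "(\<integral>\<^sup>+z. ennreal ((cmod (mOp z))\<^sup>2) * h (\<phi>Op z) \<partial>HS) = (\<integral>\<^sup>+z. h z \<partial>X)" .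
qed

lemma Op_unitary: "L2_unitary G HS (Op muQ muV muX act \<eta> b)"
  unfolding Op_eq
proof (rule L2_unitary_compose[OF F_unitary])
  show "L2_unitary X HS (pullback mOp \<phi>Op)"
  \<comment> \<open>A frequency \<xi> = \<eta>(p) - \<eta>(q) determines q almost everywhere as
    \<eta>inv(\<eta>(p) - \<xi>).\<close>
  proof (rule L2_unitary_pullback[OF L2_pullback_Op, where \<theta> = "\<lambda>z. (fst z, \<eta>inv (\<eta> (fst z) - snd z))"])
    show "(\<lambda>z. (fst z, \<eta>inv (\<eta> (fst z) - snd z))) \<in> measurable X HS" by measurable
    have "AE z in HS. \<eta>inv (\<eta> (snd z)) = snd z"
      by (rule AE_pair_snd[OF sf(1,1) AE_etainv_eta])
    then show "AE z in HS. (fst (\<phi>Op z), \<eta>inv (\<eta> (fst (\<phi>Op z)) - snd (\<phi>Op z))) = z"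
      by eventually_elim (simp add: \<phi>Op_def)
    have "mOp z \<noteq> 0" for z by (simp add: mOp_def)
    then show "AE z in HS. mOp z \<noteq> 0" by simp
  qed
qed

definition mOJ :: "'q \<times> 'q \<Rightarrow> complex" where
  "mOJ z = of_real (md (fst z) * inverse (sqrt (md (snd z) * \<Delta> (fst z)))) * b (- snd z + fst z) (- fst z)"

definition \<phi>OJ :: "'q \<times> 'q \<Rightarrow> 'q \<times> 'v pdual" where
  "\<phi>OJ z = (- fst z, \<eta> (- fst z + snd z))"

text \<open>The arguments combine by \<open>eta_left_diff\<close>, and the three factors of modulus
  1 collapse to the single value \<open>b (- q + p) (- p)\<close> because \<psi> =
  \<partial>b.\<close>

lemma pullback_OJ: "pullback mOp \<phi>Op (pullback mFJ \<phi>FJ h) = pullback mOJ \<phi>OJ h"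
  and L2_pullback_OJ: "L2_pullback HS X mOJ \<phi>OJ"
proof -
  have \<phi>: "\<phi>FJ (\<phi>Op z) = \<phi>OJ z" for z
    by (simp add: \<phi>FJ_def \<phi>Op_def \<phi>OJ_def eta_left_diff da_diff)
  have m: "mOp z * mFJ (\<phi>Op z) = mOJ z" for z
  proof -
    obtain p q where z: "z = (p, q)" by force
    have r: "inverse (sqrt (md (p + q))) * (md p * inverse (sqrt (\<Delta> p / md p))) = md p * inverse (sqrt (md q * \<Delta> p))"
      by (simp add: md_add real_sqrt_mult real_sqrt_divide field_simps)
    \<comment> \<open>The pairing is split so that \<psi> = \<partial>b applies at the triples (-p,
      p, -p) and (-q, p, -p); the values of \<open>b\<close> with an argument 0 are 1 by
      normalization.\<close>
    have "pairing (\<eta> p - \<eta> q) (\<beta> p (- p)) = pairing (\<eta> (- (- p))) (\<beta> p (- p)) / pairing (\<eta> (- (- q))) (\<beta> p (- p))"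
      by (simp add: pairing_diff_left)
    also have "\<dots> = (b p (- p) / b (- p) p) / (b p (- p) / (b (- q) p * b (- q + p) (- p)))"
      unfolding pairing_eta_beta by simp
    finally have "b (- p) p * cnj (b (- q) p) * pairing (\<eta> p - \<eta> q) (\<beta> p (- p)) = b (- q + p) (- p)"
      by (simp add: cnj_b)
    with r show ?thesis
      by (simp add: z mOp_def mFJ_def mOJ_def \<phi>Op_def mult_ac flip: of_real_mult of_real_inverse)
  qed
  show "pullback mOp \<phi>Op (pullback mFJ \<phi>FJ h) = pullback mOJ \<phi>OJ h"
    by (simp add: pullback_pullback \<phi> m)
  show "L2_pullback HS X mOJ \<phi>OJ"
    using L2_pullback_compose[OF L2_pullback_Op L2_pullback_FJ] by (simp add: \<phi> m)
qed

lemma OpJ_eq: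
  assumes f: "f \<in> L2 G"
  shows "AE z in HS. Op muQ muV muX act \<eta> b (pullback mJ \<phi>J f) z = pullback mOJ \<phi>OJ (F f) z"
  using pullback_cong_AE[OF L2_pullback_Op FJ_eq[OF f]]
  by (simp add: Op_eq pullback_OJ)


section \<open>The operator \<open>W\<close> before and after Fourier transform in both
  variables\<close>

definition \<phi>W :: "('q \<times> 'v) \<times> ('q \<times> 'v) \<Rightarrow> ('q \<times> 'v) \<times> ('q \<times> 'v)" where
  "\<phi>W z = (ext_mult act \<beta> (snd z) (fst z), snd z)"

lemma W_hat_eq: "W_hat act \<beta> = pullback (\<lambda>_. 1) \<phi>W"
  by (auto simp: fun_eq_iff W_hat_def pullback_def \<phi>W_def)

lemma ext_mult_eq: "ext_mult act \<beta> g h = (fst g + fst h, snd g + act (fst g) (snd h) + \<beta> (fst g) (fst h))"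
  by (simp add: ext_mult_def split_beta)

lemma nn_integral_V_affine':
  assumes [measurable]: "h \<in> borel_measurable borel"
  shows "(\<integral>\<^sup>+v. h (w + act p v + x) \<partial>muV) = ennreal (inverse (md p)) * (\<integral>\<^sup>+v. h v \<partial>muV)"
proof -
  have "(\<integral>\<^sup>+v. h (w + act p v + x) \<partial>muV) = ennreal (inverse (md p)) * (\<integral>\<^sup>+v. h (w + v + x) \<partial>muV)"
    by (rule nn_integral_act[where f = "\<lambda>v. h (w + v + x)"]) measurable
  also have "(\<integral>\<^sup>+v. h (w + v + x) \<partial>muV) = (\<integral>\<^sup>+v. h ((w + x) + v) \<partial>muV)" by (simp add: add_ac)
  also have "\<dots> = (\<integral>\<^sup>+v. h v \<partial>muV)" by (rule V.nn_integral_left) measurable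
  finally show ?thesis .
qed

text \<open>The action of \<open>p\<close> on \<open>V\<close> contributes
  \<open>inverse (md p)\<close>, which completes the weight to \<open>inverse (md (p + q))\<close>,
  so that the translation in \<open>Q\<close> can be undone; the cocycle merely shifts
  \<open>v\<close>.\<close>

lemma nn_integral_G_left:
  assumes h [measurable]: "h \<in> borel_measurable (borel \<Otimes>\<^sub>M borel)"
  shows "(\<integral>\<^sup>+g. h (ext_mult act \<beta> g0 g) \<partial>G) = (\<integral>\<^sup>+g. h g \<partial>G)"
proof -
  interpret V: sigma_finite_measure muV by (rule sf)
  obtain p w where g0: "g0 = (p, w)" by force
  define H where "H q = (\<integral>\<^sup>+v. h (q, v) \<partial>muV)" for q
  have [measurable]: "H \<in> borel_measurable borel" unfolding H_def[abs_def] by measurable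
  have "(\<integral>\<^sup>+g. h (ext_mult act \<beta> g0 g) \<partial>G)
      = (\<integral>\<^sup>+q. ennreal (inverse (md q)) * (\<integral>\<^sup>+v. h (p + q, w + act p v + \<beta> p q) \<partial>muV) \<partial>muQ)"
    unfolding ext_mult_eq g0 by (subst nn_integral_G) auto
  also have "\<dots> = (\<integral>\<^sup>+q. ennreal (inverse (md (p + q))) * H (p + q) \<partial>muQ)"
  proof (rule nn_integral_cong)
    fix q
    have "(\<integral>\<^sup>+v. h (p + q, w + act p v + \<beta> p q) \<partial>muV) = ennreal (inverse (md p)) * H (p + q)"
      unfolding H_def by (rule nn_integral_V_affine'[where h = "\<lambda>v. h (p + q, v)"]) measurable
    moreover have "inverse (md q) * inverse (md p) = inverse (md (p + q))" by (simp add: md_add)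
    ultimately show "ennreal (inverse (md q)) * (\<integral>\<^sup>+v. h (p + q, w + act p v + \<beta> p q) \<partial>muV)
        = ennreal (inverse (md (p + q))) * H (p + q)"
      by (simp add: ennreal_mult_mult)
  qed
  also have "\<dots> = (\<integral>\<^sup>+q. ennreal (inverse (md q)) * H q \<partial>muQ)"
    by (rule Q.nn_integral_left[where f = "\<lambda>q. ennreal (inverse (md q)) * H q"]) measurable
  also have "\<dots> = (\<integral>\<^sup>+g. h g \<partial>G)" unfolding H_def by (rule nn_integral_G[symmetric]) measurable
  finally show ?thesis .
qed

lemma L2_pullback_W: "L2_pullback (G \<Otimes>\<^sub>M G) (G \<Otimes>\<^sub>M G) (\<lambda>_. 1) \<phi>W"
  unfolding L2_pullback_def
proof (intro conjI ballI)
  interpret GG: pair_sigma_finite G G using sf by (simp add: pair_sigma_finite_def)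
  show \<phi> [measurable]: "\<phi>W \<in> measurable (G \<Otimes>\<^sub>M G) (G \<Otimes>\<^sub>M G)"
    unfolding \<phi>W_def[abs_def] ext_mult_eq by measurable
  show "(\<lambda>_. 1 :: complex) \<in> borel_measurable (G \<Otimes>\<^sub>M G)" by measurable
  fix h :: "_ \<Rightarrow> ennreal" assume h [measurable]: "h \<in> borel_measurable (G \<Otimes>\<^sub>M G)"
  have "(\<integral>\<^sup>+z. ennreal ((cmod 1)\<^sup>2) * h (\<phi>W z) \<partial>(G \<Otimes>\<^sub>M G)) = (\<integral>\<^sup>+z. h (\<phi>W z) \<partial>(G \<Otimes>\<^sub>M G))" by simp
  also have "\<dots> = (\<integral>\<^sup>+g0. \<integral>\<^sup>+g. h (\<phi>W (g, g0)) \<partial>G \<partial>G)"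
    by (rule GG.nn_integral_snd[symmetric]) measurable
  also have "\<dots> = (\<integral>\<^sup>+g0. \<integral>\<^sup>+g. h (g, g0) \<partial>G \<partial>G)"
  proof (rule nn_integral_cong)
    fix g0 assume "g0 \<in> space G"
    then have "(\<lambda>g. h (g, g0)) \<in> borel_measurable G" by measurable
    then have "(\<lambda>g. h (g, g0)) \<in> borel_measurable (borel \<Otimes>\<^sub>M borel)" by measurable
    from nn_integral_G_left[OF this]
    show "(\<integral>\<^sup>+g. h (\<phi>W (g, g0)) \<partial>G) = (\<integral>\<^sup>+g. h (g, g0) \<partial>G)" by (simp add: \<phi>W_def)
  qed
  also have "\<dots> = (\<integral>\<^sup>+z. h z \<partial>(G \<Otimes>\<^sub>M G))" by (rule GG.nn_integral_snd) measurable
  finally show "(\<integral>\<^sup>+z. ennreal ((cmod 1)\<^sup>2) * h (\<phi>W z) \<partial>(G \<Otimes>\<^sub>M G)) = (\<integral>\<^sup>+z. h z \<partial>(G \<Otimes>\<^sub>M G))" .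
qed

text \<open>\<open>W\<close> seen after both Fourier transforms. With \<open>p\<close> the second
  group coordinate, substituting w + p v + \<beta>(p, q) for v contributes
  \<open>inverse (md p)\<close> and turns \<xi> into \<open>da p \<xi>\<close>; evaluating this
  character at the shift leaves a phase at \<beta>(p, q) and a copy on \<open>w\<close>, whence the
  change of the second frequency.\<close>

definition mFW :: "('q \<times> 'v pdual) \<times> ('q \<times> 'v pdual) \<Rightarrow> complex" where
  "mFW z = of_real (inverse (md (fst (snd z)))) * pairing (da (fst (snd z)) (snd (fst z))) (\<beta> (fst (snd z)) (fst (fst z)))"

definition \<phi>FW :: "('q \<times> 'v pdual) \<times> ('q \<times> 'v pdual) \<Rightarrow> ('q \<times> 'v pdual) \<times> ('q \<times> 'v pdual)" where
  "\<phi>FW z = ((fst (snd z) + fst (fst z), da (fst (snd z)) (snd (fst z))),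
            (fst (snd z), snd (snd z) - da (fst (snd z)) (snd (fst z))))"

text \<open>One factor \<open>md p\<close> comes from the dual action on \<open>muX\<close>, the
  other from translating the weight of \<open>Qw\<close>.\<close>

lemma nn_integral_X_left_act:
  assumes h [measurable]: "h \<in> borel_measurable (borel \<Otimes>\<^sub>M borel)"
  shows "(\<integral>\<^sup>+x. h (p + fst x, da p (snd x)) \<partial>X) = ennreal ((md p)\<^sup>2) * (\<integral>\<^sup>+x. h x \<partial>X)"
proof -
  interpret X: sigma_finite_measure muX by (rule sf)
  define H where "H q = (\<integral>\<^sup>+\<xi>. h (q, \<xi>) \<partial>muX)" for q
  have [measurable]: "H \<in> borel_measurable borel" unfolding H_def[abs_def] by measurable
  have "(\<integral>\<^sup>+x. h (p + fst x, da p (snd x)) \<partial>X)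
      = (\<integral>\<^sup>+q. ennreal (inverse (md q)) * (\<integral>\<^sup>+\<xi>. h (p + q, da p \<xi>) \<partial>muX) \<partial>muQ)"
    by (subst nn_integral_X) auto
  also have "\<dots> = (\<integral>\<^sup>+q. ennreal ((md p)\<^sup>2) * (ennreal (inverse (md (p + q))) * H (p + q)) \<partial>muQ)"
  proof (rule nn_integral_cong)
    fix q
    have "(\<integral>\<^sup>+\<xi>. h (p + q, da p \<xi>) \<partial>muX) = ennreal (md p) * H (p + q)"
      unfolding H_def by (rule nn_integral_da[where f = "\<lambda>\<xi>. h (p + q, \<xi>)"]) measurable
    moreover have "inverse (md q) * md p = (md p)\<^sup>2 * inverse (md (p + q))"
      by (simp add: md_add power2_eq_square)
    ultimately show "ennreal (inverse (md q)) * (\<integral>\<^sup>+\<xi>. h (p + q, da p \<xi>) \<partial>muX)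
        = ennreal ((md p)\<^sup>2) * (ennreal (inverse (md (p + q))) * H (p + q))"
      by (simp add: ennreal_mult_mult)
  qed
  also have "\<dots> = ennreal ((md p)\<^sup>2) * (\<integral>\<^sup>+q. ennreal (inverse (md (p + q))) * H (p + q) \<partial>muQ)"
    by (rule nn_integral_cmult) measurable
  also have "(\<integral>\<^sup>+q. ennreal (inverse (md (p + q))) * H (p + q) \<partial>muQ) = (\<integral>\<^sup>+q. ennreal (inverse (md q)) * H q \<partial>muQ)"
    by (rule Q.nn_integral_left[where f = "\<lambda>q. ennreal (inverse (md q)) * H q"]) measurable
  also have "\<dots> = (\<integral>\<^sup>+x. h x \<partial>X)" unfolding H_def by (rule nn_integral_X[symmetric]) measurable
  finally show ?thesis .
qed

text \<open>For fixed \<open>p\<close> the powers of \<open>md p\<close> balance: two inverse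
  factors from the squared multiplier and one from \<open>Qw\<close> against the two of
  \<open>nn_integral_X_left_act\<close> leave exactly the weight of \<open>Qw\<close>. Tonelli's
  theorem is used to keep \<open>p\<close> fixed meanwhile.\<close>

lemma L2_pullback_FW: "L2_pullback (X \<Otimes>\<^sub>M X) (X \<Otimes>\<^sub>M X) mFW \<phi>FW"
  unfolding L2_pullback_def
proof (intro conjI ballI)
  interpret X: sigma_finite_measure X by (rule sf)
  interpret mX: sigma_finite_measure muX by (rule sf)
  interpret Q: sigma_finite_measure muQ by (rule sf)
  interpret XQ: pair_sigma_finite X muQ ..
  show \<phi> [measurable]: "\<phi>FW \<in> measurable (X \<Otimes>\<^sub>M X) (X \<Otimes>\<^sub>M X)" unfolding \<phi>FW_def[abs_def] by measurable
  show m [measurable]: "mFW \<in> borel_measurable (X \<Otimes>\<^sub>M X)" unfolding mFW_def[abs_def] by measurable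
  fix h :: "_ \<Rightarrow> ennreal" assume h [measurable]: "h \<in> borel_measurable (X \<Otimes>\<^sub>M X)"
  have h' [measurable]: "h \<in> borel_measurable ((borel \<Otimes>\<^sub>M borel) \<Otimes>\<^sub>M (borel \<Otimes>\<^sub>M borel))"
    using h by (subst measurable_cong_sets[OF sets_pair_measure_cong[OF sets_X sets_X, symmetric] refl])
  \<comment> \<open>The second frequency enters only through a translate, so it is integrated out
    before the other variables.\<close>
  define K where "K x p = (\<integral>\<^sup>+\<zeta>. h (x, (p, \<zeta>)) \<partial>muX)" for x p
  have K [measurable]: "(\<lambda>z. K (fst z) (snd z)) \<in> borel_measurable ((borel \<Otimes>\<^sub>M borel) \<Otimes>\<^sub>M borel)"
    unfolding K_def[abs_def] by measurable
  have K' [measurable]: "(\<lambda>x. K x p) \<in> borel_measurable (borel \<Otimes>\<^sub>M borel)" for p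
    unfolding K_def[abs_def] by measurable
  have "(\<integral>\<^sup>+z. ennreal ((cmod (mFW z))\<^sup>2) * h (\<phi>FW z) \<partial>(X \<Otimes>\<^sub>M X))
      = (\<integral>\<^sup>+x. \<integral>\<^sup>+y. ennreal ((cmod (mFW (x, y)))\<^sup>2) * h (\<phi>FW (x, y)) \<partial>X \<partial>X)"
    by (rule X.nn_integral_fst[symmetric]) measurable
  also have "\<dots> = (\<integral>\<^sup>+x. \<integral>\<^sup>+p. ennreal (inverse (md p) ^ 3) * K (p + fst x, da p (snd x)) p \<partial>muQ \<partial>X)"
  proof (rule nn_integral_cong)
    fix x :: "'q \<times> 'v pdual"
    obtain q \<xi> where x: "x = (q, \<xi>)" by force
    have "(\<integral>\<^sup>+y. ennreal ((cmod (mFW (x, y)))\<^sup>2) * h (\<phi>FW (x, y)) \<partial>X)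
        = (\<integral>\<^sup>+y. ennreal ((inverse (md (fst y)))\<^sup>2) * h ((fst y + q, da (fst y) \<xi>), (fst y, snd y - da (fst y) \<xi>)) \<partial>X)"
      by (simp add: x mFW_def \<phi>FW_def norm_mult norm_inverse)
    also have "\<dots> = (\<integral>\<^sup>+p. ennreal (inverse (md p)) * (\<integral>\<^sup>+\<zeta>. ennreal ((inverse (md p))\<^sup>2) * h ((p + q, da p \<xi>), (p, \<zeta> - da p \<xi>)) \<partial>muX) \<partial>muQ)"
      by (subst nn_integral_X) auto
    also have "\<dots> = (\<integral>\<^sup>+p. ennreal (inverse (md p) ^ 3) * K (p + fst x, da p (snd x)) p \<partial>muQ)"
    proof (rule nn_integral_cong)
      fix p
      have "(\<integral>\<^sup>+\<zeta>. ennreal ((inverse (md p))\<^sup>2) * h ((p + q, da p \<xi>), (p, \<zeta> - da p \<xi>)) \<partial>muX)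
          = ennreal ((inverse (md p))\<^sup>2) * (\<integral>\<^sup>+\<zeta>. h ((p + q, da p \<xi>), (p, - da p \<xi> + \<zeta>)) \<partial>muX)"
        by (subst nn_integral_cmult) auto
      also have "(\<integral>\<^sup>+\<zeta>. h ((p + q, da p \<xi>), (p, - da p \<xi> + \<zeta>)) \<partial>muX) = K (p + q, da p \<xi>) p"
        unfolding K_def by (rule nn_integral_X_left) measurable
      finally show "ennreal (inverse (md p)) * (\<integral>\<^sup>+\<zeta>. ennreal ((inverse (md p))\<^sup>2) * h ((p + q, da p \<xi>), (p, \<zeta> - da p \<xi>)) \<partial>muX)
          = ennreal (inverse (md p) ^ 3) * K (p + fst x, da p (snd x)) p"
        by (simp add: x ennreal_mult_mult power3_eq_cube power2_eq_square mult.assoc)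
    qed
    finally show "(\<integral>\<^sup>+y. ennreal ((cmod (mFW (x, y)))\<^sup>2) * h (\<phi>FW (x, y)) \<partial>X)
        = (\<integral>\<^sup>+p. ennreal (inverse (md p) ^ 3) * K (p + fst x, da p (snd x)) p \<partial>muQ)" .
  qed
  also have "\<dots> = (\<integral>\<^sup>+p. \<integral>\<^sup>+x. ennreal (inverse (md p) ^ 3) * K (p + fst x, da p (snd x)) p \<partial>X \<partial>muQ)"
  proof (rule XQ.Fubini'[symmetric])
    have "(\<lambda>z. K (fst (snd z + fst (fst z), da (snd z) (snd (fst z)), snd z), fst (snd (snd z + fst (fst z), da (snd z) (snd (fst z)), snd z))) (snd z))
       \<in> borel_measurable (X \<Otimes>\<^sub>M muQ)"
      using measurable_compose[OF _ K, of "\<lambda>z. ((snd z + fst (fst z), da (snd z) (snd (fst z))), snd z)" "X \<Otimes>\<^sub>M muQ"] by simp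
    then have [measurable]: "(\<lambda>z. K (snd z + fst (fst z), da (snd z) (snd (fst z))) (snd z)) \<in> borel_measurable (X \<Otimes>\<^sub>M muQ)"
      by simp
    show "(\<lambda>(x, p). ennreal (inverse (md p) ^ 3) * K (p + fst x, da p (snd x)) p) \<in> borel_measurable (X \<Otimes>\<^sub>M muQ)"
      unfolding split_beta' by measurable
  qed
  also have "\<dots> = (\<integral>\<^sup>+p. ennreal (inverse (md p)) * (\<integral>\<^sup>+x. K x p \<partial>X) \<partial>muQ)"
  proof (rule nn_integral_cong)
    fix p
    have "(\<integral>\<^sup>+x. ennreal (inverse (md p) ^ 3) * K (p + fst x, da p (snd x)) p \<partial>X)
        = ennreal (inverse (md p) ^ 3) * (\<integral>\<^sup>+x. K (p + fst x, da p (snd x)) p \<partial>X)"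
      using measurable_compose[OF _ K', of "\<lambda>x. (p + fst x, da p (snd x))" X p]
      by (intro nn_integral_cmult) simp
    also have "(\<integral>\<^sup>+x. K (p + fst x, da p (snd x)) p \<partial>X) = ennreal ((md p)\<^sup>2) * (\<integral>\<^sup>+x. K x p \<partial>X)"
      by (rule nn_integral_X_left_act[OF K'])
    also have "ennreal (inverse (md p) ^ 3) * (ennreal ((md p)\<^sup>2) * (\<integral>\<^sup>+x. K x p \<partial>X)) = ennreal (inverse (md p)) * (\<integral>\<^sup>+x. K x p \<partial>X)"
    proof -
      have "inverse (md p) ^ 3 * (md p)\<^sup>2 = inverse (md p)" by (simp add: power3_eq_cube power2_eq_square divide_simps)
      then show ?thesis by (simp add: ennreal_mult_mult)
    qed
    finally show "(\<integral>\<^sup>+x. ennreal (inverse (md p) ^ 3) * K (p + fst x, da p (snd x)) p \<partial>X) = ennreal (inverse (md p)) * (\<integral>\<^sup>+x. K x p \<partial>X)" .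
  qed
  also have "\<dots> = (\<integral>\<^sup>+p. \<integral>\<^sup>+x. ennreal (inverse (md p)) * K x p \<partial>X \<partial>muQ)"
    by (intro nn_integral_cong nn_integral_cmult[symmetric]) measurable
  also have "\<dots> = (\<integral>\<^sup>+x. \<integral>\<^sup>+p. ennreal (inverse (md p)) * K x p \<partial>muQ \<partial>X)"
  proof (rule XQ.Fubini')
    have [measurable]: "(\<lambda>z. K (fst z) (snd z)) \<in> borel_measurable (X \<Otimes>\<^sub>M muQ)" using K by measurable
    show "(\<lambda>(x, p). ennreal (inverse (md p)) * K x p) \<in> borel_measurable (X \<Otimes>\<^sub>M muQ)"
      unfolding split_beta' by measurable
  qed
  also have "\<dots> = (\<integral>\<^sup>+x. \<integral>\<^sup>+y. h (x, y) \<partial>X \<partial>X)"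
  proof (rule nn_integral_cong)
    fix x :: "'q \<times> 'v pdual"
    show "(\<integral>\<^sup>+p. ennreal (inverse (md p)) * K x p \<partial>muQ) = (\<integral>\<^sup>+y. h (x, y) \<partial>X)"
      unfolding K_def
      by (rule nn_integral_X[symmetric, OF measurable_compose_Pair1[OF _ h']]) (simp add: space_pair_measure)
  qed
  also have "\<dots> = (\<integral>\<^sup>+z. h z \<partial>(X \<Otimes>\<^sub>M X))" by (rule X.nn_integral_fst) measurable
  finally show "(\<integral>\<^sup>+z. ennreal ((cmod (mFW z))\<^sup>2) * h (\<phi>FW z) \<partial>(X \<Otimes>\<^sub>M X)) = (\<integral>\<^sup>+z. h z \<partial>(X \<Otimes>\<^sub>M X))" .
qed


definition double_fourier :: "(('q \<times> 'v) \<times> ('q \<times> 'v) \<Rightarrow> complex) \<Rightarrow> ('q \<times> 'v pdual) \<times> ('q \<times> 'v pdual) \<Rightarrow> complex" where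
  "double_fourier f z = (\<integral>v. cnj (pairing (snd (fst z)) v) *
     (\<integral>w. cnj (pairing (snd (snd z)) w) * f ((fst (fst z), v), (fst (snd z), w)) \<partial>muV) \<partial>muV)"

text \<open>F \<otimes> F is factored as (F \<otimes> 1)(1 \<otimes> F), and the integral formula is
  used for each factor. Finiteness for every \<open>q\<close> and \<open>p\<close>, not just for
  almost every, keeps the intermediate function \<open>h\<close> integrable in every fibre.\<close>

lemma double_fourier_eq:
  assumes f: "f \<in> L2 (G \<Otimes>\<^sub>M G)"
    and fin: "\<And>q p. (\<integral>\<^sup>+v. \<integral>\<^sup>+w. ennreal (cmod (f ((q, v), (p, w)))) \<partial>muV \<partial>muV) < \<infinity>"
  shows "AE z in X \<Otimes>\<^sub>M X. L2_tensor G G X X F F f z = double_fourier f z"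
proof -
  interpret V: sigma_finite_measure muV by (rule sf)
  interpret QV: pair_sigma_finite Qw muV using sf by (simp add: pair_sigma_finite_def)
  interpret GQ: pair_sigma_finite G Qw using sf by (simp add: pair_sigma_finite_def)
  note Fo = L2_unitaryD(1)[OF F_unitary]
  have fm [measurable]: "f \<in> borel_measurable (G \<Otimes>\<^sub>M G)" by (rule L2_measurable[OF f])
  have fm' [measurable]: "f \<in> borel_measurable ((borel \<Otimes>\<^sub>M borel) \<Otimes>\<^sub>M (borel \<Otimes>\<^sub>M borel))"
    using fm by (subst measurable_cong_sets[OF sets_pair_measure_cong[OF sets_G sets_G, symmetric] refl])
  define N where "N z = (\<integral>\<^sup>+w. ennreal (cmod (f (fst z, (snd z, w)))) \<partial>muV)" for z
  have N [measurable]: "N \<in> borel_measurable (G \<Otimes>\<^sub>M Qw)" unfolding N_def[abs_def] by measurable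
  have N' [measurable]: "(\<lambda>y. N (y, p)) \<in> borel_measurable G" for p
    
  proof -
    have "(\<lambda>y. (y, p)) \<in> measurable G (G \<Otimes>\<^sub>M Qw)" by (rule measurable_Pair2') simp
    from measurable_compose[OF this N] show ?thesis by simp
  qed
  have N'' [measurable]: "(\<lambda>v. N ((q, v), p)) \<in> borel_measurable muV" for q p
  proof -
    have "(\<lambda>v. (q, v)) \<in> measurable muV G" unfolding G_def by (rule measurable_Pair1') simp
    from measurable_compose[OF this N'[of p]] show ?thesis by simp
  qed
  \<comment> \<open>The estimate is obtained with \<open>p\<close> fixed. The quantifiers are
    exchanged afterwards because \<open>kernel_operator_id_tensor\<close> expects the spectator
    variable \<open>y\<close> outermost.\<close>
  have "AE p in Qw. AE y in G. N (y, p) \<noteq> \<infinity>"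
  proof (rule AE_I2)
    fix p
    have "AE q in Qw. AE v in muV. N ((q, v), p) \<noteq> \<infinity>"
    proof (rule AE_I2)
      fix q
      show "AE v in muV. N ((q, v), p) \<noteq> \<infinity>"
        using fin[of q p] by (intro nn_integral_PInf_AE N'') (simp add: N_def)
    qed
    then show "AE y in G. N (y, p) \<noteq> \<infinity>"
      unfolding G_def using N'[of p, unfolded G_def] by (intro QV.AE_pair_measure) measurable
  qed
  moreover have "{z \<in> space (G \<Otimes>\<^sub>M Qw). N (fst z, snd z) \<noteq> \<infinity>} \<in> sets (G \<Otimes>\<^sub>M Qw)"
    unfolding prod.collapse by (rule borel_measurable_neq[OF N]) measurable
  ultimately have AN: "AE y in G. AE p in Qw. N (y, p) \<noteq> \<infinity>"
    using GQ.AE_commute[of "\<lambda>y p. N (y, p) \<noteq> \<infinity>"] by simp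
  have i1: "AE y in G. AE p in Qw. integrable muV (\<lambda>w. f (y, (p, w)))"
    using AN
  proof eventually_elim
    case (elim y)
    then show ?case
    proof eventually_elim
      case (elim p)
      have "(\<lambda>w. (y, (p, w))) \<in> measurable muV ((borel \<Otimes>\<^sub>M borel) \<Otimes>\<^sub>M (borel \<Otimes>\<^sub>M borel))"
        by (intro measurable_Pair measurable_const) (simp_all add: space_pair_measure)
      from measurable_compose[OF this fm'] have "(\<lambda>w. f (y, (p, w))) \<in> borel_measurable muV" by simp
      then show ?case using elim by (intro integrableI_bounded) (simp_all add: N_def less_top)
    qed
  qed
  define h where "h z = (\<integral>w. cnj (pairing (snd (snd z)) w) * f (fst z, (fst (snd z), w)) \<partial>muV)" for z
  have hm [measurable]: "h \<in> borel_measurable (G \<Otimes>\<^sub>M X)"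
    unfolding h_def[abs_def] by (rule kernel_integral_measurable[OF sf(2) kernel_measurable(1)]) measurable
  define f2 where "f2 = L2_tensor G G G X id F f"
  have f2: "f2 \<in> L2 (G \<Otimes>\<^sub>M X)"
    unfolding f2_def by (rule L2_operator_L2[OF L2_tensor_spec(1)[OF sf(5,5,5,6) L2_operator_id Fo] f])
  have f2m [measurable]: "f2 \<in> borel_measurable (G \<Otimes>\<^sub>M X)" by (rule L2_measurable[OF f2])
  have "AE z in G \<Otimes>\<^sub>M X. f2 z = h z"
    unfolding f2_def h_def
    by (rule kernel_operator_id_tensor[OF sf(4,2,3,5) F_kernel kernel_measurable(1), folded G_def X_def, OF f i1])
  from AE_pair_eqD(2)[OF sf(5,6) this]
  have s3: "AE y in X. AE q in Qw. AE v in muV. f2 ((q, v), y) = h ((q, v), y)"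
  proof eventually_elim
    case (elim y)
    from AE_pair_eqD(1)[OF sf(4,2) elim[unfolded G_def]] show ?case .
  qed
  have sl: "(\<lambda>v. f2 ((q, v), y)) \<in> borel_measurable muV" "(\<lambda>v. h ((q, v), y)) \<in> borel_measurable muV" for q y
  proof -
    have 1: "f2 \<in> borel_measurable ((borel \<Otimes>\<^sub>M borel) \<Otimes>\<^sub>M (borel \<Otimes>\<^sub>M borel))"
      "h \<in> borel_measurable ((borel \<Otimes>\<^sub>M borel) \<Otimes>\<^sub>M (borel \<Otimes>\<^sub>M borel))"
      using f2m hm by (subst measurable_cong_sets[OF sets_pair_measure_cong[OF sets_G sets_X, symmetric] refl]; simp)+
    have "(\<lambda>v. ((q, v), y)) \<in> measurable muV ((borel \<Otimes>\<^sub>M borel) \<Otimes>\<^sub>M (borel \<Otimes>\<^sub>M borel))"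
      by (intro measurable_Pair measurable_const) (simp_all add: space_pair_measure)
    from measurable_compose[OF this 1(1)] measurable_compose[OF this 1(2)]
    show "(\<lambda>v. f2 ((q, v), y)) \<in> borel_measurable muV" "(\<lambda>v. h ((q, v), y)) \<in> borel_measurable muV" by simp_all
  qed
  have hi: "integrable muV (\<lambda>v. h ((q, v), y))" for q y
  proof (rule integrableI_bounded[OF sl(2)])
    have "(\<integral>\<^sup>+v. ennreal (cmod (h ((q, v), y))) \<partial>muV) \<le> (\<integral>\<^sup>+v. \<integral>\<^sup>+w. ennreal (cmod (f ((q, v), (fst y, w)))) \<partial>muV \<partial>muV)"
    proof (rule nn_integral_mono)
      fix v
      show "ennreal (cmod (h ((q, v), y))) \<le> (\<integral>\<^sup>+w. ennreal (cmod (f ((q, v), (fst y, w)))) \<partial>muV)"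
        using norm_integral_le_nn[of muV "\<lambda>w. cnj (pairing (snd y) w) * f ((q, v), (fst y, w))"]
        by (simp add: h_def norm_mult)
    qed
    then show "(\<integral>\<^sup>+v. ennreal (cmod (h ((q, v), y))) \<partial>muV) < \<infinity>" using fin by (rule le_less_trans)
  qed
  have i2: "AE y in X. AE q in Qw. integrable muV (\<lambda>v. f2 ((q, v), y))"
    using s3
  proof eventually_elim
    case (elim y)
    then show ?case
    proof eventually_elim
      case (elim q)
      show ?case by (rule integrable_cong_AE_imp[OF hi[of q y] sl(1)]) (use elim in eventually_elim, simp)
    qed
  qed
  have s5: "AE z in X \<Otimes>\<^sub>M X. L2_tensor G X X X F id f2 z
      = (\<integral>v. cnj (pairing (snd (fst z)) v) * f2 ((fst (fst z), v), snd z) \<partial>muV)"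
    by (rule kernel_operator_tensor_id[OF sf(4,2,3,6) F_kernel kernel_measurable(1), folded G_def X_def, OF f2 i2])
  have s6: "AE z in X \<Otimes>\<^sub>M X. (\<integral>v. cnj (pairing (snd (fst z)) v) * f2 ((fst (fst z), v), snd z) \<partial>muV)
      = (\<integral>v. cnj (pairing (snd (fst z)) v) * h ((fst (fst z), v), snd z) \<partial>muV)"
  proof (rule AE_pair_eqI'[OF sf(6,6)])
    show "(\<lambda>z. \<integral>v. cnj (pairing (snd (fst z)) v) * f2 ((fst (fst z), v), snd z) \<partial>muV) \<in> borel_measurable (X \<Otimes>\<^sub>M X)"
      "(\<lambda>z. \<integral>v. cnj (pairing (snd (fst z)) v) * h ((fst (fst z), v), snd z) \<partial>muV) \<in> borel_measurable (X \<Otimes>\<^sub>M X)"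
      by (rule kernel_integral_measurable[OF sf(2) kernel_measurable(1)]; measurable)+
    show "AE y in X. AE x in X. (\<integral>v. cnj (pairing (snd (fst (x, y))) v) * f2 ((fst (fst (x, y)), v), snd (x, y)) \<partial>muV)
       = (\<integral>v. cnj (pairing (snd (fst (x, y))) v) * h ((fst (fst (x, y)), v), snd (x, y)) \<partial>muV)"
      using s3
    proof eventually_elim
      case (elim y)
      from AE_pair_fst[OF sf(4,3) this] show ?case
        unfolding X_def
      proof eventually_elim
        case (elim x)
        have [measurable]: "(\<lambda>v. f2 ((fst x, v), y)) \<in> borel_measurable muV" "(\<lambda>v. h ((fst x, v), y)) \<in> borel_measurable muV"
          by (rule sl)+
        show ?case
          unfolding fst_conv snd_conv
        proof (rule integral_cong_AE)
          show "(\<lambda>v. cnj (pairing (snd x) v) * f2 ((fst x, v), y)) \<in> borel_measurable muV"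
            "(\<lambda>v. cnj (pairing (snd x) v) * h ((fst x, v), y)) \<in> borel_measurable muV" by simp_all
          show "AE v in muV. cnj (pairing (snd x) v) * f2 ((fst x, v), y) = cnj (pairing (snd x) v) * h ((fst x, v), y)"
            using elim by eventually_elim simp
        qed
      qed
    qed
  qed
  have "AE z in X \<Otimes>\<^sub>M X. L2_tensor G X X X F id f2 z = L2_tensor G G X X F F f z"
    using L2_tensor_comp[OF sf(5,5,5,6,6,6) L2_operator_id Fo Fo L2_operator_id f] by (simp add: f2_def)
  with s5 s6 show ?thesis
    by eventually_elim (simp add: double_fourier_def h_def)
qed

text \<open>On rectangles all integrals converge absolutely. Their transforms factor into the
  integrals \<open>I B\<close> and \<open>I D\<close>, and \<open>W\<close> acts as a substitution
  in the variable belonging to \<open>B\<close>.\<close>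

lemma FFW_eq:
  assumes f: "f \<in> L2 (G \<Otimes>\<^sub>M G)"
  shows "AE z in X \<Otimes>\<^sub>M X. L2_tensor G G X X F F (pullback (\<lambda>_. 1) \<phi>W f) z
    = pullback mFW \<phi>FW (L2_tensor G G X X F F f) z"
proof -
  interpret V: sigma_finite_measure muV by (rule sf)
  interpret VV: pair_sigma_finite muV muV using sf by (simp add: pair_sigma_finite_def)
  let ?FF = "L2_tensor G G X X F F"
  note FF = L2_tensor_spec(1)[OF sf(5,5,6,6) L2_unitaryD(1)[OF F_unitary] L2_unitaryD(1)[OF F_unitary]]
  note Wo = L2_operator_pullback[OF L2_pullback_W]
  have 1: "L2_operator ((Qw \<Otimes>\<^sub>M muV) \<Otimes>\<^sub>M (Qw \<Otimes>\<^sub>M muV)) (X \<Otimes>\<^sub>M X) (?FF \<circ> pullback (\<lambda>_. 1) \<phi>W)"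
    using L2_operator_compose[OF Wo FF] by (simp add: G_def)
  have 2: "L2_operator ((Qw \<Otimes>\<^sub>M muV) \<Otimes>\<^sub>M (Qw \<Otimes>\<^sub>M muV)) (X \<Otimes>\<^sub>M X) (pullback mFW \<phi>FW \<circ> ?FF)"
    using L2_operator_compose[OF FF L2_operator_pullback[OF L2_pullback_FW]] by (simp add: G_def)
  have "AE z in X \<Otimes>\<^sub>M X. (?FF \<circ> pullback (\<lambda>_. 1) \<phi>W) f z = (pullback mFW \<phi>FW \<circ> ?FF) f z"
  proof (rule L2_operators_eq_rect[OF sf(4,2,4,2) 1 2 _ f[unfolded G_def]])
    fix A B C D
    assume A: "A \<in> sets Qw" "emeasure Qw A < \<infinity>" and B: "B \<in> sets muV" "emeasure muV B < \<infinity>"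
      and C: "C \<in> sets Qw" "emeasure Qw C < \<infinity>" and D: "D \<in> sets muV" "emeasure muV D < \<infinity>"
    let ?f = "tensor_fun (tensor_fun (indicator A) (indicator B)) (tensor_fun (indicator C) (indicator D)) :: _ \<Rightarrow> complex"
    let ?Wf = "pullback (\<lambda>_. 1) \<phi>W ?f"
    have [measurable]: "A \<in> sets borel" "B \<in> sets borel" "C \<in> sets borel" "D \<in> sets borel"
      using A B C D by simp_all
    have f2: "?f \<in> L2 (G \<Otimes>\<^sub>M G)" by (intro L2_tensor_fun rect_L2 sf A B C D)
    have Wf2: "?Wf \<in> L2 (G \<Otimes>\<^sub>M G)" by (rule L2_operator_L2[OF Wo f2])
    have fe: "?f ((q, v), (p, w)) = indicator A q * indicator B v * (indicator C p * indicator D w)" for q v p w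
      by (simp add: tensor_fun_def)
    have We: "?Wf ((q, v), (p, w)) = indicator A (p + q) * indicator B (w + act p v + \<beta> p q) * (indicator C p * indicator D w)" for q v p w
      by (simp add: pullback_def \<phi>W_def ext_mult_eq tensor_fun_def)
    have cind: "ennreal (cmod (indicator A1 a * indicator B1 b * (indicator C1 c * indicator D1 d))) \<le> indicator B1 b * indicator D1 d"
      for A1 :: "'q set" and B1 :: "'v set" and C1 :: "'q set" and D1 :: "'v set" and a b c d
      by (auto simp: indicator_def)
    have ffin: "(\<integral>\<^sup>+v. \<integral>\<^sup>+w. ennreal (cmod (?f ((q, v), (p, w)))) \<partial>muV \<partial>muV) < \<infinity>" for q p
    proof -
      have "(\<integral>\<^sup>+v. \<integral>\<^sup>+w. ennreal (cmod (?f ((q, v), (p, w)))) \<partial>muV \<partial>muV) \<le> (\<integral>\<^sup>+v. \<integral>\<^sup>+w. indicator B v * indicator D w \<partial>muV \<partial>muV)"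
        unfolding fe by (intro nn_integral_mono cind)
      also have "\<dots> = emeasure muV B * emeasure muV D"
        by (simp add: nn_integral_cmult nn_integral_multc)
      also have "\<dots> < \<infinity>" using B D by (simp add: ennreal_mult_less_top)
      finally show ?thesis .
    qed
    have Wfin: "(\<integral>\<^sup>+v. \<integral>\<^sup>+w. ennreal (cmod (?Wf ((q, v), (p, w)))) \<partial>muV \<partial>muV) < \<infinity>" for q p
    proof -
      have "(\<integral>\<^sup>+v. \<integral>\<^sup>+w. ennreal (cmod (?Wf ((q, v), (p, w)))) \<partial>muV \<partial>muV)
          \<le> (\<integral>\<^sup>+v. \<integral>\<^sup>+w. indicator B (w + act p v + \<beta> p q) * indicator D w \<partial>muV \<partial>muV)"
        unfolding We by (intro nn_integral_mono cind)
      also have "\<dots> = (\<integral>\<^sup>+w. \<integral>\<^sup>+v. indicator B (w + act p v + \<beta> p q) * indicator D w \<partial>muV \<partial>muV)"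
        by (rule VV.Fubini') measurable
      also have "\<dots> = (\<integral>\<^sup>+w. ennreal (inverse (md p)) * emeasure muV B * indicator D w \<partial>muV)"
      proof (rule nn_integral_cong)
        fix w
        have "(\<integral>\<^sup>+v. indicator B (w + act p v + \<beta> p q) * indicator D w \<partial>muV) = (\<integral>\<^sup>+v. indicator B (w + act p v + \<beta> p q) \<partial>muV) * indicator D w"
          by (rule nn_integral_multc) measurable
        also have "(\<integral>\<^sup>+v. indicator B (w + act p v + \<beta> p q) \<partial>muV) = ennreal (inverse (md p)) * emeasure muV B"
          by (subst nn_integral_V_affine') auto
        finally show "(\<integral>\<^sup>+v. indicator B (w + act p v + \<beta> p q) * indicator D w \<partial>muV) = ennreal (inverse (md p)) * emeasure muV B * indicator D w" .
      qed
      also have "\<dots> = ennreal (inverse (md p)) * emeasure muV B * emeasure muV D"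
        by (subst nn_integral_cmult) auto
      also have "\<dots> < \<infinity>" using B D by (simp add: ennreal_mult_less_top)
      finally show ?thesis .
    qed
    define I where "I S \<xi> = (\<integral>v. cnj (pairing \<xi> v) * indicator S v \<partial>muV)" for S :: "'v set" and \<xi>
    have f_int: "double_fourier ?f ((q, \<xi>), (p, \<zeta>)) = indicator A q * indicator C p * (I B \<xi> * I D \<zeta>)" for q \<xi> p \<zeta>
    proof -
      have i: "(\<integral>w. cnj (pairing \<zeta> w) * (indicator A q * indicator B v * (indicator C p * indicator D w)) \<partial>muV)
          = indicator A q * indicator B v * indicator C p * I D \<zeta>" for v
      proof -
        have "(\<integral>w. cnj (pairing \<zeta> w) * (indicator A q * indicator B v * (indicator C p * indicator D w)) \<partial>muV)
            = (\<integral>w. indicator A q * indicator B v * indicator C p * (cnj (pairing \<zeta> w) * indicator D w) \<partial>muV)"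
          by (rule Bochner_Integration.integral_cong) (simp_all only: mult_ac refl)
        also have "\<dots> = indicator A q * indicator B v * indicator C p * I D \<zeta>"
          unfolding I_def by (rule integral_mult_right_zero)
        finally show ?thesis .
      qed
      have "double_fourier ?f ((q, \<xi>), (p, \<zeta>)) = (\<integral>v. (cnj (pairing \<xi> v) * indicator B v) * (indicator A q * indicator C p * I D \<zeta>) \<partial>muV)"
        unfolding double_fourier_def fst_conv snd_conv fe i
        by (rule Bochner_Integration.integral_cong) (simp_all only: mult_ac refl)
      also have "\<dots> = I B \<xi> * (indicator A q * indicator C p * I D \<zeta>)"
        unfolding I_def[of B] by (rule integral_mult_left_zero)
      also have "\<dots> = indicator A q * indicator C p * (I B \<xi> * I D \<zeta>)" by (simp only: mult_ac)
      finally show ?thesis .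
    qed
    have W_int: "double_fourier ?Wf z = pullback mFW \<phi>FW (double_fourier ?f) z" for z
    proof -
      obtain q \<xi> p \<zeta> where z: "z = ((q, \<xi>), (p, \<zeta>))" by (metis prod.collapse)
      let ?c = "indicator A (p + q) * indicator C p :: complex"
      let ?k = "\<lambda>v w. cnj (pairing \<xi> v) * (cnj (pairing \<zeta> w) * ?Wf ((q, v), (p, w)))"
      \<comment> \<open>Integrating over \<open>v\<close> before \<open>w\<close> allows the
        substitution \<open>T\<close>; its shift by \<open>w\<close> feeds the character
        \<open>da p \<xi>\<close> into the remaining integral.\<close>
      have inner: "(\<integral>v. ?k v w \<partial>muV) = (cnj (pairing (\<zeta> - da p \<xi>) w) * indicator D w) *
         (?c * of_real (inverse (md p)) * pairing (da p \<xi>) (\<beta> p q) * I B (da p \<xi>))" for w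
      proof -
        define T where "T v = w + act p v + \<beta> p q" for v
        have Tm: "T \<in> measurable muV muV" unfolding T_def[abs_def] by measurable
        have p: "cnj (pairing \<xi> v) = pairing (da p \<xi>) (w + \<beta> p q) * cnj (pairing (da p \<xi>) (T v))" for v
        proof -
          have 1: "T v = act p v + (w + \<beta> p q)" by (simp add: T_def add_ac)
          have 2: "pairing (da p \<xi>) (act p v) = pairing \<xi> v" by (simp add: pairing_da)
          have "pairing (da p \<xi>) (T v) = pairing \<xi> v * pairing (da p \<xi>) (w + \<beta> p q)"
            unfolding 1 pairing_add[of "da p \<xi>" "act p v"] 2 by (rule refl)
          then have 3: "inverse (pairing (da p \<xi>) (T v)) = inverse (pairing (da p \<xi>) (w + \<beta> p q)) * inverse (pairing \<xi> v)"
            by (simp only: inverse_mult_distrib mult.commute)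
          show ?thesis
            unfolding cnj_pairing 3 mult.assoc[symmetric] by (subst right_inverse) simp_all
        qed
        have "(\<integral>v. ?k v w \<partial>muV) = (\<integral>v. (cnj (pairing \<zeta> w) * indicator D w * ?c * pairing (da p \<xi>) (w + \<beta> p q)) *
            (cnj (pairing (da p \<xi>) (T v)) * indicator B (T v)) \<partial>muV)"
          unfolding p We by (simp add: T_def mult_ac)
        also have "\<dots> = (cnj (pairing \<zeta> w) * indicator D w * ?c * pairing (da p \<xi>) (w + \<beta> p q)) *
            (\<integral>v. cnj (pairing (da p \<xi>) (T v)) * indicator B (T v) \<partial>muV)"
          by (rule integral_mult_right_zero)
        also have "(\<integral>v. cnj (pairing (da p \<xi>) (T v)) * indicator B (T v) \<partial>muV) = of_real (inverse (md p)) * I B (da p \<xi>)"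
          unfolding I_def
        proof (rule scaled_integral(2)[OF Tm, where f = "\<lambda>x. cnj (pairing (da p \<xi>) x) * indicator B x"])
          show "(\<integral>\<^sup>+v. h (T v) \<partial>muV) = ennreal (inverse (md p)) * (\<integral>\<^sup>+v. h v \<partial>muV)" if "h \<in> borel_measurable muV" for h
            unfolding T_def using that by (intro nn_integral_V_affine') simp
          show "integrable muV (\<lambda>x. cnj (pairing (da p \<xi>) x) * indicator B x)"
            by (rule Bochner_Integration.integrable_bound[OF integrable_indicator_L2[OF B]]) (measurable, simp add: norm_mult)
        qed simp
        finally show ?thesis
          by (simp add: pairing_add pairing_diff_left cnj_pairing mult_ac divide_inverse)
      qed
      have int: "integrable (muV \<Otimes>\<^sub>M muV) (\<lambda>(v, w). ?k v w)"
      proof (rule integrableI_bounded)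
        show m [measurable]: "(\<lambda>(v, w). ?k v w) \<in> borel_measurable (muV \<Otimes>\<^sub>M muV)" unfolding We by measurable
        have "(\<integral>\<^sup>+z. ennreal (norm (case z of (v, w) \<Rightarrow> ?k v w)) \<partial>(muV \<Otimes>\<^sub>M muV))
            = (\<integral>\<^sup>+v. \<integral>\<^sup>+w. ennreal (cmod (?Wf ((q, v), (p, w)))) \<partial>muV \<partial>muV)"
          by (subst V.nn_integral_fst[symmetric]) (measurable, simp add: norm_mult)
        then show "(\<integral>\<^sup>+z. ennreal (norm (case z of (v, w) \<Rightarrow> ?k v w)) \<partial>(muV \<Otimes>\<^sub>M muV)) < \<infinity>" using Wfin by simp
      qed
      have "double_fourier ?Wf z = (\<integral>v. \<integral>w. ?k v w \<partial>muV \<partial>muV)"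
        unfolding double_fourier_def z fst_conv snd_conv by (simp only: integral_mult_right_zero)
      also have "\<dots> = (\<integral>w. \<integral>v. ?k v w \<partial>muV \<partial>muV)"
        by (rule VV.Fubini_integral[OF int, symmetric])
      also have "\<dots> = I D (\<zeta> - da p \<xi>) * (?c * of_real (inverse (md p)) * pairing (da p \<xi>) (\<beta> p q) * I B (da p \<xi>))"
        unfolding inner I_def by (rule integral_mult_left_zero)
      also have "\<dots> = pullback mFW \<phi>FW (double_fourier ?f) z"
        by (simp add: pullback_def z mFW_def \<phi>FW_def f_int mult_ac)
      finally show ?thesis .
    qed
    have "AE z in X \<Otimes>\<^sub>M X. pullback mFW \<phi>FW (?FF ?f) z = pullback mFW \<phi>FW (double_fourier ?f) z"
      by (rule pullback_cong_AE[OF L2_pullback_FW double_fourier_eq[OF f2 ffin]])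
    with double_fourier_eq[OF Wf2 Wfin]
    show "AE z in X \<Otimes>\<^sub>M X. (?FF \<circ> pullback (\<lambda>_. 1) \<phi>W) ?f z = (pullback mFW \<phi>FW \<circ> ?FF) ?f z"
      by eventually_elim (simp add: W_int)
  qed
  then show ?thesis by simp
qed


section \<open>The Galois map\<close>

abbreviation "dfl \<equiv> duflo_moore muQ muV act"

lemma dfl_eq: "dfl q = md q * inverse (\<Delta> q)"
  by (simp add: duflo_moore_def)

lemma dfl_pos [simp]: "0 < dfl q"
  by (simp add: dfl_eq)

lemma dfl_nonneg [simp]: "0 \<le> dfl q" and dfl_nonzero [simp]: "dfl q \<noteq> 0"
  using dfl_pos[of q] by linarith+

lemma measurable_dfl [measurable]: "dfl \<in> borel_measurable borel"
  unfolding dfl_eq[abs_def] by measurable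

definition \<kappa>G :: "('q \<times> 'v pdual) \<times> ('q \<times> 'q) \<Rightarrow> 'q" where
  "\<kappa>G z = \<eta>inv (snd (fst z) + \<eta> (fst (snd z)))"

text \<open>\<open>mG\<close> and \<open>\<phi>G\<close> give the Galois map after a Fourier transform in \<open>v\<close>: the kernel of \<open>\<pi>(q,v) S \<pi>(q,v)\<^sup>* T\<close> is an
  integral over a variable \<open>s\<close> in \<open>Q\<close> with phase \<open>\<langle>\<eta>(s) - \<eta>(q0), v\<rangle>\<close>, and \<open>\<kappa>G\<close> recovers \<open>s\<close> from the frequency
  \<open>\<xi> = \<eta>(s) - \<eta>(q0)\<close>.\<close>

definition mG :: "('q \<times> 'v pdual) \<times> ('q \<times> 'q) \<Rightarrow> complex" where
  "mG z = of_real (md (\<kappa>G z) * inverse (sqrt (dfl (- fst (fst z) + \<kappa>G z))))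
     * (b (- fst (snd z)) (fst (fst z)) * cnj (b (- \<kappa>G z) (fst (fst z))))"

definition \<phi>G :: "('q \<times> 'v pdual) \<times> ('q \<times> 'q) \<Rightarrow> ('q \<times> 'q) \<times> ('q \<times> 'q)" where
  "\<phi>G z = ((- fst (fst z) + fst (snd z), - fst (fst z) + \<kappa>G z), (\<kappa>G z, snd (snd z)))"

text \<open>Inversion and right translation each cost a modular factor, and the weight
  \<open>\<Delta> (- q + r)\<close> compensates both.\<close>

lemma nn_integral_reflect:
  assumes [measurable]: "k \<in> borel_measurable borel"
  shows "(\<integral>\<^sup>+q. ennreal (\<Delta> (- q + r)) * k (- q + r) \<partial>muQ) = (\<integral>\<^sup>+q. k q \<partial>muQ)"
proof -
  have "(\<integral>\<^sup>+q. ennreal (\<Delta> (- q + r)) * k (- q + r) \<partial>muQ)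
      = (\<integral>\<^sup>+q. ennreal (inverse (\<Delta> q)) * (ennreal (\<Delta> (q + r)) * k (q + r)) \<partial>muQ)"
    by (rule Q.nn_integral_inverse[where f = "\<lambda>q. ennreal (\<Delta> (q + r)) * k (q + r)"]) measurable
  also have "\<dots> = (\<integral>\<^sup>+q. ennreal (\<Delta> r) * k (q + r) \<partial>muQ)"
  proof (rule nn_integral_cong)
    fix q
    have "inverse (\<Delta> q) * (\<Delta> q * \<Delta> r) = \<Delta> r"
      by (simp add: mult.assoc[symmetric])
    then show "ennreal (inverse (\<Delta> q)) * (ennreal (\<Delta> (q + r)) * k (q + r)) = ennreal (\<Delta> r) * k (q + r)"
      by (simp only: ennreal_mult_mult Q.modular_function_add Delta_nonneg inverse_nonnegative_iff_nonnegative mult_nonneg_nonneg)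
  qed
  also have "\<dots> = ennreal (\<Delta> r) * (\<integral>\<^sup>+q. k (q + r) \<partial>muQ)"
    by (rule nn_integral_cmult) measurable
  also have "(\<integral>\<^sup>+q. k (q + r) \<partial>muQ) = ennreal (inverse (\<Delta> r)) * (\<integral>\<^sup>+q. k q \<partial>muQ)"
    by (rule Q.nn_integral_right) measurable
  finally show ?thesis by (simp add: ennreal_mult_mult)
qed

lemma measurable_\<kappa>G: "\<kappa>G \<in> borel_measurable (X \<Otimes>\<^sub>M HS)"
  "\<kappa>G \<in> borel_measurable ((borel \<Otimes>\<^sub>M borel) \<Otimes>\<^sub>M (borel \<Otimes>\<^sub>M borel))"
  unfolding \<kappa>G_def[abs_def] by measurable

text \<open>Passing from \<xi> to s = \<open>\<kappa>G z\<close> costs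
  \<open>inverse (md s)\<close>. All weights then combine to \<open>\<Delta> (- q + s)\<close>,
  precisely because of the Duflo-Moore factor in \<open>mG\<close>, and
  \<open>nn_integral_reflect\<close> trades \<open>q\<close> for the free variable
  \<open>- q + s\<close>.\<close>

lemma L2_pullback_G: "L2_pullback (X \<Otimes>\<^sub>M HS) (HS \<Otimes>\<^sub>M HS) mG \<phi>G"
  unfolding L2_pullback_def
proof (intro conjI ballI)
  note [measurable] = measurable_\<kappa>G
  show "\<phi>G \<in> measurable (X \<Otimes>\<^sub>M HS) (HS \<Otimes>\<^sub>M HS)" unfolding \<phi>G_def[abs_def] by measurable
  show "mG \<in> borel_measurable (X \<Otimes>\<^sub>M HS)" unfolding mG_def[abs_def] by measurable
  have [measurable]: "\<phi>G \<in> (borel \<Otimes>\<^sub>M borel) \<Otimes>\<^sub>M (borel \<Otimes>\<^sub>M borel) \<rightarrow>\<^sub>M (borel \<Otimes>\<^sub>M borel) \<Otimes>\<^sub>M (borel \<Otimes>\<^sub>M borel)"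
    "mG \<in> borel_measurable ((borel \<Otimes>\<^sub>M borel) \<Otimes>\<^sub>M (borel \<Otimes>\<^sub>M borel))"
    unfolding \<phi>G_def[abs_def] mG_def[abs_def] by measurable
  fix h :: "_ \<Rightarrow> ennreal" assume "h \<in> borel_measurable (HS \<Otimes>\<^sub>M HS)"
  then have h [measurable]: "h \<in> borel_measurable ((borel \<Otimes>\<^sub>M borel) \<Otimes>\<^sub>M (borel \<Otimes>\<^sub>M borel))" by measurable
  interpret Q: sigma_finite_measure muQ by (rule sf)
  interpret HS: sigma_finite_measure HS by (rule sf)
  interpret QQ: pair_sigma_finite muQ muQ using sf by (simp add: pair_sigma_finite_def)
  interpret QX: pair_sigma_finite muX muQ using sf by (simp add: pair_sigma_finite_def)
  \<comment> \<open>The last variable is left untouched by \<open>\<phi>G\<close>, so it is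
    integrated out before the others.\<close>
  define H where "H a c r = (\<integral>\<^sup>+p. h ((a, c), (r, p)) \<partial>muQ)" for a c r
  have [measurable (raw)]: "(\<lambda>x. H (f x) (g x) (l x)) \<in> borel_measurable M"
    if [measurable]: "f \<in> borel_measurable M" "g \<in> borel_measurable M" "l \<in> borel_measurable M" for f g l and M :: "'z measure"
    unfolding H_def by measurable
  have m2: "ennreal ((cmod (mG ((q, \<xi>), (p, r))))\<^sup>2) * h (\<phi>G ((q, \<xi>), (p, r)))
      = ennreal ((md s)\<^sup>2 * inverse (dfl (- q + s))) * h ((- q + p, - q + s), (s, r))"
    if "s = \<eta>inv (\<xi> + \<eta> p)" for q \<xi> p r s
  proof -
    have "\<kappa>G ((q, \<xi>), (p, r)) = s" by (simp add: \<kappa>G_def that)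
    then show ?thesis
      by (simp add: mG_def \<phi>G_def norm_mult power_mult_distrib norm_inverse power_inverse)
  qed
  have "(\<integral>\<^sup>+z. ennreal ((cmod (mG z))\<^sup>2) * h (\<phi>G z) \<partial>(X \<Otimes>\<^sub>M HS))
      = (\<integral>\<^sup>+x. \<integral>\<^sup>+y. ennreal ((cmod (mG (x, y)))\<^sup>2) * h (\<phi>G (x, y)) \<partial>HS \<partial>X)"
    by (rule HS.nn_integral_fst[symmetric]) measurable
  also have "\<dots> = (\<integral>\<^sup>+q. ennreal (inverse (md q)) *
      (\<integral>\<^sup>+\<xi>. \<integral>\<^sup>+y. ennreal ((cmod (mG ((q, \<xi>), y)))\<^sup>2) * h (\<phi>G ((q, \<xi>), y)) \<partial>HS \<partial>muX) \<partial>muQ)"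
    by (rule nn_integral_X) measurable
  also have "\<dots> = (\<integral>\<^sup>+q. \<integral>\<^sup>+a. \<integral>\<^sup>+s. ennreal (\<Delta> (- q + s)) * H a (- q + s) s \<partial>muQ \<partial>muQ \<partial>muQ)"
  proof (rule nn_integral_cong)
    fix q
    define w where "w s = ennreal ((md s)\<^sup>2 * inverse (dfl (- q + s)))" for s
    have [measurable]: "w \<in> borel_measurable borel" unfolding w_def[abs_def] by measurable
    have "(\<integral>\<^sup>+\<xi>. \<integral>\<^sup>+y. ennreal ((cmod (mG ((q, \<xi>), y)))\<^sup>2) * h (\<phi>G ((q, \<xi>), y)) \<partial>HS \<partial>muX)
        = (\<integral>\<^sup>+\<xi>. \<integral>\<^sup>+p. w (\<eta>inv (\<xi> + \<eta> p)) * H (- q + p) (- q + \<eta>inv (\<xi> + \<eta> p)) (\<eta>inv (\<xi> + \<eta> p)) \<partial>muQ \<partial>muX)"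
    proof (rule nn_integral_cong)
      fix \<xi>
      have "(\<integral>\<^sup>+y. ennreal ((cmod (mG ((q, \<xi>), y)))\<^sup>2) * h (\<phi>G ((q, \<xi>), y)) \<partial>HS)
          = (\<integral>\<^sup>+p. \<integral>\<^sup>+r. ennreal ((cmod (mG ((q, \<xi>), (p, r))))\<^sup>2) * h (\<phi>G ((q, \<xi>), (p, r))) \<partial>muQ \<partial>muQ)"
        by (rule nn_integral_HS) measurable
      also have "\<dots> = (\<integral>\<^sup>+p. w (\<eta>inv (\<xi> + \<eta> p)) * H (- q + p) (- q + \<eta>inv (\<xi> + \<eta> p)) (\<eta>inv (\<xi> + \<eta> p)) \<partial>muQ)"
      proof (rule nn_integral_cong)
        fix p
        have "(\<integral>\<^sup>+r. ennreal ((cmod (mG ((q, \<xi>), (p, r))))\<^sup>2) * h (\<phi>G ((q, \<xi>), (p, r))) \<partial>muQ)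
            = (\<integral>\<^sup>+r. w (\<eta>inv (\<xi> + \<eta> p)) * h ((- q + p, - q + \<eta>inv (\<xi> + \<eta> p)), (\<eta>inv (\<xi> + \<eta> p), r)) \<partial>muQ)"
          unfolding w_def m2[OF refl] by (rule refl)
        also have "\<dots> = w (\<eta>inv (\<xi> + \<eta> p)) * H (- q + p) (- q + \<eta>inv (\<xi> + \<eta> p)) (\<eta>inv (\<xi> + \<eta> p))"
          unfolding H_def by (rule nn_integral_cmult) measurable
        finally show "(\<integral>\<^sup>+r. ennreal ((cmod (mG ((q, \<xi>), (p, r))))\<^sup>2) * h (\<phi>G ((q, \<xi>), (p, r))) \<partial>muQ)
            = w (\<eta>inv (\<xi> + \<eta> p)) * H (- q + p) (- q + \<eta>inv (\<xi> + \<eta> p)) (\<eta>inv (\<xi> + \<eta> p))" .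
      qed
      finally show "(\<integral>\<^sup>+y. ennreal ((cmod (mG ((q, \<xi>), y)))\<^sup>2) * h (\<phi>G ((q, \<xi>), y)) \<partial>HS)
          = (\<integral>\<^sup>+p. w (\<eta>inv (\<xi> + \<eta> p)) * H (- q + p) (- q + \<eta>inv (\<xi> + \<eta> p)) (\<eta>inv (\<xi> + \<eta> p)) \<partial>muQ)" .
    qed
    also have "\<dots> = (\<integral>\<^sup>+p. \<integral>\<^sup>+\<xi>. w (\<eta>inv (\<xi> + \<eta> p)) * H (- q + p) (- q + \<eta>inv (\<xi> + \<eta> p)) (\<eta>inv (\<xi> + \<eta> p)) \<partial>muX \<partial>muQ)"
      by (rule QX.Fubini'[symmetric]) measurable
    also have "\<dots> = (\<integral>\<^sup>+p. \<integral>\<^sup>+s. w s * H (- q + p) (- q + s) s * ennreal (inverse (md s)) \<partial>muQ \<partial>muQ)"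
    proof (rule nn_integral_cong)
      fix p
      have "(\<integral>\<^sup>+\<xi>. w (\<eta>inv (\<xi> + \<eta> p)) * H (- q + p) (- q + \<eta>inv (\<xi> + \<eta> p)) (\<eta>inv (\<xi> + \<eta> p)) \<partial>muX)
          = (\<integral>\<^sup>+\<xi>. w (\<eta>inv \<xi>) * H (- q + p) (- q + \<eta>inv \<xi>) (\<eta>inv \<xi>) \<partial>muX)"
        using nn_integral_X_left[of "\<lambda>\<xi>. w (\<eta>inv \<xi>) * H (- q + p) (- q + \<eta>inv \<xi>) (\<eta>inv \<xi>)" "\<eta> p"]
        by (simp add: add.commute)
      also have "\<dots> = (\<integral>\<^sup>+s. w s * H (- q + p) (- q + s) s * ennreal (inverse (md s)) \<partial>muQ)"
        by (rule nn_integral_etainv) measurable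
      finally show "(\<integral>\<^sup>+\<xi>. w (\<eta>inv (\<xi> + \<eta> p)) * H (- q + p) (- q + \<eta>inv (\<xi> + \<eta> p)) (\<eta>inv (\<xi> + \<eta> p)) \<partial>muX)
          = (\<integral>\<^sup>+s. w s * H (- q + p) (- q + s) s * ennreal (inverse (md s)) \<partial>muQ)" .
    qed
    also have "\<dots> = (\<integral>\<^sup>+a. \<integral>\<^sup>+s. w s * H a (- q + s) s * ennreal (inverse (md s)) \<partial>muQ \<partial>muQ)"
      by (rule Q.nn_integral_left[where f = "\<lambda>a. \<integral>\<^sup>+s. w s * H a (- q + s) s * ennreal (inverse (md s)) \<partial>muQ"]) measurable
    finally have "ennreal (inverse (md q)) *
        (\<integral>\<^sup>+\<xi>. \<integral>\<^sup>+y. ennreal ((cmod (mG ((q, \<xi>), y)))\<^sup>2) * h (\<phi>G ((q, \<xi>), y)) \<partial>HS \<partial>muX)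
        = (\<integral>\<^sup>+a. ennreal (inverse (md q)) * (\<integral>\<^sup>+s. w s * H a (- q + s) s * ennreal (inverse (md s)) \<partial>muQ) \<partial>muQ)"
      by (simp add: nn_integral_cmult)
    also have "\<dots> = (\<integral>\<^sup>+a. \<integral>\<^sup>+s. ennreal (\<Delta> (- q + s)) * H a (- q + s) s \<partial>muQ \<partial>muQ)"
    proof (rule nn_integral_cong)
      fix a
      have "ennreal (inverse (md q)) * (\<integral>\<^sup>+s. w s * H a (- q + s) s * ennreal (inverse (md s)) \<partial>muQ)
          = (\<integral>\<^sup>+s. ennreal (inverse (md q)) * (w s * H a (- q + s) s * ennreal (inverse (md s))) \<partial>muQ)"
        by (rule nn_integral_cmult[symmetric]) measurable
      also have "\<dots> = (\<integral>\<^sup>+s. ennreal (\<Delta> (- q + s)) * H a (- q + s) s \<partial>muQ)"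
      proof (rule nn_integral_cong)
        fix s
        have "inverse (md q) * ((md s)\<^sup>2 * inverse (dfl (- q + s)) * inverse (md s)) = \<Delta> (- q + s)"
          by (simp add: dfl_eq md_add md_minus power2_eq_square field_simps)
        then have "ennreal (inverse (md q)) * (w s * ennreal (inverse (md s))) = ennreal (\<Delta> (- q + s))"
          by (simp add: w_def flip: ennreal_mult)
        then show "ennreal (inverse (md q)) * (w s * H a (- q + s) s * ennreal (inverse (md s))) = ennreal (\<Delta> (- q + s)) * H a (- q + s) s"
          by (metis mult.assoc mult.commute)
      qed
      finally show "ennreal (inverse (md q)) * (\<integral>\<^sup>+s. w s * H a (- q + s) s * ennreal (inverse (md s)) \<partial>muQ)
          = (\<integral>\<^sup>+s. ennreal (\<Delta> (- q + s)) * H a (- q + s) s \<partial>muQ)" .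
    qed
    finally show "ennreal (inverse (md q)) *
        (\<integral>\<^sup>+\<xi>. \<integral>\<^sup>+y. ennreal ((cmod (mG ((q, \<xi>), y)))\<^sup>2) * h (\<phi>G ((q, \<xi>), y)) \<partial>HS \<partial>muX)
        = (\<integral>\<^sup>+a. \<integral>\<^sup>+s. ennreal (\<Delta> (- q + s)) * H a (- q + s) s \<partial>muQ \<partial>muQ)" .
  qed
  also have "\<dots> = (\<integral>\<^sup>+a. \<integral>\<^sup>+q. \<integral>\<^sup>+s. ennreal (\<Delta> (- q + s)) * H a (- q + s) s \<partial>muQ \<partial>muQ \<partial>muQ)"
    by (rule QQ.Fubini'[symmetric]) measurable
  also have "\<dots> = (\<integral>\<^sup>+a. \<integral>\<^sup>+c. \<integral>\<^sup>+s. H a c s \<partial>muQ \<partial>muQ \<partial>muQ)"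
  proof (rule nn_integral_cong)
    fix a
    have "(\<integral>\<^sup>+q. \<integral>\<^sup>+s. ennreal (\<Delta> (- q + s)) * H a (- q + s) s \<partial>muQ \<partial>muQ)
        = (\<integral>\<^sup>+s. \<integral>\<^sup>+q. ennreal (\<Delta> (- q + s)) * H a (- q + s) s \<partial>muQ \<partial>muQ)"
      by (rule QQ.Fubini'[symmetric]) measurable
    also have "\<dots> = (\<integral>\<^sup>+s. \<integral>\<^sup>+c. H a c s \<partial>muQ \<partial>muQ)"
    proof (rule nn_integral_cong)
      fix s
      show "(\<integral>\<^sup>+q. ennreal (\<Delta> (- q + s)) * H a (- q + s) s \<partial>muQ) = (\<integral>\<^sup>+c. H a c s \<partial>muQ)"
        by (rule nn_integral_reflect[where k = "\<lambda>c. H a c s"]) measurable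
    qed
    also have "\<dots> = (\<integral>\<^sup>+c. \<integral>\<^sup>+s. H a c s \<partial>muQ \<partial>muQ)"
      by (rule QQ.Fubini'[symmetric]) measurable
    finally show "(\<integral>\<^sup>+q. \<integral>\<^sup>+s. ennreal (\<Delta> (- q + s)) * H a (- q + s) s \<partial>muQ \<partial>muQ) = (\<integral>\<^sup>+c. \<integral>\<^sup>+s. H a c s \<partial>muQ \<partial>muQ)" .
  qed
  also have "\<dots> = (\<integral>\<^sup>+x. \<integral>\<^sup>+y. h (x, y) \<partial>HS \<partial>HS)"
    by (simp add: nn_integral_HS H_def)
  also have "\<dots> = (\<integral>\<^sup>+z. h z \<partial>(HS \<Otimes>\<^sub>M HS))"
    by (rule HS.nn_integral_fst) measurable
  finally show "(\<integral>\<^sup>+z. ennreal ((cmod (mG z))\<^sup>2) * h (\<phi>G z) \<partial>(X \<Otimes>\<^sub>M HS)) = (\<integral>\<^sup>+z. h z \<partial>(HS \<Otimes>\<^sub>M HS))" .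
qed

text \<open>For each fixed \<open>p\<close> the translate by \<eta>(p) of the exceptional null set
  is again null. Complex-valued indicators put the statement into the form of an equation, as
  \<open>AE_pair_eqI'\<close> requires.\<close>

lemma AE_eta_\<kappa>G: "AE z in X \<Otimes>\<^sub>M HS. \<eta> (\<kappa>G z) = snd (fst z) + \<eta> (fst (snd z))"
proof -
  obtain N where N: "{\<xi> \<in> space muX. \<eta> (\<eta>inv \<xi>) \<noteq> \<xi>} \<subseteq> N" "N \<in> null_sets muX"
    using AE_eta_etainv unfolding eventually_ae_filter by blast
  have [measurable]: "N \<in> sets borel" using null_setsD2[OF N(2)] by simp
  have sh: "AE \<xi> in muX. \<xi> + \<zeta> \<notin> N" for \<zeta>
  proof (rule AE_distrD[where f = "\<lambda>\<xi>. \<xi> + \<zeta>" and M' = muX])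
    show "(\<lambda>\<xi>. \<xi> + \<zeta>) \<in> measurable muX muX" by measurable
    have "distr muX muX (\<lambda>\<xi>. \<xi> + \<zeta>) = muX"
      using haarX by (simp add: left_haar_measure_def add.commute[of _ \<zeta>])
    then show "AE \<xi> in distr muX muX (\<lambda>\<xi>. \<xi> + \<zeta>). \<xi> \<notin> N"
      using AE_not_in[OF N(2)] by (simp only:)
  qed
  have "AE z in X \<Otimes>\<^sub>M HS. indicator N (snd (fst z) + \<eta> (fst (snd z))) = (0 :: complex)"
  proof (rule AE_pair_eqI'[OF sf(6,7)])
    show "AE y in HS. AE x in X. indicator N (snd (fst (x, y)) + \<eta> (fst (snd (x, y)))) = (0 :: complex)"
    proof (rule AE_I2)
      fix y :: "'q \<times> 'q"
      have "AE x in X. snd x + \<eta> (fst y) \<notin> N"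
        unfolding X_def by (rule AE_pair_snd[OF sf(4,3) sh])
      then show "AE x in X. indicator N (snd (fst (x, y)) + \<eta> (fst (snd (x, y)))) = (0 :: complex)"
        by eventually_elim simp
    qed
  qed measurable
  then show ?thesis
  proof eventually_elim
    case (elim z)
    then have "snd (fst z) + \<eta> (fst (snd z)) \<notin> N" by (auto simp: indicator_def split: if_splits)
    then show ?case using N(1) by (auto simp: \<kappa>G_def)
  qed
qed

text \<open>From a point ((a, c), (s, r)) in the image of \<open>\<phi>G\<close> one recovers q = s
  - c, p = q + a and \<xi> = \<eta>(s) - \<eta>(p); this is the left inverse supplied.\<close>

lemma G_unitary: "L2_unitary (HS \<Otimes>\<^sub>M HS) (X \<Otimes>\<^sub>M HS) (pullback mG \<phi>G)"
proof (rule L2_unitary_pullback[OF L2_pullback_G, where \<theta> = "\<lambda>z. ((fst (snd z) - snd (fst z), \<eta> (fst (snd z)) - \<eta> (fst (snd z) - snd (fst z) + fst (fst z))), (fst (snd z) - snd (fst z) + fst (fst z), snd (snd z)))"])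
  show "AE z in X \<Otimes>\<^sub>M HS. ((fst (snd (\<phi>G z)) - snd (fst (\<phi>G z)), \<eta> (fst (snd (\<phi>G z))) - \<eta> (fst (snd (\<phi>G z)) - snd (fst (\<phi>G z)) + fst (fst (\<phi>G z)))), (fst (snd (\<phi>G z)) - snd (fst (\<phi>G z)) + fst (fst (\<phi>G z)), snd (snd (\<phi>G z)))) = z"
    using AE_eta_\<kappa>G
  proof eventually_elim
    case (elim z)
    have "\<kappa>G z - (- fst (fst z) + \<kappa>G z) = fst (fst z)"
      by (simp add: diff_conv_add_uminus minus_add add.assoc del: add_uminus_conv_diff)
    then show ?case using elim by (simp add: \<phi>G_def prod_eq_iff add.assoc[symmetric])
  qed
  show "AE z in X \<Otimes>\<^sub>M HS. mG z \<noteq> 0"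
    by (simp add: mG_def)
qed measurable

end

section \<open>Hilbert-Schmidt operators\<close>

lemma sqn_cnj: "sqn M (\<lambda>x. cnj (f x)) = sqn M f"
  by (simp add: sqn_def)

lemma L2_cnj: "f \<in> L2 M \<Longrightarrow> (\<lambda>x. cnj (f x)) \<in> L2 M"
  by (simp add: L2_iff sqn_cnj borel_measurable_cnj)

lemma nn_integral_mult_sq_le:
  assumes [measurable]: "f \<in> borel_measurable M" "g \<in> borel_measurable M"
  shows "(\<integral>\<^sup>+x. ennreal (cmod (f x)) * ennreal (cmod (g x)) \<partial>M)\<^sup>2 \<le> sqn M f * sqn M g"
  using Cauchy_Schwarz_nn_integral[of "\<lambda>x. ennreal (cmod (f x))" M "\<lambda>x. ennreal (cmod (g x))"]
  by (simp add: sqn_def ennreal_power)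

lemma L2_inner_bound:
  assumes [measurable]: "f \<in> borel_measurable M" "g \<in> borel_measurable M"
  shows "ennreal ((cmod (L2_inner M f g))\<^sup>2) \<le> sqn M f * sqn M g"
proof -
  have "ennreal (cmod (L2_inner M f g)) \<le> (\<integral>\<^sup>+x. ennreal (cmod (f x)) * ennreal (cmod (g x)) \<partial>M)"
    unfolding L2_inner_def
    using norm_integral_le_nn[of M "\<lambda>x. f x * cnj (g x)"] by (simp add: norm_mult ennreal_mult)
  then have "ennreal (cmod (L2_inner M f g)) ^ 2 \<le> (\<integral>\<^sup>+x. ennreal (cmod (f x)) * ennreal (cmod (g x)) \<partial>M)\<^sup>2"
    by (rule power_mono) simp
  also have "\<dots> \<le> sqn M f * sqn M g" by (rule nn_integral_mult_sq_le) measurable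
  finally show ?thesis by (simp add: ennreal_power)
qed

lemma L2_inner_diff_left:
  assumes "f \<in> L2 M" "g \<in> L2 M" "h \<in> L2 M"
  shows "L2_inner M (\<lambda>x. f x - g x) h = L2_inner M f h - L2_inner M g h"
  using integrable_L2_inner[OF assms(1,3)] integrable_L2_inner[OF assms(2,3)]
  by (simp add: L2_inner_def left_diff_distrib)

lemma L2_inner_add_left:
  assumes "f \<in> L2 M" "g \<in> L2 M" "h \<in> L2 M"
  shows "L2_inner M (\<lambda>x. f x + g x) h = L2_inner M f h + L2_inner M g h"
  using integrable_L2_inner[OF assms(1,3)] integrable_L2_inner[OF assms(2,3)]
  by (simp add: L2_inner_def distrib_right)

lemma L2_inner_add_right:
  assumes "f \<in> L2 M" "g \<in> L2 M" "h \<in> L2 M"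
  shows "L2_inner M h (\<lambda>x. f x + g x) = L2_inner M h f + L2_inner M h g"
  using integrable_L2_inner[OF assms(3,1)] integrable_L2_inner[OF assms(3,2)]
  by (simp add: L2_inner_def distrib_left)

lemma L2_inner_scale_left: "L2_inner M (\<lambda>x. c * f x) h = c * L2_inner M f h"
  unfolding L2_inner_def mult.assoc by (rule integral_mult_right_zero)

lemma kernel_op_inner: "kernel_op M k f x = L2_inner M (\<lambda>y. k (x, y)) (\<lambda>y. cnj (f y))"
  by (simp add: kernel_op_def L2_inner_def)

lemma kernel_op_measurable [measurable]:
  assumes "sigma_finite_measure M" and [measurable]: "k \<in> borel_measurable (M \<Otimes>\<^sub>M M)" "f \<in> borel_measurable M"
  shows "kernel_op M k f \<in> borel_measurable M"
proof -
  interpret sigma_finite_measure M by fact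
  show ?thesis unfolding kernel_op_def[abs_def] by measurable
qed

lemma sqn_kernel_op:
  assumes sf: "sigma_finite_measure M" and [measurable]: "k \<in> borel_measurable (M \<Otimes>\<^sub>M M)" "f \<in> borel_measurable M"
  shows "sqn M (kernel_op M k f) \<le> sqn (M \<Otimes>\<^sub>M M) k * sqn M f"
proof -
  have "sqn M (kernel_op M k f) \<le> (\<integral>\<^sup>+x. sqn M (\<lambda>y. k (x, y)) * sqn M f \<partial>M)"
    unfolding sqn_def[of M "kernel_op M k f"] kernel_op_inner
  proof (rule nn_integral_mono)
    fix x assume [simp]: "x \<in> space M"
    have "(\<lambda>y. k (x, y)) \<in> borel_measurable M" by measurable
    then show "ennreal ((cmod (L2_inner M (\<lambda>y. k (x, y)) (\<lambda>y. cnj (f y))))\<^sup>2) \<le> sqn M (\<lambda>y. k (x, y)) * sqn M f"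
      using L2_inner_bound[of "\<lambda>y. k (x, y)" M "\<lambda>y. cnj (f y)"] by (simp add: sqn_cnj)
  qed
  also have "\<dots> = sqn (M \<Otimes>\<^sub>M M) k * sqn M f"
    unfolding sqn_pair[OF sf assms(2)] by (rule nn_integral_multc) (rule borel_measurable_sqn_slice[OF sf assms(2)])
  finally show ?thesis .
qed

lemma kernel_op_L2:
  assumes sf: "sigma_finite_measure M" and k: "k \<in> L2 (M \<Otimes>\<^sub>M M)" and f: "f \<in> L2 M"
  shows "kernel_op M k f \<in> L2 M"
  using sqn_kernel_op[OF sf L2_measurable[OF k] L2_measurable[OF f]]
    kernel_op_measurable[OF sf L2_measurable[OF k] L2_measurable[OF f]] k f
  by (auto simp: L2_iff ennreal_mult_less_top intro: le_less_trans)

lemma L2_operator_kernel_op: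
  assumes sf: "sigma_finite_measure M" and k: "k \<in> L2 (M \<Otimes>\<^sub>M M)"
  shows "L2_operator M M (kernel_op M k)"
proof (rule L2_operatorI[where C = "enn2real (sqn (M \<Otimes>\<^sub>M M) k)"])
  note sl = AE_L2_slice[OF sf k]
  show "AE x in M. kernel_op M k (\<lambda>x. f x + g x) x = kernel_op M k f x + kernel_op M k g x" if "f \<in> L2 M" "g \<in> L2 M" for f g
    using sl by eventually_elim (simp add: kernel_op_inner L2_inner_add_right L2_cnj that)
  show "AE x in M. kernel_op M k (\<lambda>x. c * f x) x = c * kernel_op M k f x" for c f
    by (simp add: kernel_op_def mult.left_commute)
  show "sqn M (kernel_op M k f) \<le> ennreal (enn2real (sqn (M \<Otimes>\<^sub>M M) k)) * sqn M f" if "f \<in> L2 M" for f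
    using sqn_kernel_op[OF sf L2_measurable[OF k] L2_measurable[OF that]] k
    by (simp add: L2_iff less_top)
qed (simp_all add: kernel_op_L2[OF sf k])

lemma kernel_op_diff:
  assumes sf: "sigma_finite_measure M" and k: "k \<in> L2 (M \<Otimes>\<^sub>M M)" "l \<in> L2 (M \<Otimes>\<^sub>M M)" and f: "f \<in> L2 M"
  shows "AE x in M. kernel_op M (\<lambda>z. k z - l z) f x = kernel_op M k f x - kernel_op M l f x"
  using AE_L2_slice[OF sf k(1)] AE_L2_slice[OF sf k(2)]
  by eventually_elim (simp add: kernel_op_inner L2_inner_diff_left L2_cnj[OF f])

lemma kernel_op_cong_AE:
  assumes sf: "sigma_finite_measure M" and k: "k \<in> L2 (M \<Otimes>\<^sub>M M)" "l \<in> L2 (M \<Otimes>\<^sub>M M)" and f: "f \<in> L2 M"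
    and ae: "AE z in M \<Otimes>\<^sub>M M. k z = l z"
  shows "AE x in M. kernel_op M k f x = kernel_op M l f x"
  using AE_pair_eqD(1)[OF sf sf ae] AE_L2_slice[OF sf k(1)] AE_L2_slice[OF sf k(2)]
proof eventually_elim
  case (elim x)
  have [measurable]: "(\<lambda>y. k (x, y)) \<in> borel_measurable M" "(\<lambda>y. l (x, y)) \<in> borel_measurable M" "f \<in> borel_measurable M"
    using elim f by (auto intro: L2_measurable)
  show ?case unfolding kernel_op_def
    by (rule integral_cong_AE) (measurable, use elim(1) in eventually_elim, simp)
qed

lemma kernel_op_tendsto:
  assumes sf: "sigma_finite_measure M" and k: "\<And>n. k n \<in> L2 (M \<Otimes>\<^sub>M M)" "l \<in> L2 (M \<Otimes>\<^sub>M M)" and f: "f \<in> L2 M"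
    and lim: "(\<lambda>n. sqn (M \<Otimes>\<^sub>M M) (\<lambda>z. k n z - l z)) \<longlonglongrightarrow> 0"
  shows "(\<lambda>n. sqn M (\<lambda>x. kernel_op M (k n) f x - kernel_op M l f x)) \<longlonglongrightarrow> 0"
proof (rule tendsto_0_le)
  have "sqn M f \<noteq> \<infinity>" using f by (simp add: L2_iff less_top)
  then show "(\<lambda>n. sqn (M \<Otimes>\<^sub>M M) (\<lambda>z. k n z - l z) * sqn M f) \<longlonglongrightarrow> 0"
    using tendsto_mult_ennreal[OF lim tendsto_const[of "sqn M f"]] by simp
  show "sqn M (\<lambda>x. kernel_op M (k n) f x - kernel_op M l f x) \<le> sqn (M \<Otimes>\<^sub>M M) (\<lambda>z. k n z - l z) * sqn M f" for n
    using sqn_kernel_op[OF sf L2_measurable[OF L2_diff[OF k(1)[of n] k(2)]] L2_measurable[OF f]]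
      sqn_cong_AE[OF kernel_op_diff[OF sf k(1)[of n] k(2) f]] by simp
qed

text \<open>Exchanging the integrals needs absolute convergence, which two applications of the
  Cauchy-Schwarz inequality provide for every \<open>x\<close> whose slice of \<open>k\<close> is
  square-integrable.\<close>

lemma kernel_op_comp:
  assumes sf: "sigma_finite_measure M" and k: "k \<in> L2 (M \<Otimes>\<^sub>M M)" and l: "l \<in> L2 (M \<Otimes>\<^sub>M M)" and f: "f \<in> L2 M"
  shows "AE x in M. kernel_op M k (kernel_op M l f) x = kernel_op M (\<lambda>z. \<integral>y. k (fst z, y) * l (y, snd z) \<partial>M) f x"
proof -
  interpret sigma_finite_measure M by (rule sf)
  interpret MM: pair_sigma_finite M M ..
  have [measurable]: "k \<in> borel_measurable (M \<Otimes>\<^sub>M M)" "l \<in> borel_measurable (M \<Otimes>\<^sub>M M)" "f \<in> borel_measurable M"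
    using k l f by (auto intro: L2_measurable)
  define L where "L y = (\<integral>\<^sup>+z. ennreal (cmod (l (y, z))) * ennreal (cmod (f z)) \<partial>M)" for y
  have [measurable]: "L \<in> borel_measurable M" unfolding L_def[abs_def] by measurable
  have "(\<integral>\<^sup>+y. (L y)\<^sup>2 \<partial>M) \<le> (\<integral>\<^sup>+y. sqn M (\<lambda>z. l (y, z)) * sqn M f \<partial>M)"
    unfolding L_def by (rule nn_integral_mono, rule nn_integral_mult_sq_le) measurable
  also have "\<dots> = sqn (M \<Otimes>\<^sub>M M) l * sqn M f"
    unfolding sqn_pair[OF sf L2_measurable[OF l]]
    by (rule nn_integral_multc) (rule borel_measurable_sqn_slice[OF sf L2_measurable[OF l]])
  also have "\<dots> < \<infinity>" using l f by (auto simp: L2_iff ennreal_mult_less_top)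
  finally have fin: "(\<integral>\<^sup>+y. (L y)\<^sup>2 \<partial>M) < \<infinity>" .
  show ?thesis
    using AE_L2_slice[OF sf k] AE_space
  proof eventually_elim
    case (elim x)
    note [simp] = elim(2)
    have [measurable]: "(\<lambda>y. k (x, y)) \<in> borel_measurable M" by measurable
    have "(\<integral>\<^sup>+y. ennreal (cmod (k (x, y))) * L y \<partial>M)\<^sup>2 \<le> sqn M (\<lambda>y. k (x, y)) * (\<integral>\<^sup>+y. (L y)\<^sup>2 \<partial>M)"
      using Cauchy_Schwarz_nn_integral[of "\<lambda>y. ennreal (cmod (k (x, y)))" M L]
      by (simp add: sqn_def ennreal_power)
    also have "\<dots> < \<infinity>" using elim fin by (auto simp: L2_iff ennreal_mult_less_top)
    finally have fin2: "(\<integral>\<^sup>+y. ennreal (cmod (k (x, y))) * L y \<partial>M) < \<infinity>"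
      by (simp add: power_less_top_ennreal)
    have int: "integrable (M \<Otimes>\<^sub>M M) (\<lambda>(y, z). k (x, y) * (l (y, z) * f z))"
    proof (rule integrableI_bounded)
      show "(\<lambda>(y, z). k (x, y) * (l (y, z) * f z)) \<in> borel_measurable (M \<Otimes>\<^sub>M M)" by measurable
      have "(\<integral>\<^sup>+w. ennreal (norm (case w of (y, z) \<Rightarrow> k (x, y) * (l (y, z) * f z))) \<partial>(M \<Otimes>\<^sub>M M))
          = (\<integral>\<^sup>+y. \<integral>\<^sup>+z. ennreal (cmod (k (x, y))) * (ennreal (cmod (l (y, z))) * ennreal (cmod (f z))) \<partial>M \<partial>M)"
        by (subst nn_integral_fst[symmetric]) (measurable, simp add: norm_mult ennreal_mult)
      also have "\<dots> = (\<integral>\<^sup>+y. ennreal (cmod (k (x, y))) * L y \<partial>M)"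
        unfolding L_def by (rule nn_integral_cong, rule nn_integral_cmult) measurable
      finally show "(\<integral>\<^sup>+w. ennreal (norm (case w of (y, z) \<Rightarrow> k (x, y) * (l (y, z) * f z))) \<partial>(M \<Otimes>\<^sub>M M)) < \<infinity>"
        using fin2 by simp
    qed
    have "kernel_op M k (kernel_op M l f) x = (\<integral>y. \<integral>z. k (x, y) * (l (y, z) * f z) \<partial>M \<partial>M)"
      unfolding kernel_op_def by (simp only: integral_mult_right_zero)
    also have "\<dots> = (\<integral>z. \<integral>y. k (x, y) * (l (y, z) * f z) \<partial>M \<partial>M)"
      by (rule MM.Fubini_integral[OF int, symmetric])
    also have "\<dots> = kernel_op M (\<lambda>z. \<integral>y. k (fst z, y) * l (y, snd z) \<partial>M) f x"
      unfolding kernel_op_def fst_conv snd_conv mult.assoc[symmetric] by (simp only: integral_mult_left_zero)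
    finally show ?case .
  qed
qed

text \<open>Vanishing on indicators makes the conjugate kernel orthogonal to rectangles, hence by
  density to everything, in particular to itself.\<close>

lemma kernel_op_eq_zeroD:
  assumes sf: "sigma_finite_measure M" and h: "h \<in> L2 (M \<Otimes>\<^sub>M M)"
    and zero: "\<And>B. B \<in> sets M \<Longrightarrow> emeasure M B < \<infinity> \<Longrightarrow> AE x in M. kernel_op M h (indicator B) x = 0"
  shows "AE z in M \<Otimes>\<^sub>M M. h z = 0"
proof -
  interpret sigma_finite_measure M by (rule sf)
  interpret MM: pair_sigma_finite M M ..
  let ?h = "\<lambda>z. cnj (h z)"
  have h': "?h \<in> L2 (M \<Otimes>\<^sub>M M)" by (rule L2_cnj[OF h])
  have "L2_inner (M \<Otimes>\<^sub>M M) f ?h = 0" if f: "f \<in> L2 (M \<Otimes>\<^sub>M M)" for f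
    using sf sf f
  proof (induction rule: L2_prod_induct)
    case (rect A B)
    let ?f = "tensor_fun (indicator A) (indicator B) :: _ \<Rightarrow> complex"
    have f: "?f \<in> L2 (M \<Otimes>\<^sub>M M)" by (intro L2_tensor_fun sf L2_indicator rect)
    have "L2_inner (M \<Otimes>\<^sub>M M) ?f ?h = (\<integral>x. \<integral>y. ?f (x, y) * h (x, y) \<partial>M \<partial>M)"
      unfolding L2_inner_def using integrable_L2_inner[OF f h'] by (subst MM.integral_fst'[symmetric]) simp_all
    also have "\<dots> = (\<integral>x. indicator A x * kernel_op M h (indicator B) x \<partial>M)"
      unfolding kernel_op_def
      by (subst integral_mult_right_zero[symmetric]) (simp add: tensor_fun_def mult_ac)
    also have "\<dots> = (\<integral>x. 0 \<partial>M)"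
    proof (rule integral_cong_AE)
      show "(\<lambda>x. indicator A x * kernel_op M h (indicator B) x) \<in> borel_measurable M"
        using rect by (intro borel_measurable_times borel_measurable_indicator kernel_op_measurable sf L2_measurable[OF h])
      show "AE x in M. indicator A x * kernel_op M h (indicator B) x = 0"
        using zero[OF rect(3,4)] by eventually_elim simp
    qed simp
    finally show ?case by simp
  next
    case (scale c f)
    then show ?case by (simp add: L2_inner_scale_left)
  next
    case (add f g)
    then show ?case by (simp add: L2_inner_add_left[OF _ _ h'])
  next
    case (lim F f)
    have "ennreal ((cmod (L2_inner (M \<Otimes>\<^sub>M M) f ?h))\<^sup>2) \<le> sqn (M \<Otimes>\<^sub>M M) (\<lambda>x. F n x - f x) * sqn (M \<Otimes>\<^sub>M M) ?h" for n
      using L2_inner_bound[OF L2_measurable[OF L2_diff[OF lim(1)[of n] lim(2)]] L2_measurable[OF h']]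
      unfolding L2_inner_diff_left[OF lim(1)[of n] lim(2) h'] lim(4) by simp
    moreover have "sqn (M \<Otimes>\<^sub>M M) ?h \<noteq> \<infinity>" using h' by (simp add: L2_iff less_top)
    then have "(\<lambda>n. sqn (M \<Otimes>\<^sub>M M) (\<lambda>x. F n x - f x) * sqn (M \<Otimes>\<^sub>M M) ?h) \<longlonglongrightarrow> 0"
      using tendsto_mult_ennreal[OF lim(3) tendsto_const[of "sqn (M \<Otimes>\<^sub>M M) ?h"]] by simp
    ultimately have "(\<lambda>n::nat. ennreal ((cmod (L2_inner (M \<Otimes>\<^sub>M M) f ?h))\<^sup>2)) \<longlonglongrightarrow> 0"
      by (rule tendsto_0_le[rotated])
    then have "ennreal ((cmod (L2_inner (M \<Otimes>\<^sub>M M) f ?h))\<^sup>2) = 0"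
      by (rule LIMSEQ_unique[OF tendsto_const])
    then show ?case by simp
  qed
  from L2_inner_self_zero[OF h' this[OF h']] show ?thesis by eventually_elim simp
qed

section \<open>The projective representation and its action on kernels\<close>

context extension_data
begin

definition m\<pi> :: "'q \<times> 'v \<Rightarrow> 'q \<Rightarrow> complex" where
  "m\<pi> g r = cnj (pairing (\<eta> r) (snd g)) * b (- r) (fst g)"

lemma norm_m\<pi> [simp]: "cmod (m\<pi> g r) = 1"
  by (simp add: m\<pi>_def norm_mult)

lemma m\<pi>_cnj [simp]: "m\<pi> g r * cnj (m\<pi> g r) = 1"
  unfolding complex_norm_square[symmetric] by simp

lemma measurable_m\<pi> [measurable]: "m\<pi> g \<in> borel_measurable borel"
  unfolding m\<pi>_def[abs_def] by measurable

lemma proj_rep_eq: "proj_rep \<eta> b g = pullback (m\<pi> g) (\<lambda>r. - fst g + r)"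
  by (auto simp: fun_eq_iff proj_rep_def pullback_def m\<pi>_def split_beta')

lemma L2_pullback_translation:
  assumes [measurable]: "m \<in> borel_measurable borel" and m: "\<And>r. cmod (m r) = 1"
  shows "L2_pullback muQ muQ m (\<lambda>r. q + r)"
  unfolding L2_pullback_def
proof (intro conjI ballI)
  fix h :: "'q \<Rightarrow> ennreal" assume "h \<in> borel_measurable muQ"
  then show "(\<integral>\<^sup>+r. ennreal ((cmod (m r))\<^sup>2) * h (q + r) \<partial>muQ) = (\<integral>\<^sup>+r. h r \<partial>muQ)"
    by (simp add: m Q.nn_integral_left)
qed measurable

lemma proj_rep_unitary: "L2_unitary muQ muQ (proj_rep \<eta> b g)"
  unfolding proj_rep_eq
proof (rule L2_unitary_pullback[OF L2_pullback_translation])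
  show "(\<lambda>r. fst g + r) \<in> measurable muQ muQ" by measurable
  show "AE r in muQ. fst g + (- fst g + r) = r" by simp
  have "m\<pi> g r \<noteq> 0" for r
    using norm_m\<pi>[of g r] by (metis norm_zero zero_neq_one)
  then show "AE r in muQ. m\<pi> g r \<noteq> 0" by simp
qed simp_all

text \<open>The inverse of \<pi>(g) written out as a weighted translation;
  \<open>proj_rep_adjoint\<close> identifies it with the adjoint obtained by choice.\<close>

definition rep_adj :: "'q \<times> 'v \<Rightarrow> ('q \<Rightarrow> complex) \<Rightarrow> 'q \<Rightarrow> complex" where
  "rep_adj g = pullback (\<lambda>r. cnj (m\<pi> g (fst g + r))) (\<lambda>r. fst g + r)"

lemma rep_adj_operator: "L2_operator muQ muQ (rep_adj g)"
  unfolding rep_adj_def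
  by (rule L2_operator_pullback, rule L2_pullback_translation) simp_all

lemma proj_rep_adjoint:
  assumes f: "f \<in> L2 muQ"
  shows "AE r in muQ. L2_adjoint muQ muQ (proj_rep \<eta> b g) f r = rep_adj g f r"
proof (rule L2_adjoint_eqI[OF proj_rep_unitary _ f])
  show "rep_adj g f \<in> L2 muQ" by (rule L2_operator_L2[OF rep_adj_operator f])
  show "AE r in muQ. proj_rep \<eta> b g (rep_adj g f) r = f r"
    by (simp add: proj_rep_eq rep_adj_def pullback_def mult.assoc[symmetric])
qed

text \<open>The kernel of the operator with kernel \<open>k\<close> after conjugation by
  \<pi>(g).\<close>

definition conj_kernel :: "'q \<times> 'v \<Rightarrow> ('q \<times> 'q \<Rightarrow> complex) \<Rightarrow> 'q \<times> 'q \<Rightarrow> complex" where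
  "conj_kernel g k = (\<lambda>z. m\<pi> g (fst z) * cnj (m\<pi> g (snd z)) * k (- fst g + fst z, - fst g + snd z))"

lemma conj_kernel_L2:
  assumes k: "k \<in> L2 HS"
  shows "conj_kernel g k \<in> L2 HS"
proof -
  have "L2_pullback HS HS (\<lambda>z. m\<pi> g (fst z) * cnj (m\<pi> g (snd z))) (\<lambda>z. (- fst g + fst z, - fst g + snd z))"
    unfolding L2_pullback_def
  proof (intro conjI ballI)
    fix h :: "'q \<times> 'q \<Rightarrow> ennreal" assume "h \<in> borel_measurable HS"
    then have [measurable]: "h \<in> borel_measurable (borel \<Otimes>\<^sub>M borel)" by measurable
    interpret Q: sigma_finite_measure muQ by (rule sf)
    have "(\<integral>\<^sup>+z. ennreal ((cmod (m\<pi> g (fst z) * cnj (m\<pi> g (snd z))))\<^sup>2) * h (- fst g + fst z, - fst g + snd z) \<partial>HS)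
        = (\<integral>\<^sup>+p. \<integral>\<^sup>+r. h (- fst g + p, - fst g + r) \<partial>muQ \<partial>muQ)"
      by (subst nn_integral_HS) (measurable, simp add: norm_mult)
    also have "\<dots> = (\<integral>\<^sup>+p. \<integral>\<^sup>+r. h (- fst g + p, r) \<partial>muQ \<partial>muQ)"
    proof (rule nn_integral_cong)
      fix p
      show "(\<integral>\<^sup>+r. h (- fst g + p, - fst g + r) \<partial>muQ) = (\<integral>\<^sup>+r. h (- fst g + p, r) \<partial>muQ)"
        by (rule Q.nn_integral_left[where f = "\<lambda>r. h (- fst g + p, r)"]) measurable
    qed
    also have "\<dots> = (\<integral>\<^sup>+p. \<integral>\<^sup>+r. h (p, r) \<partial>muQ \<partial>muQ)"
      by (rule Q.nn_integral_left[where f = "\<lambda>p. \<integral>\<^sup>+r. h (p, r) \<partial>muQ"]) measurable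
    also have "\<dots> = (\<integral>\<^sup>+z. h z \<partial>HS)" by (rule nn_integral_HS[symmetric]) measurable
    finally show "(\<integral>\<^sup>+z. ennreal ((cmod (m\<pi> g (fst z) * cnj (m\<pi> g (snd z))))\<^sup>2) * h (- fst g + fst z, - fst g + snd z) \<partial>HS)
        = (\<integral>\<^sup>+z. h z \<partial>HS)" .
  qed measurable
  from L2_pullback_L2[OF this k] show ?thesis by (simp add: conj_kernel_def pullback_def)
qed

lemma integral_left:
  fixes f :: "'q \<Rightarrow> complex"
  assumes [measurable]: "f \<in> borel_measurable borel"
  shows "(\<integral>r. f (q + r) \<partial>muQ) = (\<integral>r. f r \<partial>muQ)"
proof -
  have "(\<integral>r. f r \<partial>muQ) = (\<integral>r. f r \<partial>distr muQ muQ (\<lambda>r. q + r))"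
    using haarQ by (simp add: left_haar_measure_def)
  also have "\<dots> = (\<integral>r. f (q + r) \<partial>muQ)"
    by (rule integral_distr) measurable
  finally show ?thesis ..
qed

text \<open>Only a left translation of the integration variable is involved, so this is an identity
  of functions and not merely one almost everywhere.\<close>

lemma kernel_op_conj:
  assumes k: "k \<in> L2 HS" and f: "f \<in> L2 muQ"
  shows "proj_rep \<eta> b g (kernel_op muQ k (rep_adj g f)) = kernel_op muQ (conj_kernel g k) f"
proof
  fix p
  have "k \<in> borel_measurable HS" "f \<in> borel_measurable muQ" using L2_measurable[OF k] L2_measurable[OF f] by simp_all
  then have [measurable]: "k \<in> borel_measurable (borel \<Otimes>\<^sub>M borel)" "f \<in> borel_measurable borel" by measurable
  let ?h = "\<lambda>r. k (- fst g + p, - fst g + r) * (cnj (m\<pi> g r) * f r)"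
  have "kernel_op muQ k (rep_adj g f) (- fst g + p) = (\<integral>r. ?h (fst g + r) \<partial>muQ)"
    by (simp add: kernel_op_def rep_adj_def pullback_def add.assoc[symmetric])
  also have "\<dots> = (\<integral>r. ?h r \<partial>muQ)" by (rule integral_left) measurable
  finally have "proj_rep \<eta> b g (kernel_op muQ k (rep_adj g f)) p = m\<pi> g p * (\<integral>r. ?h r \<partial>muQ)"
    by (simp add: proj_rep_eq pullback_def)
  also have "\<dots> = (\<integral>r. m\<pi> g p * ?h r \<partial>muQ)" by (rule integral_mult_right_zero[symmetric])
  also have "\<dots> = kernel_op muQ (conj_kernel g k) f p"
    unfolding kernel_op_def conj_kernel_def fst_conv snd_conv by (simp only: mult_ac)
  finally show "proj_rep \<eta> b g (kernel_op muQ k (rep_adj g f)) p = kernel_op muQ (conj_kernel g k) f p" .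
qed

section \<open>Cut-offs by the Duflo-Moore operator and uniqueness of GNS-kernels\<close>

definition trunc :: "nat \<Rightarrow> 'q \<Rightarrow> complex" where
  "trunc n = indicator {q. 1 \<le> real (Suc n) * dfl q}"

lemma measurable_trunc [measurable]: "trunc n \<in> borel_measurable borel"
  unfolding trunc_def by measurable

lemma norm_trunc: "cmod (trunc n q) \<le> 1"
  by (simp add: trunc_def indicator_def)

lemma trunc_tendsto: "(\<lambda>n. trunc n q) \<longlonglongrightarrow> 1"
proof (rule tendsto_eventually)
  obtain N where N: "inverse (dfl q) < real N" using reals_Archimedean2 by blast
  have "1 \<le> real (Suc n) * dfl q" if "N \<le> n" for n
  proof -
    have "1 = inverse (dfl q) * dfl q" by simp
    also have "\<dots> \<le> real (Suc n) * dfl q" using N that by (intro mult_right_mono) auto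
    finally show ?thesis .
  qed
  then show "\<forall>\<^sub>F n in sequentially. trunc n q = 1"
    unfolding eventually_sequentially trunc_def by (intro exI[of _ N]) simp
qed

text \<open>If \<open>k\<close> is the kernel of \<open>S\<close> times the square root of the
  Duflo-Moore operator, multiplying \<open>k\<close> by \<open>truncD\<close> in the second variable
  undoes that root on the region kept by \<open>trunc\<close>. There the inverse root is at most
  \<open>sqrt (real (Suc n))\<close>.\<close>

definition truncD :: "nat \<Rightarrow> 'q \<Rightarrow> complex" where
  "truncD n q = trunc n q * of_real (inverse (sqrt (dfl q)))"

lemma measurable_truncD [measurable]: "truncD n \<in> borel_measurable borel"
  unfolding truncD_def[abs_def] by measurable

lemma sqrt_truncD: "of_real (sqrt (dfl q)) * truncD n q = trunc n q"
  by (simp add: truncD_def)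

lemma norm_truncD: "cmod (truncD n q) \<le> sqrt (real (Suc n))"
proof (cases "1 \<le> real (Suc n) * dfl q")
  case True
  then have "1 \<le> sqrt (real (Suc n)) * sqrt (dfl q)"
    by (simp add: real_sqrt_mult[symmetric])
  then have "inverse (sqrt (dfl q)) \<le> sqrt (real (Suc n))"
    by (simp add: field_simps)
  then show ?thesis using True by (simp add: truncD_def trunc_def norm_mult norm_inverse)
next
  case False
  then show ?thesis by (simp add: truncD_def trunc_def)
qed

lemma trunc_L2:
  assumes f: "f \<in> L2 muQ"
  shows "(\<lambda>q. trunc n q * f q) \<in> L2 muQ" "(\<lambda>n. sqn muQ (\<lambda>q. trunc n q * f q - f q)) \<longlonglongrightarrow> 0"
    "(\<lambda>q. truncD n q * f q) \<in> L2 muQ"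
proof -
  have [measurable]: "f \<in> borel_measurable muQ" by (rule L2_measurable[OF f])
  have lim: "AE q in muQ. (\<lambda>n. trunc n q * f q) \<longlonglongrightarrow> f q"
    using tendsto_mult[OF trunc_tendsto tendsto_const] by simp
  have bd: "cmod (trunc n q * f q) \<le> 2 * cmod (f q)" for n q
    using mult_right_mono[OF norm_trunc[of n q], of "cmod (f q)"] norm_ge_zero[of "f q"] unfolding norm_mult by linarith
  show "(\<lambda>q. trunc n q * f q) \<in> L2 muQ"
    by (rule L2_dominated_lim(1)[OF f _ lim bd]) measurable
  show "(\<lambda>n. sqn muQ (\<lambda>q. trunc n q * f q - f q)) \<longlonglongrightarrow> 0"
    by (rule L2_dominated_lim(2)[OF f _ lim bd]) measurable
  show "(\<lambda>q. truncD n q * f q) \<in> L2 muQ"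
    by (rule L2_bounded_mult[OF f _ norm_truncD]) measurable
qed

lemma trunc_HS:
  assumes k: "k \<in> L2 HS"
  shows "(\<lambda>z. trunc n (snd z) * k z) \<in> L2 HS" "(\<lambda>n. sqn HS (\<lambda>z. trunc n (snd z) * k z - k z)) \<longlonglongrightarrow> 0"
    "(\<lambda>z. truncD n (snd z) * k z) \<in> L2 HS"
proof -
  have [measurable]: "k \<in> borel_measurable HS" by (rule L2_measurable[OF k])
  have lim: "AE z in HS. (\<lambda>n. trunc n (snd z) * k z) \<longlonglongrightarrow> k z"
    using tendsto_mult[OF trunc_tendsto tendsto_const] by simp
  have bd: "cmod (trunc n (snd z) * k z) \<le> 2 * cmod (k z)" for n z
    using mult_right_mono[OF norm_trunc[of n "snd z"], of "cmod (k z)"] norm_ge_zero[of "k z"] unfolding norm_mult by linarith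
  show "(\<lambda>z. trunc n (snd z) * k z) \<in> L2 HS"
    by (rule L2_dominated_lim(1)[OF k _ lim bd]) measurable
  show "(\<lambda>n. sqn HS (\<lambda>z. trunc n (snd z) * k z - k z)) \<longlonglongrightarrow> 0"
    by (rule L2_dominated_lim(2)[OF k _ lim bd]) measurable
  show "(\<lambda>z. truncD n (snd z) * k z) \<in> L2 HS"
    by (rule L2_bounded_mult[OF k _ norm_truncD]) measurable
qed

abbreviation "GNS \<equiv> gns muQ muV act"

lemma gnsD:
  assumes "GNS S k"
  shows "L2_operator muQ muQ S" "k \<in> L2 HS"
    "\<And>f. f \<in> L2 muQ \<Longrightarrow> (\<lambda>q. of_real (sqrt (dfl q)) * f q) \<in> L2 muQ \<Longrightarrow>
      AE p in muQ. S (\<lambda>q. of_real (sqrt (dfl q)) * f q) p = kernel_op muQ k f p"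
  using assms by (simp_all add: gns_def)

text \<open>On the cut-off region \<open>S\<close> itself has a square-integrable kernel:
  \<open>truncD n q * f q\<close> is an admissible test function in \<open>gns\<close>, and the
  square root cancels.\<close>

lemma gns_trunc:
  assumes S: "GNS S k" and f: "f \<in> L2 muQ"
  shows "AE p in muQ. S (\<lambda>q. trunc n q * f q) p = kernel_op muQ (\<lambda>z. truncD n (snd z) * k z) f p"
proof -
  have e: "of_real (sqrt (dfl q)) * (truncD n q * f q) = trunc n q * f q" for q
    unfolding mult.assoc[symmetric] sqrt_truncD by (rule refl)
  have "kernel_op muQ k (\<lambda>q. truncD n q * f q) = kernel_op muQ (\<lambda>z. truncD n (snd z) * k z) f"
    unfolding kernel_op_def snd_conv by (simp only: mult_ac)
  then show ?thesis
    using gnsD(3)[OF S trunc_L2(3)[OF f, of n]] trunc_L2(1)[OF f, of n] unfolding e by simp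
qed

lemma gns_kernel_op:
  assumes "k \<in> L2 HS" "(\<lambda>z. of_real (sqrt (dfl (snd z))) * k z) \<in> L2 HS"
  shows "GNS (kernel_op muQ k) (\<lambda>z. of_real (sqrt (dfl (snd z))) * k z)"
  unfolding gns_def
proof (intro conjI ballI impI)
  show "L2_operator muQ muQ (kernel_op muQ k)" by (rule L2_operator_kernel_op[OF sf(1) assms(1)])
  show "AE p in muQ. kernel_op muQ k (\<lambda>q. of_real (sqrt (dfl q)) * f q) p
      = kernel_op muQ (\<lambda>z. of_real (sqrt (dfl (snd z))) * k z) f p" for f
    unfolding kernel_op_def snd_conv by (simp only: mult_ac) simp
qed (rule assms)

text \<open>The relation in \<open>gns\<close> may only be tested on functions that stay
  square-integrable after multiplication by the root of \<open>dfl\<close>. Restricting an indicator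
  to \<open>dfl q \<le> real n\<close> achieves this, and boundedness of both kernel operators
  removes the restriction in the limit.\<close>

lemma gns_unique:
  assumes k: "GNS S k" and l: "GNS S l"
  shows "AE z in HS. k z = l z"
proof -
  note k2 = gnsD(2)[OF k] and l2 = gnsD(2)[OF l]
  note ops = L2_operator_kernel_op[OF sf(1) k2] L2_operator_kernel_op[OF sf(1) l2]
  have "AE z in HS. k z - l z = 0"
  proof (rule kernel_op_eq_zeroD[OF sf(1) L2_diff[OF k2 l2]])
    fix B assume B: "B \<in> sets muQ" "emeasure muQ B < \<infinity>"
    have [measurable]: "B \<in> sets borel" using B by simp
    note f = L2_indicator[OF B]
    let ?E = "\<lambda>n::nat. indicator {q. dfl q \<le> real n} :: 'q \<Rightarrow> complex"
    let ?f = "\<lambda>n q. ?E n q * indicator B q"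
    have lim: "AE q in muQ. (\<lambda>n. ?f n q) \<longlonglongrightarrow> indicator B q"
    proof (rule AE_I2, rule tendsto_eventually)
      fix q
      obtain N where "dfl q < real N" using reals_Archimedean2 by blast
      then show "\<forall>\<^sub>F n in sequentially. ?f n q = indicator B q"
        unfolding eventually_sequentially by (intro exI[of _ N]) (auto simp: indicator_def)
    qed
    have bd: "cmod (?f n q) \<le> 2 * cmod (indicator B q)" for n q by (simp add: indicator_def)
    have fn: "?f n \<in> L2 muQ" for n by (rule L2_dominated_lim(1)[OF f _ lim bd]) measurable
    have fl: "(\<lambda>n. sqn muQ (\<lambda>q. ?f n q - indicator B q)) \<longlonglongrightarrow> 0"
      by (rule L2_dominated_lim(2)[OF f _ lim bd]) measurable
    have Df: "(\<lambda>q. of_real (sqrt (dfl q)) * ?f n q) \<in> L2 muQ" for n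
    proof -
      have "cmod (of_real (sqrt (dfl q)) * ?E n q) \<le> sqrt (real n)" for q
        by (simp add: indicator_def norm_mult)
      from L2_bounded_mult[OF f _ this] show ?thesis by (simp add: mult.assoc)
    qed
    have eq: "AE p in muQ. kernel_op muQ k (?f n) p = kernel_op muQ l (?f n) p" for n
      using gnsD(3)[OF k fn[of n] Df[of n]] gnsD(3)[OF l fn[of n] Df[of n]]
    proof eventually_elim
      case (elim p)
      show ?case by (rule trans[OF elim(1)[symmetric] elim(2)])
    qed
    have "AE p in muQ. kernel_op muQ k (indicator B) p = kernel_op muQ l (indicator B) p"
      by (rule L2_operators_eq_lim[where F = ?f, OF ops fn f fl eq])
    then show "AE p in muQ. kernel_op muQ (\<lambda>z. k z - l z) (indicator B) p = 0"
      using kernel_op_diff[OF sf(1) k2 l2 f]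
    proof eventually_elim
      case (elim p)
      show ?case unfolding elim(2) elim(1) by simp
    qed
  qed
  then show ?thesis by eventually_elim simp
qed


section \<open>The explicit form of the Galois map\<close>

lemma AE_reflect:
  assumes "AE p in muQ. P p"
  shows "AE q in muQ. P (- q + r)"
proof -
  obtain N where N: "{p \<in> space muQ. \<not> P p} \<subseteq> N" "N \<in> null_sets muQ"
    using assms unfolding eventually_ae_filter by blast
  have [measurable]: "N \<in> sets borel" using null_setsD2[OF N(2)] by simp
  have "(\<integral>\<^sup>+q. indicator N (- q + r) \<partial>muQ)
      = (\<integral>\<^sup>+q. ennreal (\<Delta> (- q + r)) * (ennreal (inverse (\<Delta> (- q + r))) * indicator N (- q + r)) \<partial>muQ)"
    by (simp add: ennreal_mult_mult)
  also have "\<dots> = (\<integral>\<^sup>+q. ennreal (inverse (\<Delta> q)) * indicator N q \<partial>muQ)"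
    by (rule nn_integral_reflect[where k = "\<lambda>q. ennreal (inverse (\<Delta> q)) * indicator N q"]) measurable
  also have "\<dots> = (\<integral>\<^sup>+q. 0 \<partial>muQ)"
    by (rule nn_integral_cong_AE) (use AE_not_in[OF N(2)] in eventually_elim, simp)
  finally have "(\<integral>\<^sup>+q. indicator N (- q + r) \<partial>muQ) = 0" by simp
  then have "AE q in muQ. indicator N (- q + r) = (0 :: ennreal)"
    by (subst (asm) nn_integral_0_iff_AE) measurable
  then show ?thesis
  proof eventually_elim
    case (elim q)
    then have "- q + r \<notin> N" by (auto simp: indicator_def split: if_splits)
    then show ?case using N(1) by auto
  qed
qed

text \<open>Weighted by \<open>md\<close> of its value, the shifted \<open>\<eta>inv\<close> carries
  \<open>muX\<close> to \<open>muQ\<close>. This is the change of variable from frequencies to group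
  elements for complex integrals.\<close>

lemma etainv_integral:
  fixes h :: "'q \<Rightarrow> complex"
  assumes [measurable]: "h \<in> borel_measurable borel"
  shows "integrable muQ h \<Longrightarrow> integrable muX (\<lambda>\<xi>. of_real (md (\<eta>inv (\<xi> + \<zeta>))) * h (\<eta>inv (\<xi> + \<zeta>)))"
    and "(\<integral>\<xi>. of_real (md (\<eta>inv (\<xi> + \<zeta>))) * h (\<eta>inv (\<xi> + \<zeta>)) \<partial>muX) = (\<integral>q. h q \<partial>muQ)"
proof -
  define T where "T \<xi> = \<eta>inv (\<xi> + \<zeta>)" for \<xi>
  have T [measurable]: "T \<in> borel_measurable borel" unfolding T_def[abs_def] by measurable
  let ?D = "density muX (\<lambda>\<xi>. ennreal (md (T \<xi>)))"
  have Td: "T \<in> measurable ?D muQ" by measurable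
  have eq: "distr ?D muQ T = muQ"
  proof (rule measure_eqI)
    fix A assume "A \<in> sets (distr ?D muQ T)"
    then have [measurable]: "A \<in> sets borel" by simp
    have "emeasure (distr ?D muQ T) A = (\<integral>\<^sup>+q. indicator A q \<partial>distr ?D muQ T)" by simp
    also have "\<dots> = (\<integral>\<^sup>+\<xi>. indicator A (T \<xi>) \<partial>?D)" by (rule nn_integral_distr[OF Td]) measurable
    also have "\<dots> = (\<integral>\<^sup>+\<xi>. ennreal (md (T \<xi>)) * indicator A (T \<xi>) \<partial>muX)"
      by (rule nn_integral_density) measurable
    also have "\<dots> = (\<integral>\<^sup>+\<xi>. ennreal (md (\<eta>inv \<xi>)) * indicator A (\<eta>inv \<xi>) \<partial>muX)"
      using nn_integral_X_left[of "\<lambda>\<xi>. ennreal (md (\<eta>inv \<xi>)) * indicator A (\<eta>inv \<xi>)" \<zeta>]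
      by (simp add: T_def add.commute)
    also have "\<dots> = (\<integral>\<^sup>+q. ennreal (md q) * indicator A q * ennreal (inverse (md q)) \<partial>muQ)"
      by (rule nn_integral_etainv) measurable
    also have "\<dots> = (\<integral>\<^sup>+q. indicator A q \<partial>muQ)"
    proof (rule nn_integral_cong)
      fix q
      have "ennreal (md q) * ennreal (inverse (md q)) = 1" by (simp flip: ennreal_mult)
      then show "ennreal (md q) * indicator A q * ennreal (inverse (md q)) = indicator A q"
        by (simp add: indicator_def)
    qed
    finally show "emeasure (distr ?D muQ T) A = emeasure muQ A" by simp
  qed simp
  show "integrable muX (\<lambda>\<xi>. of_real (md (\<eta>inv (\<xi> + \<zeta>))) * h (\<eta>inv (\<xi> + \<zeta>)))" if "integrable muQ h"
  proof -
    have "integrable (distr ?D muQ T) h" unfolding eq by (rule that)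
    then have "integrable ?D (\<lambda>\<xi>. h (T \<xi>))" by (subst (asm) integrable_distr_eq[OF Td]) measurable
    then have "integrable muX (\<lambda>\<xi>. md (T \<xi>) *\<^sub>R h (T \<xi>))" by (subst (asm) integrable_density) auto
    then show ?thesis by (simp add: T_def scaleR_conv_of_real)
  qed
  have "(\<integral>q. h q \<partial>muQ) = (\<integral>q. h q \<partial>distr ?D muQ T)" unfolding eq by (rule refl)
  also have "\<dots> = (\<integral>\<xi>. h (T \<xi>) \<partial>?D)" by (rule integral_distr[OF Td]) measurable
  also have "\<dots> = (\<integral>\<xi>. md (T \<xi>) *\<^sub>R h (T \<xi>) \<partial>muX)" by (rule integral_density) auto
  finally show "(\<integral>\<xi>. of_real (md (\<eta>inv (\<xi> + \<zeta>))) * h (\<eta>inv (\<xi> + \<zeta>)) \<partial>muX) = (\<integral>q. h q \<partial>muQ)"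
    by (simp add: T_def scaleR_conv_of_real)
qed

lemma AE_eta_etainv_shift: "AE \<xi> in muX. \<eta> (\<eta>inv (\<xi> + \<zeta>)) = \<xi> + \<zeta>"
proof (rule AE_distrD[where f = "\<lambda>\<xi>. \<xi> + \<zeta>" and M' = muX])
  show "(\<lambda>\<xi>. \<xi> + \<zeta>) \<in> measurable muX muX" by measurable
  have "distr muX muX (\<lambda>\<xi>. \<xi> + \<zeta>) = muX"
    using haarX by (simp add: left_haar_measure_def add.commute[of _ \<zeta>])
  then show "AE \<xi> in distr muX muX (\<lambda>\<xi>. \<xi> + \<zeta>). \<eta> (\<eta>inv \<xi>) = \<xi>"
    using AE_eta_etainv by (simp only:)
qed

text \<open>The explicit candidate for the Galois map on kernels: its form in the frequency
  variable, followed by the inverse Fourier transform in \<open>v\<close>.\<close>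

definition galois0 :: "(('q \<times> 'q) \<times> ('q \<times> 'q) \<Rightarrow> complex) \<Rightarrow> ('q \<times> 'v) \<times> ('q \<times> 'q) \<Rightarrow> complex" where
  "galois0 = L2_tensor X HS G HS F' id \<circ> pullback mG \<phi>G"

lemma F'_operator: "L2_operator X G F'"
  by (rule L2_adjoint_unitary(1)[OF F_unitary])

lemma galois0_operator: "L2_operator (HS \<Otimes>\<^sub>M HS) (G \<Otimes>\<^sub>M HS) galois0"
  unfolding galois0_def
  by (rule L2_operator_compose[OF L2_operator_pullback[OF L2_pullback_G] L2_tensor_spec(1)[OF sf(6,7,5,7) F'_operator L2_operator_id]])

text \<open>Under s = \<eta>inv(\<xi> + \<eta>(p)) the inverse Fourier integral over \<xi> becomes
  the integral that composes the conjugated kernel of \<open>k\<close> with \<open>l\<close>. The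
  root of \<open>dfl\<close> in the first tensor factor cancels the inverse root in
  \<open>mG\<close>.\<close>

lemma galois0_kernel:
  assumes k: "k \<in> L2 HS" and k': "(\<lambda>z. of_real (sqrt (dfl (snd z))) * k z) \<in> L2 HS" and l: "l \<in> L2 HS"
  shows "AE z in G \<Otimes>\<^sub>M HS. galois0 (tensor_fun (\<lambda>z. of_real (sqrt (dfl (snd z))) * k z) l) z
    = (\<integral>s. conj_kernel (fst z) k (fst (snd z), s) * l (s, snd (snd z)) \<partial>muQ)"
proof -
  let ?k' = "\<lambda>z. of_real (sqrt (dfl (snd z))) * k z"
  let ?f = "pullback mG \<phi>G (tensor_fun ?k' l)"
  have "k \<in> borel_measurable HS" "l \<in> borel_measurable HS" using L2_measurable[OF k] L2_measurable[OF l] by simp_all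
  then have [measurable]: "k \<in> borel_measurable (borel \<Otimes>\<^sub>M borel)" "l \<in> borel_measurable (borel \<Otimes>\<^sub>M borel)" by measurable
  have kl: "tensor_fun ?k' l \<in> L2 (HS \<Otimes>\<^sub>M HS)" by (rule L2_tensor_fun[OF sf(7) k' l])
  have f: "?f \<in> L2 (X \<Otimes>\<^sub>M HS)" by (rule L2_pullback_L2[OF L2_pullback_G kl])
  define \<Phi> where "\<Phi> q p r s = b (- p) q * cnj (b (- s) q) * (k (- q + p, - q + s) * l (s, r))" for q p r s
  have \<Phi>m [measurable]: "\<Phi> q p r \<in> borel_measurable borel" for q p r unfolding \<Phi>_def[abs_def] by measurable
  have fe: "?f ((q, \<xi>), (p, r)) = of_real (md (\<eta>inv (\<xi> + \<eta> p))) * \<Phi> q p r (\<eta>inv (\<xi> + \<eta> p))" for q \<xi> p r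
  proof -
    let ?s = "\<eta>inv (\<xi> + \<eta> p)"
    have e: "\<kappa>G ((q, \<xi>), (p, r)) = ?s" by (simp add: \<kappa>G_def)
    have c: "A * c * B * (d * K * L) = A * (B * (K * L))" if "c * d = 1" for A B K L c d :: complex
    proof -
      have "A * c * B * (d * K * L) = (c * d) * (A * (B * (K * L)))" by (simp only: mult_ac)
      then show ?thesis by (simp only: that mult_1_left)
    qed
    have "of_real (inverse (sqrt (dfl (- q + ?s)))) * of_real (sqrt (dfl (- q + ?s))) = (1 :: complex)"
      by simp
    from c[OF this] show ?thesis
      unfolding pullback_def mG_def \<phi>G_def e \<Phi>_def tensor_fun_def fst_conv snd_conv prod.case of_real_mult .
  qed
  \<comment> \<open>\<open>k\<close> is evaluated in the row \<open>- q + p\<close>. For each fixed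
    \<open>p\<close> almost every \<open>q\<close> gives a square-integrable row, because
    reflections preserve null sets.\<close>
  have "AE p in muQ. (\<lambda>s. k (p, s)) \<in> L2 muQ" by (rule AE_L2_slice[OF sf(1) k])
  from AE_reflect[OF this] have a1: "AE q in muQ. (\<lambda>s. k (- q + p, s)) \<in> L2 muQ" for p .
  have a2: "AE r in muQ. (\<lambda>s. l (s, r)) \<in> L2 muQ"
  proof -
    have "(\<lambda>z. l (snd z, fst z)) \<in> L2 HS"
      using L2_operator_L2[OF L2_unitaryD(1)[OF L2_unitary_swap[OF sf(1,1)]] l] by (simp add: swap_op_def pullback_def split_beta')
    from AE_L2_slice[OF sf(1) this] show ?thesis by simp
  qed
  have \<Phi>i: "integrable muQ (\<Phi> q p r)" if "(\<lambda>s. k (- q + p, s)) \<in> L2 muQ" "(\<lambda>s. l (s, r)) \<in> L2 muQ" for q p r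
  proof -
    have "L2_pullback muQ muQ (\<lambda>_. 1) (\<lambda>s. - q + s)" by (rule L2_pullback_translation) simp_all
    from L2_pullback_L2[OF this that(1)] have "(\<lambda>s. k (- q + p, - q + s)) \<in> L2 muQ" by (simp add: pullback_def)
    from integrable_L2_inner[OF this L2_cnj[OF that(2)]]
    have "integrable muQ (\<lambda>s. k (- q + p, - q + s) * l (s, r))" by simp
    then show ?thesis
      by (rule Bochner_Integration.integrable_bound) (measurable, simp add: \<Phi>_def norm_mult)
  qed
  have "AE y in HS. AE q in Qw. integrable muX (\<lambda>\<xi>. ?f ((q, \<xi>), y))"
    using AE_pair_snd[OF sf(1,1) a2]
  proof eventually_elim
    case (elim y)
    have "AE q in Qw. (\<lambda>s. k (- q + fst y, s)) \<in> L2 muQ" unfolding AE_Qw by (rule a1)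
    then show ?case
    proof eventually_elim
      case (elim q)
      from etainv_integral(1)[OF \<Phi>m \<Phi>i[OF this \<open>(\<lambda>s. l (s, snd y)) \<in> L2 muQ\<close>]]
      show ?case using fe[of q _ "fst y" "snd y"] by simp
    qed
  qed
  from kernel_operator_tensor_id[OF sf(4,3,2,7) F'_kernel kernel_measurable(2), folded G_def X_def, OF f this]
  have K: "AE z in G \<Otimes>\<^sub>M HS. galois0 (tensor_fun ?k' l) z = (\<integral>\<xi>. pairing \<xi> (snd (fst z)) * ?f ((fst (fst z), \<xi>), snd z) \<partial>muX)"
    by (simp add: galois0_def)
  have I: "(\<integral>\<xi>. pairing \<xi> v * ?f ((q, \<xi>), (p, r)) \<partial>muX) = (\<integral>s. conj_kernel (q, v) k (p, s) * l (s, r) \<partial>muQ)" for q v p r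
  proof -
    let ?h = "\<lambda>s. pairing (\<eta> s - \<eta> p) v * \<Phi> q p r s"
    have "(\<integral>\<xi>. pairing \<xi> v * ?f ((q, \<xi>), (p, r)) \<partial>muX)
        = (\<integral>\<xi>. of_real (md (\<eta>inv (\<xi> + \<eta> p))) * ?h (\<eta>inv (\<xi> + \<eta> p)) \<partial>muX)"
    proof (rule integral_cong_AE)
      show "AE \<xi> in muX. pairing \<xi> v * ?f ((q, \<xi>), (p, r)) = of_real (md (\<eta>inv (\<xi> + \<eta> p))) * ?h (\<eta>inv (\<xi> + \<eta> p))"
        using AE_eta_etainv_shift[of "\<eta> p"]
      proof eventually_elim
        case (elim \<xi>)
        show ?case unfolding fe elim by (simp only: add_diff_cancel mult_ac)
      qed
    qed (unfold fe, measurable)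
    also have "\<dots> = (\<integral>s. ?h s \<partial>muQ)" by (rule etainv_integral(2)) measurable
    also have "\<dots> = (\<integral>s. conj_kernel (q, v) k (p, s) * l (s, r) \<partial>muQ)"
    proof (rule Bochner_Integration.integral_cong)
      fix s
      show "?h s = conj_kernel (q, v) k (p, s) * l (s, r)"
        by (simp add: \<Phi>_def conj_kernel_def m\<pi>_def pairing_diff_left cnj_pairing divide_inverse mult_ac)
    qed simp
    finally show ?thesis .
  qed
  from K show ?thesis
  proof eventually_elim
    case (elim z)
    show ?case
      unfolding elim using I[of "snd (fst z)" "fst (fst z)" "fst (snd z)" "snd (snd z)"]
      by (simp only: prod.collapse)
  qed
qed

end

lemma tensor_fun_tendsto:
  assumes sf: "sigma_finite_measure N" and F: "\<And>n. F n \<in> L2 M" "f \<in> L2 M" and g: "g \<in> L2 N"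
    and lim: "(\<lambda>n. sqn M (\<lambda>x. F n x - f x)) \<longlonglongrightarrow> 0"
  shows "(\<lambda>n. sqn (M \<Otimes>\<^sub>M N) (\<lambda>z. tensor_fun (F n) g z - tensor_fun f g z)) \<longlonglongrightarrow> 0"
proof -
  have "sqn (M \<Otimes>\<^sub>M N) (\<lambda>z. tensor_fun (F n) g z - tensor_fun f g z) = sqn M (\<lambda>x. F n x - f x) * sqn N g" for n
  proof -
    have "(\<lambda>z. tensor_fun (F n) g z - tensor_fun f g z) = tensor_fun (\<lambda>x. F n x - f x) g"
      by (auto simp: fun_eq_iff tensor_fun_def left_diff_distrib)
    then show ?thesis
      using sqn_tensor[OF sf L2_measurable[OF L2_diff[OF F(1)[of n] F(2)]] L2_measurable[OF g]] by simp
  qed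
  moreover have "sqn N g \<noteq> \<infinity>" using g by (simp add: L2_iff less_top)
  ultimately show ?thesis
    using tendsto_mult_ennreal[OF lim tendsto_const[of "sqn N g"]] by simp
qed

lemma tensor_fun_tendsto':
  assumes sf: "sigma_finite_measure N" and F: "\<And>n. F n \<in> L2 N" "f \<in> L2 N" and g: "g \<in> L2 M"
    and lim: "(\<lambda>n. sqn N (\<lambda>x. F n x - f x)) \<longlonglongrightarrow> 0"
  shows "(\<lambda>n. sqn (M \<Otimes>\<^sub>M N) (\<lambda>z. tensor_fun g (F n) z - tensor_fun g f z)) \<longlonglongrightarrow> 0"
proof -
  have "sqn (M \<Otimes>\<^sub>M N) (\<lambda>z. tensor_fun g (F n) z - tensor_fun g f z) = sqn M g * sqn N (\<lambda>x. F n x - f x)" for n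
  proof -
    have "(\<lambda>z. tensor_fun g (F n) z - tensor_fun g f z) = tensor_fun g (\<lambda>x. F n x - f x)"
      by (auto simp: fun_eq_iff tensor_fun_def right_diff_distrib)
    then show ?thesis
      using sqn_tensor[OF sf L2_measurable[OF g] L2_measurable[OF L2_diff[OF F(1)[of n] F(2)]]] by simp
  qed
  moreover have "sqn M g \<noteq> \<infinity>" using g by (simp add: L2_iff less_top)
  ultimately show ?thesis
    using tendsto_mult_ennreal[OF tendsto_const[of "sqn M g"] lim] by simp
qed

context extension_data
begin

lemma galois0_spec:
  assumes S: "GNS S kS" and T: "GNS T kT"
  shows "AE g in G. GNS (proj_rep \<eta> b g \<circ> S \<circ> L2_adjoint muQ muQ (proj_rep \<eta> b g) \<circ> T)
    (\<lambda>z. galois0 (tensor_fun kS kT) (g, z))"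
proof -
  interpret Q: sigma_finite_measure muQ by (rule sf)
  note kS = gnsD(2)[OF S] and kT = gnsD(2)[OF T]
  define kd where "kd n = (\<lambda>z. truncD n (snd z) * kS z)" for n
  define kn where "kn n = (\<lambda>z. trunc n (snd z) * kS z)" for n
  have kd: "kd n \<in> L2 HS" and kn: "kn n \<in> L2 HS" for n
    unfolding kd_def kn_def by (rule trunc_HS(3)[OF kS], rule trunc_HS(1)[OF kS])
  have kdn: "(\<lambda>z. of_real (sqrt (dfl (snd z))) * kd n z) = kn n" for n
    unfolding kd_def kn_def mult.assoc[symmetric] sqrt_truncD by (rule refl)
  define t where "t n = galois0 (tensor_fun (kn n) kT)" for n
  define t0 where "t0 = galois0 (tensor_fun kS kT)"
  have tL: "t n \<in> L2 (G \<Otimes>\<^sub>M HS)" and t0L: "t0 \<in> L2 (G \<Otimes>\<^sub>M HS)" for n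
    unfolding t_def t0_def by (intro L2_operator_L2[OF galois0_operator] L2_tensor_fun sf kn kS kT)+
  have "(\<lambda>n. sqn (G \<Otimes>\<^sub>M HS) (\<lambda>z. t n z - t0 z)) \<longlonglongrightarrow> 0"
    unfolding t_def t0_def
  proof (rule L2_operator_tendsto[OF galois0_operator])
    have "(\<lambda>n. sqn HS (\<lambda>z. kn n z - kS z)) \<longlonglongrightarrow> 0" unfolding kn_def by (rule trunc_HS(2)[OF kS])
    then show "(\<lambda>n. sqn (HS \<Otimes>\<^sub>M HS) (\<lambda>z. tensor_fun (kn n) kT z - tensor_fun kS kT z)) \<longlonglongrightarrow> 0"
      by (rule tensor_fun_tendsto[OF sf(7) kn kS kT])
  qed (intro L2_tensor_fun sf kn kS kT)+
  then have "(\<lambda>n. \<integral>\<^sup>+g. sqn HS (\<lambda>y. t n (g, y) - t0 (g, y)) \<partial>G) \<longlonglongrightarrow> 0"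
    using sqn_pair[OF sf(7) L2_measurable[OF L2_diff[OF tL t0L]]] by simp
  \<comment> \<open>\<open>r\<close> depends only on the kernels and is fixed before
    \<open>g\<close> and the test function \<open>f\<close>. So the exceptional set of
    \<open>g\<close> does not depend on \<open>f\<close>, as the quantifiers in
    \<open>galois_map\<close> require.\<close>
  then have "\<exists>r::nat \<Rightarrow> nat. strict_mono r \<and> (AE g in G. (\<lambda>n. sqn HS (\<lambda>y. t (r n) (g, y) - t0 (g, y))) \<longlonglongrightarrow> 0)"
    by (rule AE_tendsto_0_subseq[where u = "\<lambda>n g. sqn HS (\<lambda>y. t n (g, y) - t0 (g, y))",
          OF borel_measurable_sqn_slice[OF sf(7) L2_measurable[OF L2_diff[OF tL t0L]]]])
  then obtain r :: "nat \<Rightarrow> nat" where r: "strict_mono r"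
    "AE g in G. (\<lambda>n. sqn HS (\<lambda>y. t (r n) (g, y) - t0 (g, y))) \<longlonglongrightarrow> 0" by blast
  define c where "c g n z = (\<integral>s. conj_kernel g (kd n) (fst z, s) * kT (s, snd z) \<partial>muQ)" for g n z
  have cm: "c g n \<in> borel_measurable HS" for g n
  proof -
    have [measurable]: "conj_kernel g (kd n) \<in> borel_measurable HS" "kT \<in> borel_measurable HS"
      using L2_measurable[OF conj_kernel_L2[OF kd]] L2_measurable[OF kT] by simp_all
    show ?thesis unfolding c_def[abs_def] by measurable
  qed
  have "AE z in G \<Otimes>\<^sub>M HS. t n z = c (fst z) n (snd z)" for n
    using galois0_kernel[OF kd[of n] kn[of n, folded kdn] kT] unfolding kdn t_def c_def .
  from AE_pair_eqD(1)[OF sf(5,7) this]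
  have a1: "AE g in G. \<forall>n. AE y in HS. t n (g, y) = c g n y"
    unfolding AE_all_countable by simp
  have a2: "AE g in G. \<forall>n. (\<lambda>y. t n (g, y)) \<in> L2 HS"
    unfolding AE_all_countable using AE_L2_slice[OF sf(7) tL] by simp
  show ?thesis
    using r(2) a1 a2 AE_L2_slice[OF sf(7) t0L]
  proof eventually_elim
    case (elim g)
    let ?\<pi> = "proj_rep \<eta> b g" and ?A = "L2_adjoint muQ muQ (proj_rep \<eta> b g)"
    note \<pi>o = L2_unitaryD(1)[OF proj_rep_unitary, of g]
    note Ao = L2_adjoint_unitary(1)[OF proj_rep_unitary, of g]
    note So = gnsD(1)[OF S] and To = gnsD(1)[OF T]
    note \<pi>S = L2_operator_compose[OF So \<pi>o]
    show ?case
      unfolding gns_def t0_def[symmetric]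
    proof (intro conjI ballI impI)
      show "L2_operator muQ muQ (?\<pi> \<circ> S \<circ> ?A \<circ> T)"
        by (rule L2_operator_compose[OF To L2_operator_compose[OF Ao \<pi>S]])
      show "(\<lambda>z. t0 (g, z)) \<in> L2 HS" by (rule elim(4))
      fix f :: "'q \<Rightarrow> complex"
      let ?Df = "\<lambda>q. of_real (sqrt (dfl q)) * f q"
      assume f: "f \<in> L2 muQ" and Df: "?Df \<in> L2 muQ"
      define h where "h = kernel_op muQ kT f"
      have h: "h \<in> L2 muQ" unfolding h_def by (rule kernel_op_L2[OF sf(1) kT f])
      define u where "u = rep_adj g h"
      have u: "u \<in> L2 muQ" unfolding u_def by (rule L2_operator_L2[OF rep_adj_operator h])
      have Tf: "T ?Df \<in> L2 muQ" by (rule L2_operator_L2[OF To Df])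
      have ATf: "?A (T ?Df) \<in> L2 muQ" by (rule L2_operator_L2[OF Ao Tf])
      have "AE p in muQ. T ?Df p = h p" unfolding h_def by (rule gnsD(3)[OF T f Df])
      from L2_operator_cong[OF Ao Tf h this]
      have "AE p in muQ. ?A (T ?Df) p = u p"
        using proj_rep_adjoint[OF h, of g] unfolding u_def
      proof eventually_elim
        case (elim p) show ?case by (rule trans[OF elim])
      qed
      from L2_operator_cong[OF \<pi>S ATf u this]
      have e1: "AE p in muQ. (?\<pi> \<circ> S \<circ> ?A \<circ> T) ?Df p = (?\<pi> \<circ> S) u p" by (simp only: comp_apply)
      let ?u = "\<lambda>n q. trunc n q * u q"
      have un: "?u n \<in> L2 muQ" for n by (rule trunc_L2(1)[OF u])
      \<comment> \<open>For cut-off input \<open>S\<close> acts through the square-integrable kernel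
        \<open>kd n\<close>, so conjugation and the factor \<open>T\<close> amount to a composition
        of kernels, whose result is the slice at \<open>g\<close> of \<open>galois0\<close> for the
        cut-off kernel.\<close>
      have e2: "AE p in muQ. (?\<pi> \<circ> S) (?u n) p = kernel_op muQ (\<lambda>y. t n (g, y)) f p" for n
      proof -
        note ck = conj_kernel_L2[OF kd[of n], of g]
        have ko: "kernel_op muQ (kd n) u \<in> L2 muQ" by (rule kernel_op_L2[OF sf(1) kd u])
        have tn: "(\<lambda>y. t n (g, y)) \<in> L2 HS" using elim(3) by (rule spec)
        have tc: "AE y in HS. t n (g, y) = c g n y" using elim(2) by (rule spec)
        have cn: "c g n \<in> L2 HS" by (rule L2_cong_AE[OF tn cm tc])
        have "AE p in muQ. S (?u n) p = kernel_op muQ (kd n) u p"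
          unfolding kd_def by (rule gns_trunc[OF S u])
        from L2_operator_cong[OF \<pi>o L2_operator_L2[OF So un] ko this]
        have 1: "AE p in muQ. ?\<pi> (S (?u n)) p = kernel_op muQ (conj_kernel g (kd n)) h p"
          unfolding u_def kernel_op_conj[OF kd h] .
        have 2: "AE p in muQ. kernel_op muQ (conj_kernel g (kd n)) h p = kernel_op muQ (c g n) f p"
          unfolding h_def c_def[abs_def] by (rule kernel_op_comp[OF sf(1) ck kT f])
        have 3: "AE p in muQ. kernel_op muQ (\<lambda>y. t n (g, y)) f p = kernel_op muQ (c g n) f p"
          by (rule kernel_op_cong_AE[OF sf(1) tn cn f tc])
        from 1 2 3 show ?thesis
        proof eventually_elim
          case (elim p)
          show ?case unfolding comp_apply elim by (rule refl)
        qed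
      qed
      \<comment> \<open>One sequence, two limits: by boundedness of \<open>S\<close> the cut-off
        disappears on the operator side, and along the subsequence it disappears on the kernel side.
        Uniqueness of L2 limits identifies the results.\<close>
      have l1: "(\<lambda>n. sqn muQ (\<lambda>p. (?\<pi> \<circ> S) (?u (r n)) p - (?\<pi> \<circ> S) u p)) \<longlonglongrightarrow> 0"
        using LIMSEQ_subseq_LIMSEQ[OF L2_operator_tendsto[OF \<pi>S un u trunc_L2(2)[OF u]] r(1)]
        by (simp only: comp_def)
      have "(\<lambda>n. sqn muQ (\<lambda>p. kernel_op muQ (\<lambda>y. t (r n) (g, y)) f p - kernel_op muQ (\<lambda>y. t0 (g, y)) f p)) \<longlonglongrightarrow> 0"
        by (rule kernel_op_tendsto[OF sf(1) _ elim(4) f elim(1)]) (rule spec[OF elim(3)])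
      moreover have "sqn muQ (\<lambda>p. kernel_op muQ (\<lambda>y. t (r n) (g, y)) f p - kernel_op muQ (\<lambda>y. t0 (g, y)) f p)
          = sqn muQ (\<lambda>p. (?\<pi> \<circ> S) (?u (r n)) p - kernel_op muQ (\<lambda>y. t0 (g, y)) f p)" for n
      proof (rule sqn_cong_AE)
        show "AE p in muQ. kernel_op muQ (\<lambda>y. t (r n) (g, y)) f p - kernel_op muQ (\<lambda>y. t0 (g, y)) f p
            = (?\<pi> \<circ> S) (?u (r n)) p - kernel_op muQ (\<lambda>y. t0 (g, y)) f p"
          using e2[of "r n"]
        proof eventually_elim
          case (elim p)
          show ?case unfolding elim by (rule refl)
        qed
      qed
      ultimately have l2: "(\<lambda>n. sqn muQ (\<lambda>p. (?\<pi> \<circ> S) (?u (r n)) p - kernel_op muQ (\<lambda>y. t0 (g, y)) f p)) \<longlonglongrightarrow> 0"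
        by (simp only:)
      have "AE p in muQ. (?\<pi> \<circ> S) u p = kernel_op muQ (\<lambda>y. t0 (g, y)) f p"
        by (rule L2_lim_unique[OF L2_measurable[OF L2_operator_L2[OF \<pi>S un]] L2_measurable[OF L2_operator_L2[OF \<pi>S u]]
            L2_measurable[OF kernel_op_L2[OF sf(1) elim(4) f]] l1 l2])
      with e1 show "AE p in muQ. (?\<pi> \<circ> S \<circ> ?A \<circ> T) ?Df p = kernel_op muQ (\<lambda>z. t0 (g, z)) f p"
      proof eventually_elim
        case (elim p)
        show ?case by (rule trans[OF elim])
      qed
    qed
  qed
qed

text \<open>The condition in \<open>galois_map\<close> speaks only about GNS-kernels of bounded
  operators. For these \<open>gns_unique\<close> gives equality with \<open>galois0\<close> for
  almost every \<open>g\<close>, and cut-off kernels, which arise from Hilbert-Schmidt operators,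
  are dense.\<close>

lemma galois_map_operator: "L2_operator (HS \<Otimes>\<^sub>M HS) (G \<Otimes>\<^sub>M HS) (galois_map muQ muV act \<eta> b)"
  and galois_map_eq: "f \<in> L2 (HS \<Otimes>\<^sub>M HS) \<Longrightarrow>
    AE z in G \<Otimes>\<^sub>M HS. galois_map muQ muV act \<eta> b f z = galois0 f z"
proof -
  define sp where "sp \<G> \<longleftrightarrow> L2_operator (HS \<Otimes>\<^sub>M HS) (G \<Otimes>\<^sub>M HS) \<G> \<and>
     (\<forall>S T kS kT. GNS S kS \<longrightarrow> GNS T kT \<longrightarrow>
        (AE g in G. GNS (proj_rep \<eta> b g \<circ> S \<circ> L2_adjoint muQ muQ (proj_rep \<eta> b g) \<circ> T)
             (\<lambda>z. \<G> (tensor_fun kS kT) (g, z))))" for \<G>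
  have "sp galois0" unfolding sp_def by (intro conjI galois0_operator allI impI galois0_spec)
  then have "sp (SOME \<G>. sp \<G>)" by (rule someI[of sp])
  moreover have "(SOME \<G>. sp \<G>) = galois_map muQ muV act \<eta> b" unfolding galois_map_def sp_def ..
  ultimately have sp: "sp (galois_map muQ muV act \<eta> b)" by (simp only:)
  let ?H = "galois_map muQ muV act \<eta> b"
  have Ho: "L2_operator (HS \<Otimes>\<^sub>M HS) (G \<Otimes>\<^sub>M HS) ?H" using sp unfolding sp_def by (rule conjunct1)
  have Hs: "AE g in G. GNS (proj_rep \<eta> b g \<circ> S \<circ> L2_adjoint muQ muQ (proj_rep \<eta> b g) \<circ> T) (\<lambda>z. ?H (tensor_fun kS kT) (g, z))"
    if "GNS S kS" "GNS T kT" for S T kS kT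
    using sp that unfolding sp_def by (elim conjE allE impE)
  have gn: "AE z in G \<Otimes>\<^sub>M HS. ?H (tensor_fun kS kT) z = galois0 (tensor_fun kS kT) z"
    if k: "GNS S kS" "GNS T kT" for S T kS kT
  proof (rule AE_pair_eqI[OF sf(5,7)])
    have kk: "tensor_fun kS kT \<in> L2 (HS \<Otimes>\<^sub>M HS)"
      by (rule L2_tensor_fun[OF sf(7) gnsD(2)[OF k(1)] gnsD(2)[OF k(2)]])
    show "?H (tensor_fun kS kT) \<in> borel_measurable (G \<Otimes>\<^sub>M HS)" by (rule L2_measurable[OF L2_operator_L2[OF Ho kk]])
    show "galois0 (tensor_fun kS kT) \<in> borel_measurable (G \<Otimes>\<^sub>M HS)" by (rule L2_measurable[OF L2_operator_L2[OF galois0_operator kk]])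
    show "AE g in G. AE y in HS. ?H (tensor_fun kS kT) (g, y) = galois0 (tensor_fun kS kT) (g, y)"
      using Hs[OF k] galois0_spec[OF k]
    proof eventually_elim
      case (elim g)
      show ?case by (rule gns_unique[OF elim])
    qed
  qed
  have tr: "GNS (kernel_op muQ (\<lambda>z. truncD n (snd z) * k z)) (\<lambda>z. trunc n (snd z) * k z)" if k: "k \<in> L2 HS" for k n
  proof -
    have e: "(\<lambda>z. of_real (sqrt (dfl (snd z))) * (truncD n (snd z) * k z)) = (\<lambda>z. trunc n (snd z) * k z)"
      unfolding mult.assoc[symmetric] sqrt_truncD by (rule refl)
    from gns_kernel_op[OF trunc_HS(3)[OF k, of n]] trunc_HS(1)[OF k, of n] show ?thesis
      unfolding e by simp
  qed
  have tn: "AE z in G \<Otimes>\<^sub>M HS. ?H (tensor_fun k l) z = galois0 (tensor_fun k l) z"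
    if k: "k \<in> L2 HS" and l: "l \<in> L2 HS" for k l
  proof -
    define kn where "kn n = (\<lambda>z. trunc n (snd z) * k z)" for n
    define ln where "ln n = (\<lambda>z. trunc n (snd z) * l z)" for n
    have kn: "kn n \<in> L2 HS" "ln n \<in> L2 HS" for n
      unfolding kn_def ln_def by (rule trunc_HS(1)[OF k], rule trunc_HS(1)[OF l])
    have lim: "(\<lambda>n. sqn HS (\<lambda>z. kn n z - k z)) \<longlonglongrightarrow> 0" "(\<lambda>n. sqn HS (\<lambda>z. ln n z - l z)) \<longlonglongrightarrow> 0"
      unfolding kn_def ln_def by (rule trunc_HS(2)[OF k], rule trunc_HS(2)[OF l])
    note tf = L2_tensor_fun[OF sf(7)]
    have 1: "AE z in G \<Otimes>\<^sub>M HS. ?H (tensor_fun (kn n) (ln m)) z = galois0 (tensor_fun (kn n) (ln m)) z" for n m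
      unfolding kn_def ln_def by (rule gn[OF tr[OF k] tr[OF l]])
    \<comment> \<open>The cut-offs are removed one tensor factor at a time, each by a limit in a
      single argument.\<close>
    have 2: "AE z in G \<Otimes>\<^sub>M HS. ?H (tensor_fun (kn n) l) z = galois0 (tensor_fun (kn n) l) z" for n
      by (rule L2_operators_eq_lim[where F = "\<lambda>m. tensor_fun (kn n) (ln m)", OF Ho galois0_operator
          tf[OF kn(1) kn(2)] tf[OF kn(1) l] tensor_fun_tendsto'[OF sf(7) kn(2) l kn(1) lim(2)] 1])
    show ?thesis
      by (rule L2_operators_eq_lim[where F = "\<lambda>n. tensor_fun (kn n) l", OF Ho galois0_operator
          tf[OF kn(1) l] tf[OF k l] tensor_fun_tendsto[OF sf(7) kn(1) k l lim(1)] 2])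
  qed
  show "L2_operator (HS \<Otimes>\<^sub>M HS) (G \<Otimes>\<^sub>M HS) ?H" by (rule Ho)
  assume f: "f \<in> L2 (HS \<Otimes>\<^sub>M HS)"
  show "AE z in G \<Otimes>\<^sub>M HS. ?H f z = galois0 f z"
  proof (rule L2_operators_eq_pair[OF sf(7,7) Ho galois0_operator _ f])
    fix A B assume AB: "A \<in> sets HS" "emeasure HS A < \<infinity>" "B \<in> sets HS" "emeasure HS B < \<infinity>"
    show "AE y in G \<Otimes>\<^sub>M HS. ?H (tensor_fun (indicator A) (indicator B)) y = galois0 (tensor_fun (indicator A) (indicator B)) y"
      by (rule tn[OF L2_indicator[OF AB(1,2)] L2_indicator[OF AB(3,4)]])
  qed
qed

lemma galois0_unitary: "L2_unitary (HS \<Otimes>\<^sub>M HS) (G \<Otimes>\<^sub>M HS) galois0"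
  unfolding galois0_def
proof (rule L2_unitary_compose[OF G_unitary])
  show "L2_unitary (X \<Otimes>\<^sub>M HS) (G \<Otimes>\<^sub>M HS) (L2_tensor X HS G HS F' id)"
    by (rule L2_tensor_unitary[OF sf(6,7,5,7) L2_adjoint_unitary'[OF F_unitary] L2_unitary_id])
qed

lemma galois_map_unitary: "L2_unitary (HS \<Otimes>\<^sub>M HS) (G \<Otimes>\<^sub>M HS) (galois_map muQ muV act \<eta> b)"
proof (rule L2_unitary_cong[OF galois0_unitary _ galois_map_eq])
  show "L2_operator (HS \<Otimes>\<^sub>M HS) (G \<Otimes>\<^sub>M HS) (galois_map muQ muV act \<eta> b)"
    by (rule galois_map_operator)
qed


section \<open>The multiplier identity\<close>

definition mR :: "('q \<times> 'v pdual) \<times> ('q \<times> 'v pdual) \<Rightarrow> complex" where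
  "mR z = of_real (inverse (md (\<eta>inv (snd (fst z)))))
     * cnj (b (- \<eta>inv (snd (snd z))) (- \<eta>inv (snd (fst z))))
     * cnj (psi \<eta> \<beta> (- \<eta>inv (snd (snd z))) (- \<eta>inv (snd (fst z))) (\<eta>inv (snd (fst z)) + fst (snd z)))"

definition \<phi>R :: "('q \<times> 'v pdual) \<times> ('q \<times> 'v pdual) \<Rightarrow> ('q \<times> 'v pdual) \<times> ('q \<times> 'v pdual)" where
  "\<phi>R z = (fst z, (\<eta>inv (snd (fst z)) + fst (snd z), da (\<eta>inv (snd (fst z))) (snd (snd z))))"

text \<open>\<open>mL\<close> and \<open>\<phi>L\<close> describe the side of the equation that
  carries the unknown, \<open>mE\<close> and \<open>\<phi>E\<close> the side that carries
  \<open>f\<close>; \<open>mR\<close> and \<open>\<phi>R\<close> are the asserted solution.\<close>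

definition mL :: "('q \<times> 'v pdual) \<times> ('q \<times> 'q) \<Rightarrow> complex" where
  "mL z = mG z * tensor_fun mOJ mOJ (\<phi>G z)"

definition \<phi>L :: "('q \<times> 'v pdual) \<times> ('q \<times> 'q) \<Rightarrow> ('q \<times> 'v pdual) \<times> ('q \<times> 'v pdual)" where
  "\<phi>L z = map_prod \<phi>OJ \<phi>OJ (\<phi>G z)"

definition mE :: "('q \<times> 'v pdual) \<times> ('q \<times> 'q) \<Rightarrow> complex" where
  "mE z = tensor_fun (\<lambda>_. 1) mOJ z * mFW (map_prod (\<lambda>x. x) \<phi>OJ z)"

definition \<phi>E :: "('q \<times> 'v pdual) \<times> ('q \<times> 'q) \<Rightarrow> ('q \<times> 'v pdual) \<times> ('q \<times> 'v pdual)" where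
  "\<phi>E z = \<phi>FW (map_prod (\<lambda>x. x) \<phi>OJ z)"

text \<open>\<psi> = \<partial>b is used at the triple (-r+s, -s+p, -p) on the left and at (-s+p,
  -p, q) on the right. Both expand into values of \<open>b\<close>, and \<open>gen\<close> is the
  cancellation that remains.\<close>

lemma phase_identity:
  "b (- p) q * cnj (b (- s) q) * b (- s + p) (- p + q) * b (- r + s) (- s)
     * cnj (b (- r + s) (- s + p)) * cnj (pairing (\<eta> (- (- r + s))) (\<beta> (- s + p) (- p)))
   = b (- r + p) (- p) * pairing (\<eta> (- (- s + p))) (\<beta> (- p) q)"
proof -
  have 1: "- s + p + - p = - s" "- r + s + (- s + p) = - r + p" "- s + p + - p = - s"
    by (simp_all add: add.assoc)
  have gen: "A * inverse B * C * D * inverse E * inverse ((H * D) / (E * K)) = K * ((A * C) / (H * B))"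
    if "B \<noteq> 0" "D \<noteq> 0" "E \<noteq> 0" "H \<noteq> 0" "K \<noteq> 0" for A B C D E H K :: complex
    using that by (simp add: field_simps)
  show ?thesis
    unfolding cnj_pairing cnj_b unfolding pairing_eta_beta 1 by (rule gen) (rule b_nonzero)+
qed

text \<open>\<open>md\<close> and \<open>\<Delta>\<close> are homomorphisms, so both sides are
  products of powers of their values at single points; writing these values as squares removes the
  roots.\<close>

lemma scale_identity:
  "md s * inverse (sqrt (dfl (- q + s))) * (md (- q + p) * inverse (sqrt (md (- q + s) * \<Delta> (- q + p))))
     * (md s * inverse (sqrt (md r * \<Delta> s))) * inverse (md (- p + s))
   = md p * inverse (sqrt (md r * \<Delta> p)) * md p"
proof -
  have D: "\<Delta> (x + y) = \<Delta> x * \<Delta> y" "\<Delta> (- x) = inverse (\<Delta> x)" for x y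
    by (rule Q.modular_function_add, rule Q.modular_function_minus)
  have m: "\<exists>a>0. md x = a\<^sup>2" "\<exists>a>0. \<Delta> x = a\<^sup>2" for x
    by (rule exI[of _ "sqrt (md x)"], simp) (rule exI[of _ "sqrt (\<Delta> x)"], simp)
  obtain q' s' p' r' where m': "0 < q'" "md q = q'\<^sup>2" "0 < s'" "md s = s'\<^sup>2" "0 < p'" "md p = p'\<^sup>2" "0 < r'" "md r = r'\<^sup>2"
    using m(1)[of q] m(1)[of s] m(1)[of p] m(1)[of r] by blast
  obtain dq ds dp where D': "0 < dq" "\<Delta> q = dq\<^sup>2" "0 < ds" "\<Delta> s = ds\<^sup>2" "0 < dp" "\<Delta> p = dp\<^sup>2"
    using m(2)[of q] m(2)[of s] m(2)[of p] by blast
  show ?thesis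
    unfolding dfl_eq md_add md_minus D m'(2,4,6,8) D'(2,4,6)
    using m'(1,3,5,7) D'(1,3,5)
    by (simp add: real_sqrt_mult real_sqrt_inverse inverse_mult_distrib) (simp add: field_simps power2_eq_square)
qed

text \<open>With s = \<open>\<kappa>G z\<close> the hypothesis \<open>z\<close> reads \<xi> =
  \<eta>(s) - \<eta>(p), so \<open>da (- p) \<xi>\<close> becomes \<eta>(-p+s). The other two
  hypotheses let \<open>\<eta>inv\<close> undo \<eta> at the points where \<open>mR\<close> and
  \<open>\<phi>R\<close> evaluate it.\<close>

lemma multiplier_identity:
  assumes z: "\<eta> (\<kappa>G z) = snd (fst z) + \<eta> (fst (snd z))"
    and 1: "\<eta>inv (\<eta> (- fst (snd z) + \<kappa>G z)) = - fst (snd z) + \<kappa>G z"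
    and 2: "\<eta>inv (\<eta> (- \<kappa>G z + snd (snd z))) = - \<kappa>G z + snd (snd z)"
  shows "mL z * mR (\<phi>L z) = mE z" and "\<phi>R (\<phi>L z) = \<phi>E z"
proof -
  obtain q \<xi> p r where zz: "z = ((q, \<xi>), (p, r))" by (metis prod.collapse)
  define s where "s = \<kappa>G z"
  have G: "\<phi>G z = ((- q + p, - q + s), (s, r))" by (simp add: \<phi>G_def zz s_def)
  have c: "- (- q + p) + (- q + s) = - p + s" "- (- q + p) = - p + q" "- (- q + s) + (- q + p) = - s + p"
    by (simp_all add: minus_add add.assoc)
  have L: "\<phi>L z = ((- p + q, \<eta> (- p + s)), (- s, \<eta> (- s + r)))"
    unfolding \<phi>L_def G \<phi>OJ_def map_prod_simp fst_conv snd_conv c(1) unfolding c(2) by (rule refl)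
  have 1: "\<eta>inv (\<eta> (- p + s)) = - p + s" and 2: "\<eta>inv (\<eta> (- s + r)) = - s + r"
    using 1 2 by (simp_all add: zz s_def)
  have \<xi>: "\<xi> = \<eta> s - \<eta> p" using z by (simp add: zz s_def)
  have d: "da (- p) \<xi> = \<eta> (- p + s)" unfolding \<xi> eta_left_diff by (rule refl)
  have da: "da (- p + s) (\<eta> (- s + r)) = \<eta> (- p + r) - \<eta> (- p + s)"
    unfolding da_eta by (simp add: add.assoc)
  show "\<phi>R (\<phi>L z) = \<phi>E z"
    unfolding L \<phi>R_def \<phi>E_def \<phi>FW_def \<phi>OJ_def unfolding zz
    by (simp add: 1 da d add.assoc)
  have mE: "mE z = of_real (md p * inverse (sqrt (md r * \<Delta> p)) * md p) * (b (- r + p) (- p) * pairing (\<eta> (- (- s + p))) (\<beta> (- p) q))"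
    by (simp add: mE_def zz tensor_fun_def mFW_def \<phi>OJ_def mOJ_def d md_minus minus_add)
  have mL: "mL z = of_real (md s * inverse (sqrt (dfl (- q + s)))) * (b (- p) q * cnj (b (- s) q))
      * (of_real (md (- q + p) * inverse (sqrt (md (- q + s) * \<Delta> (- q + p)))) * b (- s + p) (- p + q)
      * (of_real (md s * inverse (sqrt (md r * \<Delta> s))) * b (- r + s) (- s)))"
  proof -
    have mG: "mG z = of_real (md s * inverse (sqrt (dfl (- q + s)))) * (b (- p) q * cnj (b (- s) q))"
      unfolding mG_def s_def[symmetric] unfolding zz fst_conv snd_conv by (rule refl)
    show ?thesis
      unfolding mL_def mG G tensor_fun_def prod.case mOJ_def fst_conv snd_conv c by (rule refl)
  qed
  have n: "- (- p + s) = - s + p" "- (- s + r) = - r + s" "- p + s + - s = - p"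
    by (simp_all add: minus_add add.assoc)
  have mR: "mR (\<phi>L z) = of_real (inverse (md (- p + s))) * cnj (b (- r + s) (- s + p))
      * cnj (pairing (\<eta> (- (- r + s))) (\<beta> (- s + p) (- p)))"
    unfolding L mR_def fst_conv snd_conv 1 2 psi_def n by (rule refl)
  have "mL z * mR (\<phi>L z) = of_real (md s * inverse (sqrt (dfl (- q + s))) * (md (- q + p) * inverse (sqrt (md (- q + s) * \<Delta> (- q + p))))
     * (md s * inverse (sqrt (md r * \<Delta> s))) * inverse (md (- p + s)))
     * (b (- p) q * cnj (b (- s) q) * b (- s + p) (- p + q) * b (- r + s) (- s)
     * cnj (b (- r + s) (- s + p)) * cnj (pairing (\<eta> (- (- r + s))) (\<beta> (- s + p) (- p))))"
    unfolding mL mR of_real_mult by (simp only: mult_ac)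
  then show "mL z * mR (\<phi>L z) = mE z"
    unfolding phase_identity scale_identity mE .
qed

text \<open>The map from (p, r) to (p, -p+r) preserves the product measure, so the null set on which
  \<open>\<eta>inv\<close> fails to invert \<eta> pulls back to a null set.\<close>

lemma AE_etainv_eta_diff: "AE z in HS. \<eta>inv (\<eta> (- fst z + snd z)) = - fst z + snd z"
proof -
  have "L2_pullback HS HS (\<lambda>_. 1) (\<lambda>z. (fst z, - fst z + snd z))"
    unfolding L2_pullback_def
  proof (intro conjI ballI)
    fix h :: "'q \<times> 'q \<Rightarrow> ennreal" assume "h \<in> borel_measurable HS"
    then have [measurable]: "h \<in> borel_measurable (borel \<Otimes>\<^sub>M borel)" by measurable
    have "(\<integral>\<^sup>+z. ennreal ((cmod 1)\<^sup>2) * h (fst z, - fst z + snd z) \<partial>HS)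
        = (\<integral>\<^sup>+p. \<integral>\<^sup>+r. h (p, - p + r) \<partial>muQ \<partial>muQ)"
      by (simp add: nn_integral_HS)
    also have "\<dots> = (\<integral>\<^sup>+p. \<integral>\<^sup>+r. h (p, r) \<partial>muQ \<partial>muQ)"
    proof (rule nn_integral_cong)
      fix p
      show "(\<integral>\<^sup>+r. h (p, - p + r) \<partial>muQ) = (\<integral>\<^sup>+r. h (p, r) \<partial>muQ)"
        by (rule Q.nn_integral_left[where f = "\<lambda>r. h (p, r)"]) measurable
    qed
    also have "\<dots> = (\<integral>\<^sup>+z. h z \<partial>HS)" by (rule nn_integral_HS[symmetric]) measurable
    finally show "(\<integral>\<^sup>+z. ennreal ((cmod 1)\<^sup>2) * h (fst z, - fst z + snd z) \<partial>HS) = (\<integral>\<^sup>+z. h z \<partial>HS)" .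
  qed measurable
  from AE_pullback[OF this AE_pair_snd[OF sf(1,1) AE_etainv_eta]] show ?thesis by simp
qed

lemma mG_nonzero [simp]: "mG z \<noteq> 0"
  by (simp add: mG_def)

lemma AE_multiplier_identity: "AE z in X \<Otimes>\<^sub>M HS. mL z * mR (\<phi>L z) = mE z \<and> \<phi>R (\<phi>L z) = \<phi>E z"
proof -
  \<comment> \<open>Both pairs in the value of \<open>\<phi>G\<close> are used: within the first
    pair the difference is -p+s because \<open>q\<close> cancels, within the second it is
    -s+r.\<close>
  note a1 = AE_pullback[OF L2_pullback_G AE_pair_fst[OF sf(7,7) AE_etainv_eta_diff]]
  note a2 = AE_pullback[OF L2_pullback_G AE_pair_snd[OF sf(7,7) AE_etainv_eta_diff]]
  from AE_eta_\<kappa>G a1 a2 show ?thesis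
  proof eventually_elim
    case (elim z)
    have c: "- (- q + p) + (- q + s) = - p + s" for q p s :: 'q
      by (simp add: minus_add add.assoc)
    have 1: "\<eta>inv (\<eta> (- fst (snd z) + \<kappa>G z)) = - fst (snd z) + \<kappa>G z"
      using elim(2) by (simp add: \<phi>G_def c)
    have 2: "\<eta>inv (\<eta> (- \<kappa>G z + snd (snd z))) = - \<kappa>G z + snd (snd z)"
      using elim(3) by (simp add: \<phi>G_def)
    show ?case using multiplier_identity[OF elim(1) 1 2] by (rule conjI)
  qed
qed

lemma L2_pullback_L: "L2_pullback (X \<Otimes>\<^sub>M HS) (X \<Otimes>\<^sub>M X) mL \<phi>L"
  using L2_pullback_compose[OF L2_pullback_G L2_pullback_prod[OF sf(7,7,6,6) L2_pullback_OJ L2_pullback_OJ]]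
  by (simp add: mL_def[abs_def] \<phi>L_def[abs_def])

text \<open>Measurability is what \<open>pullback_inj\<close> asks of the candidate; its
  square-integrability then follows from the equality with the unknown.\<close>

lemma multiplier_measurable:
  assumes f: "f \<in> L2 (X \<Otimes>\<^sub>M X)"
  shows "pullback mR \<phi>R f \<in> borel_measurable (X \<Otimes>\<^sub>M X)"
proof -
  have [measurable]: "f \<in> borel_measurable (X \<Otimes>\<^sub>M X)" by (rule L2_measurable[OF f])
  have [measurable]: "\<phi>R \<in> measurable (X \<Otimes>\<^sub>M X) (X \<Otimes>\<^sub>M X)" unfolding \<phi>R_def[abs_def] by measurable
  have [measurable]: "mR \<in> borel_measurable (X \<Otimes>\<^sub>M X)" unfolding mR_def[abs_def] psi_def by measurable
  show ?thesis unfolding pullback_def by measurable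
qed

end

section \<open>Assembling and solving the equation for the dual cocycle\<close>

lemma L2_tensor_left_inverse:
  assumes sf: "sigma_finite_measure M1" "sigma_finite_measure M2" "sigma_finite_measure N1" "sigma_finite_measure N2"
    and A: "L2_operator M1 N1 A" and B: "L2_operator M2 N2 B"
    and C: "L2_operator N1 M1 C" and D: "L2_operator N2 M2 D"
    and CA: "\<And>f. f \<in> L2 M1 \<Longrightarrow> AE x in M1. C (A f) x = f x"
    and DB: "\<And>f. f \<in> L2 M2 \<Longrightarrow> AE x in M2. D (B f) x = f x"
    and f: "f \<in> L2 (M1 \<Otimes>\<^sub>M M2)"
  shows "AE z in M1 \<Otimes>\<^sub>M M2. L2_tensor N1 N2 M1 M2 C D (L2_tensor M1 M2 N1 N2 A B f) z = f z"
proof -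
  have 1: "AE z in M1 \<Otimes>\<^sub>M M2. L2_tensor M1 M2 M1 M2 (C \<circ> A) (D \<circ> B) f z = id f z"
  proof (rule L2_tensor_eq[OF sf(1,2,1,2) L2_operator_compose[OF A C] L2_operator_compose[OF B D] L2_operator_id _ f])
    fix g h assume g: "g \<in> L2 M1" and h: "h \<in> L2 M2"
    from AE_pair_fst[OF sf(1,2) CA[OF g]] AE_pair_snd[OF sf(1,2) DB[OF h]]
    show "AE z in M1 \<Otimes>\<^sub>M M2. id (tensor_fun g h) z = tensor_fun ((C \<circ> A) g) ((D \<circ> B) h) z"
      by eventually_elim (simp add: tensor_fun_def split_beta')
  qed
  from L2_tensor_comp[OF sf sf(1,2) A B C D f] 1 show ?thesis
  proof eventually_elim
    case (elim z)
    show ?case unfolding elim by simp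
  qed
qed

context extension_data
begin

abbreviation "OpQ \<equiv> Op muQ muV muX act \<eta> b"
abbreviation "POJ \<equiv> pullback mOJ \<phi>OJ"
abbreviation "JG \<equiv> pullback mJ \<phi>J"

lemmas F_operator = L2_unitaryD(1)[OF F_unitary]
lemmas J_operator = L2_unitaryD(1)[OF J_unitary]
lemmas Op_operator = L2_unitaryD(1)[OF Op_unitary]
lemma F_F': "g \<in> L2 X \<Longrightarrow> AE z in X. F (F' g) z = g z"
  by (rule L2_adjoint_unitary(2)[OF F_unitary])

lemma Op_Op': "g \<in> L2 HS \<Longrightarrow> AE z in HS. OpQ (L2_adjoint G HS OpQ g) z = g z"
  by (rule L2_adjoint_unitary(2)[OF Op_unitary])

lemma id_id: "AE x in M. id (id f) x = f x"
  by simp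

lemma JG_JG: "AE x in G. JG (JG f) x = f x"
  by simp

lemmas POJ_operator = L2_operator_pullback[OF L2_pullback_OJ]

lemma OpJ_comp: "f \<in> L2 G \<Longrightarrow> AE z in HS. (OpQ \<circ> JG) f z = (POJ \<circ> F) f z"
  using OpJ_eq by (simp only: comp_apply)

lemma galois_tilde_unitary: "L2_unitary (G \<Otimes>\<^sub>M G) (G \<Otimes>\<^sub>M G) (galois_tilde muQ muV muX act \<eta> b)"
  unfolding galois_tilde_def Let_def
  by (rule L2_unitary_compose[OF L2_tensor_unitary[OF sf(5,5,7,7) Op_unitary Op_unitary]
        L2_unitary_compose[OF galois_map_unitary
          L2_tensor_unitary[OF sf(5,7,5,5) L2_unitary_id L2_adjoint_unitary'[OF Op_unitary]]]])

text \<open>The outer factor 1 \<otimes> Op cancels the adjoint of \<open>OpQ\<close> inside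
  \<open>galois_tilde\<close>, leaving the Galois map on kernels in its explicit form.\<close>

lemma galois_tilde_Op:
  assumes k: "k \<in> L2 (G \<Otimes>\<^sub>M G)"
  shows "AE z in G \<Otimes>\<^sub>M HS. L2_tensor G G G HS id OpQ (galois_tilde muQ muV muX act \<eta> b k) z
    = L2_tensor X HS G HS F' id (pullback mG \<phi>G (L2_tensor G G HS HS OpQ OpQ k)) z"
proof -
  have w: "L2_tensor G G HS HS OpQ OpQ k \<in> L2 (HS \<Otimes>\<^sub>M HS)"
    by (rule L2_operator_L2[OF L2_tensor_spec(1)[OF sf(5,5,7,7) Op_operator Op_operator] k])
  note Hw = L2_operator_L2[OF galois_map_operator w]
  have "AE z in G \<Otimes>\<^sub>M HS. L2_tensor G G G HS id OpQ (L2_tensor G HS G G id (L2_adjoint G HS OpQ)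
      (galois_map muQ muV act \<eta> b (L2_tensor G G HS HS OpQ OpQ k))) z = galois_map muQ muV act \<eta> b (L2_tensor G G HS HS OpQ OpQ k) z"
    by (rule L2_tensor_left_inverse[where A = id and C = id and B = "L2_adjoint G HS OpQ" and D = OpQ,
          OF sf(5,7,5,5) L2_operator_id L2_adjoint_unitary(1)[OF Op_unitary] L2_operator_id Op_operator id_id Op_Op' Hw])
  with galois_map_eq[OF w] show ?thesis
  proof eventually_elim
    case (elim z)
    then show ?case by (simp add: galois_tilde_def Let_def galois0_def)
  qed
qed

text \<open>Since J is an involution, \<open>k\<close> is J \<otimes> J applied to the function
  whose Fourier transform is sought; Op after J is then replaced by the substitution
  \<open>POJ\<close> after \<open>F\<close>.\<close>

lemma Op_J_tensor:
  assumes k: "k \<in> L2 (G \<Otimes>\<^sub>M G)"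
  shows "AE z in HS \<Otimes>\<^sub>M HS. L2_tensor G G HS HS OpQ OpQ k z
    = pullback (tensor_fun mOJ mOJ) (map_prod \<phi>OJ \<phi>OJ) (L2_tensor G G X X F F (L2_tensor G G G G JG JG k)) z"
proof -
  let ?JJ = "L2_tensor G G G G JG JG"
  note JJo = L2_tensor_spec(1)[OF sf(5,5,5,5) J_operator J_operator]
  note OO = L2_tensor_spec(1)[OF sf(5,5,7,7) Op_operator Op_operator]
  define g where "g = ?JJ k"
  have g: "g \<in> L2 (G \<Otimes>\<^sub>M G)" unfolding g_def by (rule L2_operator_L2[OF JJo k])
  have y: "L2_tensor G G X X F F g \<in> L2 (X \<Otimes>\<^sub>M X)"
    by (rule L2_operator_L2[OF L2_tensor_spec(1)[OF sf(5,5,6,6) F_operator F_operator] g])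
  have "AE z in G \<Otimes>\<^sub>M G. ?JJ g z = k z"
    unfolding g_def 
    by (rule L2_tensor_left_inverse[where A = JG and B = JG and C = JG and D = JG,
          OF sf(5,5,5,5) J_operator J_operator J_operator J_operator JG_JG JG_JG k])
  then have "AE z in HS \<Otimes>\<^sub>M HS. L2_tensor G G HS HS OpQ OpQ (?JJ g) z = L2_tensor G G HS HS OpQ OpQ k z"
    by (rule L2_operator_cong[OF OO L2_operator_L2[OF JJo g] k])
  moreover note L2_tensor_comp[OF sf(5,5,5,5,7,7) J_operator J_operator Op_operator Op_operator g]
  moreover have "AE z in HS \<Otimes>\<^sub>M HS. L2_tensor G G HS HS (OpQ \<circ> JG) (OpQ \<circ> JG) g z = L2_tensor G G HS HS (POJ \<circ> F) (POJ \<circ> F) g z"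
    by (rule L2_tensor_cong[OF sf(5,5,7,7) L2_operator_compose[OF J_operator Op_operator] L2_operator_compose[OF F_operator POJ_operator]
          L2_operator_compose[OF J_operator Op_operator] L2_operator_compose[OF F_operator POJ_operator] OpJ_comp OpJ_comp g])
  moreover note L2_tensor_comp[OF sf(5,5,6,6,7,7) F_operator F_operator POJ_operator POJ_operator g]
  moreover note L2_tensor_pullback[OF sf(6,6,7,7) L2_pullback_OJ L2_pullback_OJ y]
  ultimately show ?thesis
    unfolding g_def[symmetric]
  proof eventually_elim
    case (elim z)
    show ?case using elim by simp
  qed
qed

text \<open>The first variable sees only the Fourier transform. In the second, Op after J is again a
  substitution after \<open>F\<close>, so a double Fourier transform can be split off.\<close>

lemma J_Fourier_tensor:
  assumes w: "w \<in> L2 (G \<Otimes>\<^sub>M G)"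
  shows "AE z in X \<Otimes>\<^sub>M HS. L2_tensor G HS X HS F id (L2_tensor G G G HS id OpQ (L2_tensor G G G G id JG w)) z
    = pullback (tensor_fun (\<lambda>_. 1) mOJ) (map_prod (\<lambda>x. x) \<phi>OJ) (L2_tensor G G X X F F w) z"
proof -
  note io = L2_operator_id
  have OJ: "L2_operator G HS (OpQ \<circ> JG)" by (rule L2_operator_compose[OF J_operator Op_operator])
  have PF: "L2_operator G HS (POJ \<circ> F)" by (rule L2_operator_compose[OF F_operator POJ_operator])
  have Jw: "L2_tensor G G G G id JG w \<in> L2 (G \<Otimes>\<^sub>M G)"
    by (rule L2_operator_L2[OF L2_tensor_spec(1)[OF sf(5,5,5,5) io J_operator] w])
  have OJw: "L2_tensor G G G HS id OpQ (L2_tensor G G G G id JG w) \<in> L2 (G \<Otimes>\<^sub>M HS)"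
    by (rule L2_operator_L2[OF L2_tensor_spec(1)[OF sf(5,5,5,7) io Op_operator] Jw])
  have tw: "L2_tensor G G G HS id (POJ \<circ> F) w \<in> L2 (G \<Otimes>\<^sub>M HS)"
    by (rule L2_operator_L2[OF L2_tensor_spec(1)[OF sf(5,5,5,7) io PF] w])
  have y: "L2_tensor G G X X F F w \<in> L2 (X \<Otimes>\<^sub>M X)"
    by (rule L2_operator_L2[OF L2_tensor_spec(1)[OF sf(5,5,6,6) F_operator F_operator] w])
  have "AE z in G \<Otimes>\<^sub>M HS. L2_tensor G G G HS id (OpQ \<circ> JG) w z = L2_tensor G G G HS id (POJ \<circ> F) w z"
    by (rule L2_tensor_cong[OF sf(5,5,5,7) io io OJ PF _ OpJ_comp w]) simp_all
  then have "AE z in G \<Otimes>\<^sub>M HS. L2_tensor G G G HS id OpQ (L2_tensor G G G G id JG w) z = L2_tensor G G G HS id (POJ \<circ> F) w z"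
    using L2_tensor_comp[OF sf(5,5,5,5,5,7) io J_operator io Op_operator w]
    by eventually_elim simp
  from L2_operator_cong[OF L2_tensor_spec(1)[OF sf(5,7,6,7) F_operator io] OJw tw this]
  have "AE z in X \<Otimes>\<^sub>M HS. L2_tensor G HS X HS F id (L2_tensor G G G HS id OpQ (L2_tensor G G G G id JG w)) z
      = L2_tensor G HS X HS F id (L2_tensor G G G HS id (POJ \<circ> F) w) z" .
  moreover note L2_tensor_comp[OF sf(5,5,5,7,6,7) io PF F_operator io w]
  moreover note L2_tensor_comp[OF sf(5,5,6,6,6,7) F_operator F_operator io POJ_operator w]
  moreover have "AE z in X \<Otimes>\<^sub>M HS. L2_tensor X X X HS id POJ (L2_tensor G G X X F F w) z
      = pullback (tensor_fun (\<lambda>_. 1) mOJ) (map_prod (\<lambda>x. x) \<phi>OJ) (L2_tensor G G X X F F w) z"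
  proof -
    have "pullback (\<lambda>_. 1) (\<lambda>x. x) = (id :: ('q \<times> 'v pdual \<Rightarrow> complex) \<Rightarrow> _)"
      by (auto simp: pullback_def fun_eq_iff)
    then show ?thesis
      using L2_tensor_pullback[OF sf(6,6,6,7) L2_pullback_id L2_pullback_OJ y] by simp
  qed
  ultimately show ?thesis
  proof eventually_elim
    case (elim z)
    show ?case using elim by simp
  qed
qed

lemma Omega_formula:
  assumes f: "f \<in> L2 (X \<Otimes>\<^sub>M X)"
  shows "AE z in X \<Otimes>\<^sub>M X. (L2_tensor G G X X F F \<circ> Omega muQ muV muX act \<eta> \<beta> b \<circ> L2_tensor X X G G F' F') f z
    = pullback mR \<phi>R f z"
proof -
  let ?FF = "L2_tensor G G X X F F"
  let ?gt = "galois_tilde muQ muV muX act \<eta> b"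
  let ?gt' = "L2_adjoint (G \<Otimes>\<^sub>M G) (G \<Otimes>\<^sub>M G) ?gt"
  note io = L2_operator_id
  note FFo = L2_tensor_spec(1)[OF sf(5,5,6,6) F_operator F_operator]
  define f0 where "f0 = L2_tensor X X G G F' F' f"
  have f0: "f0 \<in> L2 (G \<Otimes>\<^sub>M G)"
    unfolding f0_def by (rule L2_operator_L2[OF L2_tensor_spec(1)[OF sf(6,6,5,5) F'_operator F'_operator] f])
  have FF0: "AE z in X \<Otimes>\<^sub>M X. ?FF f0 z = f z"
    unfolding f0_def
    by (rule L2_tensor_left_inverse[where A = F' and B = F' and C = F and D = F,
          OF sf(6,6,5,5) F'_operator F'_operator F_operator F_operator F_F' F_F' f])
  define w where "w = W_hat act \<beta> f0"
  have w: "w \<in> L2 (G \<Otimes>\<^sub>M G)" unfolding w_def W_hat_eq by (rule L2_pullback_L2[OF L2_pullback_W f0])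
  define h where "h = L2_tensor G G G G id JG w"
  have h: "h \<in> L2 (G \<Otimes>\<^sub>M G)"
    unfolding h_def by (rule L2_operator_L2[OF L2_tensor_spec(1)[OF sf(5,5,5,5) io J_operator] w])
  define k where "k = ?gt' h"
  have k: "k \<in> L2 (G \<Otimes>\<^sub>M G)"
    unfolding k_def by (rule L2_operator_L2[OF L2_adjoint_unitary(1)[OF galois_tilde_unitary] h])
  have gtk: "AE z in G \<Otimes>\<^sub>M G. ?gt k z = h z"
    unfolding k_def by (rule L2_adjoint_unitary(2)[OF galois_tilde_unitary h])
  define g where "g = L2_tensor G G G G JG JG k"
  have g: "g \<in> L2 (G \<Otimes>\<^sub>M G)"
    unfolding g_def by (rule L2_operator_L2[OF L2_tensor_spec(1)[OF sf(5,5,5,5) J_operator J_operator] k])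
  define y where "y = ?FF g"
  have y: "y \<in> L2 (X \<Otimes>\<^sub>M X)" unfolding y_def by (rule L2_operator_L2[OF FFo g])
  have Om: "(?FF \<circ> Omega muQ muV muX act \<eta> \<beta> b \<circ> L2_tensor X X G G F' F') f = y"
    unfolding Omega_def Let_def J_op_eq comp_apply y_def g_def k_def h_def w_def f0_def by (rule refl)
  let ?OO = "L2_tensor G G HS HS OpQ OpQ k"
  have OO: "?OO \<in> L2 (HS \<Otimes>\<^sub>M HS)"
    by (rule L2_operator_L2[OF L2_tensor_spec(1)[OF sf(5,5,7,7) Op_operator Op_operator] k])
  note GO = L2_pullback_L2[OF L2_pullback_G OO]
  note IO = L2_tensor_spec(1)[OF sf(5,5,5,7) io Op_operator]
  note FI = L2_tensor_spec(1)[OF sf(5,7,6,7) F_operator io]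
  have "AE z in G \<Otimes>\<^sub>M HS. L2_tensor G G G HS id OpQ (?gt k) z = L2_tensor G G G HS id OpQ h z"
    by (rule L2_operator_cong[OF IO L2_operator_L2[OF L2_unitaryD(1)[OF galois_tilde_unitary] k] h gtk])
  with galois_tilde_Op[OF k]
  have a1: "AE z in G \<Otimes>\<^sub>M HS. L2_tensor X HS G HS F' id (pullback mG \<phi>G ?OO) z = L2_tensor G G G HS id OpQ h z"
    by eventually_elim simp
  \<comment> \<open>Transforming in the first variable removes \<open>F'\<close> on the side of the
    unknown and completes the double Fourier transform of \<open>w\<close> on the other.\<close>
  have a2: "AE z in X \<Otimes>\<^sub>M HS. L2_tensor G HS X HS F id (L2_tensor X HS G HS F' id (pullback mG \<phi>G ?OO)) z
      = L2_tensor G HS X HS F id (L2_tensor G G G HS id OpQ h) z"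
    by (rule L2_operator_cong[OF FI L2_operator_L2[OF L2_tensor_spec(1)[OF sf(6,7,5,7) F'_operator io] GO] L2_operator_L2[OF IO h] a1])
  have a3: "AE z in X \<Otimes>\<^sub>M HS. L2_tensor G HS X HS F id (L2_tensor X HS G HS F' id (pullback mG \<phi>G ?OO)) z = pullback mG \<phi>G ?OO z"
    by (rule L2_tensor_left_inverse[where A = F' and B = id and C = F and D = id,
          OF sf(6,7,5,7) F'_operator io F_operator io F_F' id_id GO])
  have a4: "AE z in X \<Otimes>\<^sub>M HS. pullback mG \<phi>G ?OO z = pullback mL \<phi>L y z"
    using pullback_cong_AE[OF L2_pullback_G Op_J_tensor[OF k]]
    by (simp add: pullback_pullback mL_def[abs_def] \<phi>L_def[abs_def] y_def g_def)
  have "AE z in X \<Otimes>\<^sub>M X. ?FF w z = pullback mFW \<phi>FW (?FF f0) z"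
    unfolding w_def W_hat_eq by (rule FFW_eq[OF f0])
  with pullback_cong_AE[OF L2_pullback_FW FF0]
  have a5: "AE z in X \<Otimes>\<^sub>M X. ?FF w z = pullback mFW \<phi>FW f z" by eventually_elim simp
  have PE: "L2_pullback (X \<Otimes>\<^sub>M HS) (X \<Otimes>\<^sub>M X) (tensor_fun (\<lambda>_. 1) mOJ) (map_prod (\<lambda>x. x) \<phi>OJ)"
    by (rule L2_pullback_prod[OF sf(6,7,6,6) L2_pullback_id L2_pullback_OJ])
  have a6: "AE z in X \<Otimes>\<^sub>M HS. pullback (tensor_fun (\<lambda>_. 1) mOJ) (map_prod (\<lambda>x. x) \<phi>OJ) (?FF w) z = pullback mE \<phi>E f z"
    using pullback_cong_AE[OF PE a5] by (simp add: pullback_pullback mE_def[abs_def] \<phi>E_def[abs_def])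
  \<comment> \<open>The candidate satisfies the same equation as \<open>y\<close>, so injectivity of
    the substitution given by \<open>mL\<close> and \<open>\<phi>L\<close> identifies the
    two.\<close>
  have "AE z in X \<Otimes>\<^sub>M HS. pullback mL \<phi>L y z = pullback mL \<phi>L (pullback mR \<phi>R f) z"
    using a2 a3 a4 J_Fourier_tensor[OF w, folded h_def] a6 AE_multiplier_identity
  proof eventually_elim
    case (elim z)
    have "pullback mL \<phi>L (pullback mR \<phi>R f) z = (mL z * mR (\<phi>L z)) * f (\<phi>R (\<phi>L z))"
      by (simp add: pullback_def mult.assoc)
    also have "\<dots> = pullback mE \<phi>E f z" using elim(6) by (simp add: pullback_def)
    finally show ?case using elim(1-5) by simp
  qed
  from pullback_inj[OF L2_pullback_L L2_measurable[OF y] multiplier_measurable[OF f] this]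
  show ?thesis unfolding Om .
qed

end

theorem theorem3p1:
  fixes act :: "'q::{topological_group_add, second_countable_topology, t2_space}
                  \<Rightarrow> 'v::{topological_ab_group_add, second_countable_topology, t2_space} \<Rightarrow> 'v"
    and muQ :: "'q measure" and muV :: "'v measure" and muX :: "'v pdual measure"
    and \<eta> :: "'q \<Rightarrow> 'v pdual" and \<eta>inv :: "'v pdual \<Rightarrow> 'q"
    and \<beta> :: "'q \<Rightarrow> 'q \<Rightarrow> 'v" and b :: "'q \<Rightarrow> 'q \<Rightarrow> complex"
    and f :: "('q \<times> 'v pdual) \<times> ('q \<times> 'v pdual) \<Rightarrow> complex"
  assumes "locally_compact_space (euclidean :: 'q topology)"
    and "locally_compact_space (euclidean :: 'v topology)"
    and "continuous_action act"
    and "left_haar_measure muQ" and "left_haar_measure muV" and "left_haar_measure muX"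
    and "\<eta> \<in> Z1c act" and "\<beta> \<in> Z2 act" and "compatible \<eta> \<beta>"
    and "measure_class_isomorphism muQ muX \<eta>"
    and "ae_inverse muQ muX \<eta> \<eta>inv"
    and "circle_cochain2 b" and "psi \<eta> \<beta> = cobd b"
    and "\<And>q. \<beta> 0 q = 0" and "\<And>q. \<beta> q 0 = 0"
    and "\<And>q. b 0 q = 1" and "\<And>q. b q 0 = 1"
    and "\<And>h :: 'v pdual \<Rightarrow> ennreal. h \<in> borel_measurable borel \<Longrightarrow>
           (\<integral>\<^sup>+q. h (\<eta> q) * ennreal (inverse (modulus muV act q)) \<partial>muQ) = (\<integral>\<^sup>+\<xi>. h \<xi> \<partial>muX)"
    and "fourier_unitary muV muX"
    and "f \<in> L2 (dual_side muQ muV muX act \<Otimes>\<^sub>M dual_side muQ muV muX act)"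
  shows "let G = haar_G muQ muV act; X = dual_side muQ muV muX act;
             F = partial_fourier muQ muV muX act; F' = L2_adjoint G X F;
             \<Omega> = Omega muQ muV muX act \<eta> \<beta> b in
         AE ((q1, \<xi>1), (q2, \<xi>2)) in X \<Otimes>\<^sub>M X.
           (L2_tensor G G X X F F \<circ> \<Omega> \<circ> L2_tensor X X G G F' F') f ((q1, \<xi>1), (q2, \<xi>2))
           = of_real (inverse (modulus muV act (\<eta>inv \<xi>1)))
             * cnj (b (- \<eta>inv \<xi>2) (- \<eta>inv \<xi>1))
             * cnj (psi \<eta> \<beta> (- \<eta>inv \<xi>2) (- \<eta>inv \<xi>1) (\<eta>inv \<xi>1 + q2))
             * f ((q1, \<xi>1), (\<eta>inv \<xi>1 + q2, dual_action act (\<eta>inv \<xi>1) \<xi>2))"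
  proof -
  interpret extension_data act muQ muV muX \<eta> \<eta>inv \<beta> b
    by unfold_locales fact+
  show ?thesis
    unfolding Let_def using Omega_formula[OF assms(20)]
  proof eventually_elim
    case (elim z)
    obtain q1 \<xi>1 q2 \<xi>2 where z: "z = ((q1, \<xi>1), (q2, \<xi>2))" by (metis prod.collapse)
    show ?case
      using elim unfolding z prod.case by (simp only: pullback_def mR_def \<phi>R_def fst_conv snd_conv)
  qed
qed

end
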